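(* Assume $G$ satisfies Mazur's finiteness condition $\Phi_p$ and let $\rho^{\mathrm{univ}}:G\to\mathrm{GL}_2(R^{\mathrm{univ}})$ be the universal deformation of $\overline\rho$. (a) The following are equivalent: (i) $\rho^{\mathrm{univ}}$ is dihedral; (ii) every deformation $\rho:G\to\mathrm{GL}_2(\mathbb{F}[X]/(X^2))$ of $\overline\rho$ is dihedral; (iii) every infinitesimal deformation of $\overline\rho$ is dihedral; (iv) $\rho^{\mathrm{univ}}_{\mathrm{inf}}$ is dihedral. (b) If the conditions in (a) are satisfied, then $R^{\mathrm{univ}}$ is isomorphic to the universal deformation ring $R^{\mathrm{univ}}_{\overline\chi}$ of the character $\overline\chi$ in $\mathcal{C}$.
   Context: Let $p$ be a prime, $\mathbb{F}$ a finite field of characteristic $p$, $W(\mathbb{F})$ its Witt vectors, $\mathcal{C}$ the category of complete local Noetherian $W(\mathbb{F})$-algebras with residue field $\mathbb{F}$, $\mathfrak{m}_R$ the maximal ideal of $R\in\mathcal{C}$. All representations and characters are continuous. Let $G$ be a profinite group, $H\lhd G$ open of index $2$, $\sigma\in G\setminus H$, $\overline\chi:H\to\mathbb{F}^\times$ a character with $\overline\chi\neq\overline\chi^\sigma$ ($\overline\chi^\sigma(h)=\overline\chi(\sigma h\sigma^{-1})$). For a topological ring $R$ and a character $\chi$ of an open index-2 subgroup $H'$, $\mathrm{Ind}_{H'}^G(\chi)_R=\{f:G\to R\mid f(hg)=\chi(h)f(g)\}$ with $G$ acting by $(\tilde gf)(g)=f(g\tilde g)$. Let $\overline\rho=\mathrm{Ind}_H^G(\overline\chi)_{\mathbb{F}}$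 (absolutely irreducible). A representation $\rho:G\to\mathrm{GL}_2(R)$ is dihedral if there are an open index-$2$ subgroup $H'\lhd G$ and a character $\chi':H'\to R^\times$ with $\rho$ equivalent to $\mathrm{Ind}_{H'}^G(\chi')_R$. Condition $\Phi_p$: every open subgroup of $G$ has only finitely many continuous homomorphisms to $\mathbb{Z}/p\mathbb{Z}$. Lifts, deformations (lifts up to conjugation by $\ker(\mathrm{GL}_2(R)\to\mathrm{GL}_2(\mathbb{F}))$) and the universal deformation are as usual, and similarly for deformations of the character $\overline\chi$ (characters $H\to R^\times$, $R\in\mathcal{C}$, reducing to $\overline\chi$), whose universal ring is $R^{\mathrm{univ}}_{\overline\chi}$. For a lift $\rho$ to $R$, $\rho_{\mathrm{inf}}=\pi\circ\rho$ with $\pi:\mathrm{GL}_2(R)\to\mathrm{GL}_2(R/(\mathfrak{m}_R^2,p))$; $\rho$ is infinitesimal if $\mathfrak{m}_R^2=0$ and $pR=0$; $\rho^{\mathrm{univ}}_{\mathrm{inf}}=(\rho^{\mathrm{univ}})_{\mathrm{inf}}$.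
   Formalization: Part (b) is proved when ρ^univ is induced from a character of H itself or χ̄² ≠ (χ̄^σ)²; without this it fails (e.g. Z/p ⋊ D4, p odd). In (a)(iii) the rings range over isomorphic copies with carrier in the subsets of ℕ, which covers all cases. *)

theory Defs
  imports
    "HOL-Algebra.Polynomial_Divisibility"
    "HOL-Algebra.Ring_Divisibility"
    "HOL-Algebra.Ideal_Product"
    "HOL-Algebra.Elementary_Groups"
    "HOL-Analysis.Abstract_Topological_Spaces"
    "HOL-Library.Poly_Mapping"
    "HOL-Computational_Algebra.Primes"
begin

section \<open>Witt vectors\<close>

text \<open>
  The ring of \<open>p\<close>-typical Witt vectors is given by Witt's universal integral polynomials
  \<open>S\<^sub>0, S\<^sub>1, \<dots>\<close> (addition) and \<open>M\<^sub>0, M\<^sub>1, \<dots>\<close> (multiplication) in the variables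
  \<open>X\<^sub>i = Inl i\<close> and \<open>Y\<^sub>i = Inr i\<close>, determined by
  \<open>w\<^sub>n(S\<^sub>0,\<dots>,S\<^sub>n) = w\<^sub>n(X) + w\<^sub>n(Y)\<close> and \<open>w\<^sub>n(M\<^sub>0,\<dots>,M\<^sub>n) = w\<^sub>n(X) * w\<^sub>n(Y)\<close>, where \<open>w\<^sub>n\<close> is the
  \<open>n\<close>-th ghost component. The coefficientwise division by \<open>p ^ n\<close> below is exact (Witt).
\<close>

type_synonym witt_mpoly = "((nat + nat) \<Rightarrow>\<^sub>0 nat) \<Rightarrow>\<^sub>0 int"

definition witt_var :: "nat + nat \<Rightarrow> witt_mpoly" where
  "witt_var v = Poly_Mapping.single (Poly_Mapping.single v 1) 1"

definition ghost :: "nat \<Rightarrow> nat \<Rightarrow> (nat \<Rightarrow> 'a::comm_semiring_1) \<Rightarrow> 'a" where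
  "ghost p n x = (\<Sum>i\<le>n. of_nat p ^ i * x i ^ (p ^ (n - i)))"

fun witt_law :: "(witt_mpoly \<Rightarrow> witt_mpoly \<Rightarrow> witt_mpoly) \<Rightarrow> nat \<Rightarrow> nat \<Rightarrow> witt_mpoly" where
  "witt_law f p n =
     Poly_Mapping.map (\<lambda>c. c div int p ^ n)
       (f (ghost p n (\<lambda>i. witt_var (Inl i))) (ghost p n (\<lambda>i. witt_var (Inr i)))
        - (\<Sum>i<n. of_nat p ^ i * witt_law f p i ^ (p ^ (n - i))))"

declare witt_law.simps [simp del]

definition witt_eval :: "('f, 'm) ring_scheme \<Rightarrow> (nat + nat \<Rightarrow> 'f) \<Rightarrow> witt_mpoly \<Rightarrow> 'f" where
  "witt_eval F a P =
     (\<Oplus>\<^bsub>F\<^esub>m \<in> Poly_Mapping.keys P. [Poly_Mapping.lookup P m] \<cdot>\<^bsub>F\<^esub> \<one>\<^bsub>F\<^esub> \<otimes>\<^bsub>F\<^esub>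
        (\<Otimes>\<^bsub>F\<^esub>v \<in> Poly_Mapping.keys m. a v [^]\<^bsub>F\<^esub> Poly_Mapping.lookup m v))"

definition witt_vectors :: "nat \<Rightarrow> ('f, 'm) ring_scheme \<Rightarrow> (nat \<Rightarrow> 'f) ring" where
  "witt_vectors p F =
     \<lparr> carrier = {w. \<forall>n. w n \<in> carrier F},
       mult = (\<lambda>x y n. witt_eval F (case_sum x y) (witt_law (*) p n)),
       one = (\<lambda>n. if n = 0 then \<one>\<^bsub>F\<^esub> else \<zero>\<^bsub>F\<^esub>),
       zero = (\<lambda>n. \<zero>\<^bsub>F\<^esub>),
       add = (\<lambda>x y n. witt_eval F (case_sum x y) (witt_law (+) p n)) \<rparr>"


section \<open>The category of coefficient rings\<close>

definition local_ring :: "('r, 'm) ring_scheme \<Rightarrow> bool" where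
  "local_ring R \<longleftrightarrow> cring R \<and> (\<exists>!M. maximalideal M R)"

definition max_ideal :: "('r, 'm) ring_scheme \<Rightarrow> 'r set" where
  "max_ideal R = (THE M. maximalideal M R)"

abbreviation max_ideal_pow :: "('r, 'm) ring_scheme \<Rightarrow> nat \<Rightarrow> 'r set" where
  "max_ideal_pow R n \<equiv> max_ideal R [^]\<^bsub>ideals_set R\<^esub> n"

text \<open>The topology is discrete if the maximal ideal is nilpotent, e.g. for a field.\<close>

definition adic_topology :: "('r, 'm) ring_scheme \<Rightarrow> 'r topology" where
  "adic_topology R = topology (\<lambda>U. U \<subseteq> carrier R \<and>
     (\<forall>x\<in>U. \<exists>n. \<forall>y\<in>carrier R. y \<ominus>\<^bsub>R\<^esub> x \<in> max_ideal_pow R n \<longrightarrow> y \<in> U))"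

text \<open>Bijectivity of the canonical map from \<open>R\<close> to the inverse limit of the \<open>R / m\<^sup>n\<close>.\<close>

definition adic_complete :: "('r, 'm) ring_scheme \<Rightarrow> bool" where
  "adic_complete R \<longleftrightarrow>
     (\<Inter>n. max_ideal_pow R n) = {\<zero>\<^bsub>R\<^esub>} \<and>
     (\<forall>x. (\<forall>n. x n \<in> carrier R \<and> x (Suc n) \<ominus>\<^bsub>R\<^esub> x n \<in> max_ideal_pow R n) \<longrightarrow>
        (\<exists>y\<in>carrier R. \<forall>n. y \<ominus>\<^bsub>R\<^esub> x n \<in> max_ideal_pow R n))"

text \<open>
  The residue map is uniquely determined on the carrier by the algebra structure
  (see \<open>coeff_object\<close>); it is stored for convenience.
\<close>

record ('f, 'r) coeff_ring = "'r ring" +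
  struct_map :: "(nat \<Rightarrow> 'f) \<Rightarrow> 'r"
  residue :: "'r \<Rightarrow> 'f"

definition coeff_object :: "nat \<Rightarrow> 'f ring \<Rightarrow> ('f, 'r) coeff_ring \<Rightarrow> bool" where
  "coeff_object p F R \<longleftrightarrow>
     local_ring R \<and> noetherian_ring R \<and> adic_complete R \<and>
     struct_map R \<in> ring_hom (witt_vectors p F) R \<and>
     residue R \<in> ring_hom R F \<and>
     residue R ` carrier R = carrier F \<and>
     a_kernel R F (residue R) = max_ideal R \<and>
     (\<forall>w\<in>carrier (witt_vectors p F). residue R (struct_map R w) = w 0)"

definition coeff_hom ::
    "nat \<Rightarrow> 'f ring \<Rightarrow> ('f, 'r) coeff_ring \<Rightarrow> ('f, 's) coeff_ring \<Rightarrow> ('r \<Rightarrow> 's) set" where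
  "coeff_hom p F R S =
     {\<phi> \<in> ring_hom R S \<inter> extensional (carrier R).
        (\<forall>w\<in>carrier (witt_vectors p F). \<phi> (struct_map R w) = struct_map S w) \<and>
        \<phi> ` max_ideal R \<subseteq> max_ideal S}"

definition coeff_iso ::
    "nat \<Rightarrow> 'f ring \<Rightarrow> ('f, 'r) coeff_ring \<Rightarrow> ('f, 's) coeff_ring \<Rightarrow> bool" where
  "coeff_iso p F R S \<longleftrightarrow>
     (\<exists>\<phi>\<in>coeff_hom p F R S. \<exists>\<psi>\<in>coeff_hom p F S R.
        (\<forall>x\<in>carrier R. \<psi> (\<phi> x) = x) \<and> (\<forall>y\<in>carrier S. \<phi> (\<psi> y) = y))"

definition quot_coeff_ring :: "('f, 'r) coeff_ring \<Rightarrow> 'r set \<Rightarrow> ('f, 'r set) coeff_ring" where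
  "quot_coeff_ring R I =
     \<lparr> carrier = carrier (R Quot I), mult = mult (R Quot I), one = one (R Quot I),
       zero = zero (R Quot I), add = add (R Quot I),
       struct_map = (\<lambda>w. I +>\<^bsub>R\<^esub> struct_map R w),
       residue = (\<lambda>C. the_elem (residue R ` C)) \<rparr>"

definition inf_ideal :: "nat \<Rightarrow> ('r, 'm) ring_scheme \<Rightarrow> 'r set" where
  "inf_ideal p R = Idl\<^bsub>R\<^esub> (max_ideal_pow R 2 \<union> {[p] \<cdot>\<^bsub>R\<^esub> \<one>\<^bsub>R\<^esub>})"

text \<open>The ring \<open>F[X]/(X\<^sup>2)\<close> as a coefficient ring.\<close>

definition dual_numbers :: "'f ring \<Rightarrow> ('f, 'f list set) coeff_ring" where
  "dual_numbers F =
     (let P = univ_poly F (carrier F); f = X\<^bsub>F\<^esub> [^]\<^bsub>P\<^esub> (2::nat); Q = Rupt\<^bsub>F\<^esub> (carrier F) f in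
     \<lparr> carrier = carrier Q, mult = mult Q, one = one Q, zero = zero Q, add = add Q,
       struct_map = (\<lambda>w. PIdl\<^bsub>P\<^esub> f +>\<^bsub>P\<^esub> ring.poly_of_const F (w 0)),
       residue = (\<lambda>C. the_elem (ring.const_term F ` C)) \<rparr>)"


section \<open>Profinite groups\<close>

definition profinite_group :: "('g, 'm) monoid_scheme \<Rightarrow> 'g topology \<Rightarrow> bool" where
  "profinite_group G T \<longleftrightarrow>
     group G \<and> topspace T = carrier G \<and>
     continuous_map (prod_topology T T) T (\<lambda>(x, y). x \<otimes>\<^bsub>G\<^esub> y) \<and>
     continuous_map T T (\<lambda>x. inv\<^bsub>G\<^esub> x) \<and>
     compact_space T \<and> Hausdorff_space T \<and>
     (\<forall>S. connectedin T S \<longrightarrow> (\<forall>x\<in>S. \<forall>y\<in>S. x = y))"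

definition open_index2 :: "('g, 'm) monoid_scheme \<Rightarrow> 'g topology \<Rightarrow> 'g set \<Rightarrow> bool" where
  "open_index2 G T H \<longleftrightarrow> H \<lhd> G \<and> openin T H \<and> card (rcosets\<^bsub>G\<^esub> H) = 2"

definition mazur_finiteness :: "nat \<Rightarrow> ('g, 'm) monoid_scheme \<Rightarrow> 'g topology \<Rightarrow> bool" where
  "mazur_finiteness p G T \<longleftrightarrow>
     (\<forall>K. subgroup K G \<and> openin T K \<longrightarrow>
        finite {f \<in> extensional K. f \<in> hom (G\<lparr>carrier := K\<rparr>) (integer_mod_group p) \<and>
           continuous_map (subtopology T K)
             (discrete_topology (carrier (integer_mod_group p))) f})"


section \<open>Two-dimensional representations\<close>

datatype 'a mat2 = Mat2 (e11: 'a) (e12: 'a) (e21: 'a) (e22: 'a)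

definition mat2_monoid :: "('r, 'm) ring_scheme \<Rightarrow> 'r mat2 monoid" where
  "mat2_monoid R =
     \<lparr> carrier = {A. set_mat2 A \<subseteq> carrier R},
       mult = (\<lambda>A B. Mat2 (e11 A \<otimes>\<^bsub>R\<^esub> e11 B \<oplus>\<^bsub>R\<^esub> e12 A \<otimes>\<^bsub>R\<^esub> e21 B)
                          (e11 A \<otimes>\<^bsub>R\<^esub> e12 B \<oplus>\<^bsub>R\<^esub> e12 A \<otimes>\<^bsub>R\<^esub> e22 B)
                          (e21 A \<otimes>\<^bsub>R\<^esub> e11 B \<oplus>\<^bsub>R\<^esub> e22 A \<otimes>\<^bsub>R\<^esub> e21 B)
                          (e21 A \<otimes>\<^bsub>R\<^esub> e12 B \<oplus>\<^bsub>R\<^esub> e22 A \<otimes>\<^bsub>R\<^esub> e22 B)),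
       one = Mat2 \<one>\<^bsub>R\<^esub> \<zero>\<^bsub>R\<^esub> \<zero>\<^bsub>R\<^esub> \<one>\<^bsub>R\<^esub> \<rparr>"

definition GL2 :: "('r, 'm) ring_scheme \<Rightarrow> 'r mat2 monoid" where
  "GL2 R = units_of (mat2_monoid R)"

definition mat2_vec :: "('r, 'm) ring_scheme \<Rightarrow> 'r mat2 \<Rightarrow> 'r \<times> 'r \<Rightarrow> 'r \<times> 'r" where
  "mat2_vec R A v = (e11 A \<otimes>\<^bsub>R\<^esub> fst v \<oplus>\<^bsub>R\<^esub> e12 A \<otimes>\<^bsub>R\<^esub> snd v,
                     e21 A \<otimes>\<^bsub>R\<^esub> fst v \<oplus>\<^bsub>R\<^esub> e22 A \<otimes>\<^bsub>R\<^esub> snd v)"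

definition representation ::
    "('g, 'm) monoid_scheme \<Rightarrow> 'g topology \<Rightarrow> ('r, 'n) ring_scheme \<Rightarrow> ('g \<Rightarrow> 'r mat2) \<Rightarrow> bool" where
  "representation G T R \<rho> \<longleftrightarrow>
     \<rho> \<in> hom G (GL2 R) \<and>
     continuous_map T (adic_topology R) (\<lambda>g. e11 (\<rho> g)) \<and>
     continuous_map T (adic_topology R) (\<lambda>g. e12 (\<rho> g)) \<and>
     continuous_map T (adic_topology R) (\<lambda>g. e21 (\<rho> g)) \<and>
     continuous_map T (adic_topology R) (\<lambda>g. e22 (\<rho> g))"

definition character_on ::
    "('g, 'm) monoid_scheme \<Rightarrow> 'g topology \<Rightarrow> ('r, 'n) ring_scheme \<Rightarrow> 'g set \<Rightarrow> ('g \<Rightarrow> 'r) \<Rightarrow> bool" where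
  "character_on G T R H chi \<longleftrightarrow>
     chi \<in> hom (G\<lparr>carrier := H\<rparr>) (units_of R) \<and>
     continuous_map (subtopology T H) (adic_topology R) chi"

definition ind_space ::
    "('g, 'm) monoid_scheme \<Rightarrow> ('r, 'n) ring_scheme \<Rightarrow> 'g set \<Rightarrow> ('g \<Rightarrow> 'r) \<Rightarrow> ('g \<Rightarrow> 'r) set" where
  "ind_space G R H chi =
     {f \<in> carrier G \<rightarrow>\<^sub>E carrier R. \<forall>h\<in>H. \<forall>g\<in>carrier G. f (h \<otimes>\<^bsub>G\<^esub> g) = chi h \<otimes>\<^bsub>R\<^esub> f g}"

definition ind_action :: "('g, 'm) monoid_scheme \<Rightarrow> 'g \<Rightarrow> ('g \<Rightarrow> 'r) \<Rightarrow> ('g \<Rightarrow> 'r)" where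
  "ind_action G g' f = (\<lambda>g\<in>carrier G. f (g \<otimes>\<^bsub>G\<^esub> g'))"

text \<open>
  A representation by matrices is equivalent to the induced module if there is a linear
  \<open>G\<close>-equivariant isomorphism from \<open>R\<^sup>2\<close> onto the latter.
\<close>

definition equiv_to_ind ::
    "('g, 'm) monoid_scheme \<Rightarrow> ('r, 'n) ring_scheme \<Rightarrow> ('g \<Rightarrow> 'r mat2) \<Rightarrow> 'g set \<Rightarrow> ('g \<Rightarrow> 'r) \<Rightarrow> bool" where
  "equiv_to_ind G R \<rho> H chi \<longleftrightarrow>
     (\<exists>\<phi>. bij_betw \<phi> (carrier R \<times> carrier R) (ind_space G R H chi) \<and>
        (\<forall>v\<in>carrier R \<times> carrier R. \<forall>w\<in>carrier R \<times> carrier R. \<forall>x\<in>carrier G.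
           \<phi> (fst v \<oplus>\<^bsub>R\<^esub> fst w, snd v \<oplus>\<^bsub>R\<^esub> snd w) x = \<phi> v x \<oplus>\<^bsub>R\<^esub> \<phi> w x) \<and>
        (\<forall>a\<in>carrier R. \<forall>v\<in>carrier R \<times> carrier R. \<forall>x\<in>carrier G.
           \<phi> (a \<otimes>\<^bsub>R\<^esub> fst v, a \<otimes>\<^bsub>R\<^esub> snd v) x = a \<otimes>\<^bsub>R\<^esub> \<phi> v x) \<and>
        (\<forall>g\<in>carrier G. \<forall>v\<in>carrier R \<times> carrier R.
           \<phi> (mat2_vec R (\<rho> g) v) = ind_action G g (\<phi> v)))"

text \<open>
  For lifts of a residual representation with projective image the Klein four-group, the inducing
  subgroup is not unique. Let \<open>G\<close> be the semidirect product of \<open>\<int>/p\<close> (\<open>p\<close> odd) by the dihedral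
  group of order 8, the latter acting by inversion through the character with kernel \<open>V'\<close>, one of
  its two Klein four-groups \<open>V\<close>, \<open>V'\<close>. The universal deformation of the 2-dimensional
  irreducible representation of the dihedral group is induced from \<open>H' = \<int>/p \<times> V'\<close>, and its ring is
  not isomorphic to the universal deformation ring of the character of the preimage \<open>H\<close> of \<open>V\<close>
  which induces the same residual representation. Comparing the two deformation rings thus
  requires that the universal deformation be induced from \<open>H\<close> itself.
\<close>

definition dihedral ::
    "('g, 'm) monoid_scheme \<Rightarrow> 'g topology \<Rightarrow> ('r, 'n) ring_scheme \<Rightarrow> ('g \<Rightarrow> 'r mat2) \<Rightarrow> bool" where
  "dihedral G T R \<rho> \<longleftrightarrow>
     (\<exists>H chi. open_index2 G T H \<and> character_on G T R H chi \<and> equiv_to_ind G R \<rho> H chi)"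


section \<open>Deformations\<close>

text \<open>
  A deformation is a class of lifts under strict equivalence and is handled through its
  representatives; being dihedral does not depend on the representative.
\<close>

definition lift_of ::
    "('g, 'm) monoid_scheme \<Rightarrow> 'g topology \<Rightarrow> ('g \<Rightarrow> 'f mat2) \<Rightarrow> ('f, 'r) coeff_ring \<Rightarrow>
     ('g \<Rightarrow> 'r mat2) \<Rightarrow> bool" where
  "lift_of G T \<rho>bar R \<rho> \<longleftrightarrow>
     representation G T R \<rho> \<and> (\<forall>g\<in>carrier G. map_mat2 (residue R) (\<rho> g) = \<rho>bar g)"

definition strictly_equivalent ::
    "('g, 'm) monoid_scheme \<Rightarrow> 'f ring \<Rightarrow> ('f, 'r) coeff_ring \<Rightarrow>
     ('g \<Rightarrow> 'r mat2) \<Rightarrow> ('g \<Rightarrow> 'r mat2) \<Rightarrow> bool" where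
  "strictly_equivalent G F R \<rho> \<rho>' \<longleftrightarrow>
     (\<exists>A\<in>carrier (GL2 R). map_mat2 (residue R) A = \<one>\<^bsub>GL2 F\<^esub> \<and>
        (\<forall>g\<in>carrier G. \<rho>' g = A \<otimes>\<^bsub>GL2 R\<^esub> \<rho> g \<otimes>\<^bsub>GL2 R\<^esub> inv\<^bsub>GL2 R\<^esub> A))"

text \<open>
  A coefficient ring is the inverse limit of the finite rings \<open>R / m\<^sup>n\<close>, so it has at most
  the cardinality of the continuum and is isomorphic to one whose carrier consists of elements
  of type \<^typ>\<open>nat set\<close>. Quantifying over the latter therefore amounts to quantifying over
  the whole category.
\<close>

definition universal_deformation ::
    "nat \<Rightarrow> 'f ring \<Rightarrow> ('g, 'm) monoid_scheme \<Rightarrow> 'g topology \<Rightarrow> ('g \<Rightarrow> 'f mat2) \<Rightarrow>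
     ('f, 'r) coeff_ring \<Rightarrow> ('g \<Rightarrow> 'r mat2) \<Rightarrow> bool" where
  "universal_deformation p F G T \<rho>bar U \<rho>univ \<longleftrightarrow>
     coeff_object p F U \<and> lift_of G T \<rho>bar U \<rho>univ \<and>
     (\<forall>(R :: ('f, nat set) coeff_ring) \<rho>. coeff_object p F R \<and> lift_of G T \<rho>bar R \<rho> \<longrightarrow>
        (\<exists>!\<phi>. \<phi> \<in> coeff_hom p F U R \<and> strictly_equivalent G F R (\<lambda>g. map_mat2 \<phi> (\<rho>univ g)) \<rho>))"

definition character_lift ::
    "('g, 'm) monoid_scheme \<Rightarrow> 'g topology \<Rightarrow> 'g set \<Rightarrow> ('g \<Rightarrow> 'f) \<Rightarrow> ('f, 'r) coeff_ring \<Rightarrow>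
     ('g \<Rightarrow> 'r) \<Rightarrow> bool" where
  "character_lift G T H chibar R chi \<longleftrightarrow>
     character_on G T R H chi \<and> (\<forall>h\<in>H. residue R (chi h) = chibar h)"

definition universal_character_deformation ::
    "nat \<Rightarrow> 'f ring \<Rightarrow> ('g, 'm) monoid_scheme \<Rightarrow> 'g topology \<Rightarrow> 'g set \<Rightarrow> ('g \<Rightarrow> 'f) \<Rightarrow>
     ('f, 'r) coeff_ring \<Rightarrow> ('g \<Rightarrow> 'r) \<Rightarrow> bool" where
  "universal_character_deformation p F G T H chibar U chiuniv \<longleftrightarrow>
     coeff_object p F U \<and> character_lift G T H chibar U chiuniv \<and>
     (\<forall>(R :: ('f, nat set) coeff_ring) chi. coeff_object p F R \<and> character_lift G T H chibar R chi \<longrightarrow>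
        (\<exists>!\<phi>. \<phi> \<in> coeff_hom p F U R \<and> (\<forall>h\<in>H. \<phi> (chiuniv h) = chi h)))"

definition infinitesimal :: "nat \<Rightarrow> ('r, 'm) ring_scheme \<Rightarrow> bool" where
  "infinitesimal p R \<longleftrightarrow>
     max_ideal_pow R 2 = {\<zero>\<^bsub>R\<^esub>} \<and> (\<forall>x\<in>carrier R. [p] \<cdot>\<^bsub>R\<^esub> x = \<zero>\<^bsub>R\<^esub>)"

definition reduce_inf :: "nat \<Rightarrow> ('r, 'm) ring_scheme \<Rightarrow> ('g \<Rightarrow> 'r mat2) \<Rightarrow> 'g \<Rightarrow> 'r set mat2" where
  "reduce_inf p R \<rho> g = map_mat2 (\<lambda>r. inf_ideal p R +>\<^bsub>R\<^esub> r) (\<rho> g)"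

end

theory Submission
  imports Defs
begin

text \<open>
  A representation \<open>\<rho>\<close> is induced from an open subgroup \<open>H\<close> of index 2 iff, in a suitable basis,
  \<open>\<rho> g\<close> is diagonal for \<open>g \<in> H\<close> and antidiagonal otherwise, i.e. iff \<open>\<rho>\<close> is compatible with a
  \<open>\<int>/2\<close>-grading of the matrix ring. This property is stable under base change and strict
  equivalence, so everything reduces to showing that all lifts are graded if those to the dual
  numbers are.

  The subgroup may a priori depend on the lift. However, the residual representation is graded along
  more than one subgroup only if its projective image is the Klein four-group; then \<open>p\<close> is odd and
  there are at most three such subgroups. The lifts to the dual numbers correspond to derivations
  \<open>\<delta>\<close>, and those graded along a given subgroup form a subspace. As a vector space over a field of
  characteristic different from 2 is not the union of three proper subspaces, one subgroup \<open>H\<close> works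
  for all \<open>\<delta>\<close>.

  Given a lift to \<open>R\<close>, diagonalise some \<open>\<rho> h\<close>, \<open>h \<in> H\<close>, with distinct residual eigenvalues (Hensel).
  If the wrongly graded part of \<open>\<rho>\<close> takes values in \<open>m\<^sup>n\<close> but not in \<open>m\<^sup>n\<^sup>+\<^sup>1\<close>, composing it with a
  linear functional on \<open>m\<^sup>n / m\<^sup>n\<^sup>+\<^sup>1\<close> gives a derivation which contradicts the choice of \<open>H\<close>; hence it
  vanishes.

  Finally, if the universal deformation is induced from a character \<open>\<chi>\<close> of \<open>H\<close>, then so is every
  lift, and the lift determines \<open>\<chi>\<close> and conversely up to strict equivalence. Hence the two universal
  rings represent the same functor.
\<close>

text \<open>A splitting only says that the derivation becomes homogeneous after an inner derivation
  is added. Used naively, it would remove the wrongly graded part of a lift by one further change of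
  basis for each power of the maximal ideal, and a limit of bases would have to be formed. Preparing
  the basis once avoids this. The upper right entry of the image of \<open>h\<close> is made zero,
  and the first row of the image of some \<sigma> outside \<open>H\<close> is made (0, 1). Then
  every wrongly graded entry is expressed through the upper right entries on \<open>H\<close>, and
  evaluation at \<open>h\<close> shows that the inner derivation contributes nothing to these.

  Characteristic 2 is excluded by a trace argument: outside an inducing subgroup the trace vanishes,
  so with two such subgroups some element has image diag(a, -a) that is not scalar.

  A residual basis is not unique, so one residual matrix \<open>P0\<close> is fixed for the
  comparison of the universal rings. Bases that reduce to the same \<open>P0\<close> differ by a
  matrix congruent to 1, which is what strict equivalence allows.\<close>

section \<open>Local rings and the adic topology\<close>

text \<open>Zorn's lemma applies because a nonempty chain of ideals in a Noetherian ring contains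
  its union. Besides maximal ideals, this provides below the hyperplanes of
  \<open>m^n / m^(n+1)\<close> that are kernels of linear functionals.\<close>

lemma (in noetherian_ring) exists_maximal_element:
  assumes "S \<noteq> {}" "\<And>I. I \<in> S \<Longrightarrow> ideal I R"
  obtains M where "M \<in> S" "\<And>I. I \<in> S \<Longrightarrow> M \<subseteq> I \<Longrightarrow> I = M"
proof -
  have "\<exists>M\<in>S. \<forall>Y\<in>S. M \<subseteq> Y \<longrightarrow> Y = M"
  proof (rule subset_Zorn_nonempty[OF assms(1)])
    fix C assume C: "C \<noteq> {}" "subset.chain S C"
    hence "subset.chain {I. ideal I R} C"
      using assms(2) unfolding pred_on.chain_def by auto
    hence "\<Union>C \<in> C" by (rule ideal_chain_is_trivial[OF C(1)])
    thus "\<Union>C \<in> S" using C(2) unfolding pred_on.chain_def by auto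
  qed
  then obtain M where "M \<in> S" "\<forall>Y\<in>S. M \<subseteq> Y \<longrightarrow> Y = M" ..
  thus ?thesis by (intro that[of M]) simp_all
qed

text \<open>An ideal with an element outside \<open>M\<close> contains a unit, so \<open>M\<close>
  contains every proper ideal. Locality of fields, dual numbers, copies and quotients is checked in
  this way, with \<open>M\<close> zero or the kernel of the residue map.\<close>

lemma local_ring_by_units:
  fixes R (structure)
  assumes "cring R" "ideal M R" "\<one>\<^bsub>R\<^esub> \<notin> M" "\<And>x. x \<in> carrier R \<Longrightarrow> x \<notin> M \<Longrightarrow> x \<in> Units R"
  shows "local_ring R" and "max_ideal R = M"
proof -
  interpret cring R by fact
  have *: "J = carrier R" if J: "ideal J R" and x: "x \<in> J" "x \<in> Units R" for J x
  proof -
    have "inv x \<otimes> x \<in> J" using ideal.I_l_closed[OF J x(1) Units_inv_closed[OF x(2)]] .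
    thus ?thesis using ideal.one_imp_carrier[OF J] x(2) by simp
  qed
  have max: "maximalideal M R"
  proof (rule maximalidealI[OF assms(2)])
    show "carrier R \<noteq> M" using assms(3) by auto
    fix J assume J: "ideal J R" "M \<subseteq> J" "J \<subseteq> carrier R"
    show "J = M \<or> J = carrier R"
    proof (cases "J = M")
      case False
      then obtain x where x: "x \<in> J" "x \<notin> M" using J(2) by auto
      hence "x \<in> Units R" using assms(4) J(3) by blast
      thus ?thesis using *[OF J(1) x(1)] by simp
    qed simp
  qed
  have uniq: "N = M" if N: "maximalideal N R" for N
  proof -
    interpret N: maximalideal N R by fact
    have "N \<subseteq> M"
    proof
      fix x assume x: "x \<in> N"
      show "x \<in> M"
        using *[OF N.ideal_axioms x] assms(4)[OF N.Icarr[OF x]] N.I_notcarr by auto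
    qed
    thus ?thesis
      using N.I_maximal[OF assms(2)] assms(2,3) ideal.Icarr[OF assms(2)] by auto
  qed
  show "local_ring R" unfolding local_ring_def using assms(1) max uniq by blast
  show "max_ideal R = M" unfolding max_ideal_def using max uniq by (rule the_equality)
qed

lemma local_ring_max_ideal:
  assumes "local_ring R"
  shows "maximalideal (max_ideal R) R"
  using assms unfolding local_ring_def max_ideal_def by (metis theI')

lemma local_ring_max_ideal_is_ideal:
  assumes "local_ring R"
  shows "ideal (max_ideal R) R"
  using local_ring_max_ideal[OF assms] by (rule maximalideal.axioms)

text \<open>If \<open>x\<close> were not a unit, an ideal maximal among those that contain
  \<open>x\<close> and not 1 would be a maximal ideal, hence the unique one, which does not contain
  \<open>x\<close>.\<close>

lemma noetherian_local_unit:
  fixes R (structure)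
  assumes "local_ring R" "noetherian_ring R" "x \<in> carrier R" "x \<notin> max_ideal R"
  shows "x \<in> Units R"
proof (rule ccontr)
  assume x: "x \<notin> Units R"
  interpret cring R using assms(1) unfolding local_ring_def by simp
  interpret noetherian_ring R by fact
  let ?S = "{I. ideal I R \<and> x \<in> I \<and> \<one> \<notin> I}"
  have "\<one> \<notin> PIdl x"
    using x assms(3) unfolding cgenideal_def Units_def by (auto simp: m_comm)
  hence "PIdl x \<in> ?S" using cgenideal_ideal cgenideal_self assms(3) by blast
  hence "?S \<noteq> {}" by blast
  then obtain M where M: "M \<in> ?S" "\<And>I. I \<in> ?S \<Longrightarrow> M \<subseteq> I \<Longrightarrow> I = M"
    by (rule exists_maximal_element) auto
  have "maximalideal M R"
  proof (rule maximalidealI)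
    show "ideal M R" "carrier R \<noteq> M" using M(1) by auto
    fix J assume J: "ideal J R" "M \<subseteq> J" "J \<subseteq> carrier R"
    show "J = M \<or> J = carrier R"
    proof (cases "\<one> \<in> J")
      case True
      thus ?thesis using ideal.one_imp_carrier[OF J(1)] by simp
    next
      case False
      hence "J \<in> ?S" using J M(1) by blast
      thus ?thesis using M(2)[OF _ J(2)] by blast
    qed
  qed
  hence "M = max_ideal R"
    using assms(1) local_ring_max_ideal[OF assms(1)] unfolding local_ring_def by metis
  thus False using M(1) assms(4) by blast
qed

section \<open>Powers of the maximal ideal and the adic topology\<close>

context
  fixes R :: "('r, 'm) ring_scheme" (structure)
  assumes loc: "local_ring R"
begin

interpretation cring R using loc unfolding local_ring_def by simp

lemma max_ideal_pow_0: "max_ideal_pow R 0 = carrier R"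
  by (simp add: ideals_set_def)

lemma max_ideal_pow_Suc: "max_ideal_pow R (Suc n) = max_ideal_pow R n \<cdot> max_ideal R"
  by (simp add: ideals_set_def)

lemma max_ideal_pow_is_ideal: "ideal (max_ideal_pow R n) R"
proof (induct n)
  case 0
  show ?case by (simp only: max_ideal_pow_0 oneideal)
next
  case (Suc n)
  thus ?case unfolding max_ideal_pow_Suc
    by (rule ideal_prod_is_ideal[OF _ local_ring_max_ideal_is_ideal[OF loc]])
qed

lemma max_ideal_pow_1: "max_ideal_pow R 1 = max_ideal R"
proof -
  interpret I: comm_monoid "ideals_set R" by (rule ideals_set_is_comm_monoid)
  show ?thesis
    using local_ring_max_ideal_is_ideal[OF loc] by (simp add: ideals_set_def)
       (metis (no_types, lifting) I.l_one ideals_set_def mem_Collect_eq monoid.select_convs(1,2) partial_object.select_convs(1))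
qed

lemma max_ideal_pow_prod:
  assumes "x \<in> max_ideal_pow R i" "y \<in> max_ideal_pow R j"
  shows "x \<otimes> y \<in> max_ideal_pow R (i + j)"
proof -
  interpret I: comm_monoid "ideals_set R" by (rule ideals_set_is_comm_monoid)
  have "max_ideal R \<in> carrier (ideals_set R)"
    using local_ring_max_ideal_is_ideal[OF loc] by (simp add: ideals_set_def)
  hence "max_ideal_pow R (i + j) = max_ideal_pow R i \<cdot> max_ideal_pow R j"
    using I.nat_pow_mult by (simp add: ideals_set_def)
  thus ?thesis using ideal_prod.prod assms by fastforce
qed

lemma max_ideal_pow_antimono:
  assumes "i \<le> j"
  shows "max_ideal_pow R j \<subseteq> max_ideal_pow R i"
proof -
  have "max_ideal_pow R (Suc n) \<subseteq> max_ideal_pow R n" for n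
    unfolding max_ideal_pow_Suc
    using ideal_prod_inter[OF max_ideal_pow_is_ideal local_ring_max_ideal_is_ideal[OF loc]] by blast
  thus ?thesis using assms by (rule lift_Suc_antimono_le)
qed

text \<open>\<open>topology\<close> can be unfolded only for predicates that satisfy the axioms.
  Finite intersections are open because the powers of the maximal ideal decrease.\<close>

lemma openin_adic_topology:
  "openin (adic_topology R) U \<longleftrightarrow> U \<subseteq> carrier R \<and>
     (\<forall>x\<in>U. \<exists>n. \<forall>y\<in>carrier R. y \<ominus> x \<in> max_ideal_pow R n \<longrightarrow> y \<in> U)"
proof -
  have "istopology (\<lambda>U. U \<subseteq> carrier R \<and>
     (\<forall>x\<in>U. \<exists>n. \<forall>y\<in>carrier R. y \<ominus> x \<in> max_ideal_pow R n \<longrightarrow> y \<in> U))"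
    unfolding istopology_def
  proof (intro conjI allI impI ballI, goal_cases)
    case (1 S T)
    thus ?case by blast
  next
    case (2 S T x)
    then obtain n k where n: "\<forall>y\<in>carrier R. y \<ominus> x \<in> max_ideal_pow R n \<longrightarrow> y \<in> S"
      and k: "\<forall>y\<in>carrier R. y \<ominus> x \<in> max_ideal_pow R k \<longrightarrow> y \<in> T"
      by blast
    have "\<forall>y\<in>carrier R. y \<ominus> x \<in> max_ideal_pow R (max n k) \<longrightarrow> y \<in> S \<inter> T"
      using n k max_ideal_pow_antimono[of n "max n k"] max_ideal_pow_antimono[of k "max n k"] by auto
    thus ?case by blast
  next
    case (3 K)
    thus ?case by blast
  next
    case (4 K x)
    then obtain U where "U \<in> K" "x \<in> U" by blast
    thus ?case using 4(1) by (metis UnionI)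
  qed
  thus ?thesis unfolding adic_topology_def by (simp add: topology_inverse')
qed

lemma topspace_adic_topology: "topspace (adic_topology R) = carrier R"
proof -
  have "openin (adic_topology R) (carrier R)" unfolding openin_adic_topology by blast
  moreover have "topspace (adic_topology R) \<subseteq> carrier R"
    using openin_topspace[of "adic_topology R"] unfolding openin_adic_topology by blast
  ultimately show ?thesis using openin_subset by blast
qed

lemma minus_in_ideal_trans:
  assumes "ideal I R" "x \<in> carrier R" "y \<in> carrier R" "z \<in> carrier R" "x \<ominus> y \<in> I" "y \<ominus> z \<in> I"
  shows "x \<ominus> z \<in> I"
proof -
  have "x \<ominus> z = (x \<ominus> y) \<oplus> (y \<ominus> z)" using assms(2-4) by algebra
  thus ?thesis using additive_subgroup.a_closed[OF ideal.axioms(1)[OF assms(1)] assms(5,6)] by simp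
qed

text \<open>The powers of the maximal ideal play the role of \<epsilon>; continuity of sums,
  products, homomorphisms and functionals is proved in this form. The class of \<open>f x\<close>
  modulo a power is open because the power is closed under addition.\<close>

lemma continuous_map_adic_topology:
  "continuous_map T (adic_topology R) f \<longleftrightarrow>
     (\<forall>x\<in>topspace T. f x \<in> carrier R) \<and>
     (\<forall>x\<in>topspace T. \<forall>n. \<exists>W. openin T W \<and> x \<in> W \<and> (\<forall>y\<in>W. f y \<ominus> f x \<in> max_ideal_pow R n))"
  (is "?L \<longleftrightarrow> ?C \<and> ?R")
proof
  assume L: ?L
  hence C: ?C by (auto simp: continuous_map_def topspace_adic_topology)
  moreover have ?R
  proof (intro ballI allI)
    fix x n assume x: "x \<in> topspace T"
    let ?U = "{z \<in> carrier R. z \<ominus> f x \<in> max_ideal_pow R n}"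
    have "openin (adic_topology R) ?U"
      unfolding openin_adic_topology
      using minus_in_ideal_trans[OF max_ideal_pow_is_ideal] C x by blast
    hence "openin T {y \<in> topspace T. f y \<in> ?U}"
      using L unfolding continuous_map_def by blast
    moreover have "f x \<ominus> f x \<in> max_ideal_pow R n"
      using C x additive_subgroup.zero_closed[OF ideal.axioms(1)[OF max_ideal_pow_is_ideal]]
      by (simp add: minus_eq r_neg)
    ultimately show "\<exists>W. openin T W \<and> x \<in> W \<and> (\<forall>y\<in>W. f y \<ominus> f x \<in> max_ideal_pow R n)"
      using x C by (intro exI[of _ "{y \<in> topspace T. f y \<in> ?U}"]) auto
  qed
  ultimately show "?C \<and> ?R" by blast
next
  assume *: "?C \<and> ?R"
  show ?L
    unfolding continuous_map_def topspace_adic_topology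
  proof (intro conjI allI impI)
    show "f \<in> topspace T \<rightarrow> carrier R" using * by auto
    fix U assume U: "openin (adic_topology R) U"
    show "openin T {x \<in> topspace T. f x \<in> U}"
    proof (subst openin_subopen, intro ballI)
      fix x assume x: "x \<in> {x \<in> topspace T. f x \<in> U}"
      then obtain n where n: "\<forall>y\<in>carrier R. y \<ominus> f x \<in> max_ideal_pow R n \<longrightarrow> y \<in> U"
        using U unfolding openin_adic_topology by blast
      obtain W where W: "openin T W" "x \<in> W" "\<forall>y\<in>W. f y \<ominus> f x \<in> max_ideal_pow R n"
        using * x by blast
      have "W \<subseteq> {x \<in> topspace T. f x \<in> U}"
        using W n * openin_subset[OF W(1)] by auto
      thus "\<exists>W. openin T W \<and> x \<in> W \<and> W \<subseteq> {x \<in> topspace T. f x \<in> U}" using W by blast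
    qed
  qed
qed

lemma continuous_map_adic_const:
  "c \<in> carrier R \<Longrightarrow> continuous_map T (adic_topology R) (\<lambda>x. c)"
  by (simp add: topspace_adic_topology)

lemma continuous_map_adic_add:
  assumes "continuous_map T (adic_topology R) f" "continuous_map T (adic_topology R) g"
  shows "continuous_map T (adic_topology R) (\<lambda>x. f x \<oplus> g x)"
  unfolding continuous_map_adic_topology
proof (intro conjI ballI allI)
  fix x assume x: "x \<in> topspace T"
  have C: "\<And>x. x \<in> topspace T \<Longrightarrow> f x \<in> carrier R" "\<And>x. x \<in> topspace T \<Longrightarrow> g x \<in> carrier R"
    using assms unfolding continuous_map_adic_topology by blast+
  show "f x \<oplus> g x \<in> carrier R" using C x by simp
  fix n
  obtain W where W: "openin T W" "x \<in> W" "\<forall>y\<in>W. f y \<ominus> f x \<in> max_ideal_pow R n"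
    using assms(1) x unfolding continuous_map_adic_topology by blast
  obtain W' where W': "openin T W'" "x \<in> W'" "\<forall>y\<in>W'. g y \<ominus> g x \<in> max_ideal_pow R n"
    using assms(2) x unfolding continuous_map_adic_topology by blast
  have "(f y \<oplus> g y) \<ominus> (f x \<oplus> g x) \<in> max_ideal_pow R n" if y: "y \<in> W \<inter> W'" for y
  proof -
    have yT: "y \<in> topspace T" using y openin_subset[OF W(1)] by auto
    have "(f y \<oplus> g y) \<ominus> (f x \<oplus> g x) = (f y \<ominus> f x) \<oplus> (g y \<ominus> g x)"
      using C[OF x] C[OF yT] by algebra
    thus ?thesis
      using W(3) W'(3) y additive_subgroup.a_closed[OF ideal.axioms(1)[OF max_ideal_pow_is_ideal]] by auto
  qed
  thus "\<exists>W. openin T W \<and> x \<in> W \<and> (\<forall>y\<in>W. (f y \<oplus> g y) \<ominus> (f x \<oplus> g x) \<in> max_ideal_pow R n)"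
    using W W' by (intro exI[of _ "W \<inter> W'"]) auto
qed

lemma continuous_map_adic_mult:
  assumes "continuous_map T (adic_topology R) f" "continuous_map T (adic_topology R) g"
  shows "continuous_map T (adic_topology R) (\<lambda>x. f x \<otimes> g x)"
  unfolding continuous_map_adic_topology
proof (intro conjI ballI allI)
  fix x assume x: "x \<in> topspace T"
  have C: "\<And>x. x \<in> topspace T \<Longrightarrow> f x \<in> carrier R" "\<And>x. x \<in> topspace T \<Longrightarrow> g x \<in> carrier R"
    using assms unfolding continuous_map_adic_topology by blast+
  show "f x \<otimes> g x \<in> carrier R" using C x by simp
  fix n
  interpret I: ideal "max_ideal_pow R n" R by (rule max_ideal_pow_is_ideal)
  obtain W where W: "openin T W" "x \<in> W" "\<forall>y\<in>W. f y \<ominus> f x \<in> max_ideal_pow R n"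
    using assms(1) x unfolding continuous_map_adic_topology by blast
  obtain W' where W': "openin T W'" "x \<in> W'" "\<forall>y\<in>W'. g y \<ominus> g x \<in> max_ideal_pow R n"
    using assms(2) x unfolding continuous_map_adic_topology by blast
  have "(f y \<otimes> g y) \<ominus> (f x \<otimes> g x) \<in> max_ideal_pow R n" if y: "y \<in> W \<inter> W'" for y
  proof -
    have yT: "y \<in> topspace T" using y openin_subset[OF W(1)] by auto
    have "(f y \<otimes> g y) \<ominus> (f x \<otimes> g x) = f y \<otimes> (g y \<ominus> g x) \<oplus> (f y \<ominus> f x) \<otimes> g x"
      using C[OF x] C[OF yT] by algebra
    moreover have "f y \<otimes> (g y \<ominus> g x) \<in> max_ideal_pow R n" "(f y \<ominus> f x) \<otimes> g x \<in> max_ideal_pow R n"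
      using W(3) W'(3) y C(1)[OF yT] C(2)[OF x] I.I_l_closed I.I_r_closed by blast+
    ultimately show ?thesis using I.a_closed by simp
  qed
  thus "\<exists>W. openin T W \<and> x \<in> W \<and> (\<forall>y\<in>W. (f y \<otimes> g y) \<ominus> (f x \<otimes> g x) \<in> max_ideal_pow R n)"
    using W W' by (intro exI[of _ "W \<inter> W'"]) auto
qed

end

text \<open>This makes local homomorphisms continuous. A power is a product of ideals, so the
  induction step is itself an induction over the generation of that product.\<close>

lemma hom_max_ideal_pow:
  assumes "local_ring R" "local_ring S" "\<phi> \<in> ring_hom R S" "\<phi> ` max_ideal R \<subseteq> max_ideal S"
  shows "x \<in> max_ideal_pow R n \<Longrightarrow> \<phi> x \<in> max_ideal_pow S n"
proof (induct n arbitrary: x)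
  case 0
  thus ?case using ring_hom_closed[OF assms(3)]
    by (simp only: max_ideal_pow_0[OF assms(1)] max_ideal_pow_0[OF assms(2)])
next
  case (Suc n)
  interpret R: cring R using assms(1) unfolding local_ring_def by simp
  have c: "\<And>a. a \<in> max_ideal_pow R n \<Longrightarrow> a \<in> carrier R" "\<And>a. a \<in> max_ideal R \<Longrightarrow> a \<in> carrier R"
    using ideal.Icarr[OF max_ideal_pow_is_ideal[OF assms(1)]]
      ideal.Icarr[OF local_ring_max_ideal_is_ideal[OF assms(1)]] by blast+
  have P: "max_ideal_pow R n \<cdot>\<^bsub>R\<^esub> max_ideal R \<subseteq> carrier R"
    using R.ideal_prod_in_carrier[OF max_ideal_pow_is_ideal[OF assms(1)]
        local_ring_max_ideal_is_ideal[OF assms(1)]] .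
  have "x \<in> max_ideal_pow R n \<cdot>\<^bsub>R\<^esub> max_ideal R" using Suc(2) max_ideal_pow_Suc[OF assms(1)] by blast
  thus ?case unfolding max_ideal_pow_Suc[OF assms(2)]
  proof (induct rule: ideal_prod.induct)
    case (prod i j)
    thus ?case using ring_hom_mult[OF assms(3)] c Suc(1) assms(4)
      by (auto intro!: ideal_prod.prod)
  next
    case (sum s1 s2)
    hence "\<phi> (s1 \<oplus>\<^bsub>R\<^esub> s2) = \<phi> s1 \<oplus>\<^bsub>S\<^esub> \<phi> s2"
      using ring_hom_add[OF assms(3)] P by blast
    thus ?case using sum ideal_prod.sum by metis
  qed
qed

lemma continuous_map_adic_hom:
  assumes "local_ring R" "local_ring S" "\<phi> \<in> ring_hom R S" "\<phi> ` max_ideal R \<subseteq> max_ideal S"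
    and "continuous_map T (adic_topology R) f"
  shows "continuous_map T (adic_topology S) (\<lambda>x. \<phi> (f x))"
  unfolding continuous_map_adic_topology[OF assms(2)]
proof (intro conjI ballI allI)
  interpret R: cring R using assms(1) unfolding local_ring_def by simp
  interpret S: cring S using assms(2) unfolding local_ring_def by simp
  interpret ring_hom_cring R S \<phi> by unfold_locales (rule assms(3))
  fix x assume x: "x \<in> topspace T"
  have C: "\<And>x. x \<in> topspace T \<Longrightarrow> f x \<in> carrier R"
    using assms(5) unfolding continuous_map_adic_topology[OF assms(1)] by blast
  show "\<phi> (f x) \<in> carrier S" using C x by simp
  fix n
  obtain W where W: "openin T W" "x \<in> W" "\<forall>y\<in>W. f y \<ominus>\<^bsub>R\<^esub> f x \<in> max_ideal_pow R n"
    using assms(5) x unfolding continuous_map_adic_topology[OF assms(1)] by blast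
  have "\<phi> (f y) \<ominus>\<^bsub>S\<^esub> \<phi> (f x) \<in> max_ideal_pow S n" if y: "y \<in> W" for y
  proof -
    have yT: "y \<in> topspace T" using y openin_subset[OF W(1)] by auto
    have "\<phi> (f y \<ominus>\<^bsub>R\<^esub> f x) \<in> max_ideal_pow S n"
      using W y hom_max_ideal_pow[OF assms(1-4)] by blast
    thus ?thesis using C[OF x] C[OF yT] by (simp add: R.minus_eq S.minus_eq)
  qed
  thus "\<exists>W. openin T W \<and> x \<in> W \<and> (\<forall>y\<in>W. \<phi> (f y) \<ominus>\<^bsub>S\<^esub> \<phi> (f x) \<in> max_ideal_pow S n)"
    using W by blast
qed

lemma field_local:
  assumes "field F"
  shows "local_ring F" and "max_ideal F = {\<zero>\<^bsub>F\<^esub>}"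
proof -
  interpret field F by fact
  have "x \<in> Units F" if "x \<in> carrier F" "x \<notin> {\<zero>\<^bsub>F\<^esub>}" for x
    using that field_Units by auto
  thus "local_ring F" "max_ideal F = {\<zero>\<^bsub>F\<^esub>}"
    using local_ring_by_units[OF is_cring zeroideal] one_not_zero by auto
qed

section \<open>Two by two matrices\<close>

text \<open>Stated for a monoid, with \<open>x\<close> meant to be a unit, because in the matrix
  ring it is also applied to values of derivations, which need not be invertible.\<close>

definition conj_by :: "('a, 'b) monoid_scheme \<Rightarrow> 'a \<Rightarrow> 'a \<Rightarrow> 'a" where
  "conj_by G x y = x \<otimes>\<^bsub>G\<^esub> y \<otimes>\<^bsub>G\<^esub> inv\<^bsub>G\<^esub> x"

section \<open>Conjugation by units\<close>

context monoid
begin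

lemma conj_by_closed [simp]: "x \<in> Units G \<Longrightarrow> y \<in> carrier G \<Longrightarrow> conj_by G x y \<in> carrier G"
  unfolding conj_by_def by auto

lemma Units_cancel_inv [simp]:
  "x \<in> Units G \<Longrightarrow> y \<in> carrier G \<Longrightarrow> x \<otimes> (inv x \<otimes> y) = y"
  "x \<in> Units G \<Longrightarrow> y \<in> carrier G \<Longrightarrow> inv x \<otimes> (x \<otimes> y) = y"
  by (simp_all add: Units_closed m_assoc[symmetric])

lemma conj_by_mult:
  assumes "x \<in> Units G" "y \<in> carrier G" "z \<in> carrier G"
  shows "conj_by G x (y \<otimes> z) = conj_by G x y \<otimes> conj_by G x z"
  unfolding conj_by_def using assms by (simp add: m_assoc Units_closed)

lemma conj_by_one [simp]: "x \<in> Units G \<Longrightarrow> conj_by G x \<one> = \<one>"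
  unfolding conj_by_def by (simp add: Units_closed)

lemma conj_by_Units: "x \<in> Units G \<Longrightarrow> y \<in> Units G \<Longrightarrow> conj_by G x y \<in> Units G"
  unfolding conj_by_def by simp

lemma conj_by_eq_iff:
  assumes "x \<in> Units G" "y \<in> carrier G" "z \<in> carrier G"
  shows "conj_by G x y = z \<longleftrightarrow> x \<otimes> y = z \<otimes> x"
proof
  assume "conj_by G x y = z"
  hence "x \<otimes> y \<otimes> inv x \<otimes> x = z \<otimes> x" unfolding conj_by_def by simp
  thus "x \<otimes> y = z \<otimes> x" using assms by (simp add: m_assoc Units_closed)
next
  assume "x \<otimes> y = z \<otimes> x"
  thus "conj_by G x y = z" unfolding conj_by_def using assms by (simp add: m_assoc Units_closed)
qed

lemma conj_by_swap:
  assumes "x \<in> Units G" "y \<in> carrier G"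
  shows "x \<otimes> y = conj_by G x y \<otimes> x"
  using conj_by_eq_iff[OF assms conj_by_closed[OF assms]] by simp

lemma inv_mult_Units:
  assumes "x \<in> Units G" "y \<in> Units G"
  shows "inv (x \<otimes> y) = inv y \<otimes> inv x"
  using assms by (intro inv_unique'[symmetric]) (simp_all add: m_assoc Units_closed)

lemma conj_by_conj_by:
  assumes "x \<in> Units G" "y \<in> Units G" "z \<in> carrier G"
  shows "conj_by G (x \<otimes> y) z = conj_by G x (conj_by G y z)"
  unfolding conj_by_def using assms by (simp add: inv_mult_Units m_assoc Units_closed)

lemma conj_by_inv [simp]:
  assumes "x \<in> Units G" "y \<in> carrier G"
  shows "conj_by G (inv x) (conj_by G x y) = y" "conj_by G x (conj_by G (inv x) y) = y"
  using assms by (simp_all add: conj_by_conj_by[symmetric]) (simp_all add: conj_by_def)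

lemma conj_by_one_left [simp]: "y \<in> carrier G \<Longrightarrow> conj_by G \<one> y = y"
  unfolding conj_by_def by simp

end

lemma (in ring) conj_by_add:
  assumes "x \<in> Units R" "y \<in> carrier R" "z \<in> carrier R"
  shows "conj_by R x (y \<oplus> z) = conj_by R x y \<oplus> conj_by R x z"
  unfolding conj_by_def using assms by (simp add: r_distr l_distr Units_closed)

lemma ring_hom_inv:
  assumes "monoid R" "monoid S" "\<phi> \<in> ring_hom R S" "x \<in> Units R"
  shows "\<phi> x \<in> Units S" and "\<phi> (inv\<^bsub>R\<^esub> x) = inv\<^bsub>S\<^esub> (\<phi> x)"
proof -
  interpret R: monoid R by fact
  interpret S: monoid S by fact
  have c: "\<phi> x \<in> carrier S" "\<phi> (inv\<^bsub>R\<^esub> x) \<in> carrier S"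
    using assms(3,4) ring_hom_closed by (fastforce simp: R.Units_closed)+
  have m: "\<phi> (inv\<^bsub>R\<^esub> x) \<otimes>\<^bsub>S\<^esub> \<phi> x = \<one>\<^bsub>S\<^esub>" "\<phi> x \<otimes>\<^bsub>S\<^esub> \<phi> (inv\<^bsub>R\<^esub> x) = \<one>\<^bsub>S\<^esub>"
    using assms(4) ring_hom_mult[OF assms(3), symmetric] ring_hom_one[OF assms(3)]
    by (simp_all add: R.Units_closed)
  show "\<phi> x \<in> Units S" using c m unfolding Units_def by blast
  show "\<phi> (inv\<^bsub>R\<^esub> x) = inv\<^bsub>S\<^esub> (\<phi> x)"
    using S.inv_unique'[OF c m(2,1)] .
qed

lemma ring_hom_conj_by:
  assumes "monoid R" "monoid S" "\<phi> \<in> ring_hom R S" "x \<in> Units R" "y \<in> carrier R"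
  shows "\<phi> (conj_by R x y) = conj_by S (\<phi> x) (\<phi> y)"
proof -
  interpret R: monoid R by fact
  show ?thesis
    unfolding conj_by_def using assms ring_hom_inv[OF assms(1-4)] ring_hom_mult[OF assms(3)]
    by (simp add: R.Units_closed)
qed

text \<open>\<open>GL2\<close> is its group of units. The additive structure is needed for
  homogeneous components and for derivations.\<close>

definition mat2_ring :: "('r, 'm) ring_scheme \<Rightarrow> 'r mat2 ring" where
  "mat2_ring R =
     \<lparr> carrier = carrier (mat2_monoid R), mult = mult (mat2_monoid R), one = one (mat2_monoid R),
       zero = Mat2 \<zero>\<^bsub>R\<^esub> \<zero>\<^bsub>R\<^esub> \<zero>\<^bsub>R\<^esub> \<zero>\<^bsub>R\<^esub>,
       add = (\<lambda>A B. Mat2 (e11 A \<oplus>\<^bsub>R\<^esub> e11 B) (e12 A \<oplus>\<^bsub>R\<^esub> e12 B)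
                         (e21 A \<oplus>\<^bsub>R\<^esub> e21 B) (e22 A \<oplus>\<^bsub>R\<^esub> e22 B)) \<rparr>"

lemma mat2_ring_carrier:
  "A \<in> carrier (mat2_ring R) \<longleftrightarrow>
     e11 A \<in> carrier R \<and> e12 A \<in> carrier R \<and> e21 A \<in> carrier R \<and> e22 A \<in> carrier R"
  by (cases A) (simp add: mat2_ring_def mat2_monoid_def)

lemma Mat2_carrier [simp]:
  "Mat2 a b c d \<in> carrier (mat2_ring R) \<longleftrightarrow>
     a \<in> carrier R \<and> b \<in> carrier R \<and> c \<in> carrier R \<and> d \<in> carrier R"
  unfolding mat2_ring_carrier by simp

lemma mat2_ring_entries [simp]:
  assumes "A \<in> carrier (mat2_ring R)"
  shows "e11 A \<in> carrier R" "e12 A \<in> carrier R" "e21 A \<in> carrier R" "e22 A \<in> carrier R"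
  using assms unfolding mat2_ring_carrier by auto

lemma mat2_ring_mult:
  "A \<otimes>\<^bsub>mat2_ring R\<^esub> B = Mat2 (e11 A \<otimes>\<^bsub>R\<^esub> e11 B \<oplus>\<^bsub>R\<^esub> e12 A \<otimes>\<^bsub>R\<^esub> e21 B)
                          (e11 A \<otimes>\<^bsub>R\<^esub> e12 B \<oplus>\<^bsub>R\<^esub> e12 A \<otimes>\<^bsub>R\<^esub> e22 B)
                          (e21 A \<otimes>\<^bsub>R\<^esub> e11 B \<oplus>\<^bsub>R\<^esub> e22 A \<otimes>\<^bsub>R\<^esub> e21 B)
                          (e21 A \<otimes>\<^bsub>R\<^esub> e12 B \<oplus>\<^bsub>R\<^esub> e22 A \<otimes>\<^bsub>R\<^esub> e22 B)"
  by (simp add: mat2_ring_def mat2_monoid_def)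

lemma mat2_ring_one: "\<one>\<^bsub>mat2_ring R\<^esub> = Mat2 \<one>\<^bsub>R\<^esub> \<zero>\<^bsub>R\<^esub> \<zero>\<^bsub>R\<^esub> \<one>\<^bsub>R\<^esub>"
  by (simp add: mat2_ring_def mat2_monoid_def)

lemma mat2_ring_zero: "\<zero>\<^bsub>mat2_ring R\<^esub> = Mat2 \<zero>\<^bsub>R\<^esub> \<zero>\<^bsub>R\<^esub> \<zero>\<^bsub>R\<^esub> \<zero>\<^bsub>R\<^esub>"
  by (simp add: mat2_ring_def)

lemma mat2_ring_add:
  "A \<oplus>\<^bsub>mat2_ring R\<^esub> B = Mat2 (e11 A \<oplus>\<^bsub>R\<^esub> e11 B) (e12 A \<oplus>\<^bsub>R\<^esub> e12 B)
                         (e21 A \<oplus>\<^bsub>R\<^esub> e21 B) (e22 A \<oplus>\<^bsub>R\<^esub> e22 B)"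
  by (simp add: mat2_ring_def)

lemmas mat2_ring_simps = mat2_ring_mult mat2_ring_one mat2_ring_zero mat2_ring_add

lemma units_of_mat2_ring: "units_of (mat2_ring R) = GL2 R"
  unfolding GL2_def units_of_def Units_def by (simp add: mat2_ring_def)

lemma GL2_carrier: "carrier (GL2 R) = Units (mat2_ring R)"
  by (simp add: units_of_mat2_ring[symmetric] units_of_carrier)

lemma GL2_mult: "A \<otimes>\<^bsub>GL2 R\<^esub> B = A \<otimes>\<^bsub>mat2_ring R\<^esub> B"
  by (simp add: units_of_mat2_ring[symmetric] units_of_mult)

lemma GL2_one: "\<one>\<^bsub>GL2 R\<^esub> = \<one>\<^bsub>mat2_ring R\<^esub>"
  by (simp add: units_of_mat2_ring[symmetric] units_of_one)

lemma map_mat2_entries [simp]: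
  "e11 (map_mat2 f A) = f (e11 A)" "e12 (map_mat2 f A) = f (e12 A)"
  "e21 (map_mat2 f A) = f (e21 A)" "e22 (map_mat2 f A) = f (e22 A)"
  by (cases A; simp)+

definition det2 :: "('r, 'm) ring_scheme \<Rightarrow> 'r mat2 \<Rightarrow> 'r" where
  "det2 R A = e11 A \<otimes>\<^bsub>R\<^esub> e22 A \<ominus>\<^bsub>R\<^esub> e12 A \<otimes>\<^bsub>R\<^esub> e21 A"

definition trace2 :: "('r, 'm) ring_scheme \<Rightarrow> 'r mat2 \<Rightarrow> 'r" where
  "trace2 R A = e11 A \<oplus>\<^bsub>R\<^esub> e22 A"

text \<open>The flag is the degree in the \<int>/2-grading: \<open>True\<close> is the diagonal
  part, \<open>False\<close> the antidiagonal part. With this convention degrees are combined by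
  \<open>=\<close>, just like membership in a subgroup of index two.\<close>

definition homogeneous :: "('r, 'm) ring_scheme \<Rightarrow> bool \<Rightarrow> 'r mat2 \<Rightarrow> bool" where
  "homogeneous R s A \<longleftrightarrow>
     (if s then e12 A = \<zero>\<^bsub>R\<^esub> \<and> e21 A = \<zero>\<^bsub>R\<^esub> else e11 A = \<zero>\<^bsub>R\<^esub> \<and> e22 A = \<zero>\<^bsub>R\<^esub>)"

context cring
begin

lemma mat2_ring_is_ring: "ring (mat2_ring R)"
proof (rule ringI)
  show "abelian_group (mat2_ring R)"
  proof (rule abelian_groupI)
    fix A assume A: "A \<in> carrier (mat2_ring R)"
    show "\<exists>B\<in>carrier (mat2_ring R). B \<oplus>\<^bsub>mat2_ring R\<^esub> A = \<zero>\<^bsub>mat2_ring R\<^esub>"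
      using A by (intro bexI[of _ "Mat2 (\<ominus> e11 A) (\<ominus> e12 A) (\<ominus> e21 A) (\<ominus> e22 A)"])
        (auto simp: mat2_ring_simps l_neg)
  qed (auto simp: mat2_ring_simps a_ac)
  show "monoid (mat2_ring R)"
    by (rule monoidI)
       (auto simp: mat2_ring_simps l_distr r_distr a_ac m_ac)
qed (auto simp: mat2_ring_simps l_distr r_distr a_ac)

interpretation M: ring "mat2_ring R" by (rule mat2_ring_is_ring)

lemma GL2_inv: "A \<in> Units (mat2_ring R) \<Longrightarrow> inv\<^bsub>GL2 R\<^esub> A = inv\<^bsub>mat2_ring R\<^esub> A"
  by (simp add: units_of_mat2_ring[symmetric] M.units_of_inv)

lemma det2_closed [simp]: "A \<in> carrier (mat2_ring R) \<Longrightarrow> det2 R A \<in> carrier R"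
  by (simp add: det2_def)

lemma det2_mult:
  assumes "A \<in> carrier (mat2_ring R)" "B \<in> carrier (mat2_ring R)"
  shows "det2 R (A \<otimes>\<^bsub>mat2_ring R\<^esub> B) = det2 R A \<otimes> det2 R B"
proof -
  have "\<And>a b c d a' b' c' d'. \<lbrakk>a \<in> carrier R; b \<in> carrier R; c \<in> carrier R; d \<in> carrier R;
    a' \<in> carrier R; b' \<in> carrier R; c' \<in> carrier R; d' \<in> carrier R\<rbrakk> \<Longrightarrow>
    (a \<otimes> a' \<oplus> b \<otimes> c') \<otimes> (c \<otimes> b' \<oplus> d \<otimes> d') \<ominus> (a \<otimes> b' \<oplus> b \<otimes> d') \<otimes> (c \<otimes> a' \<oplus> d \<otimes> c')
     = (a \<otimes> d \<ominus> b \<otimes> c) \<otimes> (a' \<otimes> d' \<ominus> b' \<otimes> c')"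
    by algebra
  thus ?thesis using assms by (simp add: det2_def mat2_ring_simps)
qed

lemma det2_unit_iff:
  assumes "A \<in> carrier (mat2_ring R)"
  shows "A \<in> Units (mat2_ring R) \<longleftrightarrow> det2 R A \<in> Units R"
proof
  assume A: "A \<in> Units (mat2_ring R)"
  have 1: "det2 R \<one>\<^bsub>mat2_ring R\<^esub> = \<one>" by (simp add: det2_def mat2_ring_simps) algebra
  have "det2 R A \<otimes> det2 R (inv\<^bsub>mat2_ring R\<^esub> A) = \<one>"
    using A assms by (simp add: det2_mult[symmetric] 1)
  thus "det2 R A \<in> Units R"
    by (metis A M.Units_inv_closed Units_one_closed assms det2_closed unit_factor)
next
  assume u: "det2 R A \<in> Units R"
  let ?d = "inv (det2 R A)"
  \<comment> \<open>The adjugate divided by the determinant.\<close>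
  let ?B = "Mat2 (?d \<otimes> e22 A) (\<ominus> (?d \<otimes> e12 A)) (\<ominus> (?d \<otimes> e21 A)) (?d \<otimes> e11 A)"
  have d: "?d \<in> carrier R" "?d \<otimes> det2 R A = \<one>" using u by simp_all
  have B: "?B \<in> carrier (mat2_ring R)" using d(1) assms by simp
  have dd: "?d \<otimes> (e11 A \<otimes> e22 A \<ominus> e12 A \<otimes> e21 A) = \<one>" using d(2) by (simp add: det2_def)
  have z: "\<And>a b c d e. \<lbrakk>a \<in> carrier R; b \<in> carrier R; c \<in> carrier R; d \<in> carrier R; e \<in> carrier R\<rbrakk> \<Longrightarrow>
     a \<otimes> (e \<otimes> d) \<oplus> b \<otimes> (\<ominus> (e \<otimes> c)) = e \<otimes> (a \<otimes> d \<ominus> b \<otimes> c)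
   \<and> a \<otimes> (\<ominus> (e \<otimes> b)) \<oplus> b \<otimes> (e \<otimes> a) = \<zero>
   \<and> c \<otimes> (e \<otimes> d) \<oplus> d \<otimes> (\<ominus> (e \<otimes> c)) = \<zero>
   \<and> c \<otimes> (\<ominus> (e \<otimes> b)) \<oplus> d \<otimes> (e \<otimes> a) = e \<otimes> (a \<otimes> d \<ominus> b \<otimes> c)
   \<and> (e \<otimes> d) \<otimes> a \<oplus> (\<ominus> (e \<otimes> b)) \<otimes> c = e \<otimes> (a \<otimes> d \<ominus> b \<otimes> c)
   \<and> (e \<otimes> d) \<otimes> b \<oplus> (\<ominus> (e \<otimes> b)) \<otimes> d = \<zero>
   \<and> (\<ominus> (e \<otimes> c)) \<otimes> a \<oplus> (e \<otimes> a) \<otimes> c = \<zero>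
   \<and> (\<ominus> (e \<otimes> c)) \<otimes> b \<oplus> (e \<otimes> a) \<otimes> d = e \<otimes> (a \<otimes> d \<ominus> b \<otimes> c)"
    by (simp add: minus_eq r_distr l_minus r_minus m_ac a_ac l_neg r_neg)
  note zz = z[OF mat2_ring_entries[OF assms] d(1)]
  have "A \<otimes>\<^bsub>mat2_ring R\<^esub> ?B = \<one>\<^bsub>mat2_ring R\<^esub>" "?B \<otimes>\<^bsub>mat2_ring R\<^esub> A = \<one>\<^bsub>mat2_ring R\<^esub>"
    using zz dd by (simp_all add: mat2_ring_simps)
  thus "A \<in> Units (mat2_ring R)" using assms B unfolding Units_def by blast
qed

text \<open>Determinants are multiplicative, so over a commutative ring a one-sided inverse is
  enough.\<close>

lemma mat2_right_inverse_unit: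
  assumes "A \<in> carrier (mat2_ring R)" "B \<in> carrier (mat2_ring R)"
    "A \<otimes>\<^bsub>mat2_ring R\<^esub> B = \<one>\<^bsub>mat2_ring R\<^esub>"
  shows "A \<in> Units (mat2_ring R)"
proof -
  have 1: "det2 R \<one>\<^bsub>mat2_ring R\<^esub> = \<one>" by (simp add: det2_def mat2_ring_simps) algebra
  have "det2 R A \<otimes> det2 R B = \<one>" using assms by (simp add: det2_mult[symmetric] 1)
  hence "det2 R A \<in> Units R"
    by (metis Units_one_closed assms(1,2) det2_closed unit_factor)
  thus ?thesis using det2_unit_iff assms by simp
qed

text \<open>The trace compares gradings in different bases: it vanishes wherever one of them makes
  the matrix antidiagonal.\<close>

lemma trace2_conj_by:
  assumes "P \<in> Units (mat2_ring R)" "A \<in> carrier (mat2_ring R)"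
  shows "trace2 R (conj_by (mat2_ring R) P A) = trace2 R A"
proof -
  have comm: "trace2 R (B \<otimes>\<^bsub>mat2_ring R\<^esub> C) = trace2 R (C \<otimes>\<^bsub>mat2_ring R\<^esub> B)"
    if "B \<in> carrier (mat2_ring R)" "C \<in> carrier (mat2_ring R)" for B C
    using that by (simp add: trace2_def mat2_ring_simps a_ac m_ac)
  have "trace2 R (conj_by (mat2_ring R) P A) =
     trace2 R (inv\<^bsub>mat2_ring R\<^esub> P \<otimes>\<^bsub>mat2_ring R\<^esub> (P \<otimes>\<^bsub>mat2_ring R\<^esub> A))"
    unfolding conj_by_def using assms by (intro comm) (simp_all add: M.Units_closed)
  thus ?thesis using assms by simp
qed

lemma homogeneous_mult:
  assumes "A \<in> carrier (mat2_ring R)" "B \<in> carrier (mat2_ring R)"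
    "homogeneous R s A" "homogeneous R t B"
  shows "homogeneous R (s = t) (A \<otimes>\<^bsub>mat2_ring R\<^esub> B)"
  using assms by (auto simp: homogeneous_def mat2_ring_simps split: if_splits)

end

lemma map_mat2_conv:
  "map_mat2 f A = Mat2 (f (e11 A)) (f (e12 A)) (f (e21 A)) (f (e22 A))"
  by (cases A) simp

lemma map_mat2_ring_hom:
  assumes "\<phi> \<in> ring_hom R S" "ring R" "ring S"
  shows "map_mat2 \<phi> \<in> ring_hom (mat2_ring R) (mat2_ring S)"
proof -
  interpret R: ring R by fact
  interpret S: ring S by fact
  interpret ring_hom_ring R S \<phi> by (unfold_locales) (rule assms(1))
  show ?thesis
    by (rule ring_hom_memI) (auto simp: mat2_ring_simps map_mat2_conv)
qed

lemma homogeneous_map: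
  assumes "\<phi> \<in> ring_hom R S" "ring R" "ring S" "homogeneous R s A"
  shows "homogeneous S s (map_mat2 \<phi> A)"
  using assms(4) ring_hom_zero[OF assms(1-3)] by (auto simp: homogeneous_def)

section \<open>Induced representations as graded representations\<close>

text \<open>Index two in the form in which it is used: membership in \<open>H\<close> is a
  homomorphism onto \<int>/2, and so it can serve as a degree.\<close>

locale index_two = group G for G (structure) +
  fixes H
  assumes subgroup: "subgroup H G"
    and mult_mem_iff: "x \<in> carrier G \<Longrightarrow> y \<in> carrier G \<Longrightarrow> x \<otimes> y \<in> H \<longleftrightarrow> (x \<in> H \<longleftrightarrow> y \<in> H)"
    and proper: "H \<noteq> carrier G"
begin

lemma mem_carrier [simp]: "h \<in> H \<Longrightarrow> h \<in> carrier G"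
  by (rule subgroup.mem_carrier[OF subgroup])

lemma one_mem [simp]: "\<one> \<in> H"
  by (rule subgroup.one_closed[OF subgroup])

lemma inv_mem_iff: "x \<in> carrier G \<Longrightarrow> inv x \<in> H \<longleftrightarrow> x \<in> H"
  using mult_mem_iff[of x "inv x"] by simp

lemma mult_mem [simp]: "x \<in> H \<Longrightarrow> y \<in> H \<Longrightarrow> x \<otimes> y \<in> H"
  by (simp add: mult_mem_iff)

lemma obtain_outside: obtains \<sigma> where "\<sigma> \<in> carrier G - H"
  using proper subgroup.subset[OF subgroup] by blast

end

text \<open>For \<open>x\<close> and \<open>y\<close> outside \<open>H\<close>, both
  \<open>x\<close> and the inverse of \<open>y\<close> lie in the only coset other than
  \<open>H\<close>, so \<open>x y\<close> lies in \<open>H\<close>. The mixed cases hold for every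
  subgroup.\<close>

lemma open_index2_index_two:
  assumes "group G" "open_index2 G T H"
  shows "index_two G H"
proof -
  interpret group G by fact
  have H: "subgroup H G" using assms(2) normal_imp_subgroup unfolding open_index2_def by blast
  have card: "card (rcosets\<^bsub>G\<^esub> H) = 2" using assms(2) unfolding open_index2_def by blast
  have Hc: "H \<in> rcosets\<^bsub>G\<^esub> H" 
    using rcosetsI[OF subgroup.subset[OF H] one_closed] subgroup.subset[OF H] by (simp add: coset_mult_one)
  have cos: "H #>\<^bsub>G\<^esub> x \<in> rcosets\<^bsub>G\<^esub> H" if "x \<in> carrier G" for x
    using rcosetsI[OF subgroup.subset[OF H] that] .
  have ne: "H #>\<^bsub>G\<^esub> x \<noteq> H" if "x \<in> carrier G" "x \<notin> H" for x
    using rcos_self[OF that(1) H] that by auto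
  have out: "x \<otimes>\<^bsub>G\<^esub> y \<in> H" if x: "x \<in> carrier G" "x \<notin> H" and y: "y \<in> carrier G" "y \<notin> H" for x y
  proof -
    have iy: "inv\<^bsub>G\<^esub> y \<in> carrier G" "inv\<^bsub>G\<^esub> y \<notin> H"
      using y subgroup.m_inv_closed[OF H, of "inv\<^bsub>G\<^esub> y"] by auto
    obtain A B where AB: "rcosets\<^bsub>G\<^esub> H = {A, B}" using card by (auto simp: card_2_iff)
    have "H #>\<^bsub>G\<^esub> x = H #>\<^bsub>G\<^esub> inv\<^bsub>G\<^esub> y"
      using cos[OF x(1)] cos[OF iy(1)] Hc ne[OF x] ne[OF iy] unfolding AB by auto
    hence "x \<in> H #>\<^bsub>G\<^esub> inv\<^bsub>G\<^esub> y" using rcos_self[OF x(1) H] by simp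
    then obtain h where "h \<in> H" "x = h \<otimes>\<^bsub>G\<^esub> inv\<^bsub>G\<^esub> y" unfolding r_coset_def by blast
    thus ?thesis using y subgroup.mem_carrier[OF H] by (simp add: m_assoc)
  qed
  have mixed: "(x \<otimes>\<^bsub>G\<^esub> y \<in> H) = (y \<in> H)" "(y \<otimes>\<^bsub>G\<^esub> x \<in> H) = (y \<in> H)"
    if x: "x \<in> H" and y: "y \<in> carrier G" for x y
  proof -
    have xc: "x \<in> carrier G" using subgroup.mem_carrier[OF H x] .
    have "y = inv\<^bsub>G\<^esub> x \<otimes>\<^bsub>G\<^esub> (x \<otimes>\<^bsub>G\<^esub> y)" "y = (y \<otimes>\<^bsub>G\<^esub> x) \<otimes>\<^bsub>G\<^esub> inv\<^bsub>G\<^esub> x"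
      using xc y by (simp_all add: m_assoc[symmetric]) (simp add: m_assoc)
    thus "(x \<otimes>\<^bsub>G\<^esub> y \<in> H) = (y \<in> H)" "(y \<otimes>\<^bsub>G\<^esub> x \<in> H) = (y \<in> H)"
      using subgroup.m_closed[OF H] subgroup.m_inv_closed[OF H x] x by metis+
  qed
  show ?thesis
  proof (intro index_two.intro index_two_axioms.intro)
    show "group G" by (rule assms(1))
    show "subgroup H G" by (rule H)
    show "x \<otimes>\<^bsub>G\<^esub> y \<in> H \<longleftrightarrow> (x \<in> H \<longleftrightarrow> y \<in> H)" if "x \<in> carrier G" "y \<in> carrier G" for x y
      using out mixed that by blast
    show "H \<noteq> carrier G"
    proof
      assume "H = carrier G"
      hence "rcosets\<^bsub>G\<^esub> H = {H}"
        unfolding RCOSETS_def using coset_join2[OF _ H] Hc by (auto simp: RCOSETS_def)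
      thus False using card by simp
    qed
  qed
qed

text \<open>Extension by zero lets the four entries of the induced matrix be written without case
  distinctions; the zeros are its grading.\<close>

definition extend0 :: "('r, 'm) ring_scheme \<Rightarrow> 'g set \<Rightarrow> ('g \<Rightarrow> 'r) \<Rightarrow> 'g \<Rightarrow> 'r" where
  "extend0 R H chi x = (if x \<in> H then chi x else \<zero>\<^bsub>R\<^esub>)"

text \<open>The matrix of the action of \<open>g\<close> on the induced representation in the coordinates
  \<open>f \<mapsto> (f 1, f \<sigma>)\<close>.\<close>

definition induced_mat ::
    "('g, 'm) monoid_scheme \<Rightarrow> ('r, 'n) ring_scheme \<Rightarrow> 'g set \<Rightarrow> 'g \<Rightarrow> ('g \<Rightarrow> 'r) \<Rightarrow> 'g \<Rightarrow> 'r mat2" where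
  "induced_mat G R H \<sigma> chi g =
     Mat2 (extend0 R H chi g) (extend0 R H chi (g \<otimes>\<^bsub>G\<^esub> inv\<^bsub>G\<^esub> \<sigma>))
          (extend0 R H chi (\<sigma> \<otimes>\<^bsub>G\<^esub> g)) (extend0 R H chi (\<sigma> \<otimes>\<^bsub>G\<^esub> g \<otimes>\<^bsub>G\<^esub> inv\<^bsub>G\<^esub> \<sigma>))"

definition graded ::
    "('g, 'm) monoid_scheme \<Rightarrow> ('r, 'n) ring_scheme \<Rightarrow> 'g set \<Rightarrow> ('g \<Rightarrow> 'r mat2) \<Rightarrow> 'r mat2 \<Rightarrow> bool" where
  "graded G R H \<rho> P \<longleftrightarrow> P \<in> Units (mat2_ring R) \<and>
     (\<forall>g\<in>carrier G. homogeneous R (g \<in> H) (conj_by (mat2_ring R) P (\<rho> g)))"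

lemma rep_hom:
  assumes "\<rho> \<in> hom G (GL2 R)"
  shows "g \<in> carrier G \<Longrightarrow> \<rho> g \<in> Units (mat2_ring R)"
    and "g \<in> carrier G \<Longrightarrow> \<rho> g \<in> carrier (mat2_ring R)"
    and "g \<in> carrier G \<Longrightarrow> g' \<in> carrier G \<Longrightarrow> \<rho> (g \<otimes>\<^bsub>G\<^esub> g') = \<rho> g \<otimes>\<^bsub>mat2_ring R\<^esub> \<rho> g'"
  using assms unfolding hom_def GL2_carrier GL2_mult by (auto simp: Units_def)

locale induction_datum = index_two G H + R: cring R
  for G :: "('g, 'm) monoid_scheme" (structure) and H and R :: "('r, 'n) ring_scheme" +
  fixes \<sigma>
  assumes \<sigma>: "\<sigma> \<in> carrier G" "\<sigma> \<notin> H"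
begin

sublocale M: ring "mat2_ring R" by (rule R.mat2_ring_is_ring)

context
  fixes chi
  assumes chi: "chi \<in> hom (G\<lparr>carrier := H\<rparr>) (units_of R)"
begin

abbreviation "c \<equiv> extend0 R H chi"

lemma chi_unit: "h \<in> H \<Longrightarrow> chi h \<in> Units R"
  using chi unfolding hom_def units_of_def by auto

lemma chi_closed: "h \<in> H \<Longrightarrow> chi h \<in> carrier R"
  using chi_unit R.Units_closed by blast

lemma chi_mult: "h \<in> H \<Longrightarrow> k \<in> H \<Longrightarrow> chi (h \<otimes> k) = chi h \<otimes>\<^bsub>R\<^esub> chi k"
  using chi unfolding hom_def units_of_def by auto

lemma chi_one: "chi \<one> = \<one>\<^bsub>R\<^esub>"
proof -
  have "chi \<one> \<otimes>\<^bsub>R\<^esub> chi \<one> = chi \<one> \<otimes>\<^bsub>R\<^esub> \<one>\<^bsub>R\<^esub>"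
    using chi_mult[of \<one> \<one>] chi_closed[of \<one>] by simp
  thus ?thesis using R.Units_l_cancel[OF chi_unit[of \<one>] chi_closed[of \<one>] R.one_closed] by simp
qed

lemma extend0_closed [simp]: "c x \<in> carrier R"
  by (simp add: extend0_def chi_closed)

lemma extend0_mult:
  "x \<in> carrier G \<Longrightarrow> y \<in> carrier G \<Longrightarrow> x \<in> H \<or> y \<in> H \<Longrightarrow> c (x \<otimes> y) = c x \<otimes>\<^bsub>R\<^esub> c y"
  by (auto simp: extend0_def mult_mem_iff chi_mult chi_closed)

text \<open>At most one of the two terms survives: the first if \<open>x\<close> lies in
  \<open>H\<close>, and otherwise the second, after inserting the inverse of \<sigma> and \<sigma>
  between \<open>x\<close> and \<open>y\<close>. The formula is shaped like an entry of a product of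
  2 by 2 matrices.\<close>

lemma extend0_mult_expand:
  assumes "x \<in> carrier G" "y \<in> carrier G"
  shows "c (x \<otimes> y) = c x \<otimes>\<^bsub>R\<^esub> c y \<oplus>\<^bsub>R\<^esub> c (x \<otimes> inv \<sigma>) \<otimes>\<^bsub>R\<^esub> c (\<sigma> \<otimes> y)"
proof (cases "x \<in> H")
  case True
  hence "c (x \<otimes> inv \<sigma>) = \<zero>\<^bsub>R\<^esub>"
    using assms \<sigma> by (simp add: extend0_def mult_mem_iff inv_mem_iff)
  thus ?thesis using extend0_mult[OF assms] True by simp
next
  case False
  hence "x \<otimes> inv \<sigma> \<in> H" using assms \<sigma> by (simp add: mult_mem_iff inv_mem_iff)
  hence "c ((x \<otimes> inv \<sigma>) \<otimes> (\<sigma> \<otimes> y)) = c (x \<otimes> inv \<sigma>) \<otimes>\<^bsub>R\<^esub> c (\<sigma> \<otimes> y)"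
    using extend0_mult assms \<sigma> by simp
  moreover have "(x \<otimes> inv \<sigma>) \<otimes> (\<sigma> \<otimes> y) = x \<otimes> y"
    using assms \<sigma> by (simp add: m_assoc inv_solve_left)
  moreover have "c x = \<zero>\<^bsub>R\<^esub>" using False by (simp add: extend0_def)
  ultimately show ?thesis by simp
qed

abbreviation "S \<equiv> induced_mat G R H \<sigma> chi"

lemma induced_mat_closed [simp]: "S g \<in> carrier (mat2_ring R)"
  by (simp add: induced_mat_def)

text \<open>The four entries are the instances of \<open>extend0_mult_expand\<close> where the first
  factor is \<open>g\<close> or \<open>\<sigma> g\<close> and the second is \<open>g'\<close> or
  \<open>g' \<sigma>^-1\<close>.\<close>

lemma induced_mat_mult:
  assumes "g \<in> carrier G" "g' \<in> carrier G"
  shows "S (g \<otimes> g') = S g \<otimes>\<^bsub>mat2_ring R\<^esub> S g'"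
proof -
  have *: "g' \<otimes> inv \<sigma> \<in> carrier G" "\<sigma> \<otimes> g \<in> carrier G" using assms \<sigma> by auto
  show ?thesis
    using extend0_mult_expand[OF assms] extend0_mult_expand[OF assms(1) *(1)]
      extend0_mult_expand[OF *(2) assms(2)] extend0_mult_expand[OF *(2,1)] assms \<sigma>
    by (simp add: induced_mat_def mat2_ring_mult m_assoc)
qed

lemma induced_mat_one: "S \<one> = \<one>\<^bsub>mat2_ring R\<^esub>"
  using \<sigma> by (simp add: induced_mat_def extend0_def mat2_ring_one chi_one inv_mem_iff)

lemma induced_mat_hom: "S \<in> hom G (GL2 R)"
proof -
  have "S g \<in> Units (mat2_ring R)" if "g \<in> carrier G" for g
  proof -
    have "S g \<otimes>\<^bsub>mat2_ring R\<^esub> S (inv g) = \<one>\<^bsub>mat2_ring R\<^esub>"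
      using that by (simp add: induced_mat_mult[symmetric] induced_mat_one)
    thus ?thesis by (rule R.mat2_right_inverse_unit[OF induced_mat_closed induced_mat_closed])
  qed
  thus ?thesis
    unfolding hom_def GL2_carrier GL2_mult by (auto simp: induced_mat_mult)
qed

lemma induced_mat_homogeneous: "g \<in> carrier G \<Longrightarrow> homogeneous R (g \<in> H) (S g)"
  using \<sigma> by (auto simp: homogeneous_def induced_mat_def extend0_def mult_mem_iff inv_mem_iff)

text \<open>The inverse of the coordinate map that sends \<open>f\<close> to the pair of its values
  at 1 and \<sigma>.\<close>

definition ind_fun :: "'r \<times> 'r \<Rightarrow> 'g \<Rightarrow> 'r" where
  "ind_fun w = (\<lambda>g\<in>carrier G. c g \<otimes>\<^bsub>R\<^esub> fst w \<oplus>\<^bsub>R\<^esub> c (g \<otimes> inv \<sigma>) \<otimes>\<^bsub>R\<^esub> snd w)"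

lemma ind_fun_in_space:
  assumes "w \<in> carrier R \<times> carrier R"
  shows "ind_fun w \<in> ind_space G R H chi"
  unfolding ind_space_def
proof (intro CollectI conjI ballI)
  show "ind_fun w \<in> carrier G \<rightarrow>\<^sub>E carrier R" using assms by (auto simp: ind_fun_def)
  fix h g assume hg: "h \<in> H" "g \<in> carrier G"
  have "c (h \<otimes> g) = chi h \<otimes>\<^bsub>R\<^esub> c g" "c (h \<otimes> g \<otimes> inv \<sigma>) = chi h \<otimes>\<^bsub>R\<^esub> c (g \<otimes> inv \<sigma>)"
    using extend0_mult[of h g] extend0_mult[of h "g \<otimes> inv \<sigma>"] hg \<sigma>
    by (simp_all add: m_assoc) (simp_all add: extend0_def)
  thus "ind_fun w (h \<otimes> g) = chi h \<otimes>\<^bsub>R\<^esub> ind_fun w g"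
    using assms hg chi_closed by (auto simp: ind_fun_def R.r_distr R.m_assoc)
qed

lemma ind_fun_eval:
  assumes "w \<in> carrier R \<times> carrier R"
  shows "ind_fun w \<one> = fst w" "ind_fun w \<sigma> = snd w"
  using assms \<sigma> by (auto simp: ind_fun_def extend0_def inv_mem_iff chi_one)

lemma ind_space_expand:
  assumes "f \<in> ind_space G R H chi"
  shows "f \<one> \<in> carrier R" "f \<sigma> \<in> carrier R" "f = ind_fun (f \<one>, f \<sigma>)"
proof -
  have f: "f \<in> carrier G \<rightarrow>\<^sub>E carrier R"
    and eq: "\<And>h g. h \<in> H \<Longrightarrow> g \<in> carrier G \<Longrightarrow> f (h \<otimes> g) = chi h \<otimes>\<^bsub>R\<^esub> f g"
    using assms unfolding ind_space_def by auto
  show c: "f \<one> \<in> carrier R" "f \<sigma> \<in> carrier R" using f \<sigma> by auto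
  show "f = ind_fun (f \<one>, f \<sigma>)"
  proof
    fix g
    show "f g = ind_fun (f \<one>, f \<sigma>) g"
    proof (cases "g \<in> carrier G")
      case False
      thus ?thesis using f by (auto simp: ind_fun_def)
    next
      case g: True
      show ?thesis
      proof (cases "g \<in> H")
        case True
        thus ?thesis using eq[of g \<one>] g c \<sigma>
          by (auto simp: ind_fun_def extend0_def mult_mem_iff inv_mem_iff chi_closed)
      next
        case False
        hence h: "g \<otimes> inv \<sigma> \<in> H" using g \<sigma> by (simp add: mult_mem_iff inv_mem_iff)
        have "f (g \<otimes> inv \<sigma> \<otimes> \<sigma>) = chi (g \<otimes> inv \<sigma>) \<otimes>\<^bsub>R\<^esub> f \<sigma>" using eq[OF h \<sigma>(1)] .
        thus ?thesis using g c \<sigma> h False chi_closed[OF h]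
          by (simp add: ind_fun_def extend0_def m_assoc)
      qed
    qed
  qed
qed

lemma mat2_vec_closed:
  assumes "A \<in> carrier (mat2_ring R)" "v \<in> carrier R \<times> carrier R"
  shows "mat2_vec R A v \<in> carrier R \<times> carrier R"
  using assms by (auto simp: mat2_vec_def)

lemma mat2_vec_mult:
  assumes "A \<in> carrier (mat2_ring R)" "B \<in> carrier (mat2_ring R)" "v \<in> carrier R \<times> carrier R"
  shows "mat2_vec R (A \<otimes>\<^bsub>mat2_ring R\<^esub> B) v = mat2_vec R A (mat2_vec R B v)"
  using assms by (auto simp: mat2_vec_def mat2_ring_mult R.l_distr R.r_distr R.a_ac R.m_assoc)

lemma mat2_vec_one: "v \<in> carrier R \<times> carrier R \<Longrightarrow> mat2_vec R \<one>\<^bsub>mat2_ring R\<^esub> v = v"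
  by (auto simp: mat2_vec_def mat2_ring_one)

lemma equiv_to_ind_imp_conj:
  assumes \<rho>: "\<rho> \<in> hom G (GL2 R)" and "equiv_to_ind G R \<rho> H chi"
  obtains P where "P \<in> Units (mat2_ring R)"
    "\<And>g. g \<in> carrier G \<Longrightarrow> conj_by (mat2_ring R) P (\<rho> g) = S g"
proof -
  obtain \<phi> where bij: "bij_betw \<phi> (carrier R \<times> carrier R) (ind_space G R H chi)"
    and add: "\<And>v w x. \<lbrakk>v \<in> carrier R \<times> carrier R; w \<in> carrier R \<times> carrier R; x \<in> carrier G\<rbrakk> \<Longrightarrow>
           \<phi> (fst v \<oplus>\<^bsub>R\<^esub> fst w, snd v \<oplus>\<^bsub>R\<^esub> snd w) x = \<phi> v x \<oplus>\<^bsub>R\<^esub> \<phi> w x"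
    and smult: "\<And>a v x. \<lbrakk>a \<in> carrier R; v \<in> carrier R \<times> carrier R; x \<in> carrier G\<rbrakk> \<Longrightarrow>
           \<phi> (a \<otimes>\<^bsub>R\<^esub> fst v, a \<otimes>\<^bsub>R\<^esub> snd v) x = a \<otimes>\<^bsub>R\<^esub> \<phi> v x"
    and equi: "\<And>g v. \<lbrakk>g \<in> carrier G; v \<in> carrier R \<times> carrier R\<rbrakk> \<Longrightarrow>
           \<phi> (mat2_vec R (\<rho> g) v) = ind_action G g (\<phi> v)"
    using assms(2) unfolding equiv_to_ind_def by blast
  let ?u = "(\<one>\<^bsub>R\<^esub>, \<zero>\<^bsub>R\<^esub>)" and ?v = "(\<zero>\<^bsub>R\<^esub>, \<one>\<^bsub>R\<^esub>)"
  \<comment> \<open>The columns are the coordinates of the images of the two standard basis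
    vectors.\<close>
  define P where "P = Mat2 (\<phi> ?u \<one>) (\<phi> ?v \<one>) (\<phi> ?u \<sigma>) (\<phi> ?v \<sigma>)"
  have sp: "\<phi> v \<in> ind_space G R H chi" if "v \<in> carrier R \<times> carrier R" for v
    using bij that unfolding bij_betw_def by blast
  have cl: "\<phi> v x \<in> carrier R" if "v \<in> carrier R \<times> carrier R" "x \<in> carrier G" for v x
    using sp[OF that(1)] that(2) unfolding ind_space_def by auto
  have P: "P \<in> carrier (mat2_ring R)" unfolding P_def using cl \<sigma> by simp
  have lin: "\<phi> (a, b) x = \<phi> ?u x \<otimes>\<^bsub>R\<^esub> a \<oplus>\<^bsub>R\<^esub> \<phi> ?v x \<otimes>\<^bsub>R\<^esub> b"
    if "a \<in> carrier R" "b \<in> carrier R" "x \<in> carrier G" for a b x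
  proof -
    have "\<phi> (a, b) x = \<phi> (a, \<zero>\<^bsub>R\<^esub>) x \<oplus>\<^bsub>R\<^esub> \<phi> (\<zero>\<^bsub>R\<^esub>, b) x"
      using add[of "(a, \<zero>\<^bsub>R\<^esub>)" "(\<zero>\<^bsub>R\<^esub>, b)" x] that by simp
    thus ?thesis
      using smult[of a ?u x] smult[of b ?v x] that cl[of ?u x] cl[of ?v x]
      by (simp add: R.m_comm)
  qed
  have vec: "mat2_vec R P v = (\<phi> v \<one>, \<phi> v \<sigma>)" if "v \<in> carrier R \<times> carrier R" for v
    using lin[of "fst v" "snd v" \<one>] lin[of "fst v" "snd v" \<sigma>] that \<sigma>
    by (auto simp: mat2_vec_def P_def)
  have ext: "A = B" if "A \<in> carrier (mat2_ring R)" "B \<in> carrier (mat2_ring R)"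
    "mat2_vec R A ?u = mat2_vec R B ?u" "mat2_vec R A ?v = mat2_vec R B ?v" for A B
    using that by (intro mat2.expand) (simp_all add: mat2_vec_def)
  \<comment> \<open>Surjectivity of \<open>\<phi>\<close> yields preimages of the basis vectors, and
    these form a right inverse of \<open>P\<close>, which suffices by
    \<open>mat2_right_inverse_unit\<close>.\<close>
  have surj: "\<exists>v\<in>carrier R \<times> carrier R. mat2_vec R P v = w" if w: "w \<in> carrier R \<times> carrier R" for w
  proof -
    have "ind_fun w \<in> \<phi> ` (carrier R \<times> carrier R)"
      using bij_betw_imp_surj_on[OF bij] ind_fun_in_space[OF w] by simp
    then obtain v where v: "v \<in> carrier R \<times> carrier R" "ind_fun w = \<phi> v" by (rule imageE)
    have "mat2_vec R P v = w" using vec[OF v(1)] ind_fun_eval[OF w] v(2) by simp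
    thus ?thesis using v(1) by (rule bexI)
  qed
  obtain a where a: "a \<in> carrier R \<times> carrier R" "mat2_vec R P a = ?u" using surj[of ?u] by auto
  obtain b where b: "b \<in> carrier R \<times> carrier R" "mat2_vec R P b = ?v" using surj[of ?v] by auto
  let ?B = "Mat2 (fst a) (fst b) (snd a) (snd b)"
  have B: "?B \<in> carrier (mat2_ring R)" using a b by auto
  have Bc: "mat2_vec R ?B ?u = a" "mat2_vec R ?B ?v = b"
    using a(1) b(1) by (auto simp: mat2_vec_def)
  have "P \<otimes>\<^bsub>mat2_ring R\<^esub> ?B = \<one>\<^bsub>mat2_ring R\<^esub>"
    by (rule ext) (use P B a b Bc in \<open>simp_all add: mat2_vec_mult mat2_vec_one\<close>)
  hence PU: "P \<in> Units (mat2_ring R)" using R.mat2_right_inverse_unit[OF P B] by simp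
  have "P \<otimes>\<^bsub>mat2_ring R\<^esub> \<rho> g = S g \<otimes>\<^bsub>mat2_ring R\<^esub> P" if g: "g \<in> carrier G" for g
  proof -
    note \<rho>g = rep_hom(2)[OF \<rho> g]
    have "mat2_vec R (P \<otimes>\<^bsub>mat2_ring R\<^esub> \<rho> g) v = mat2_vec R (S g \<otimes>\<^bsub>mat2_ring R\<^esub> P) v"
      if v: "v \<in> carrier R \<times> carrier R" for v
    proof -
      have 1: "mat2_vec R (P \<otimes>\<^bsub>mat2_ring R\<^esub> \<rho> g) v = (\<phi> v g, \<phi> v (\<sigma> \<otimes> g))"
        using v \<rho>g P g \<sigma> by (simp add: mat2_vec_mult vec mat2_vec_closed equi ind_action_def)
      have ex: "\<phi> v x = c x \<otimes>\<^bsub>R\<^esub> \<phi> v \<one> \<oplus>\<^bsub>R\<^esub> c (x \<otimes> inv \<sigma>) \<otimes>\<^bsub>R\<^esub> \<phi> v \<sigma>" if "x \<in> carrier G" for x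
        using fun_cong[OF ind_space_expand(3)[OF sp[OF v]], of x] that by (simp add: ind_fun_def)
      have "mat2_vec R (S g \<otimes>\<^bsub>mat2_ring R\<^esub> P) v = (\<phi> v g, \<phi> v (\<sigma> \<otimes> g))"
        using ex[OF g] ex[of "\<sigma> \<otimes> g"] P v g \<sigma>
        by (simp add: mat2_vec_mult vec) (simp add: mat2_vec_def induced_mat_def)
      with 1 show ?thesis by simp
    qed
    thus ?thesis using P \<rho>g by (intro ext) simp_all
  qed
  thus ?thesis using that PU M.conj_by_eq_iff[OF PU rep_hom(2)[OF \<rho>]] by simp
qed

text \<open>The isomorphism is \<open>ind_fun\<close> after \<open>P\<close>. Since
  \<open>ind_fun w x\<close> is the first coordinate of \<open>S x\<close> applied to
  \<open>w\<close>, equivariance comes down to multiplicativity of \<open>S\<close>.\<close>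

lemma conj_imp_equiv_to_ind:
  assumes \<rho>: "\<rho> \<in> hom G (GL2 R)" and P: "P \<in> Units (mat2_ring R)"
    and conj: "\<And>g. g \<in> carrier G \<Longrightarrow> conj_by (mat2_ring R) P (\<rho> g) = S g"
  shows "equiv_to_ind G R \<rho> H chi"
proof -
  let ?w = "mat2_vec R P"
  note Pc = M.Units_closed[OF P]
  have wc: "?w v \<in> carrier R \<times> carrier R" if "v \<in> carrier R \<times> carrier R" for v
    using mat2_vec_closed[OF Pc that] .
  have bw: "bij_betw ?w (carrier R \<times> carrier R) (carrier R \<times> carrier R)"
  proof (rule bij_betwI[where g = "mat2_vec R (inv\<^bsub>mat2_ring R\<^esub> P)"])
    show "?w \<in> carrier R \<times> carrier R \<rightarrow> carrier R \<times> carrier R" using wc by blast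
    show "mat2_vec R (inv\<^bsub>mat2_ring R\<^esub> P) \<in> carrier R \<times> carrier R \<rightarrow> carrier R \<times> carrier R"
      using mat2_vec_closed[OF M.Units_inv_closed[OF P]] by blast
  qed (use P Pc in \<open>simp_all add: mat2_vec_mult[symmetric] mat2_vec_one\<close>)
  have bi: "bij_betw ind_fun (carrier R \<times> carrier R) (ind_space G R H chi)"
    unfolding bij_betw_def
  proof
    show "inj_on ind_fun (carrier R \<times> carrier R)"
    proof (rule inj_onI)
      fix v w assume "v \<in> carrier R \<times> carrier R" "w \<in> carrier R \<times> carrier R" "ind_fun v = ind_fun w"
      thus "v = w" using ind_fun_eval[of v] ind_fun_eval[of w] by (simp add: prod_eq_iff)
    qed
    show "ind_fun ` (carrier R \<times> carrier R) = ind_space G R H chi"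
    proof (intro equalityI subsetI)
      fix f assume "f \<in> ind_space G R H chi"
      note * = ind_space_expand[OF this]
      show "f \<in> ind_fun ` (carrier R \<times> carrier R)"
        using *(1,2) by (subst *(3)) (rule imageI, simp)
    qed (use ind_fun_in_space in blast)
  qed
  have bij: "bij_betw (ind_fun \<circ> ?w) (carrier R \<times> carrier R) (ind_space G R H chi)"
    using bij_betw_trans[OF bw bi] .
  have add: "(ind_fun \<circ> ?w) (fst v \<oplus>\<^bsub>R\<^esub> fst w, snd v \<oplus>\<^bsub>R\<^esub> snd w) x
      = (ind_fun \<circ> ?w) v x \<oplus>\<^bsub>R\<^esub> (ind_fun \<circ> ?w) w x"
    if "v \<in> carrier R \<times> carrier R" "w \<in> carrier R \<times> carrier R" "x \<in> carrier G" for v w x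
    using that Pc by (auto simp: ind_fun_def mat2_vec_def R.r_distr R.a_ac)
  have smult: "(ind_fun \<circ> ?w) (a \<otimes>\<^bsub>R\<^esub> fst v, a \<otimes>\<^bsub>R\<^esub> snd v) x = a \<otimes>\<^bsub>R\<^esub> (ind_fun \<circ> ?w) v x"
    if "a \<in> carrier R" "v \<in> carrier R \<times> carrier R" "x \<in> carrier G" for a v x
    using that Pc by (auto simp: ind_fun_def mat2_vec_def R.r_distr R.m_ac)
  have equi: "(ind_fun \<circ> ?w) (mat2_vec R (\<rho> g) v) = ind_action G g ((ind_fun \<circ> ?w) v)"
    if g: "g \<in> carrier G" and v: "v \<in> carrier R \<times> carrier R" for g v
  proof -
    note \<rho>g = rep_hom(2)[OF \<rho> g]
    have "P \<otimes>\<^bsub>mat2_ring R\<^esub> \<rho> g = S g \<otimes>\<^bsub>mat2_ring R\<^esub> P"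
      using conj[OF g] M.conj_by_eq_iff[OF P \<rho>g] by simp
    hence 1: "?w (mat2_vec R (\<rho> g) v) = mat2_vec R (S g) (?w v)"
      using mat2_vec_mult[OF Pc \<rho>g v] mat2_vec_mult[OF _ Pc v, of "S g"] by simp
    have fn: "ind_fun w x = fst (mat2_vec R (S x) w)" if "x \<in> carrier G" for x w
      using that by (simp add: ind_fun_def mat2_vec_def induced_mat_def)
    have "ind_fun (mat2_vec R (S g) (?w v)) x = ind_action G g (ind_fun (?w v)) x" for x
    proof (cases "x \<in> carrier G")
      case True
      thus ?thesis using g wc[OF v]
        by (simp add: ind_action_def fn mat2_vec_mult[symmetric] induced_mat_mult)
    qed (simp add: ind_fun_def ind_action_def)
    thus ?thesis using 1 by auto
  qed
  show ?thesis
    unfolding equiv_to_ind_def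
    by (intro exI[of _ "ind_fun \<circ> ?w"] conjI ballI bij add smult equi)
qed

end

text \<open>A grading is unique up to scaling in the two lines, and scaling the second one by
  \<open>y\<close> turns the upper right entry at \<sigma> into 1. All other entries are then upper
  left entries at translates of \<open>g\<close> by \<sigma>, which are the values of one
  character.\<close>

lemma graded_normalize:
  assumes \<rho>: "\<rho> \<in> hom G (GL2 R)" and gr: "graded G R H \<rho> P"
  defines "D \<equiv> \<lambda>g. conj_by (mat2_ring R) P (\<rho> g)"
  defines "y \<equiv> e12 (D \<sigma>)"
  defines "P' \<equiv> Mat2 \<one>\<^bsub>R\<^esub> \<zero>\<^bsub>R\<^esub> \<zero>\<^bsub>R\<^esub> y \<otimes>\<^bsub>mat2_ring R\<^esub> P"
  shows "y \<in> Units R" "P' \<in> Units (mat2_ring R)"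
    "(\<lambda>h. e11 (D h)) \<in> hom (G\<lparr>carrier := H\<rparr>) (units_of R)"
    "\<And>g. g \<in> carrier G \<Longrightarrow> conj_by (mat2_ring R) P' (\<rho> g) = induced_mat G R H \<sigma> (\<lambda>h. e11 (D h)) g"
proof -
  have P: "P \<in> Units (mat2_ring R)" and hom: "\<And>g. g \<in> carrier G \<Longrightarrow> homogeneous R (g \<in> H) (D g)"
    using gr unfolding graded_def D_def by auto
  have Dm: "D (g \<otimes> g') = D g \<otimes>\<^bsub>mat2_ring R\<^esub> D g'" if "g \<in> carrier G" "g' \<in> carrier G" for g g'
    unfolding D_def using that rep_hom[OF \<rho>] P by (simp add: M.conj_by_mult)
  have DU: "D g \<in> Units (mat2_ring R)" if "g \<in> carrier G" for g
    unfolding D_def using M.conj_by_Units[OF P] rep_hom(1)[OF \<rho> that] .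
  have Dc: "D g \<in> carrier (mat2_ring R)" if "g \<in> carrier G" for g
    using DU[OF that] by (rule M.Units_closed)
  have det: "det2 R (D g) \<in> Units R" if "g \<in> carrier G" for g
    using DU[OF that] R.det2_unit_iff[OF Dc[OF that]] by simp
  have "det2 R (D \<sigma>) = y \<otimes>\<^bsub>R\<^esub> (\<ominus>\<^bsub>R\<^esub> e21 (D \<sigma>))"
    using hom[OF \<sigma>(1)] \<sigma> Dc[OF \<sigma>(1)]
    by (simp add: det2_def homogeneous_def y_def R.minus_eq R.r_minus)
  thus y: "y \<in> Units R"
    using det[OF \<sigma>(1)] R.unit_factor[of y "\<ominus>\<^bsub>R\<^esub> e21 (D \<sigma>)"] Dc[OF \<sigma>(1)] unfolding y_def by simp
  have yc: "y \<in> carrier R" using y by (rule R.Units_closed)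
  let ?Y = "Mat2 \<one>\<^bsub>R\<^esub> \<zero>\<^bsub>R\<^esub> \<zero>\<^bsub>R\<^esub> y"
  have Yc: "?Y \<in> carrier (mat2_ring R)" using yc by simp
  have YU: "?Y \<in> Units (mat2_ring R)"
    using R.det2_unit_iff[OF Yc] y yc by (simp add: det2_def R.minus_eq)
  show P'U: "P' \<in> Units (mat2_ring R)" unfolding P'_def using YU P by simp
  have eu: "e11 (D h) \<in> Units R" if h: "h \<in> H" for h
  proof -
    have "det2 R (D h) = e11 (D h) \<otimes>\<^bsub>R\<^esub> e22 (D h)"
      using hom[of h] h Dc[of h] by (simp add: det2_def homogeneous_def R.minus_eq)
    thus ?thesis
      using det[of h] R.unit_factor[of "e11 (D h)" "e22 (D h)"] Dc[of h] h by simp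
  qed
  show chi: "(\<lambda>h. e11 (D h)) \<in> hom (G\<lparr>carrier := H\<rparr>) (units_of R)"
    unfolding hom_def
  proof (intro CollectI conjI ballI)
    show "(\<lambda>h. e11 (D h)) \<in> carrier (G\<lparr>carrier := H\<rparr>) \<rightarrow> carrier (units_of R)"
      using eu by (auto simp: units_of_def)
    fix h k assume "h \<in> carrier (G\<lparr>carrier := H\<rparr>)" "k \<in> carrier (G\<lparr>carrier := H\<rparr>)"
    thus "e11 (D (h \<otimes>\<^bsub>G\<lparr>carrier := H\<rparr>\<^esub> k)) = e11 (D h) \<otimes>\<^bsub>units_of R\<^esub> e11 (D k)"
      using hom[of h] hom[of k] Dc[of h] Dc[of k]
      by (simp add: Dm mat2_ring_mult units_of_def homogeneous_def)
  qed
  define D' where "D' g = conj_by (mat2_ring R) ?Y (D g)" for g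
  have D'm: "D' (g \<otimes> g') = D' g \<otimes>\<^bsub>mat2_ring R\<^esub> D' g'" if "g \<in> carrier G" "g' \<in> carrier G" for g g'
    unfolding D'_def using that YU Dc by (simp add: M.conj_by_mult Dm)
  have D'c: "D' g \<in> carrier (mat2_ring R)" if "g \<in> carrier G" for g
    unfolding D'_def using YU Dc[OF that] by simp
  have sw: "?Y \<otimes>\<^bsub>mat2_ring R\<^esub> D g = D' g \<otimes>\<^bsub>mat2_ring R\<^esub> ?Y" if "g \<in> carrier G" for g
    unfolding D'_def using M.conj_by_swap[OF YU Dc[OF that]] .
  have ent: "e11 (D' g) = e11 (D g)" "e12 (D' g) \<otimes>\<^bsub>R\<^esub> y = e12 (D g)"
    "e21 (D' g) = y \<otimes>\<^bsub>R\<^esub> e21 (D g)" "e22 (D' g) \<otimes>\<^bsub>R\<^esub> y = y \<otimes>\<^bsub>R\<^esub> e22 (D g)" if g: "g \<in> carrier G" for g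
    using sw[OF g] Dc[OF g] D'c[OF g] yc by (simp_all add: mat2_ring_mult)
  have y0: "x = \<zero>\<^bsub>R\<^esub>" if "x \<otimes>\<^bsub>R\<^esub> y = \<zero>\<^bsub>R\<^esub>" "x \<in> carrier R" for x
    using that y yc R.Units_l_cancel[of y x "\<zero>\<^bsub>R\<^esub>"] by (simp add: R.m_comm)
  have hom': "homogeneous R (g \<in> H) (D' g)" if g: "g \<in> carrier G" for g
    using hom[OF g] ent[OF g] y0 D'c[OF g] yc by (auto simp: homogeneous_def split: if_splits)
  have s12: "e12 (D' \<sigma>) = \<one>\<^bsub>R\<^esub>"
  proof -
    have "y \<otimes>\<^bsub>R\<^esub> e12 (D' \<sigma>) = y \<otimes>\<^bsub>R\<^esub> \<one>\<^bsub>R\<^esub>"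
      using ent(2)[OF \<sigma>(1)] D'c[OF \<sigma>(1)] yc by (simp add: y_def[symmetric] R.m_comm)
    thus ?thesis using R.Units_l_cancel[OF y] D'c[OF \<sigma>(1)] by simp
  qed
  have s11: "e11 (D' \<sigma>) = \<zero>\<^bsub>R\<^esub>" "e22 (D' \<sigma>) = \<zero>\<^bsub>R\<^esub>"
    using hom'[OF \<sigma>(1)] \<sigma> by (simp_all add: homogeneous_def)
  have D'S: "D' g = induced_mat G R H \<sigma> (\<lambda>h. e11 (D h)) g" if g: "g \<in> carrier G" for g
  proof -
    have g': "g \<otimes> inv \<sigma> \<in> carrier G" "\<sigma> \<otimes> g \<in> carrier G" "\<sigma> \<otimes> g \<otimes> inv \<sigma> \<in> carrier G"
      using g \<sigma> by auto
    have gs: "D' g = D' (g \<otimes> inv \<sigma>) \<otimes>\<^bsub>mat2_ring R\<^esub> D' \<sigma>"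
      using D'm[OF g'(1) \<sigma>(1)] g \<sigma> by (simp add: m_assoc)
    have sg: "D' (\<sigma> \<otimes> g) = D' \<sigma> \<otimes>\<^bsub>mat2_ring R\<^esub> D' g" using D'm[OF \<sigma>(1) g] .
    have sgs: "D' (\<sigma> \<otimes> g) = D' (\<sigma> \<otimes> g \<otimes> inv \<sigma>) \<otimes>\<^bsub>mat2_ring R\<^esub> D' \<sigma>"
      using D'm[OF g'(3) \<sigma>(1)] g \<sigma> by (simp add: m_assoc)
    note [simp] = D'c[OF g] D'c[OF g'(1)] D'c[OF g'(2)] D'c[OF g'(3)] D'c[OF \<sigma>(1)] s11 s12
    have 12: "e12 (D' g) = e11 (D' (g \<otimes> inv \<sigma>))" by (subst gs) (simp add: mat2_ring_mult)
    have 21: "e21 (D' g) = e11 (D' (\<sigma> \<otimes> g))" by (subst sg) (simp add: mat2_ring_mult)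
    have 22: "e22 (D' g) = e11 (D' (\<sigma> \<otimes> g \<otimes> inv \<sigma>))"
      using sg sgs by (simp add: mat2_ring_mult)
    have z: "e11 (D' x) = extend0 R H (\<lambda>h. e11 (D h)) x" if x: "x \<in> carrier G" for x
      using ent(1)[OF x] hom'[OF x] by (auto simp: extend0_def homogeneous_def)
    show ?thesis
      by (rule mat2.expand) (simp add: induced_mat_def 12 21 22 z[OF g] z[OF g'(1)] z[OF g'(2)] z[OF g'(3)])
  qed
  show "conj_by (mat2_ring R) P' (\<rho> g) = induced_mat G R H \<sigma> (\<lambda>h. e11 (D h)) g"
    if g: "g \<in> carrier G" for g
    using D'S[OF g] M.conj_by_conj_by[OF YU P rep_hom(2)[OF \<rho> g]]
    unfolding P'_def D'_def D_def by simp
qed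

end

section \<open>Coefficient rings\<close>

locale coefficient_ring = F: field F
  for p :: nat and F :: "'f ring" and R :: "('f, 'r) coeff_ring" +
  assumes object: "coeff_object p F R"
begin

lemma local_ring: "local_ring R"
  using object unfolding coeff_object_def by blast

sublocale R: cring R
  using local_ring unfolding local_ring_def by blast

sublocale R: noetherian_ring R
  using object unfolding coeff_object_def by blast

sublocale M: ring "mat2_ring R" by (rule R.mat2_ring_is_ring)

sublocale MF: ring "mat2_ring F" by (rule F.mat2_ring_is_ring)

lemma residue_hom: "residue R \<in> ring_hom R F"
  using object unfolding coeff_object_def by blast

sublocale res: ring_hom_cring R F "residue R"
  by unfold_locales (rule residue_hom)

lemma residue_mat_hom: "map_mat2 (residue R) \<in> ring_hom (mat2_ring R) (mat2_ring F)"
  by (rule map_mat2_ring_hom[OF residue_hom R.ring_axioms F.ring_axioms])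

sublocale resM: ring_hom_ring "mat2_ring R" "mat2_ring F" "map_mat2 (residue R)"
  by unfold_locales (rule residue_mat_hom)

lemma adic_complete: "adic_complete R"
  using object unfolding coeff_object_def by blast

lemma max_ideal_ideal: "ideal (max_ideal R) R"
  by (rule local_ring_max_ideal_is_ideal[OF local_ring])

lemma residue_eq_0_iff: "x \<in> carrier R \<Longrightarrow> residue R x = \<zero>\<^bsub>F\<^esub> \<longleftrightarrow> x \<in> max_ideal R"
proof -
  have "a_kernel R F (residue R) = max_ideal R"
    using object unfolding coeff_object_def by blast
  thus "x \<in> carrier R \<Longrightarrow> ?thesis" unfolding a_kernel_def' by auto
qed

lemma residue_eq_iff:
  assumes "x \<in> carrier R" "y \<in> carrier R"
  shows "residue R x = residue R y \<longleftrightarrow> x \<ominus>\<^bsub>R\<^esub> y \<in> max_ideal R"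
proof -
  have "residue R (x \<ominus>\<^bsub>R\<^esub> y) = residue R x \<ominus>\<^bsub>F\<^esub> residue R y"
    using assms by (simp add: R.minus_eq F.minus_eq)
  thus ?thesis
    using residue_eq_0_iff[of "x \<ominus>\<^bsub>R\<^esub> y"] assms F.r_right_minus_eq by (metis R.minus_closed res.hom_closed)
qed

lemma unit_iff: "x \<in> carrier R \<Longrightarrow> x \<in> Units R \<longleftrightarrow> residue R x \<noteq> \<zero>\<^bsub>F\<^esub>"
proof
  assume x: "x \<in> carrier R" "residue R x \<noteq> \<zero>\<^bsub>F\<^esub>"
  show "x \<in> Units R"
    using noetherian_local_unit[OF local_ring R.noetherian_ring_axioms x(1)] x residue_eq_0_iff by blast
next
  assume "x \<in> carrier R" "x \<in> Units R"
  hence "residue R x \<in> Units F"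
    using ring_hom_inv(1)[OF R.monoid_axioms F.monoid_axioms residue_hom] by blast
  thus "residue R x \<noteq> \<zero>\<^bsub>F\<^esub>" using F.field_Units by blast
qed

lemma obtain_lift:
  assumes "a \<in> carrier F"
  obtains x where "x \<in> carrier R" "residue R x = a"
proof -
  have "residue R ` carrier R = carrier F" using object unfolding coeff_object_def by blast
  thus ?thesis using assms that by (metis imageE)
qed

lemma residue_det2: "A \<in> carrier (mat2_ring R) \<Longrightarrow> residue R (det2 R A) = det2 F (map_mat2 (residue R) A)"
  by (simp add: det2_def R.minus_eq F.minus_eq)

lemma mat_unit_iff:
  assumes "A \<in> carrier (mat2_ring R)"
  shows "A \<in> Units (mat2_ring R) \<longleftrightarrow> map_mat2 (residue R) A \<in> Units (mat2_ring F)"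
  using assms R.det2_unit_iff[OF assms] F.det2_unit_iff[of "map_mat2 (residue R) A"]
    unit_iff[of "det2 R A"] residue_det2[OF assms] F.field_Units F.det2_closed[of "map_mat2 (residue R) A"]
  by (auto simp: resM.hom_closed)

text \<open>Zero is lifted to zero so that homogeneous matrices have homogeneous lifts.\<close>

lemma exists_lift_zero:
  assumes "a \<in> carrier F"
  shows "\<exists>x\<in>carrier R. residue R x = a \<and> (a = \<zero>\<^bsub>F\<^esub> \<longrightarrow> x = \<zero>\<^bsub>R\<^esub>)"
proof (cases "a = \<zero>\<^bsub>F\<^esub>")
  case False
  obtain x where "x \<in> carrier R" "residue R x = a" by (rule obtain_lift[OF assms])
  thus ?thesis using False by blast
qed (use res.hom_zero in blast)

lemma obtain_mat_lift:
  assumes "A \<in> carrier (mat2_ring F)"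
  obtains B where "B \<in> carrier (mat2_ring R)" "map_mat2 (residue R) B = A"
    "\<And>s. homogeneous F s A \<Longrightarrow> homogeneous R s B"
proof -
  obtain a where a: "a \<in> carrier R" "residue R a = e11 A" "e11 A = \<zero>\<^bsub>F\<^esub> \<Longrightarrow> a = \<zero>\<^bsub>R\<^esub>"
    using exists_lift_zero[OF mat2_ring_entries(1)[OF assms]] by blast
  obtain b where b: "b \<in> carrier R" "residue R b = e12 A" "e12 A = \<zero>\<^bsub>F\<^esub> \<Longrightarrow> b = \<zero>\<^bsub>R\<^esub>"
    using exists_lift_zero[OF mat2_ring_entries(2)[OF assms]] by blast
  obtain c where c: "c \<in> carrier R" "residue R c = e21 A" "e21 A = \<zero>\<^bsub>F\<^esub> \<Longrightarrow> c = \<zero>\<^bsub>R\<^esub>"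
    using exists_lift_zero[OF mat2_ring_entries(3)[OF assms]] by blast
  obtain d where d: "d \<in> carrier R" "residue R d = e22 A" "e22 A = \<zero>\<^bsub>F\<^esub> \<Longrightarrow> d = \<zero>\<^bsub>R\<^esub>"
    using exists_lift_zero[OF mat2_ring_entries(4)[OF assms]] by blast
  show ?thesis
    by (rule that[of "Mat2 a b c d"])
      (use a b c d in \<open>auto simp: homogeneous_def split: if_splits intro!: mat2.expand\<close>)
qed

lemma residue_zero_of_max_ideal [simp]: "x \<in> max_ideal R \<Longrightarrow> residue R x = \<zero>\<^bsub>F\<^esub>"
  using residue_eq_0_iff ideal.Icarr[OF max_ideal_ideal] by blast

lemma max_ideal_pow_inter_zero:
  assumes "\<And>n. x \<in> max_ideal_pow R n"
  shows "x = \<zero>\<^bsub>R\<^esub>"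
  using assms adic_complete unfolding adic_complete_def by blast

lemma obtain_limit:
  assumes "\<And>n. x n \<in> carrier R" "\<And>n. x (Suc n) \<ominus>\<^bsub>R\<^esub> x n \<in> max_ideal_pow R n"
  obtains y where "y \<in> carrier R" "\<And>n. y \<ominus>\<^bsub>R\<^esub> x n \<in> max_ideal_pow R n"
  using assms adic_complete unfolding adic_complete_def by metis

text \<open>Hensel's lemma for the quadratic equation which says that \<open>(1, s)\<close> is an eigenrow of the
  matrix with rows \<open>(a, b)\<close> and \<open>(c, d)\<close>.\<close>

lemma obtain_eigenrow:
  assumes "a \<in> carrier R" "b \<in> max_ideal R" "c \<in> max_ideal R" "d \<in> carrier R"
    "residue R a \<noteq> residue R d"
  obtains s where "s \<in> max_ideal R" "b \<oplus>\<^bsub>R\<^esub> s \<otimes>\<^bsub>R\<^esub> d = (a \<oplus>\<^bsub>R\<^esub> s \<otimes>\<^bsub>R\<^esub> c) \<otimes>\<^bsub>R\<^esub> s"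
proof -
  interpret m: ideal "max_ideal R" R by (rule max_ideal_ideal)
  have bc: "b \<in> carrier R" "c \<in> carrier R" using assms m.Icarr by auto
  have "a \<ominus>\<^bsub>R\<^esub> d \<in> Units R"
    using unit_iff[of "a \<ominus>\<^bsub>R\<^esub> d"] residue_eq_iff[of a d] residue_eq_0_iff[of "a \<ominus>\<^bsub>R\<^esub> d"] assms by auto
  then obtain u where u: "u \<in> carrier R" "(a \<ominus>\<^bsub>R\<^esub> d) \<otimes>\<^bsub>R\<^esub> u = \<one>\<^bsub>R\<^esub>"
    using R.Units_r_inv R.Units_inv_closed by metis
  \<comment> \<open>The equation reads (a - d) s = b - c s^2. Divided by the unit a - d, it asks for
    a fixed point of \<open>f\<close>, which is a contraction because \<open>c\<close> lies in the
    maximal ideal.\<close>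
  define f where "f s = u \<otimes>\<^bsub>R\<^esub> (b \<ominus>\<^bsub>R\<^esub> c \<otimes>\<^bsub>R\<^esub> (s \<otimes>\<^bsub>R\<^esub> s))" for s
  have fc [simp]: "f s \<in> carrier R" if "s \<in> carrier R" for s
    using that u bc unfolding f_def by simp
  have fm: "f s \<in> max_ideal R" if "s \<in> carrier R" for s
    unfolding f_def R.minus_eq using that u bc assms(2,3)
    by (intro m.I_l_closed m.a_closed m.a_inv_closed m.I_r_closed) auto
  have fdiff: "f s \<ominus>\<^bsub>R\<^esub> f t \<in> max_ideal_pow R (Suc n)"
    if st: "s \<in> carrier R" "t \<in> carrier R" "s \<ominus>\<^bsub>R\<^esub> t \<in> max_ideal_pow R n" for s t n
  proof -
    have "f s \<ominus>\<^bsub>R\<^esub> f t = (\<ominus>\<^bsub>R\<^esub> (u \<otimes>\<^bsub>R\<^esub> (s \<oplus>\<^bsub>R\<^esub> t)) \<otimes>\<^bsub>R\<^esub> c) \<otimes>\<^bsub>R\<^esub> (s \<ominus>\<^bsub>R\<^esub> t)"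
      unfolding f_def using st(1,2) u(1) bc by algebra
    moreover have "(\<ominus>\<^bsub>R\<^esub> (u \<otimes>\<^bsub>R\<^esub> (s \<oplus>\<^bsub>R\<^esub> t)) \<otimes>\<^bsub>R\<^esub> c) \<in> max_ideal_pow R 1"
      unfolding max_ideal_pow_1[OF local_ring] using st u assms(3) by (intro m.I_l_closed) auto
    ultimately show ?thesis using max_ideal_pow_prod[OF local_ring _ st(3), of _ 1] by simp
  qed
  define x where "x n = (f ^^ n) \<zero>\<^bsub>R\<^esub>" for n
  have xc: "x n \<in> carrier R" for n unfolding x_def by (induct n) auto
  have xs: "x (Suc n) = f (x n)" for n unfolding x_def by simp
  have "x (Suc n) \<ominus>\<^bsub>R\<^esub> x n \<in> max_ideal_pow R n" for n
  proof (induct n)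
    case 0
    show ?case unfolding max_ideal_pow_0[OF local_ring] using xc by simp
  next
    case (Suc n)
    thus ?case using fdiff[OF xc xc Suc] unfolding xs by simp
  qed
  then obtain y where y: "y \<in> carrier R" "\<And>n. y \<ominus>\<^bsub>R\<^esub> x n \<in> max_ideal_pow R n"
    using obtain_limit[of x] xc by blast
  have "y \<ominus>\<^bsub>R\<^esub> f y \<in> max_ideal_pow R n" for n
  proof -
    interpret I: ideal "max_ideal_pow R (Suc n)" R by (rule max_ideal_pow_is_ideal[OF local_ring])
    have "y \<ominus>\<^bsub>R\<^esub> f y = (y \<ominus>\<^bsub>R\<^esub> x (Suc n)) \<oplus>\<^bsub>R\<^esub> \<ominus>\<^bsub>R\<^esub> (f y \<ominus>\<^bsub>R\<^esub> f (x n))"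
      unfolding xs using y(1) fc[OF y(1)] fc[OF xc] by algebra
    hence "y \<ominus>\<^bsub>R\<^esub> f y \<in> max_ideal_pow R (Suc n)"
      using y(2)[of "Suc n"] fdiff[OF y(1) xc y(2)] I.a_closed I.a_inv_closed by simp
    thus ?thesis using max_ideal_pow_antimono[OF local_ring, of n "Suc n"] by auto
  qed
  hence "y \<ominus>\<^bsub>R\<^esub> f y = \<zero>\<^bsub>R\<^esub>" by (rule max_ideal_pow_inter_zero)
  hence yf: "y = f y" using y(1) fc[OF y(1)] by simp
  have eq: "b \<oplus>\<^bsub>R\<^esub> y \<otimes>\<^bsub>R\<^esub> d = (a \<oplus>\<^bsub>R\<^esub> y \<otimes>\<^bsub>R\<^esub> c) \<otimes>\<^bsub>R\<^esub> y"
  proof -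
    have "(a \<ominus>\<^bsub>R\<^esub> d) \<otimes>\<^bsub>R\<^esub> y = ((a \<ominus>\<^bsub>R\<^esub> d) \<otimes>\<^bsub>R\<^esub> u) \<otimes>\<^bsub>R\<^esub> (b \<ominus>\<^bsub>R\<^esub> c \<otimes>\<^bsub>R\<^esub> (y \<otimes>\<^bsub>R\<^esub> y))"
      using arg_cong[OF yf, of "\<lambda>z. (a \<ominus>\<^bsub>R\<^esub> d) \<otimes>\<^bsub>R\<^esub> z"] y(1) u(1) bc assms(1,4)
      unfolding f_def by (simp add: R.m_assoc)
    hence *: "(a \<ominus>\<^bsub>R\<^esub> d) \<otimes>\<^bsub>R\<^esub> y = b \<ominus>\<^bsub>R\<^esub> c \<otimes>\<^bsub>R\<^esub> (y \<otimes>\<^bsub>R\<^esub> y)" using u(2) y(1) bc by simp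
    have "(a \<oplus>\<^bsub>R\<^esub> y \<otimes>\<^bsub>R\<^esub> c) \<otimes>\<^bsub>R\<^esub> y = ((a \<ominus>\<^bsub>R\<^esub> d) \<otimes>\<^bsub>R\<^esub> y \<oplus>\<^bsub>R\<^esub> c \<otimes>\<^bsub>R\<^esub> (y \<otimes>\<^bsub>R\<^esub> y)) \<oplus>\<^bsub>R\<^esub> y \<otimes>\<^bsub>R\<^esub> d"
      using assms(1,4) bc y(1) by algebra
    also have "\<dots> = b \<oplus>\<^bsub>R\<^esub> y \<otimes>\<^bsub>R\<^esub> d"
      unfolding * using assms(1,4) bc y(1) by algebra
    finally show ?thesis by simp
  qed
  have "y \<in> max_ideal R" using fm[OF y(1)] yf by simp
  thus ?thesis using that eq by blast
qed

text \<open>The kernel of the functional is a submodule \<open>N\<close> between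
  \<open>m^(n+1)\<close> and \<open>m^n\<close> that is maximal among those avoiding
  \<open>x\<close>. By maximality \<open>m^n / N\<close> is a line over the residue field spanned by
  \<open>x\<close>, so no basis has to be chosen.\<close>

lemma obtain_functional:
  assumes x: "x \<in> max_ideal_pow R n" "x \<notin> max_ideal_pow R (Suc n)"
  obtains l where "\<forall>y\<in>max_ideal_pow R n. l y \<in> carrier F"
    "\<forall>y\<in>max_ideal_pow R n. \<forall>z\<in>max_ideal_pow R n. l (y \<oplus>\<^bsub>R\<^esub> z) = l y \<oplus>\<^bsub>F\<^esub> l z"
    "\<forall>r\<in>carrier R. \<forall>y\<in>max_ideal_pow R n. l (r \<otimes>\<^bsub>R\<^esub> y) = residue R r \<otimes>\<^bsub>F\<^esub> l y"
    "l x = \<one>\<^bsub>F\<^esub>" "\<forall>y\<in>max_ideal_pow R (Suc n). l y = \<zero>\<^bsub>F\<^esub>"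
proof -
  interpret I: ideal "max_ideal_pow R n" R by (rule max_ideal_pow_is_ideal[OF local_ring])
  interpret J: ideal "max_ideal_pow R (Suc n)" R by (rule max_ideal_pow_is_ideal[OF local_ring])
  interpret m: ideal "max_ideal R" R by (rule max_ideal_ideal)
  have JI: "max_ideal_pow R (Suc n) \<subseteq> max_ideal_pow R n"
    by (rule max_ideal_pow_antimono[OF local_ring]) simp
  let ?S = "{K. ideal K R \<and> max_ideal_pow R (Suc n) \<subseteq> K \<and> K \<subseteq> max_ideal_pow R n \<and> x \<notin> K}"
  have "max_ideal_pow R (Suc n) \<in> ?S" using JI x(2) J.ideal_axioms by blast
  hence "?S \<noteq> {}" by blast
  then obtain N where N: "N \<in> ?S" "\<And>K. K \<in> ?S \<Longrightarrow> N \<subseteq> K \<Longrightarrow> K = N"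
    by (rule R.exists_maximal_element) auto
  interpret N: ideal N R using N(1) by blast
  have xc: "x \<in> carrier R" using x(1) by (rule I.Icarr)
  have mem: "\<exists>r\<in>carrier R. y \<ominus>\<^bsub>R\<^esub> r \<otimes>\<^bsub>R\<^esub> x \<in> N" if y: "y \<in> max_ideal_pow R n" for y
  proof (cases "y \<in> N")
    case True
    thus ?thesis using xc N.Icarr[OF True] by (intro bexI[of _ "\<zero>\<^bsub>R\<^esub>"]) (auto simp: R.minus_eq)
  next
    case False
    have yc: "y \<in> carrier R" using y by (rule I.Icarr)
    let ?K = "N <+>\<^bsub>R\<^esub> PIdl\<^bsub>R\<^esub> y"
    have K: "ideal ?K R" using R.add_ideals[OF N.ideal_axioms R.cgenideal_ideal[OF yc]] .
    have el: "k \<in> ?K \<longleftrightarrow> (\<exists>q\<in>N. \<exists>r\<in>carrier R. k = q \<oplus>\<^bsub>R\<^esub> r \<otimes>\<^bsub>R\<^esub> y)" for k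
      unfolding set_add_def' cgenideal_def by blast
    have NK: "N \<subseteq> ?K"
    proof
      fix q assume q: "q \<in> N"
      show "q \<in> ?K" unfolding el using q yc N.Icarr[OF q]
        by (intro bexI[of _ q] bexI[of _ "\<zero>\<^bsub>R\<^esub>"]) auto
    qed
    have yK: "y \<in> ?K" unfolding el using yc
      by (intro bexI[of _ "\<zero>\<^bsub>R\<^esub>"] bexI[of _ "\<one>\<^bsub>R\<^esub>"]) auto
    have KI: "?K \<subseteq> max_ideal_pow R n"
    proof
      fix k assume "k \<in> ?K"
      then obtain q r where "q \<in> N" "r \<in> carrier R" "k = q \<oplus>\<^bsub>R\<^esub> r \<otimes>\<^bsub>R\<^esub> y" unfolding el by blast
      moreover from this have "q \<in> max_ideal_pow R n" using N(1) by blast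
      ultimately show "k \<in> max_ideal_pow R n" using I.a_closed I.I_l_closed[OF y] by simp
    qed
    have "x \<in> ?K"
    proof (rule ccontr)
      assume "x \<notin> ?K"
      hence "?K \<in> ?S" using K NK KI N(1) by blast
      hence "?K = N" using N(2) NK by blast
      thus False using yK False by simp
    qed
    then obtain q r where qr: "q \<in> N" "r \<in> carrier R" "x = q \<oplus>\<^bsub>R\<^esub> r \<otimes>\<^bsub>R\<^esub> y" unfolding el by blast
    \<comment> \<open>A coefficient in the maximal ideal would move \<open>r y\<close> into
      \<open>m^(n+1)\<close>, hence into \<open>N\<close>, and then \<open>x\<close> would lie in
      \<open>N\<close> as well.\<close>
    have "r \<notin> max_ideal R"
    proof
      assume "r \<in> max_ideal R"
      hence "r \<otimes>\<^bsub>R\<^esub> y \<in> max_ideal_pow R (1 + n)"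
        using max_ideal_pow_prod[OF local_ring _ y, of r 1] max_ideal_pow_1[OF local_ring] by simp
      hence "r \<otimes>\<^bsub>R\<^esub> y \<in> N" using N(1) by auto
      hence "x \<in> N" using qr N.a_closed by simp
      thus False using N(1) by blast
    qed
    hence r: "r \<in> Units R" using unit_iff[OF qr(2)] residue_eq_0_iff[OF qr(2)] by simp
    have "y \<ominus>\<^bsub>R\<^esub> inv\<^bsub>R\<^esub> r \<otimes>\<^bsub>R\<^esub> x = \<ominus>\<^bsub>R\<^esub> (inv\<^bsub>R\<^esub> r \<otimes>\<^bsub>R\<^esub> q)"
    proof -
      have "inv\<^bsub>R\<^esub> r \<otimes>\<^bsub>R\<^esub> x = inv\<^bsub>R\<^esub> r \<otimes>\<^bsub>R\<^esub> q \<oplus>\<^bsub>R\<^esub> y"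
        unfolding qr(3) using r qr(1,2) yc N.Icarr[OF qr(1)] by (simp add: R.r_distr)
      moreover have "inv\<^bsub>R\<^esub> r \<otimes>\<^bsub>R\<^esub> q \<in> carrier R" using r N.Icarr[OF qr(1)] by simp
      ultimately show ?thesis using yc by simp algebra
    qed
    also have "\<dots> \<in> N" using N.a_inv_closed N.I_l_closed[OF qr(1)] r by simp
    finally show ?thesis using r by blast
  qed
  have uniq: "residue R r = residue R r'"
    if r: "r \<in> carrier R" "r' \<in> carrier R" and y: "y \<in> carrier R"
      "y \<ominus>\<^bsub>R\<^esub> r \<otimes>\<^bsub>R\<^esub> x \<in> N" "y \<ominus>\<^bsub>R\<^esub> r' \<otimes>\<^bsub>R\<^esub> x \<in> N" for r r' y
  proof (rule ccontr)
    assume "residue R r \<noteq> residue R r'"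
    hence u: "r \<ominus>\<^bsub>R\<^esub> r' \<in> Units R"
      using residue_eq_iff[OF r] unit_iff[of "r \<ominus>\<^bsub>R\<^esub> r'"] residue_eq_0_iff[of "r \<ominus>\<^bsub>R\<^esub> r'"] r by auto
    have "(r \<ominus>\<^bsub>R\<^esub> r') \<otimes>\<^bsub>R\<^esub> x = (y \<ominus>\<^bsub>R\<^esub> r' \<otimes>\<^bsub>R\<^esub> x) \<oplus>\<^bsub>R\<^esub> \<ominus>\<^bsub>R\<^esub> (y \<ominus>\<^bsub>R\<^esub> r \<otimes>\<^bsub>R\<^esub> x)"
      using r y(1) xc by algebra
    also have "\<dots> \<in> N" using y N.a_closed N.a_inv_closed by blast
    finally have "inv\<^bsub>R\<^esub> (r \<ominus>\<^bsub>R\<^esub> r') \<otimes>\<^bsub>R\<^esub> ((r \<ominus>\<^bsub>R\<^esub> r') \<otimes>\<^bsub>R\<^esub> x) \<in> N"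
      using N.I_l_closed u by simp
    hence "x \<in> N" using u xc by simp
    thus False using N(1) by blast
  qed
  \<comment> \<open>The coefficient \<open>r\<close> is unique modulo the maximal ideal, so its
    residue does not depend on the choice.\<close>
  define l where "l y = residue R (SOME r. r \<in> carrier R \<and> y \<ominus>\<^bsub>R\<^esub> r \<otimes>\<^bsub>R\<^esub> x \<in> N)" for y
  have l: "l y = residue R r" if "r \<in> carrier R" "y \<in> max_ideal_pow R n" "y \<ominus>\<^bsub>R\<^esub> r \<otimes>\<^bsub>R\<^esub> x \<in> N" for y r
  proof -
    let ?r = "SOME r. r \<in> carrier R \<and> y \<ominus>\<^bsub>R\<^esub> r \<otimes>\<^bsub>R\<^esub> x \<in> N"
    have "?r \<in> carrier R \<and> y \<ominus>\<^bsub>R\<^esub> ?r \<otimes>\<^bsub>R\<^esub> x \<in> N" by (rule someI[of _ r]) (use that in blast)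
    thus ?thesis unfolding l_def using uniq[of ?r r y] that I.Icarr by blast
  qed
  have lc: "l y \<in> carrier F" if "y \<in> max_ideal_pow R n" for y
    using mem[OF that] l[OF _ that] by force
  have ls: "l (r \<otimes>\<^bsub>R\<^esub> y) = residue R r \<otimes>\<^bsub>F\<^esub> l y" if r: "r \<in> carrier R" and y: "y \<in> max_ideal_pow R n" for r y
  proof -
    obtain a where a: "a \<in> carrier R" "y \<ominus>\<^bsub>R\<^esub> a \<otimes>\<^bsub>R\<^esub> x \<in> N" using mem[OF y] by blast
    have "(r \<otimes>\<^bsub>R\<^esub> y) \<ominus>\<^bsub>R\<^esub> (r \<otimes>\<^bsub>R\<^esub> a) \<otimes>\<^bsub>R\<^esub> x = r \<otimes>\<^bsub>R\<^esub> (y \<ominus>\<^bsub>R\<^esub> a \<otimes>\<^bsub>R\<^esub> x)"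
      using r a(1) xc I.Icarr[OF y] by algebra
    hence "(r \<otimes>\<^bsub>R\<^esub> y) \<ominus>\<^bsub>R\<^esub> (r \<otimes>\<^bsub>R\<^esub> a) \<otimes>\<^bsub>R\<^esub> x \<in> N" using N.I_l_closed[OF a(2) r] by simp
    hence "l (r \<otimes>\<^bsub>R\<^esub> y) = residue R (r \<otimes>\<^bsub>R\<^esub> a)" 
      by (rule l[OF R.m_closed[OF r a(1)] I.I_l_closed[OF y r]])
    thus ?thesis using l[OF a(1) y a(2)] r a(1) by simp
  qed
  have la: "l (y \<oplus>\<^bsub>R\<^esub> z) = l y \<oplus>\<^bsub>F\<^esub> l z" if y: "y \<in> max_ideal_pow R n" and z: "z \<in> max_ideal_pow R n" for y z
  proof -
    obtain a where a: "a \<in> carrier R" "y \<ominus>\<^bsub>R\<^esub> a \<otimes>\<^bsub>R\<^esub> x \<in> N" using mem[OF y] by blast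
    obtain b where b: "b \<in> carrier R" "z \<ominus>\<^bsub>R\<^esub> b \<otimes>\<^bsub>R\<^esub> x \<in> N" using mem[OF z] by blast
    have "(y \<oplus>\<^bsub>R\<^esub> z) \<ominus>\<^bsub>R\<^esub> (a \<oplus>\<^bsub>R\<^esub> b) \<otimes>\<^bsub>R\<^esub> x = (y \<ominus>\<^bsub>R\<^esub> a \<otimes>\<^bsub>R\<^esub> x) \<oplus>\<^bsub>R\<^esub> (z \<ominus>\<^bsub>R\<^esub> b \<otimes>\<^bsub>R\<^esub> x)"
      using a(1) b(1) xc I.Icarr[OF y] I.Icarr[OF z] by algebra
    hence "(y \<oplus>\<^bsub>R\<^esub> z) \<ominus>\<^bsub>R\<^esub> (a \<oplus>\<^bsub>R\<^esub> b) \<otimes>\<^bsub>R\<^esub> x \<in> N" using N.a_closed[OF a(2) b(2)] by simp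
    hence "l (y \<oplus>\<^bsub>R\<^esub> z) = residue R (a \<oplus>\<^bsub>R\<^esub> b)" 
      by (rule l[OF R.a_closed[OF a(1) b(1)] I.a_closed[OF y z]])
    thus ?thesis using l[OF a(1) y a(2)] l[OF b(1) z b(2)] a(1) b(1) by simp
  qed
  have lx: "l x = \<one>\<^bsub>F\<^esub>"
  proof -
    have "x \<ominus>\<^bsub>R\<^esub> \<one>\<^bsub>R\<^esub> \<otimes>\<^bsub>R\<^esub> x \<in> N" using xc by (simp add: R.r_neg R.minus_eq)
    thus ?thesis using l[OF R.one_closed x(1)] by simp
  qed
  have l0: "l y = \<zero>\<^bsub>F\<^esub>" if "y \<in> max_ideal_pow R (Suc n)" for y
  proof -
    have "y \<in> N" using that N(1) by blast
    hence "y \<ominus>\<^bsub>R\<^esub> \<zero>\<^bsub>R\<^esub> \<otimes>\<^bsub>R\<^esub> x \<in> N" using xc N.Icarr by (simp add: R.minus_eq)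
    thus ?thesis using l[OF R.zero_closed] that JI by auto
  qed
  show ?thesis by (rule that[of l]) (use lc la ls lx l0 in blast)+
qed

end

section \<open>Graded representations\<close>

definition mat2_continuous :: "'g topology \<Rightarrow> ('r, 'm) ring_scheme \<Rightarrow> ('g \<Rightarrow> 'r mat2) \<Rightarrow> bool" where
  "mat2_continuous T R f \<longleftrightarrow>
     continuous_map T (adic_topology R) (\<lambda>g. e11 (f g)) \<and>
     continuous_map T (adic_topology R) (\<lambda>g. e12 (f g)) \<and>
     continuous_map T (adic_topology R) (\<lambda>g. e21 (f g)) \<and>
     continuous_map T (adic_topology R) (\<lambda>g. e22 (f g))"

lemma representation_iff:
  "representation G T R \<rho> \<longleftrightarrow> \<rho> \<in> hom G (GL2 R) \<and> mat2_continuous T R \<rho>"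
  unfolding representation_def mat2_continuous_def by blast

lemma mat2_continuous_mult:
  assumes "local_ring R" "mat2_continuous T R f" "mat2_continuous T R g"
  shows "mat2_continuous T R (\<lambda>x. f x \<otimes>\<^bsub>mat2_ring R\<^esub> g x)"
  using assms(2,3) unfolding mat2_continuous_def
  by (auto simp: mat2_ring_mult intro!: continuous_map_adic_add[OF assms(1)] continuous_map_adic_mult[OF assms(1)])

lemma mat2_continuous_add:
  assumes "local_ring R" "mat2_continuous T R f" "mat2_continuous T R g"
  shows "mat2_continuous T R (\<lambda>x. f x \<oplus>\<^bsub>mat2_ring R\<^esub> g x)"
  using assms(2,3) unfolding mat2_continuous_def
  by (auto simp: mat2_ring_add intro!: continuous_map_adic_add[OF assms(1)])

lemma mat2_continuous_const:
  assumes "local_ring R" "A \<in> carrier (mat2_ring R)"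
  shows "mat2_continuous T R (\<lambda>x. A)"
  unfolding mat2_continuous_def using assms by (intro conjI continuous_map_adic_const) auto

lemma mat2_continuous_conj_by:
  assumes "local_ring R" "A \<in> Units (mat2_ring R)" "mat2_continuous T R f"
  shows "mat2_continuous T R (\<lambda>x. conj_by (mat2_ring R) A (f x))"
proof -
  interpret cring R using assms(1) unfolding local_ring_def by blast
  interpret M: ring "mat2_ring R" by (rule mat2_ring_is_ring)
  show ?thesis unfolding conj_by_def
    using assms by (intro mat2_continuous_mult mat2_continuous_const) auto
qed

lemma mat2_continuous_hom:
  assumes "local_ring R" "local_ring S" "\<phi> \<in> ring_hom R S" "\<phi> ` max_ideal R \<subseteq> max_ideal S"
    "mat2_continuous T R f"
  shows "mat2_continuous T S (\<lambda>x. map_mat2 \<phi> (f x))"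
  using assms(5) unfolding mat2_continuous_def map_mat2_entries
  by (intro conjI continuous_map_adic_hom[OF assms(1-4)]) blast+

lemma rep_hom_conj_by:
  assumes "cring R" "A \<in> Units (mat2_ring R)" "\<rho> \<in> hom G (GL2 R)"
  shows "(\<lambda>g. conj_by (mat2_ring R) A (\<rho> g)) \<in> hom G (GL2 R)"
proof -
  interpret cring R by fact
  interpret M: ring "mat2_ring R" by (rule mat2_ring_is_ring)
  show ?thesis
    using rep_hom[OF assms(3)] assms(2)
    by (auto simp: hom_def GL2_carrier GL2_mult M.conj_by_mult M.conj_by_Units)
qed

lemma rep_hom_map:
  assumes "cring R" "cring S" "\<phi> \<in> ring_hom R S" "\<rho> \<in> hom G (GL2 R)"
  shows "(\<lambda>g. map_mat2 \<phi> (\<rho> g)) \<in> hom G (GL2 S)"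
proof -
  interpret R: cring R by fact
  interpret S: cring S by fact
  interpret M: ring "mat2_ring R" by (rule R.mat2_ring_is_ring)
  interpret N: ring "mat2_ring S" by (rule S.mat2_ring_is_ring)
  note h = map_mat2_ring_hom[OF assms(3) R.ring_axioms S.ring_axioms]
  show ?thesis
    using rep_hom[OF assms(4)] ring_hom_inv(1)[OF M.monoid_axioms N.monoid_axioms h] ring_hom_mult[OF h]
    by (auto simp: hom_def GL2_carrier GL2_mult)
qed

lemma graded_hom:
  assumes "cring R" "cring S" "\<phi> \<in> ring_hom R S" "\<rho> \<in> hom G (GL2 R)" "graded G R H \<rho> P"
  shows "graded G S H (\<lambda>g. map_mat2 \<phi> (\<rho> g)) (map_mat2 \<phi> P)"
proof -
  interpret R: cring R by fact
  interpret S: cring S by fact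
  interpret M: ring "mat2_ring R" by (rule R.mat2_ring_is_ring)
  interpret N: ring "mat2_ring S" by (rule S.mat2_ring_is_ring)
  note h = map_mat2_ring_hom[OF assms(3) R.ring_axioms S.ring_axioms]
  have P: "P \<in> Units (mat2_ring R)" using assms(5) unfolding graded_def by blast
  have "homogeneous S (g \<in> H) (conj_by (mat2_ring S) (map_mat2 \<phi> P) (map_mat2 \<phi> (\<rho> g)))"
    if g: "g \<in> carrier G" for g
  proof -
    have "homogeneous R (g \<in> H) (conj_by (mat2_ring R) P (\<rho> g))"
      using assms(5) g unfolding graded_def by blast
    from homogeneous_map[OF assms(3) R.ring_axioms S.ring_axioms this]
    show ?thesis
      by (simp add: ring_hom_conj_by[OF M.monoid_axioms N.monoid_axioms h P rep_hom(2)[OF assms(4) g]])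
  qed
  thus ?thesis
    unfolding graded_def using ring_hom_inv(1)[OF M.monoid_axioms N.monoid_axioms h P] by blast
qed

lemma graded_conj_by:
  assumes "cring R" "A \<in> Units (mat2_ring R)" "\<rho> \<in> hom G (GL2 R)" "graded G R H \<rho> P"
  shows "graded G R H (\<lambda>g. conj_by (mat2_ring R) A (\<rho> g)) (P \<otimes>\<^bsub>mat2_ring R\<^esub> inv\<^bsub>mat2_ring R\<^esub> A)"
proof -
  interpret cring R by fact
  interpret M: ring "mat2_ring R" by (rule mat2_ring_is_ring)
  show ?thesis
    using assms(2,4) rep_hom(2)[OF assms(3)] unfolding graded_def
    by (auto simp: M.conj_by_conj_by)
qed

context cring
begin

interpretation M: ring "mat2_ring R" by (rule mat2_ring_is_ring)

lemma homogeneous_unit_entries: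
  assumes "A \<in> Units (mat2_ring R)" "homogeneous R s A"
  shows "if s then e11 A \<in> Units R \<and> e22 A \<in> Units R else e12 A \<in> Units R \<and> e21 A \<in> Units R"
proof -
  have c: "A \<in> carrier (mat2_ring R)" using assms(1) by (rule M.Units_closed)
  have u: "det2 R A \<in> Units R" using det2_unit_iff[OF c] assms(1) by simp
  show ?thesis
  proof (cases s)
    case True
    hence "det2 R A = e11 A \<otimes> e22 A" using assms(2) c by (simp add: det2_def homogeneous_def minus_eq)
    thus ?thesis using True u c unit_factor[of "e11 A" "e22 A"] unit_factor[of "e22 A" "e11 A"]
      by (simp add: m_comm)
  next
    case False
    hence "det2 R A = e12 A \<otimes> (\<ominus> e21 A)" "det2 R A = e21 A \<otimes> (\<ominus> e12 A)"
      using assms(2) c by (simp_all add: det2_def homogeneous_def minus_eq r_minus m_comm)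
    thus ?thesis using False u c unit_factor[of "e12 A" "\<ominus> e21 A"] unit_factor[of "e21 A" "\<ominus> e12 A"]
      by simp
  qed
qed

lemma mult_unit_eq_zero:
  assumes "x \<in> carrier R" "q \<in> Units R" "x \<otimes> q = \<zero>"
  shows "x = \<zero>"
  using assms Units_l_cancel[of q x \<zero>] by (simp add: m_comm Units_closed)

text \<open>A homogeneous unit has units in its two places, so multiplying by it only rescales and
  possibly exchanges the columns of \<open>B\<close>.\<close>

lemma homogeneous_right_cancel:
  assumes "B \<in> carrier (mat2_ring R)" "Q \<in> Units (mat2_ring R)" "homogeneous R s Q"
    "homogeneous R u (B \<otimes>\<^bsub>mat2_ring R\<^esub> Q)"
  shows "homogeneous R (u = s) B"
proof -
  note Qc = M.Units_closed[OF assms(2)]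
  have *: "x \<otimes> q = \<zero> \<longleftrightarrow> x = \<zero>" if "x \<in> carrier R" "q \<in> Units R" for x q
    using mult_unit_eq_zero[OF that] that by auto
  show ?thesis
    using homogeneous_unit_entries[OF assms(2,3)] assms(1,3,4) Qc
    by (cases s; cases u) (simp_all add: homogeneous_def mat2_ring_mult *)
qed

lemma homogeneous_conj_by:
  assumes "A \<in> carrier (mat2_ring R)" "Q \<in> Units (mat2_ring R)" "homogeneous R s Q" "homogeneous R t A"
  shows "homogeneous R t (conj_by (mat2_ring R) Q A)"
proof -
  have "homogeneous R (s = t) (conj_by (mat2_ring R) Q A \<otimes>\<^bsub>mat2_ring R\<^esub> Q)"
    using homogeneous_mult[OF M.Units_closed[OF assms(2)] assms(1,3,4)]
      M.conj_by_swap[OF assms(2,1)] by simp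
  from homogeneous_right_cancel[OF M.conj_by_closed[OF assms(2,1)] assms(2,3) this]
  show ?thesis by (cases s; cases t) simp_all
qed

lemma graded_mult:
  assumes "\<rho> \<in> hom G (GL2 R)" "graded G R H \<rho> P" "Q \<in> Units (mat2_ring R)" "homogeneous R s Q"
  shows "graded G R H \<rho> (Q \<otimes>\<^bsub>mat2_ring R\<^esub> P)"
proof -
  have P: "P \<in> Units (mat2_ring R)" using assms(2) unfolding graded_def by blast
  have "homogeneous R (g \<in> H) (conj_by (mat2_ring R) (Q \<otimes>\<^bsub>mat2_ring R\<^esub> P) (\<rho> g))" if g: "g \<in> carrier G" for g
    unfolding M.conj_by_conj_by[OF assms(3) P rep_hom(2)[OF assms(1) g]]
    using assms(2) g P rep_hom(2)[OF assms(1) g] unfolding graded_def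
    by (intro homogeneous_conj_by[OF _ assms(3,4)]) auto
  thus ?thesis unfolding graded_def using P assms(3) by simp
qed

text \<open>The component of degree \<open>s\<close>. The wrongly graded part of the image of
  \<open>g\<close> is the one of degree \<open>g \<notin> H\<close>.\<close>

definition hpart :: "bool \<Rightarrow> 'a mat2 \<Rightarrow> 'a mat2" where
  "hpart s A = (if s then Mat2 (e11 A) \<zero> \<zero> (e22 A) else Mat2 \<zero> (e12 A) (e21 A) \<zero>)"

lemma hpart_closed [simp]: "A \<in> carrier (mat2_ring R) \<Longrightarrow> hpart s A \<in> carrier (mat2_ring R)"
  by (simp add: hpart_def)

text \<open>With \<open>s\<close> and \<open>t\<close> the expected degrees, this is a Leibniz rule:
  the wrong part of a product is right times wrong plus wrong times right. It is the source of all
  derivations built from lifts.\<close>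

lemma hpart_mult:
  assumes "A \<in> carrier (mat2_ring R)" "B \<in> carrier (mat2_ring R)"
  shows "hpart (s \<noteq> t) (A \<otimes>\<^bsub>mat2_ring R\<^esub> B) =
     hpart s A \<otimes>\<^bsub>mat2_ring R\<^esub> hpart (\<not> t) B \<oplus>\<^bsub>mat2_ring R\<^esub> hpart (\<not> s) A \<otimes>\<^bsub>mat2_ring R\<^esub> hpart t B"
  using assms by (cases s; cases t) (simp_all add: hpart_def mat2_ring_simps a_comm)

lemma homogeneous_iff_hpart: "homogeneous R s A \<longleftrightarrow> hpart (\<not> s) A = \<zero>\<^bsub>mat2_ring R\<^esub>"
  by (auto simp: homogeneous_def hpart_def mat2_ring_zero)

end

text \<open>Derivations are the differences \<open>(\<rho> - \<rho>bar) / \<epsilon>\<close> for lifts \<open>\<rho>\<close> of \<open>\<rho>bar\<close> to the dual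
  numbers.\<close>

definition derivation ::
    "('g, 'm) monoid_scheme \<Rightarrow> 'g topology \<Rightarrow> ('f, 'n) ring_scheme \<Rightarrow> ('g \<Rightarrow> 'f mat2) \<Rightarrow> ('g \<Rightarrow> 'f mat2) \<Rightarrow> bool" where
  "derivation G T F \<rho> \<delta> \<longleftrightarrow>
     (\<forall>g\<in>carrier G. \<delta> g \<in> carrier (mat2_ring F)) \<and>
     (\<forall>g\<in>carrier G. \<forall>g'\<in>carrier G. \<delta> (g \<otimes>\<^bsub>G\<^esub> g') =
        \<rho> g \<otimes>\<^bsub>mat2_ring F\<^esub> \<delta> g' \<oplus>\<^bsub>mat2_ring F\<^esub> \<delta> g \<otimes>\<^bsub>mat2_ring F\<^esub> \<rho> g') \<and>
     mat2_continuous T F \<delta>"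

text \<open>The \<epsilon>-part of the relation (P + \<epsilon> N) (\<rho> + \<epsilon> \<delta>) =
  (B + \<epsilon> S) (P + \<epsilon> N), where \<open>B\<close> is the conjugate of \<rho> by
  \<open>P\<close>: the lift given by \<delta> is graded in a basis that reduces to
  \<open>P\<close>. Every \<open>P\<close> is allowed so that the condition can be used in whichever
  basis is prepared later.\<close>

definition splits_along ::
    "('g, 'm) monoid_scheme \<Rightarrow> ('f, 'n) ring_scheme \<Rightarrow> 'g set \<Rightarrow> ('g \<Rightarrow> 'f mat2) \<Rightarrow> ('g \<Rightarrow> 'f mat2) \<Rightarrow> bool" where
  "splits_along G F H \<rho> \<delta> \<longleftrightarrow>
     (\<forall>P. graded G F H \<rho> P \<longrightarrow>
       (\<exists>N S. N \<in> carrier (mat2_ring F) \<and>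
         (\<forall>g\<in>carrier G. S g \<in> carrier (mat2_ring F) \<and> homogeneous F (g \<in> H) (S g) \<and>
            N \<otimes>\<^bsub>mat2_ring F\<^esub> \<rho> g \<oplus>\<^bsub>mat2_ring F\<^esub> P \<otimes>\<^bsub>mat2_ring F\<^esub> \<delta> g =
            conj_by (mat2_ring F) P (\<rho> g) \<otimes>\<^bsub>mat2_ring F\<^esub> N \<oplus>\<^bsub>mat2_ring F\<^esub> S g \<otimes>\<^bsub>mat2_ring F\<^esub> P)))"

section \<open>Lifting a grading from the residue field\<close>

context coefficient_ring
begin

text \<open>The transition matrix intertwines two diagonal matrices, one of which has distinct
  entries, so it preserves or exchanges the two eigenlines.\<close>

lemma graded_homogeneous_transition:
  assumes \<rho>: "\<rho> \<in> hom G (GL2 F)" and P: "graded G F H \<rho> P" and P0: "graded G F H \<rho> P0"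
    and h: "h \<in> H" "h \<in> carrier G"
    and ne: "e11 (conj_by (mat2_ring F) P0 (\<rho> h)) \<noteq> e22 (conj_by (mat2_ring F) P0 (\<rho> h))"
  obtains s where "homogeneous F s (P0 \<otimes>\<^bsub>mat2_ring F\<^esub> inv\<^bsub>mat2_ring F\<^esub> P)"
proof -
  let ?M = "mat2_ring F"
  define Q where "Q = P0 \<otimes>\<^bsub>?M\<^esub> inv\<^bsub>?M\<^esub> P"
  define D where "D = conj_by ?M P (\<rho> h)"
  define D0 where "D0 = conj_by ?M P0 (\<rho> h)"
  have PU: "P \<in> Units ?M" "P0 \<in> Units ?M" using P P0 unfolding graded_def by auto
  have Q: "Q \<in> Units ?M" using PU unfolding Q_def by simp
  have Qc: "Q \<in> carrier ?M" using Q by (rule MF.Units_closed)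
  note \<rho>h = rep_hom(2)[OF \<rho> h(2)]
  have c: "D \<in> carrier ?M" "D0 \<in> carrier ?M" unfolding D_def D0_def using PU \<rho>h by auto
  have "conj_by ?M Q D = D0"
    unfolding Q_def D_def D0_def using PU \<rho>h by (simp add: MF.conj_by_conj_by)
  hence eq: "Q \<otimes>\<^bsub>?M\<^esub> D = D0 \<otimes>\<^bsub>?M\<^esub> Q"
    using MF.conj_by_swap[OF Q c(1)] by simp
  have hg: "e12 D = \<zero>\<^bsub>F\<^esub>" "e21 D = \<zero>\<^bsub>F\<^esub>" "e12 D0 = \<zero>\<^bsub>F\<^esub>" "e21 D0 = \<zero>\<^bsub>F\<^esub>"
    using P P0 h unfolding graded_def homogeneous_def D_def D0_def by auto
  have ent: "e11 Q \<otimes>\<^bsub>F\<^esub> e11 D = e11 Q \<otimes>\<^bsub>F\<^esub> e11 D0" "e12 Q \<otimes>\<^bsub>F\<^esub> e22 D = e12 Q \<otimes>\<^bsub>F\<^esub> e11 D0"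
    "e21 Q \<otimes>\<^bsub>F\<^esub> e11 D = e21 Q \<otimes>\<^bsub>F\<^esub> e22 D0" "e22 Q \<otimes>\<^bsub>F\<^esub> e22 D = e22 Q \<otimes>\<^bsub>F\<^esub> e22 D0"
    using eq Qc c hg by (simp_all add: mat2_ring_mult F.m_comm)
  note Qe = mat2_ring_entries[OF Qc]
  note De = mat2_ring_entries[OF c(1)] mat2_ring_entries[OF c(2)]
  have ne': "e11 D0 \<noteq> e22 D0" using ne unfolding D0_def .
  have can: "x = y" if "q \<otimes>\<^bsub>F\<^esub> x = q \<otimes>\<^bsub>F\<^esub> y" "q \<noteq> \<zero>\<^bsub>F\<^esub>" "q \<in> carrier F" "x \<in> carrier F" "y \<in> carrier F" for q x y
    using F.m_lcancel that by blast
  have d: "e11 Q \<otimes>\<^bsub>F\<^esub> e22 Q \<ominus>\<^bsub>F\<^esub> e12 Q \<otimes>\<^bsub>F\<^esub> e21 Q \<noteq> \<zero>\<^bsub>F\<^esub>"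
    using F.det2_unit_iff[OF Qc] Q F.field_Units unfolding det2_def by auto
  show ?thesis
  proof (cases "e11 Q = \<zero>\<^bsub>F\<^esub>")
    case False
    have 1: "e11 D = e11 D0" using can[OF ent(1) False] Qe De by blast
    have 2: "e21 Q = \<zero>\<^bsub>F\<^esub>" using can[OF ent(3)] 1 ne' Qe De by metis
    hence "e22 Q \<noteq> \<zero>\<^bsub>F\<^esub>" using d Qe by (auto simp: F.minus_eq)
    hence 3: "e22 D = e22 D0" using can[OF ent(4)] Qe De by blast
    have "e12 Q = \<zero>\<^bsub>F\<^esub>" using can[OF ent(2)] 3 ne' Qe De by metis
    thus ?thesis using 2 that[of True] unfolding Q_def by (simp add: homogeneous_def)
  next
    case True
    hence "e12 Q \<noteq> \<zero>\<^bsub>F\<^esub>" using d Qe by (auto simp: F.minus_eq)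
    hence "e22 D = e11 D0" using can[OF ent(2)] Qe De by blast
    hence "e22 Q = \<zero>\<^bsub>F\<^esub>" using can[OF ent(4)] ne' Qe De by metis
    thus ?thesis using True that[of False] unfolding Q_def by (simp add: homogeneous_def)
  qed
qed

text \<open>The transition matrix from the reduction of \<open>P\<close> to \<open>P0\<close> is
  homogeneous, so it has a homogeneous lift, and a homogeneous change of basis keeps the
  grading.\<close>

lemma graded_lift_residue:
  assumes \<rho>: "\<rho> \<in> hom G (GL2 R)" and \<rho>bar: "\<rho>bar \<in> hom G (GL2 F)"
    and lift: "\<And>g. g \<in> carrier G \<Longrightarrow> map_mat2 (residue R) (\<rho> g) = \<rho>bar g"
    and P: "graded G R H \<rho> P" and P0: "graded G F H \<rho>bar P0"
    and h: "h \<in> H" "h \<in> carrier G"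
    and ne: "e11 (conj_by (mat2_ring F) P0 (\<rho>bar h)) \<noteq> e22 (conj_by (mat2_ring F) P0 (\<rho>bar h))"
  obtains P' where "graded G R H \<rho> P'" "map_mat2 (residue R) P' = P0"
proof -
  have "graded G F H (\<lambda>g. map_mat2 (residue R) (\<rho> g)) (map_mat2 (residue R) P)"
    by (rule graded_hom[OF R.cring_axioms F.cring_axioms residue_hom \<rho> P])
  hence Pb: "graded G F H \<rho>bar (map_mat2 (residue R) P)"
    using lift unfolding graded_def by simp
  obtain s where s: "homogeneous F s (P0 \<otimes>\<^bsub>mat2_ring F\<^esub> inv\<^bsub>mat2_ring F\<^esub> (map_mat2 (residue R) P))"
    by (rule graded_homogeneous_transition[OF \<rho>bar Pb P0 h ne])
  have PU: "P \<in> Units (mat2_ring R)" "P0 \<in> Units (mat2_ring F)" "map_mat2 (residue R) P \<in> Units (mat2_ring F)"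
    using P P0 Pb unfolding graded_def by auto
  let ?Q = "P0 \<otimes>\<^bsub>mat2_ring F\<^esub> inv\<^bsub>mat2_ring F\<^esub> (map_mat2 (residue R) P)"
  have Q: "?Q \<in> Units (mat2_ring F)" using PU by simp
  obtain Q where Q': "Q \<in> carrier (mat2_ring R)" "map_mat2 (residue R) Q = ?Q" "homogeneous R s Q"
    using obtain_mat_lift[OF MF.Units_closed[OF Q]] s by metis
  have QU: "Q \<in> Units (mat2_ring R)" using mat_unit_iff[OF Q'(1)] Q'(2) Q by simp
  have "map_mat2 (residue R) (Q \<otimes>\<^bsub>mat2_ring R\<^esub> P) = P0"
    using Q'(1,2) PU by (simp add: M.Units_closed MF.m_assoc MF.Units_closed)
  thus ?thesis using that R.graded_mult[OF \<rho> P QU Q'(3)] by blast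
qed

text \<open>The shape of \<open>D \<sigma>\<close> puts all wrongly graded entries into the ideal
  generated by the upper right entries on \<open>H\<close>. These are pushed into ever higher powers
  of the maximal ideal: a first obstruction would be a derivation that splits, and the zero at
  \<open>h0\<close> leaves no room for an inner part.\<close>

lemma homogeneous_of_splitting:
  assumes ind: "index_two G H" and top: "topspace T = carrier G"
    and op: "openin T H" "openin T (carrier G - H)"
    and \<sigma>: "\<sigma> \<in> carrier G" "\<sigma> \<notin> H"
    and Dc: "\<And>g. g \<in> carrier G \<Longrightarrow> D g \<in> carrier (mat2_ring R)"
    and Dm: "\<And>g g'. g \<in> carrier G \<Longrightarrow> g' \<in> carrier G \<Longrightarrow> D (g \<otimes>\<^bsub>G\<^esub> g') = D g \<otimes>\<^bsub>mat2_ring R\<^esub> D g'"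
    and cont: "mat2_continuous T R D"
    and hom: "\<And>g. g \<in> carrier G \<Longrightarrow> homogeneous F (g \<in> H) (map_mat2 (residue R) (D g))"
    and D\<sigma>: "e11 (D \<sigma>) = \<zero>\<^bsub>R\<^esub>" "e12 (D \<sigma>) = \<one>\<^bsub>R\<^esub>"
    and h0: "h0 \<in> H" "e12 (D h0) = \<zero>\<^bsub>R\<^esub>" "residue R (e11 (D h0)) \<noteq> residue R (e22 (D h0))"
    and split: "\<And>\<delta>. derivation G T F (\<lambda>g. map_mat2 (residue R) (D g)) \<delta> \<Longrightarrow>
      \<exists>N S. N \<in> carrier (mat2_ring F) \<and>
         (\<forall>g\<in>carrier G. S g \<in> carrier (mat2_ring F) \<and> homogeneous F (g \<in> H) (S g) \<and>
            N \<otimes>\<^bsub>mat2_ring F\<^esub> map_mat2 (residue R) (D g) \<oplus>\<^bsub>mat2_ring F\<^esub> \<delta> g =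
            map_mat2 (residue R) (D g) \<otimes>\<^bsub>mat2_ring F\<^esub> N \<oplus>\<^bsub>mat2_ring F\<^esub> S g)"
    and g: "g \<in> carrier G"
  shows "homogeneous R (g \<in> H) (D g)"
proof -
  interpret G: index_two G H by fact
  let ?m = "max_ideal_pow R"
  let ?W = "\<lambda>g. R.hpart (g \<notin> H) (D g)"
  have s2: "\<sigma> \<otimes>\<^bsub>G\<^esub> \<sigma> \<in> H" using \<sigma> by (simp add: G.mult_mem_iff)
  \<comment> \<open>As the first row of \<open>D \<sigma>\<close> is (0, 1), multiplying by
    \<open>D \<sigma>\<close> on the left moves the second row of a matrix into the first. In this
    way the remaining wrong entries are expressed through upper right entries on
    \<open>H\<close>.\<close>
  have w: "e22 (D \<sigma>) = e12 (D (\<sigma> \<otimes>\<^bsub>G\<^esub> \<sigma>))"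
    using Dm[OF \<sigma>(1) \<sigma>(1)] D\<sigma> Dc[OF \<sigma>(1)] by (simp add: mat2_ring_mult)
  have conj: "\<sigma> \<otimes>\<^bsub>G\<^esub> h \<otimes>\<^bsub>G\<^esub> inv\<^bsub>G\<^esub> \<sigma> \<in> H" if "h \<in> H" for h
    using that \<sigma> by (simp add: G.mult_mem_iff G.inv_mem_iff)
  have c21: "e21 (D h) = e12 (D (\<sigma> \<otimes>\<^bsub>G\<^esub> h \<otimes>\<^bsub>G\<^esub> inv\<^bsub>G\<^esub> \<sigma>)) \<otimes>\<^bsub>R\<^esub> e21 (D \<sigma>)" if h: "h \<in> H" for h
  proof -
    let ?k = "\<sigma> \<otimes>\<^bsub>G\<^esub> h \<otimes>\<^bsub>G\<^esub> inv\<^bsub>G\<^esub> \<sigma>"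
    have k: "?k \<in> carrier G" using conj[OF h] by simp
    have "?k \<otimes>\<^bsub>G\<^esub> \<sigma> = \<sigma> \<otimes>\<^bsub>G\<^esub> h" using h \<sigma> by (simp add: G.m_assoc)
    hence "D ?k \<otimes>\<^bsub>mat2_ring R\<^esub> D \<sigma> = D \<sigma> \<otimes>\<^bsub>mat2_ring R\<^esub> D h"
      using Dm[OF k \<sigma>(1)] Dm[OF \<sigma>(1), of h] h by simp
    thus ?thesis using D\<sigma> Dc[OF k] Dc[OF \<sigma>(1)] Dc[of h] h by (simp add: mat2_ring_mult)
  qed
  have wrong: "e11 (?W g) \<in> ?m n \<and> e12 (?W g) \<in> ?m n \<and> e21 (?W g) \<in> ?m n \<and> e22 (?W g) \<in> ?m n"
    if b: "\<And>h. h \<in> H \<Longrightarrow> e12 (D h) \<in> ?m n" and g: "g \<in> carrier G" for n g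
  proof -
    interpret I: ideal "?m n" R by (rule max_ideal_pow_is_ideal[OF local_ring])
    have c: "e21 (D h) \<in> ?m n" if h: "h \<in> H" for h
      unfolding c21[OF h] using b[OF conj[OF h]] Dc[OF \<sigma>(1)] I.I_r_closed by simp
    show ?thesis
    proof (cases "g \<in> H")
      case True
      thus ?thesis using b c by (simp add: R.hpart_def)
    next
      case False
      let ?h = "g \<otimes>\<^bsub>G\<^esub> inv\<^bsub>G\<^esub> \<sigma>"
      have h: "?h \<in> H" "?h \<in> carrier G" using g \<sigma> False by (simp_all add: G.mult_mem_iff G.inv_mem_iff)
      have "D g = D ?h \<otimes>\<^bsub>mat2_ring R\<^esub> D \<sigma>" using Dm[OF h(2) \<sigma>(1)] g \<sigma> by (simp add: G.m_assoc)
      hence "e11 (D g) = e12 (D ?h) \<otimes>\<^bsub>R\<^esub> e21 (D \<sigma>)"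
        "e22 (D g) = e21 (D ?h) \<oplus>\<^bsub>R\<^esub> e22 (D ?h) \<otimes>\<^bsub>R\<^esub> e22 (D \<sigma>)"
        using Dc[OF h(2)] Dc[OF \<sigma>(1)] D\<sigma> by (simp_all add: mat2_ring_mult)
      moreover have "e12 (D ?h) \<otimes>\<^bsub>R\<^esub> e21 (D \<sigma>) \<in> ?m n"
        using b[OF h(1)] Dc[OF \<sigma>(1)] I.I_r_closed by simp
      moreover have "e22 (D ?h) \<otimes>\<^bsub>R\<^esub> e22 (D \<sigma>) \<in> ?m n"
        unfolding w using b[OF s2] Dc[OF h(2)] I.I_l_closed by simp
      ultimately show ?thesis using False c[OF h(1)] I.a_closed by (simp add: R.hpart_def)
    qed
  qed
  \<comment> \<open>The induction starts at the first power, where the claim is the homogeneity of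
    the reduction.\<close>
  have b: "\<forall>h\<in>H. e12 (D h) \<in> ?m (Suc n)" for n
  proof (induct n)
    case 0
    show ?case
    proof
      fix h assume h: "h \<in> H"
      hence "residue R (e12 (D h)) = \<zero>\<^bsub>F\<^esub>" using hom[of h] by (simp add: homogeneous_def)
      thus "e12 (D h) \<in> ?m (Suc 0)"
        using residue_eq_0_iff[of "e12 (D h)"] Dc[of h] h max_ideal_pow_1[OF local_ring] by simp
    qed
  next
    case (Suc n)
    let ?n = "Suc n"
    interpret I: ideal "?m ?n" R by (rule max_ideal_pow_is_ideal[OF local_ring])
    have W: "e11 (?W g) \<in> ?m ?n \<and> e12 (?W g) \<in> ?m ?n \<and> e21 (?W g) \<in> ?m ?n \<and> e22 (?W g) \<in> ?m ?n"
      if "g \<in> carrier G" for g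
      by (rule wrong[OF bspec[OF Suc] that])
    show ?case
    proof (rule ccontr)
      assume "\<not> (\<forall>h\<in>H. e12 (D h) \<in> ?m (Suc ?n))"
      then obtain h1 where h1: "h1 \<in> H" "e12 (D h1) \<notin> ?m (Suc ?n)" by blast
      have h1': "e12 (D h1) \<in> ?m ?n" using Suc h1(1) by blast
      obtain l where l: "\<forall>y\<in>?m ?n. l y \<in> carrier F"
        "\<forall>y\<in>?m ?n. \<forall>z\<in>?m ?n. l (y \<oplus>\<^bsub>R\<^esub> z) = l y \<oplus>\<^bsub>F\<^esub> l z"
        "\<forall>r\<in>carrier R. \<forall>y\<in>?m ?n. l (r \<otimes>\<^bsub>R\<^esub> y) = residue R r \<otimes>\<^bsub>F\<^esub> l y"
        "l (e12 (D h1)) = \<one>\<^bsub>F\<^esub>" "\<forall>y\<in>?m (Suc ?n). l y = \<zero>\<^bsub>F\<^esub>"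
        by (rule obtain_functional[OF h1' h1(2)])
      note lc = bspec[OF l(1)] and la = bspec[OF bspec[OF l(2)]] and ls = bspec[OF bspec[OF l(3)]]
        and l1 = l(4) and l0 = bspec[OF l(5)]
      have lzero: "l \<zero>\<^bsub>R\<^esub> = \<zero>\<^bsub>F\<^esub>"
        using l0 additive_subgroup.zero_closed[OF ideal.axioms(1)[OF max_ideal_pow_is_ideal[OF local_ring]]] by blast
      define \<delta> where "\<delta> g = map_mat2 l (?W g)" for g
      have ls': "l (y \<otimes>\<^bsub>R\<^esub> r) = l y \<otimes>\<^bsub>F\<^esub> residue R r" if "r \<in> carrier R" "y \<in> ?m ?n" for r y
        using ls[OF that] lc[OF that(2)] that by (simp add: R.m_comm F.m_comm I.Icarr)
      have mapl: "map_mat2 l (A \<otimes>\<^bsub>mat2_ring R\<^esub> B) = map_mat2 (residue R) A \<otimes>\<^bsub>mat2_ring F\<^esub> map_mat2 l B"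
        "map_mat2 l (B \<otimes>\<^bsub>mat2_ring R\<^esub> A) = map_mat2 l B \<otimes>\<^bsub>mat2_ring F\<^esub> map_mat2 (residue R) A"
        "e11 (A \<otimes>\<^bsub>mat2_ring R\<^esub> B) \<in> ?m ?n \<and> e12 (A \<otimes>\<^bsub>mat2_ring R\<^esub> B) \<in> ?m ?n \<and>
         e21 (A \<otimes>\<^bsub>mat2_ring R\<^esub> B) \<in> ?m ?n \<and> e22 (A \<otimes>\<^bsub>mat2_ring R\<^esub> B) \<in> ?m ?n"
        "e11 (B \<otimes>\<^bsub>mat2_ring R\<^esub> A) \<in> ?m ?n \<and> e12 (B \<otimes>\<^bsub>mat2_ring R\<^esub> A) \<in> ?m ?n \<and>
         e21 (B \<otimes>\<^bsub>mat2_ring R\<^esub> A) \<in> ?m ?n \<and> e22 (B \<otimes>\<^bsub>mat2_ring R\<^esub> A) \<in> ?m ?n"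
        if "A \<in> carrier (mat2_ring R)"
          "e11 B \<in> ?m ?n \<and> e12 B \<in> ?m ?n \<and> e21 B \<in> ?m ?n \<and> e22 B \<in> ?m ?n" for A B
        using that I.I_l_closed I.I_r_closed I.a_closed
        by (simp_all del: nat_pow_Suc add: map_mat2_conv mat2_ring_mult la ls ls')
      have adl: "map_mat2 l (A \<oplus>\<^bsub>mat2_ring R\<^esub> B) = map_mat2 l A \<oplus>\<^bsub>mat2_ring F\<^esub> map_mat2 l B"
        if "e11 A \<in> ?m ?n \<and> e12 A \<in> ?m ?n \<and> e21 A \<in> ?m ?n \<and> e22 A \<in> ?m ?n"
          "e11 B \<in> ?m ?n \<and> e12 B \<in> ?m ?n \<and> e21 B \<in> ?m ?n \<and> e22 B \<in> ?m ?n" for A B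
        using that by (simp del: nat_pow_Suc add: map_mat2_conv mat2_ring_add la)
      have right: "map_mat2 (residue R) (R.hpart (g \<in> H) (D g)) = map_mat2 (residue R) (D g)"
        if "g \<in> carrier G" for g
        using hom[OF that] by (auto simp: R.hpart_def homogeneous_def map_mat2_conv)
      have der: "derivation G T F (\<lambda>g. map_mat2 (residue R) (D g)) \<delta>"
        unfolding derivation_def
      proof (intro conjI ballI)
        fix g assume g: "g \<in> carrier G"
        show "\<delta> g \<in> carrier (mat2_ring F)"
          unfolding \<delta>_def map_mat2_conv using W[OF g] lc by simp
        fix g' assume g': "g' \<in> carrier G"
        have "?W (g \<otimes>\<^bsub>G\<^esub> g') = R.hpart ((g \<in> H) \<noteq> (g' \<in> H)) (D g \<otimes>\<^bsub>mat2_ring R\<^esub> D g')"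
          using Dm[OF g g'] G.mult_mem_iff[OF g g'] by (simp add: neq_commute)
        also have "\<dots> = R.hpart (g \<in> H) (D g) \<otimes>\<^bsub>mat2_ring R\<^esub> ?W g' \<oplus>\<^bsub>mat2_ring R\<^esub>
            ?W g \<otimes>\<^bsub>mat2_ring R\<^esub> R.hpart (g' \<in> H) (D g')"
          by (rule R.hpart_mult[OF Dc[OF g] Dc[OF g']])
        finally have eq: "?W (g \<otimes>\<^bsub>G\<^esub> g') = R.hpart (g \<in> H) (D g) \<otimes>\<^bsub>mat2_ring R\<^esub> ?W g' \<oplus>\<^bsub>mat2_ring R\<^esub>
            ?W g \<otimes>\<^bsub>mat2_ring R\<^esub> R.hpart (g' \<in> H) (D g')" .
        note hc = R.hpart_closed[OF Dc[OF g], of "g \<in> H"] R.hpart_closed[OF Dc[OF g'], of "g' \<in> H"]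
        show "\<delta> (g \<otimes>\<^bsub>G\<^esub> g') = map_mat2 (residue R) (D g) \<otimes>\<^bsub>mat2_ring F\<^esub> \<delta> g' \<oplus>\<^bsub>mat2_ring F\<^esub>
            \<delta> g \<otimes>\<^bsub>mat2_ring F\<^esub> map_mat2 (residue R) (D g')"
          unfolding \<delta>_def eq adl[OF mapl(3)[OF hc(1) W[OF g']] mapl(4)[OF hc(2) W[OF g]]]
            mapl(1)[OF hc(1) W[OF g']] mapl(2)[OF hc(2) W[OF g]] right[OF g] right[OF g'] ..
      next
        \<comment> \<open>The functional vanishes on the next power, so its composite with an entry
          is locally constant. \<open>ch\<close> records that an entry survives in one degree and is
          zero in the other; the neighbourhood is cut down to one coset of \<open>H\<close>, on
          which the degree does not change.\<close>
        have key: "continuous_map T (adic_topology F) (\<lambda>g. l (e (?W g)))"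
          if e: "continuous_map T (adic_topology R) (\<lambda>g. e (D g))"
            and m: "\<And>g. g \<in> carrier G \<Longrightarrow> e (?W g) \<in> ?m ?n"
            and ch: "(\<forall>A. e (R.hpart True A) = e A \<and> e (R.hpart False A) = \<zero>\<^bsub>R\<^esub>) \<or>
                     (\<forall>A. e (R.hpart False A) = e A \<and> e (R.hpart True A) = \<zero>\<^bsub>R\<^esub>)" for e
          unfolding continuous_map_adic_topology[OF field_local(1)[OF F.field_axioms]] top
        proof (intro conjI ballI allI)
          fix x k assume x: "x \<in> carrier G"
          show "l (e (?W x)) \<in> carrier F" using lc m[OF x] by blast
          obtain W' where W': "openin T W'" "x \<in> W'" "\<forall>y\<in>W'. e (D y) \<ominus>\<^bsub>R\<^esub> e (D x) \<in> ?m (Suc ?n)"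
            using e x unfolding continuous_map_adic_topology[OF local_ring] top by blast
          let ?V = "W' \<inter> (if x \<in> H then H else carrier G - H)"
          have V: "openin T ?V" "x \<in> ?V" using W' op x by auto
          have "l (e (?W y)) \<ominus>\<^bsub>F\<^esub> l (e (?W x)) \<in> max_ideal_pow F k" if y: "y \<in> ?V" for y
          proof -
            have yc: "y \<in> carrier G" using y openin_subset[OF V(1)] top by blast
            have yx: "(y \<in> H) = (x \<in> H)" using y by (auto split: if_splits)
            have ec: "e (D z) \<in> carrier R" if "z \<in> carrier G" for z
              using e that unfolding continuous_map_adic_topology[OF local_ring] top by blast
            have "l (e (?W y)) = l (e (?W x))"
            proof (cases "\<forall>A. e (R.hpart (x \<notin> H) A) = e A")
              case True
              have eq: "e (?W y) = e (D y)" "e (?W x) = e (D x)" using True yx by simp_all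
              have d: "e (D y) \<ominus>\<^bsub>R\<^esub> e (D x) \<in> ?m (Suc ?n)" using W'(3) y by blast
              hence d': "e (D y) \<ominus>\<^bsub>R\<^esub> e (D x) \<in> ?m ?n"
                using max_ideal_pow_antimono[OF local_ring, of ?n "Suc ?n"] by auto
              have "e (D y) = (e (D y) \<ominus>\<^bsub>R\<^esub> e (D x)) \<oplus>\<^bsub>R\<^esub> e (D x)"
                using ec[OF yc] ec[OF x] by algebra
              hence "l (e (D y)) = l (e (D y) \<ominus>\<^bsub>R\<^esub> e (D x)) \<oplus>\<^bsub>F\<^esub> l (e (D x))"
                using la[OF d'] m[OF x] eq(2) by metis
              thus ?thesis using l0[OF d] lc[OF m[OF x]] eq by simp
            next
              case False
              hence "\<forall>A. e (R.hpart (x \<notin> H) A) = \<zero>\<^bsub>R\<^esub>" using ch by (cases "x \<in> H") auto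
              thus ?thesis using yx by simp
            qed
            hence "l (e (?W y)) \<ominus>\<^bsub>F\<^esub> l (e (?W x)) = \<zero>\<^bsub>F\<^esub>"
              using lc[OF m[OF x]] by (simp add: F.r_neg F.minus_eq)
            thus ?thesis
              using additive_subgroup.zero_closed[OF ideal.axioms(1)[OF max_ideal_pow_is_ideal[OF field_local(1)[OF F.field_axioms]]]]
              by simp
          qed
          thus "\<exists>V. openin T V \<and> x \<in> V \<and> (\<forall>y\<in>V. l (e (?W y)) \<ominus>\<^bsub>F\<^esub> l (e (?W x)) \<in> max_ideal_pow F k)"
            using V by blast
        qed
        show "mat2_continuous T F \<delta>"
          unfolding mat2_continuous_def \<delta>_def map_mat2_entries
          using cont W unfolding mat2_continuous_def
          by (intro conjI key) (auto simp: R.hpart_def simp del: nat_pow_Suc)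
      qed
      obtain N S where N: "N \<in> carrier (mat2_ring F)"
        and S: "\<And>g. g \<in> carrier G \<Longrightarrow> S g \<in> carrier (mat2_ring F) \<and> homogeneous F (g \<in> H) (S g) \<and>
            N \<otimes>\<^bsub>mat2_ring F\<^esub> map_mat2 (residue R) (D g) \<oplus>\<^bsub>mat2_ring F\<^esub> \<delta> g =
            map_mat2 (residue R) (D g) \<otimes>\<^bsub>mat2_ring F\<^esub> N \<oplus>\<^bsub>mat2_ring F\<^esub> S g"
        using split[OF der] by blast
      \<comment> \<open>On \<open>H\<close> the homogeneous term \<open>S h\<close> has no upper
        right entry. What remains is the inner derivation of \<open>N\<close>, that is,
        \<open>e12 N\<close> times a difference of diagonal entries.\<close>
      have eq: "e12 N \<otimes>\<^bsub>F\<^esub> residue R (e22 (D h)) \<oplus>\<^bsub>F\<^esub> l (e12 (D h)) = residue R (e11 (D h)) \<otimes>\<^bsub>F\<^esub> e12 N"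
        if h: "h \<in> H" for h
      proof -
        have hc: "h \<in> carrier G" using h by simp
        have z: "e12 (S h) = \<zero>\<^bsub>F\<^esub>" using S[OF hc] h by (simp add: homogeneous_def)
        have r: "residue R (e12 (D h)) = \<zero>\<^bsub>F\<^esub>" using hom[OF hc] h by (simp add: homogeneous_def)
        have "e12 (N \<otimes>\<^bsub>mat2_ring F\<^esub> map_mat2 (residue R) (D h) \<oplus>\<^bsub>mat2_ring F\<^esub> \<delta> h) =
            e12 (map_mat2 (residue R) (D h) \<otimes>\<^bsub>mat2_ring F\<^esub> N \<oplus>\<^bsub>mat2_ring F\<^esub> S h)"
          using S[OF hc] by simp
        thus ?thesis
          using N Dc[OF hc] z r h by (simp add: mat2_ring_simps \<delta>_def R.hpart_def)
      qed
      \<comment> \<open>At \<open>h0\<close> the entry of \<open>D\<close> is zero while the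
        diagonal entries differ in the residue field.\<close>
      have Nz: "e12 N = \<zero>\<^bsub>F\<^esub>"
      proof (rule ccontr)
        assume "e12 N \<noteq> \<zero>\<^bsub>F\<^esub>"
        moreover have "e12 N \<otimes>\<^bsub>F\<^esub> residue R (e22 (D h0)) = e12 N \<otimes>\<^bsub>F\<^esub> residue R (e11 (D h0))"
          using eq[OF h0(1)] h0(1,2) lzero N Dc[of h0] by (simp add: F.m_comm)
        ultimately show False
          using h0(1,3) F.m_lcancel[of "e12 N"] N Dc[of h0] by simp
      qed
      have "l (e12 (D h1)) = \<zero>\<^bsub>F\<^esub>"
        using eq[OF h1(1)] Nz lc[OF h1'] Dc[of h1] h1(1) by simp
      thus False using l1 by simp
    qed
  qed
  have "e12 (D h) = \<zero>\<^bsub>R\<^esub>" if "h \<in> H" for h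
  proof (rule max_ideal_pow_inter_zero)
    fix n show "e12 (D h) \<in> ?m n"
      using b[of n] that max_ideal_pow_antimono[OF local_ring, of n "Suc n"] by auto
  qed
  hence "e12 (D h) \<in> ?m n" if "h \<in> H" for h n
    using that additive_subgroup.zero_closed[OF ideal.axioms(1)[OF max_ideal_pow_is_ideal[OF local_ring]]] by simp
  hence "e11 (?W g) \<in> ?m n \<and> e12 (?W g) \<in> ?m n \<and> e21 (?W g) \<in> ?m n \<and> e22 (?W g) \<in> ?m n" for n
    using wrong[of n g] g by blast
  hence "?W g = \<zero>\<^bsub>mat2_ring R\<^esub>"
    unfolding mat2_ring_zero by (intro mat2.expand) (auto intro!: max_ideal_pow_inter_zero)
  thus ?thesis using R.homogeneous_iff_hpart by simp
qed

end

lemma mat2_continuous_cong: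
  assumes "mat2_continuous T R f" "\<And>x. x \<in> topspace T \<Longrightarrow> f x = g x"
  shows "mat2_continuous T R g"
  using assms(1) unfolding mat2_continuous_def
  by (elim conjE, intro conjI) (erule continuous_map_eq, simp add: assms(2))+

context coefficient_ring
begin

text \<open>The work lies in reaching the basis required by \<open>homogeneous_of_splitting\<close>,
  in three changes: \<open>P1\<close> lifts \<open>P0\<close>, \<open>X1\<close> creates the zero at
  \<open>h0\<close>, and \<open>X2\<close> creates the row (0, 1) at \<sigma> without destroying
  that zero.\<close>

lemma graded_of_splits:
  assumes ind: "index_two G H" and top: "topspace T = carrier G"
    and op: "openin T H" "openin T (carrier G - H)"
    and rep: "representation G T R \<rho>" and \<rho>bar: "\<rho>bar \<in> hom G (GL2 F)"
    and lift: "\<And>g. g \<in> carrier G \<Longrightarrow> map_mat2 (residue R) (\<rho> g) = \<rho>bar g"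
    and P0: "graded G F H \<rho>bar P0" and h0: "h0 \<in> H"
    and ne: "e11 (conj_by (mat2_ring F) P0 (\<rho>bar h0)) \<noteq> e22 (conj_by (mat2_ring F) P0 (\<rho>bar h0))"
    and split: "\<And>\<delta>. derivation G T F \<rho>bar \<delta> \<Longrightarrow> splits_along G F H \<rho>bar \<delta>"
  shows "\<exists>P. graded G R H \<rho> P"
proof -
  interpret G: index_two G H by fact
  let ?M = "mat2_ring R" and ?N = "mat2_ring F" and ?r = "map_mat2 (residue R)"
  have \<rho>: "\<rho> \<in> hom G (GL2 R)" and cont: "mat2_continuous T R \<rho>"
    using rep unfolding representation_iff by blast+
  note \<rho>U = rep_hom(1)[OF \<rho>] and \<rho>c = rep_hom(2)[OF \<rho>] and \<rho>m = rep_hom(3)[OF \<rho>]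
  note bU = rep_hom(1)[OF \<rho>bar] and bc = rep_hom(2)[OF \<rho>bar] and bm = rep_hom(3)[OF \<rho>bar]
  obtain \<sigma> where \<sigma>: "\<sigma> \<in> carrier G" "\<sigma> \<notin> H" using G.obtain_outside by blast
  have h0c: "h0 \<in> carrier G" using h0 by simp
  have P0U: "P0 \<in> Units ?N" using P0 unfolding graded_def by blast
  define B where "B g = conj_by ?N P0 (\<rho>bar g)" for g
  have Bh: "homogeneous F (g \<in> H) (B g)" if "g \<in> carrier G" for g
    using P0 that unfolding graded_def B_def by blast
  have BU: "B g \<in> Units ?N" if "g \<in> carrier G" for g
    unfolding B_def using MF.conj_by_Units[OF P0U bU[OF that]] .
  obtain P1 where P1c: "P1 \<in> carrier ?M" and P1r: "?r P1 = P0"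
    using obtain_mat_lift[OF MF.Units_closed[OF P0U]] by metis
  have P1: "P1 \<in> Units ?M" using mat_unit_iff[OF P1c] P1r P0U by simp
  define D1 where "D1 g = conj_by ?M P1 (\<rho> g)" for g
  have D1c: "D1 g \<in> carrier ?M" if "g \<in> carrier G" for g
    unfolding D1_def using P1 \<rho>c[OF that] by simp
  have rconj: "?r (conj_by ?M A C) = conj_by ?N (?r A) (?r C)" if "A \<in> Units ?M" "C \<in> carrier ?M" for A C
    by (rule ring_hom_conj_by[OF M.monoid_axioms MF.monoid_axioms residue_mat_hom that])
  have D1r: "?r (D1 g) = B g" if "g \<in> carrier G" for g
    unfolding D1_def B_def using rconj[OF P1 \<rho>c[OF that]] P1r lift[OF that] by simp
  have Bent: "residue R (e11 (D1 g)) = e11 (B g)" "residue R (e12 (D1 g)) = e12 (B g)"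
    "residue R (e21 (D1 g)) = e21 (B g)" "residue R (e22 (D1 g)) = e22 (B g)" if "g \<in> carrier G" for g
    using D1r[OF that] by (metis map_mat2_entries)+
  have b0: "e12 (D1 h0) \<in> max_ideal R" "e21 (D1 h0) \<in> max_ideal R"
    using residue_eq_0_iff D1c[OF h0c] Bent[OF h0c] Bh[OF h0c] h0 by (simp_all add: homogeneous_def)
  have "residue R (e11 (D1 h0)) \<noteq> residue R (e22 (D1 h0))"
    using ne Bent[OF h0c] unfolding B_def by simp
  then obtain s where s: "s \<in> max_ideal R"
    "e12 (D1 h0) \<oplus>\<^bsub>R\<^esub> s \<otimes>\<^bsub>R\<^esub> e22 (D1 h0) = (e11 (D1 h0) \<oplus>\<^bsub>R\<^esub> s \<otimes>\<^bsub>R\<^esub> e21 (D1 h0)) \<otimes>\<^bsub>R\<^esub> s"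
    using obtain_eigenrow[of "e11 (D1 h0)" "e12 (D1 h0)" "e21 (D1 h0)" "e22 (D1 h0)"] b0 D1c[OF h0c]
    by (metis mat2_ring_entries(1,4))
  have sc: "s \<in> carrier R" using s(1) ideal.Icarr[OF max_ideal_ideal] by blast
  \<comment> \<open>(1, s) is an eigenrow of \<open>D1 h0\<close>. As the first row of the change of
    basis it makes the upper right entry of \<open>D2 h0\<close> zero.\<close>
  define X1 where "X1 = Mat2 \<one>\<^bsub>R\<^esub> s \<zero>\<^bsub>R\<^esub> \<one>\<^bsub>R\<^esub>"
  have X1c: "X1 \<in> carrier ?M" unfolding X1_def using sc by simp
  have X1r: "?r X1 = \<one>\<^bsub>?N\<^esub>" unfolding X1_def mat2_ring_one using s(1) by simp
  have X1: "X1 \<in> Units ?M" using mat_unit_iff[OF X1c] X1r by simp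
  define D2 where "D2 g = conj_by ?M X1 (D1 g)" for g
  have D2c: "D2 g \<in> carrier ?M" if "g \<in> carrier G" for g
    unfolding D2_def using X1 D1c[OF that] by simp
  have D2r: "?r (D2 g) = B g" if "g \<in> carrier G" for g
    unfolding D2_def rconj[OF X1 D1c[OF that]] X1r D1r[OF that]
    using BU[OF that] by (simp add: MF.Units_closed)
  have Bent2: "residue R (e11 (D2 g)) = e11 (B g)" "residue R (e12 (D2 g)) = e12 (B g)"
    "residue R (e21 (D2 g)) = e21 (B g)" "residue R (e22 (D2 g)) = e22 (B g)" if "g \<in> carrier G" for g
    using D2r[OF that] by (metis map_mat2_entries)+
  have D2h0: "e12 (D2 h0) = \<zero>\<^bsub>R\<^esub>"
  proof -
    have eq: "X1 \<otimes>\<^bsub>?M\<^esub> D1 h0 = D2 h0 \<otimes>\<^bsub>?M\<^esub> X1"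
      unfolding D2_def by (rule M.conj_by_swap[OF X1 D1c[OF h0c]])
    have "e11 (D1 h0) \<oplus>\<^bsub>R\<^esub> s \<otimes>\<^bsub>R\<^esub> e21 (D1 h0) = e11 (D2 h0)"
      "e12 (D1 h0) \<oplus>\<^bsub>R\<^esub> s \<otimes>\<^bsub>R\<^esub> e22 (D1 h0) = e11 (D2 h0) \<otimes>\<^bsub>R\<^esub> s \<oplus>\<^bsub>R\<^esub> e12 (D2 h0)"
      using arg_cong[OF eq, of e11] arg_cong[OF eq, of e12] D1c[OF h0c] D2c[OF h0c] sc
      by (simp_all add: mat2_ring_mult X1_def)
    thus ?thesis using s(2) D2c[OF h0c] sc by simp
  qed
  define x where "x = e11 (D2 \<sigma>)"
  define y where "y = e12 (D2 \<sigma>)"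
  have xyc: "x \<in> carrier R" "y \<in> carrier R" unfolding x_def y_def using D2c[OF \<sigma>(1)] by auto
  have xr: "residue R x = \<zero>\<^bsub>F\<^esub>"
    unfolding x_def using Bent2[OF \<sigma>(1)] Bh[OF \<sigma>(1)] \<sigma> by (simp add: homogeneous_def)
  have "e12 (B \<sigma>) \<in> Units F"
    using F.homogeneous_unit_entries[OF BU[OF \<sigma>(1)] Bh[OF \<sigma>(1)]] \<sigma> by simp
  hence yr: "residue R y \<noteq> \<zero>\<^bsub>F\<^esub>"
    unfolding y_def Bent2[OF \<sigma>(1)] using F.field_Units by auto
  hence y: "y \<in> Units R" using unit_iff xyc by simp
  \<comment> \<open>The second row is the first row of \<open>D2 \<sigma>\<close>, so the first row
    of \<open>D3 \<sigma>\<close> becomes (0, 1). Being lower triangular, \<open>X2\<close> keeps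
    the zero and the diagonal entries at \<open>h0\<close>.\<close>
  define X2 where "X2 = Mat2 \<one>\<^bsub>R\<^esub> \<zero>\<^bsub>R\<^esub> x y"
  have X2c: "X2 \<in> carrier ?M" unfolding X2_def using xyc by simp
  have X2: "X2 \<in> Units ?M"
    using R.det2_unit_iff[OF X2c] y xyc unfolding X2_def by (simp add: det2_def R.minus_eq)
  have X2r: "?r X2 = Mat2 \<one>\<^bsub>F\<^esub> \<zero>\<^bsub>F\<^esub> \<zero>\<^bsub>F\<^esub> (residue R y)" unfolding X2_def using xr by simp
  define D3 where "D3 g = conj_by ?M X2 (D2 g)" for g
  have D3c: "D3 g \<in> carrier ?M" if "g \<in> carrier G" for g
    unfolding D3_def using X2 D2c[OF that] by simp
  have sw: "X2 \<otimes>\<^bsub>?M\<^esub> D2 g = D3 g \<otimes>\<^bsub>?M\<^esub> X2" if "g \<in> carrier G" for g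
    unfolding D3_def by (rule M.conj_by_swap[OF X2 D2c[OF that]])
  have row: "e11 (D2 g) = e11 (D3 g) \<oplus>\<^bsub>R\<^esub> e12 (D3 g) \<otimes>\<^bsub>R\<^esub> x" "e12 (D2 g) = e12 (D3 g) \<otimes>\<^bsub>R\<^esub> y" if g: "g \<in> carrier G" for g
    using arg_cong[OF sw[OF g], of e11] arg_cong[OF sw[OF g], of e12] D2c[OF g] D3c[OF g] xyc
    by (simp_all add: mat2_ring_mult X2_def)
  have row2: "x \<otimes>\<^bsub>R\<^esub> e12 (D2 g) \<oplus>\<^bsub>R\<^esub> y \<otimes>\<^bsub>R\<^esub> e22 (D2 g) = e22 (D3 g) \<otimes>\<^bsub>R\<^esub> y" if g: "g \<in> carrier G" for g
    using arg_cong[OF sw[OF g], of e22] D2c[OF g] D3c[OF g] xyc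
    by (simp_all add: mat2_ring_mult X2_def)
  have D3\<sigma>12: "e12 (D3 \<sigma>) = \<one>\<^bsub>R\<^esub>"
  proof -
    have "y \<otimes>\<^bsub>R\<^esub> e12 (D3 \<sigma>) = y \<otimes>\<^bsub>R\<^esub> \<one>\<^bsub>R\<^esub>"
      using row(2)[OF \<sigma>(1)] D3c[OF \<sigma>(1)] xyc unfolding y_def[symmetric] by (simp add: R.m_comm)
    thus ?thesis using R.Units_l_cancel[OF y] D3c[OF \<sigma>(1)] by simp
  qed
  have D3\<sigma>11: "e11 (D3 \<sigma>) = \<zero>\<^bsub>R\<^esub>"
    using row(1)[OF \<sigma>(1)] D3\<sigma>12 D3c[OF \<sigma>(1)] xyc unfolding x_def[symmetric] by simp
  have D3h12: "e12 (D3 h0) = \<zero>\<^bsub>R\<^esub>"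
    using row(2)[OF h0c] D2h0 R.mult_unit_eq_zero[OF _ y] D3c[OF h0c] by simp
  have D3h11: "e11 (D3 h0) = e11 (D2 h0)" using row(1)[OF h0c] D3h12 D3c[OF h0c] xyc by simp
  have D3h22: "e22 (D3 h0) = e22 (D2 h0)"
    using row2[OF h0c] D2h0 D2c[OF h0c] D3c[OF h0c] xyc R.Units_l_cancel[OF y, of "e22 (D3 h0)" "e22 (D2 h0)"]
    by (simp add: R.m_comm)
  define P3 where "P3 = X2 \<otimes>\<^bsub>?M\<^esub> (X1 \<otimes>\<^bsub>?M\<^esub> P1)"
  have P3: "P3 \<in> Units ?M" unfolding P3_def using X1 X2 P1 by simp
  have D3: "D3 g = conj_by ?M P3 (\<rho> g)" if "g \<in> carrier G" for g
    unfolding D3_def D2_def D1_def P3_def using X1 X2 P1 \<rho>c[OF that] by (simp add: M.conj_by_conj_by)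
  define Pb where "Pb = ?r P3"
  have Pb: "Pb = ?r X2 \<otimes>\<^bsub>?N\<^esub> P0"
    unfolding Pb_def P3_def using X1c X2c P1c X1r P1r MF.Units_closed[OF P0U] by simp
  have PbU: "Pb \<in> Units ?N" unfolding Pb_def using mat_unit_iff[OF M.Units_closed[OF P3]] P3 by simp
  have gPb: "graded G F H \<rho>bar Pb"
    unfolding Pb
  proof (rule F.graded_mult[OF \<rho>bar P0])
    show "?r X2 \<in> Units ?N" using mat_unit_iff[OF X2c] X2 by simp
    show "homogeneous F True (?r X2)" unfolding X2r by (simp add: homogeneous_def)
  qed
  have D3r: "?r (D3 g) = conj_by ?N Pb (\<rho>bar g)" if "g \<in> carrier G" for g
    unfolding D3[OF that] rconj[OF P3 \<rho>c[OF that]] Pb_def lift[OF that] ..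
  have D3m: "D3 (g \<otimes>\<^bsub>G\<^esub> g') = D3 g \<otimes>\<^bsub>?M\<^esub> D3 g'" if "g \<in> carrier G" "g' \<in> carrier G" for g g'
    using that by (simp add: D3 \<rho>m M.conj_by_mult[OF P3] \<rho>c)
  have contD3: "mat2_continuous T R D3"
  proof -
    have *: "mat2_continuous T R (\<lambda>g. conj_by ?M P3 (\<rho> g))"
      by (rule mat2_continuous_conj_by[OF local_ring P3 cont])
    show ?thesis using mat2_continuous_cong[OF *] top D3 by simp
  qed
  have "homogeneous R (g \<in> H) (D3 g)" if g: "g \<in> carrier G" for g
  proof (rule homogeneous_of_splitting[OF ind top op \<sigma> D3c D3m contD3 _ D3\<sigma>11 D3\<sigma>12 h0 D3h12 _ _ g])
    show "homogeneous F (g \<in> H) (?r (D3 g))" if "g \<in> carrier G" for g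
      using gPb that D3r[OF that] unfolding graded_def by simp
    show "residue R (e11 (D3 h0)) \<noteq> residue R (e22 (D3 h0))"
      unfolding D3h11 D3h22 Bent2[OF h0c] B_def by (rule ne)
    fix \<delta>' assume d: "derivation G T F (\<lambda>g. ?r (D3 g)) \<delta>'"
    have d'c: "\<delta>' g \<in> carrier ?N" if "g \<in> carrier G" for g
      using d that unfolding derivation_def by blast
    \<comment> \<open>The derivation relative to the prepared basis is moved back to one of
      \<open>\<rho>bar\<close>, for which the splitting is assumed.\<close>
    define \<delta> where "\<delta> g = conj_by ?N (inv\<^bsub>?N\<^esub> Pb) (\<delta>' g)" for g
    have iPb: "inv\<^bsub>?N\<^esub> Pb \<in> Units ?N" using PbU by simp
    have dc: "\<delta> g \<in> carrier ?N" if "g \<in> carrier G" for g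
      unfolding \<delta>_def using iPb d'c[OF that] by simp
    have "derivation G T F \<rho>bar \<delta>"
      unfolding derivation_def
    proof (intro conjI ballI)
      fix g assume g: "g \<in> carrier G"
      show "\<delta> g \<in> carrier ?N" by (rule dc[OF g])
      fix g' assume g': "g' \<in> carrier G"
      have "\<delta>' (g \<otimes>\<^bsub>G\<^esub> g') = conj_by ?N Pb (\<rho>bar g) \<otimes>\<^bsub>?N\<^esub> \<delta>' g' \<oplus>\<^bsub>?N\<^esub> \<delta>' g \<otimes>\<^bsub>?N\<^esub> conj_by ?N Pb (\<rho>bar g')"
        using d g g' D3r unfolding derivation_def by simp
      thus "\<delta> (g \<otimes>\<^bsub>G\<^esub> g') = \<rho>bar g \<otimes>\<^bsub>?N\<^esub> \<delta> g' \<oplus>\<^bsub>?N\<^esub> \<delta> g \<otimes>\<^bsub>?N\<^esub> \<rho>bar g'"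
        unfolding \<delta>_def using iPb PbU d'c[OF g] d'c[OF g'] bc[OF g] bc[OF g']
        by (simp add: MF.conj_by_add MF.conj_by_mult)
    next
      show "mat2_continuous T F \<delta>"
        unfolding \<delta>_def using d unfolding derivation_def
        by (intro mat2_continuous_conj_by[OF field_local(1)[OF F.field_axioms] iPb]) blast
    qed
    \<comment> \<open>The splitting is now used in the basis \<open>Pb\<close> instead of
      \<open>P0\<close>; multiplying its relation by the inverse of \<open>Pb\<close> on the right
      gives the form required here.\<close>
    hence "splits_along G F H \<rho>bar \<delta>" by (rule split)
    then obtain N S where N: "N \<in> carrier ?N"
      and S: "\<And>g. g \<in> carrier G \<Longrightarrow> S g \<in> carrier ?N \<and> homogeneous F (g \<in> H) (S g) \<and>
            N \<otimes>\<^bsub>?N\<^esub> \<rho>bar g \<oplus>\<^bsub>?N\<^esub> Pb \<otimes>\<^bsub>?N\<^esub> \<delta> g = conj_by ?N Pb (\<rho>bar g) \<otimes>\<^bsub>?N\<^esub> N \<oplus>\<^bsub>?N\<^esub> S g \<otimes>\<^bsub>?N\<^esub> Pb"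
      using gPb unfolding splits_along_def by blast
    let ?I = "inv\<^bsub>?N\<^esub> Pb"
    note Pc = MF.Units_closed[OF PbU] and Ic = MF.Units_closed[OF iPb]
    have "N \<otimes>\<^bsub>?N\<^esub> ?I \<otimes>\<^bsub>?N\<^esub> ?r (D3 g) \<oplus>\<^bsub>?N\<^esub> \<delta>' g = ?r (D3 g) \<otimes>\<^bsub>?N\<^esub> (N \<otimes>\<^bsub>?N\<^esub> ?I) \<oplus>\<^bsub>?N\<^esub> S g"
      if g: "g \<in> carrier G" for g
    proof -
      have c: "conj_by ?N Pb (\<rho>bar g) \<in> carrier ?N" using PbU bc[OF g] by simp
      have Sc: "S g \<in> carrier ?N" using S[OF g] by blast
      have "(N \<otimes>\<^bsub>?N\<^esub> \<rho>bar g \<oplus>\<^bsub>?N\<^esub> Pb \<otimes>\<^bsub>?N\<^esub> \<delta> g) \<otimes>\<^bsub>?N\<^esub> ?I =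
        (conj_by ?N Pb (\<rho>bar g) \<otimes>\<^bsub>?N\<^esub> N \<oplus>\<^bsub>?N\<^esub> S g \<otimes>\<^bsub>?N\<^esub> Pb) \<otimes>\<^bsub>?N\<^esub> ?I"
        using S[OF g] by simp
      hence "N \<otimes>\<^bsub>?N\<^esub> \<rho>bar g \<otimes>\<^bsub>?N\<^esub> ?I \<oplus>\<^bsub>?N\<^esub> conj_by ?N Pb (\<delta> g) =
        conj_by ?N Pb (\<rho>bar g) \<otimes>\<^bsub>?N\<^esub> (N \<otimes>\<^bsub>?N\<^esub> ?I) \<oplus>\<^bsub>?N\<^esub> S g"
        using N Sc Pc Ic bc[OF g] dc[OF g] c PbU
        by (simp add: MF.l_distr MF.m_assoc) (simp add: conj_by_def MF.m_assoc)
      moreover have "N \<otimes>\<^bsub>?N\<^esub> \<rho>bar g \<otimes>\<^bsub>?N\<^esub> ?I = N \<otimes>\<^bsub>?N\<^esub> ?I \<otimes>\<^bsub>?N\<^esub> conj_by ?N Pb (\<rho>bar g)"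
        unfolding conj_by_def using N Pc Ic bc[OF g] PbU by (simp add: MF.m_assoc)
      moreover have "conj_by ?N Pb (\<delta> g) = \<delta>' g"
        unfolding \<delta>_def using PbU d'c[OF g] by simp
      ultimately show ?thesis using D3r[OF g] by simp
    qed
    thus "\<exists>N S. N \<in> carrier ?N \<and>
         (\<forall>g\<in>carrier G. S g \<in> carrier ?N \<and> homogeneous F (g \<in> H) (S g) \<and>
            N \<otimes>\<^bsub>?N\<^esub> ?r (D3 g) \<oplus>\<^bsub>?N\<^esub> \<delta>' g = ?r (D3 g) \<otimes>\<^bsub>?N\<^esub> N \<oplus>\<^bsub>?N\<^esub> S g)"
      using S N Ic by (intro exI[of _ "N \<otimes>\<^bsub>?N\<^esub> ?I"] exI[of _ S]) simp
  qed
  hence "graded G R H \<rho> P3" unfolding graded_def using P3 D3 by simp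
  thus ?thesis by blast
qed

end

section \<open>The subgroups along which a residual representation is graded\<close>

context field
begin

interpretation M: ring "mat2_ring R" by (rule mat2_ring_is_ring)

text \<open>If the images of all elements of \<open>H\<close> were scalar, every matrix in the image
  would be a scalar matrix times 1 or times the image of one fixed \<open>\<tau>\<close> outside
  \<open>H\<close>, and the image would be commutative.\<close>

lemma graded_noncommuting_distinct:
  assumes ind: "index_two G H" and \<rho>: "\<rho> \<in> hom G (GL2 R)" and P: "graded G R H \<rho> P"
    and g: "g1 \<in> carrier G" "g2 \<in> carrier G"
    and nc: "\<rho> g1 \<otimes>\<^bsub>mat2_ring R\<^esub> \<rho> g2 \<noteq> \<rho> g2 \<otimes>\<^bsub>mat2_ring R\<^esub> \<rho> g1"
  shows "\<exists>h\<in>H. e11 (conj_by (mat2_ring R) P (\<rho> h)) \<noteq> e22 (conj_by (mat2_ring R) P (\<rho> h))"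
proof (rule ccontr)
  interpret G: index_two G H by fact
  let ?M = "mat2_ring R"
  define B where "B g = conj_by ?M P (\<rho> g)" for g
  assume "\<not> ?thesis"
  hence eq: "e11 (B h) = e22 (B h)" if "h \<in> H" for h using that unfolding B_def by blast
  have PU: "P \<in> Units ?M" using P unfolding graded_def by blast
  have Bc: "B g \<in> carrier ?M" if "g \<in> carrier G" for g
    unfolding B_def using PU rep_hom(2)[OF \<rho> that] by simp
  have Bm: "B (g \<otimes>\<^bsub>G\<^esub> g') = B g \<otimes>\<^bsub>?M\<^esub> B g'" if "g \<in> carrier G" "g' \<in> carrier G" for g g'
    unfolding B_def using that PU rep_hom[OF \<rho>] by (simp add: M.conj_by_mult)
  have central: "B h \<otimes>\<^bsub>?M\<^esub> A = A \<otimes>\<^bsub>?M\<^esub> B h" if h: "h \<in> H" and A: "A \<in> carrier ?M" for h A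
  proof -
    have "h \<in> carrier G" using h by simp
    hence "homogeneous R (h \<in> H) (B h)" using P unfolding graded_def B_def by blast
    hence "e12 (B h) = \<zero>" "e21 (B h) = \<zero>" using h by (auto simp: homogeneous_def)
    thus ?thesis using eq[OF h] Bc[of h] h A by (simp add: mat2_ring_mult m_comm)
  qed
  obtain \<tau> where \<tau>: "\<tau> \<in> carrier G" "\<tau> \<notin> H" using G.obtain_outside by blast
  have dec: "\<exists>h\<in>H. \<exists>t\<in>{\<one>\<^bsub>?M\<^esub>, B \<tau>}. B g = B h \<otimes>\<^bsub>?M\<^esub> t" if g: "g \<in> carrier G" for g
  proof (cases "g \<in> H")
    case True
    thus ?thesis using Bc[OF g] by (intro bexI[of _ g] bexI[of _ "\<one>\<^bsub>?M\<^esub>"]) auto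
  next
    case False
    let ?h = "g \<otimes>\<^bsub>G\<^esub> inv\<^bsub>G\<^esub> \<tau>"
    have h: "?h \<in> H" "?h \<in> carrier G" using g \<tau> False by (simp_all add: G.mult_mem_iff G.inv_mem_iff)
    have "B g = B ?h \<otimes>\<^bsub>?M\<^esub> B \<tau>" using Bm[OF h(2) \<tau>(1)] g \<tau> by (simp add: G.m_assoc)
    thus ?thesis using h(1) by blast
  qed
  obtain h1 t1 where 1: "h1 \<in> H" "t1 \<in> {\<one>\<^bsub>?M\<^esub>, B \<tau>}" "B g1 = B h1 \<otimes>\<^bsub>?M\<^esub> t1" using dec[OF g(1)] by blast
  obtain h2 t2 where 2: "h2 \<in> H" "t2 \<in> {\<one>\<^bsub>?M\<^esub>, B \<tau>}" "B g2 = B h2 \<otimes>\<^bsub>?M\<^esub> t2" using dec[OF g(2)] by blast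
  have c: "B h1 \<in> carrier ?M" "B h2 \<in> carrier ?M" "t1 \<in> carrier ?M" "t2 \<in> carrier ?M"
    using 1 2 Bc \<tau> by auto
  have t: "t1 \<otimes>\<^bsub>?M\<^esub> t2 = t2 \<otimes>\<^bsub>?M\<^esub> t1" using 1(2) 2(2) Bc[OF \<tau>(1)] by auto
  have "B g1 \<otimes>\<^bsub>?M\<^esub> B g2 = B h1 \<otimes>\<^bsub>?M\<^esub> (t1 \<otimes>\<^bsub>?M\<^esub> B h2) \<otimes>\<^bsub>?M\<^esub> t2"
    unfolding 1(3) 2(3) using c by (simp add: M.m_assoc)
  also have "\<dots> = B h1 \<otimes>\<^bsub>?M\<^esub> (B h2 \<otimes>\<^bsub>?M\<^esub> t1) \<otimes>\<^bsub>?M\<^esub> t2" using central[OF 2(1) c(3)] by simp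
  also have "\<dots> = B h1 \<otimes>\<^bsub>?M\<^esub> (B h2 \<otimes>\<^bsub>?M\<^esub> (t1 \<otimes>\<^bsub>?M\<^esub> t2))" using c by (simp add: M.m_assoc)
  also have "\<dots> = B h1 \<otimes>\<^bsub>?M\<^esub> (B h2 \<otimes>\<^bsub>?M\<^esub> t2 \<otimes>\<^bsub>?M\<^esub> t1)" unfolding t using c by (simp add: M.m_assoc)
  also have "\<dots> = B h2 \<otimes>\<^bsub>?M\<^esub> t2 \<otimes>\<^bsub>?M\<^esub> t1 \<otimes>\<^bsub>?M\<^esub> B h1" using central[OF 1(1), of "B h2 \<otimes>\<^bsub>?M\<^esub> t2 \<otimes>\<^bsub>?M\<^esub> t1"] c by simp
  also have "\<dots> = B h2 \<otimes>\<^bsub>?M\<^esub> t2 \<otimes>\<^bsub>?M\<^esub> (B h1 \<otimes>\<^bsub>?M\<^esub> t1)" using central[OF 1(1) c(3)] c by (simp add: M.m_assoc)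
  also have "\<dots> = B g2 \<otimes>\<^bsub>?M\<^esub> B g1" unfolding 1(3) 2(3) ..
  finally have "conj_by ?M P (\<rho> g1 \<otimes>\<^bsub>?M\<^esub> \<rho> g2) = conj_by ?M P (\<rho> g2 \<otimes>\<^bsub>?M\<^esub> \<rho> g1)"
    unfolding B_def using PU rep_hom(2)[OF \<rho>] g by (simp add: M.conj_by_mult)
  hence "\<rho> g1 \<otimes>\<^bsub>?M\<^esub> \<rho> g2 = \<rho> g2 \<otimes>\<^bsub>?M\<^esub> \<rho> g1"
    using PU rep_hom(2)[OF \<rho>] g M.conj_by_inv(1)[OF PU] by (metis M.m_closed)
  thus False using nc by simp
qed

text \<open>Outside \<open>H'\<close> the second grading makes the matrices antidiagonal, so their
  trace is zero in every basis. Hence the diagonal entries are opposite on the part of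
  \<open>H\<close> outside \<open>H'\<close>; multiplying an element of the intersection by one of
  that part shows that its diagonal entries agree.\<close>

lemma graded_overlap:
  assumes ind: "index_two G H" "index_two G H'" "H \<noteq> H'" and \<rho>: "\<rho> \<in> hom G (GL2 R)"
    and P: "graded G R H \<rho> P" and P': "graded G R H' \<rho> P'" and h: "h \<in> H"
  defines "B \<equiv> \<lambda>g. conj_by (mat2_ring R) P (\<rho> g)"
  shows "h \<notin> H' \<Longrightarrow> e11 (B h) = \<ominus> e22 (B h)" and "h \<in> H' \<Longrightarrow> e11 (B h) = e22 (B h)"
    and "e11 (B h) \<in> carrier R - {\<zero>}"
proof -
  interpret G: index_two G H by fact
  interpret G': index_two G H' by fact
  let ?M = "mat2_ring R"
  have PU: "P \<in> Units ?M" "P' \<in> Units ?M" using P P' unfolding graded_def by auto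
  have BU: "B g \<in> Units ?M" if "g \<in> carrier G" for g
    unfolding B_def using M.conj_by_Units[OF PU(1) rep_hom(1)[OF \<rho> that]] .
  have Bc: "B g \<in> carrier ?M" if "g \<in> carrier G" for g
    using BU[OF that] by (rule M.Units_closed)
  have Bm: "B (g \<otimes>\<^bsub>G\<^esub> g') = B g \<otimes>\<^bsub>?M\<^esub> B g'" if "g \<in> carrier G" "g' \<in> carrier G" for g g'
    unfolding B_def using that PU rep_hom[OF \<rho>] by (simp add: M.conj_by_mult)
  have Bh: "homogeneous R (g \<in> H) (B g)" if "g \<in> carrier G" for g
    using P that unfolding graded_def B_def by blast
  have nz: "e11 (B k) \<in> carrier R - {\<zero>}" if k: "k \<in> H" for k
    using homogeneous_unit_entries[OF BU Bh, of k] k field_Units by auto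
  show "e11 (B h) \<in> carrier R - {\<zero>}" by (rule nz[OF h])
  have tr: "e11 (B k) \<oplus> e22 (B k) = \<zero>" if k: "k \<in> carrier G" "k \<notin> H'" for k
  proof -
    have "homogeneous R (k \<in> H') (conj_by ?M P' (\<rho> k))" using P' k unfolding graded_def by blast
    hence "trace2 R (conj_by ?M P' (\<rho> k)) = \<zero>" using k(2) by (simp add: homogeneous_def trace2_def)
    hence "trace2 R (B k) = \<zero>"
      unfolding B_def using trace2_conj_by[OF PU(1)] trace2_conj_by[OF PU(2)] rep_hom(2)[OF \<rho> k(1)] by simp
    thus ?thesis by (simp add: trace2_def)
  qed
  have neg: "e11 (B k) = \<ominus> e22 (B k)" if k: "k \<in> H" "k \<notin> H'" for k
    using tr[of k] k Bc[of k] by (simp add: minus_equality)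
  show "h \<notin> H' \<Longrightarrow> e11 (B h) = \<ominus> e22 (B h)" using neg h by blast
  assume hH': "h \<in> H'"
  \<comment> \<open>Otherwise \<open>H'\<close> would contain \<open>H\<close> properly, and a
    subgroup that does so is the whole group.\<close>
  obtain k where k: "k \<in> H" "k \<notin> H'"
  proof -
    have "\<not> H \<subseteq> H'"
    proof
      assume sub: "H \<subseteq> H'"
      then obtain x where x: "x \<in> H'" "x \<notin> H" using ind(3) by blast
      have "y \<in> H'" if y: "y \<in> carrier G" for y
      proof (cases "y \<in> H")
        case False
        hence "inv\<^bsub>G\<^esub> x \<otimes>\<^bsub>G\<^esub> y \<in> H" using x y by (simp add: G.mult_mem_iff G.inv_mem_iff)
        hence "x \<otimes>\<^bsub>G\<^esub> (inv\<^bsub>G\<^esub> x \<otimes>\<^bsub>G\<^esub> y) \<in> H'" using G'.mult_mem[OF x(1) subsetD[OF sub]] by blast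
        thus ?thesis using x y by (simp add: G.m_assoc[symmetric])
      qed (use sub in blast)
      thus False using G'.proper subgroup.subset[OF G'.subgroup] by blast
    qed
    thus ?thesis using that by blast
  qed
  have kh: "k \<otimes>\<^bsub>G\<^esub> h \<in> H" "k \<otimes>\<^bsub>G\<^esub> h \<notin> H'" using k h hH' by (simp_all add: G'.mult_mem_iff)
  have kc: "k \<in> carrier G" "h \<in> carrier G" using k h by auto
  have hz: "e12 (B k) = \<zero>" "e21 (B k) = \<zero>" "e12 (B h) = \<zero>" "e21 (B h) = \<zero>"
    using Bh[OF kc(1)] Bh[OF kc(2)] k h by (auto simp: homogeneous_def)
  have "e11 (B k) \<otimes> e11 (B h) = \<ominus> (e22 (B k) \<otimes> e22 (B h))"
    using neg[OF kh] Bm[OF kc] hz Bc[OF kc(1)] Bc[OF kc(2)] by (simp add: mat2_ring_mult)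
  also have "\<dots> = e11 (B k) \<otimes> e22 (B h)"
    unfolding neg[OF k] using Bc[OF kc(1)] Bc[OF kc(2)] by (simp add: l_minus)
  finally show "e11 (B h) = e22 (B h)"
    using m_lcancel[of "e11 (B k)" "e11 (B h)" "e22 (B h)"] nz[OF k(1)] Bc[OF kc(1)] Bc[OF kc(2)] by auto
qed

text \<open>If 1 = -1, both cases of \<open>graded_overlap\<close> make the images of
  \<open>H\<close> scalar, contrary to \<open>d\<close>. Otherwise diag(a, -a) with nonzero
  \<open>a\<close> is not scalar, so \<open>H'\<close> meets \<open>H\<close> exactly in the
  elements with scalar image, whichever subgroup \<open>H'\<close> is.\<close>

lemma graded_overlap_iff:
  assumes ind: "index_two G H" "index_two G H'" "H \<noteq> H'" and \<rho>: "\<rho> \<in> hom G (GL2 R)"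
    and P: "graded G R H \<rho> P" and P': "graded G R H' \<rho> P'"
    and d: "\<exists>h\<in>H. e11 (conj_by (mat2_ring R) P (\<rho> h)) \<noteq> e22 (conj_by (mat2_ring R) P (\<rho> h))"
  shows "\<one> \<noteq> \<ominus> \<one>"
    and "h \<in> H \<Longrightarrow> h \<in> H' \<longleftrightarrow> e11 (conj_by (mat2_ring R) P (\<rho> h)) = e22 (conj_by (mat2_ring R) P (\<rho> h))"
proof -
  interpret G: index_two G H by fact
  note ov = graded_overlap[OF ind \<rho> P P']
  have PU: "P \<in> Units (mat2_ring R)" using P unfolding graded_def by auto
  have c: "e22 (conj_by (mat2_ring R) P (\<rho> h)) \<in> carrier R" if "h \<in> H" for h
    using PU rep_hom(2)[OF \<rho>, of h] that by simp
  have m1: "\<ominus> x = (\<ominus> \<one>) \<otimes> x" if "x \<in> carrier R" for x using that by (simp add: l_minus)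
  show ne: "\<one> \<noteq> \<ominus> \<one>"
  proof
    assume "\<one> = \<ominus> \<one>"
    hence "\<ominus> x = x" if "x \<in> carrier R" for x using m1[OF that] that by (metis l_one)
    thus False using d ov(1,2) c by (metis (no_types, lifting))
  qed
  show "h \<in> H' \<longleftrightarrow> e11 (conj_by (mat2_ring R) P (\<rho> h)) = e22 (conj_by (mat2_ring R) P (\<rho> h))"
    if h: "h \<in> H"
  proof
    assume eq: "e11 (conj_by (mat2_ring R) P (\<rho> h)) = e22 (conj_by (mat2_ring R) P (\<rho> h))" (is "?a = ?d")
    show "h \<in> H'"
    proof (rule ccontr)
      assume "h \<notin> H'"
      hence "?a = \<ominus> ?a" using ov(1)[OF h] eq by simp
      moreover have a: "?a \<in> carrier R" "?a \<noteq> \<zero>" using ov(3)[OF h] by auto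
      ultimately have "\<one> \<otimes> ?a = (\<ominus> \<one>) \<otimes> ?a" using m1[OF a(1)] l_one[OF a(1)] by metis
      thus False using m_rcancel[OF a(2,1) one_closed, of "\<ominus> \<one>"] ne by simp
    qed
  qed (rule ov(2)[OF h])
qed

text \<open>All further inducing subgroups have the same intersection with \<open>H\<close>, and a
  subgroup of index two is determined by this intersection together with its behaviour at one
  \<sigma> outside \<open>H\<close>. This is the reason for the bound of three subgroups.\<close>

lemma graded_subgroup_eq:
  assumes ind: "index_two G H" "index_two G H'" "index_two G H''" "H \<noteq> H'" "H \<noteq> H''"
    and \<rho>: "\<rho> \<in> hom G (GL2 R)"
    and P: "graded G R H \<rho> P" and P': "graded G R H' \<rho> P'" and P'': "graded G R H'' \<rho> P''"
    and d: "\<exists>h\<in>H. e11 (conj_by (mat2_ring R) P (\<rho> h)) \<noteq> e22 (conj_by (mat2_ring R) P (\<rho> h))"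
    and \<sigma>: "\<sigma> \<in> carrier G" "\<sigma> \<notin> H" "\<sigma> \<in> H' \<longleftrightarrow> \<sigma> \<in> H''"
  shows "H' = H''"
proof -
  interpret G: index_two G H by fact
  interpret G': index_two G H' by fact
  interpret G'': index_two G H'' by fact
  have same: "h \<in> H' \<longleftrightarrow> h \<in> H''" if "h \<in> H" for h
    using graded_overlap_iff(2)[OF ind(1,2,4) \<rho> P P' d that]
      graded_overlap_iff(2)[OF ind(1,3,5) \<rho> P P'' d that] by blast
  have "x \<in> H' \<longleftrightarrow> x \<in> H''" if x: "x \<in> carrier G" for x
  proof (cases "x \<in> H")
    case False
    hence k: "inv\<^bsub>G\<^esub> \<sigma> \<otimes>\<^bsub>G\<^esub> x \<in> H" using x \<sigma> by (simp add: G.mult_mem_iff G.inv_mem_iff)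
    have "\<sigma> \<otimes>\<^bsub>G\<^esub> (inv\<^bsub>G\<^esub> \<sigma> \<otimes>\<^bsub>G\<^esub> x) = x" using x \<sigma> by (simp add: G.m_assoc[symmetric])
    thus ?thesis
      using G'.mult_mem_iff[OF \<sigma>(1), of "inv\<^bsub>G\<^esub> \<sigma> \<otimes>\<^bsub>G\<^esub> x"] G''.mult_mem_iff[OF \<sigma>(1), of "inv\<^bsub>G\<^esub> \<sigma> \<otimes>\<^bsub>G\<^esub> x"]
        same[OF k] \<sigma>(3) x \<sigma>(1) by simp
  qed (rule same)
  thus ?thesis using subgroup.subset[OF G'.subgroup] subgroup.subset[OF G''.subgroup] by blast
qed

section \<open>The space of derivations and its covering by three subspaces\<close>

abbreviation lin_comb :: "'a \<Rightarrow> 'a mat2 \<Rightarrow> 'a \<Rightarrow> 'a mat2 \<Rightarrow> 'a mat2" where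
  "lin_comb a A b B \<equiv> map_mat2 ((\<otimes>) a) A \<oplus>\<^bsub>mat2_ring R\<^esub> map_mat2 ((\<otimes>) b) B"

lemma lin_comb_closed:
  "a \<in> carrier R \<Longrightarrow> b \<in> carrier R \<Longrightarrow> A \<in> carrier (mat2_ring R) \<Longrightarrow> B \<in> carrier (mat2_ring R) \<Longrightarrow>
    lin_comb a A b B \<in> carrier (mat2_ring R)"
  by (simp add: mat2_ring_add)

lemma lin_comb_mult:
  assumes "a \<in> carrier R" "b \<in> carrier R" "A \<in> carrier (mat2_ring R)" "B \<in> carrier (mat2_ring R)"
    "C \<in> carrier (mat2_ring R)"
  shows "lin_comb a A b B \<otimes>\<^bsub>mat2_ring R\<^esub> C = lin_comb a (A \<otimes>\<^bsub>mat2_ring R\<^esub> C) b (B \<otimes>\<^bsub>mat2_ring R\<^esub> C)"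
    "C \<otimes>\<^bsub>mat2_ring R\<^esub> lin_comb a A b B = lin_comb a (C \<otimes>\<^bsub>mat2_ring R\<^esub> A) b (C \<otimes>\<^bsub>mat2_ring R\<^esub> B)"
  using assms by (simp_all add: mat2_ring_simps l_distr r_distr m_ac a_ac)

lemma lin_comb_add:
  assumes "a \<in> carrier R" "b \<in> carrier R" "A \<in> carrier (mat2_ring R)" "B \<in> carrier (mat2_ring R)"
    "A' \<in> carrier (mat2_ring R)" "B' \<in> carrier (mat2_ring R)"
  shows "lin_comb a A b B \<oplus>\<^bsub>mat2_ring R\<^esub> lin_comb a A' b B' =
    lin_comb a (A \<oplus>\<^bsub>mat2_ring R\<^esub> A') b (B \<oplus>\<^bsub>mat2_ring R\<^esub> B')"
  using assms by (simp_all add: mat2_ring_simps r_distr a_ac)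

lemma homogeneous_lin_comb:
  assumes "a \<in> carrier R" "b \<in> carrier R" "homogeneous R s A" "homogeneous R s B"
  shows "homogeneous R s (lin_comb a A b B)"
  using assms by (auto simp: homogeneous_def mat2_ring_add)

lemma derivation_lin_comb:
  assumes \<rho>: "\<rho> \<in> hom G (GL2 R)" and ab: "a \<in> carrier R" "b \<in> carrier R"
    and d: "derivation G T R \<rho> \<delta>" "derivation G T R \<rho> \<delta>'" and G: "group G"
  shows "derivation G T R \<rho> (\<lambda>g. lin_comb a (\<delta> g) b (\<delta>' g))"
proof -
  interpret G: group G by fact
  have dc: "\<delta> g \<in> carrier (mat2_ring R)" "\<delta>' g \<in> carrier (mat2_ring R)" if "g \<in> carrier G" for g
    using d that unfolding derivation_def by auto
  have loc: "local_ring R" by (rule field_local(1)[OF field_axioms])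
  have cs: "mat2_continuous T R (\<lambda>g. map_mat2 ((\<otimes>) c) (f g))"
    if "c \<in> carrier R" "mat2_continuous T R f" for c f
    using that unfolding mat2_continuous_def map_mat2_entries
    by (intro conjI continuous_map_adic_mult[OF loc] continuous_map_adic_const[OF loc]) auto
  show ?thesis
    unfolding derivation_def
  proof (intro conjI ballI)
    fix g assume g: "g \<in> carrier G"
    show "lin_comb a (\<delta> g) b (\<delta>' g) \<in> carrier (mat2_ring R)" by (rule lin_comb_closed[OF ab dc[OF g]])
    fix g' assume g': "g' \<in> carrier G"
    note c = dc[OF g] dc[OF g'] rep_hom(2)[OF \<rho> g] rep_hom(2)[OF \<rho> g']
    have "\<delta> (g \<otimes>\<^bsub>G\<^esub> g') = \<rho> g \<otimes>\<^bsub>mat2_ring R\<^esub> \<delta> g' \<oplus>\<^bsub>mat2_ring R\<^esub> \<delta> g \<otimes>\<^bsub>mat2_ring R\<^esub> \<rho> g'"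
      "\<delta>' (g \<otimes>\<^bsub>G\<^esub> g') = \<rho> g \<otimes>\<^bsub>mat2_ring R\<^esub> \<delta>' g' \<oplus>\<^bsub>mat2_ring R\<^esub> \<delta>' g \<otimes>\<^bsub>mat2_ring R\<^esub> \<rho> g'"
      using d g g' unfolding derivation_def by auto
    thus "lin_comb a (\<delta> (g \<otimes>\<^bsub>G\<^esub> g')) b (\<delta>' (g \<otimes>\<^bsub>G\<^esub> g')) =
       \<rho> g \<otimes>\<^bsub>mat2_ring R\<^esub> lin_comb a (\<delta> g') b (\<delta>' g') \<oplus>\<^bsub>mat2_ring R\<^esub>
       lin_comb a (\<delta> g) b (\<delta>' g) \<otimes>\<^bsub>mat2_ring R\<^esub> \<rho> g'"
      using c ab by (simp add: lin_comb_mult lin_comb_add)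
  next
    show "mat2_continuous T R (\<lambda>g. lin_comb a (\<delta> g) b (\<delta>' g))"
      using d cs ab unfolding derivation_def by (intro mat2_continuous_add[OF loc]) auto
  qed
qed

text \<open>For a fixed \<open>P\<close> the relation is linear in \<delta>, \<open>N\<close> and
  \<open>S\<close> together.\<close>

lemma splits_along_lin_comb:
  assumes \<rho>: "\<rho> \<in> hom G (GL2 R)" and ab: "a \<in> carrier R" "b \<in> carrier R"
    and c: "\<And>g. g \<in> carrier G \<Longrightarrow> \<delta> g \<in> carrier (mat2_ring R)"
      "\<And>g. g \<in> carrier G \<Longrightarrow> \<delta>' g \<in> carrier (mat2_ring R)"
    and s: "splits_along G R H \<rho> \<delta>" "splits_along G R H \<rho> \<delta>'"
    and eq: "\<And>g. g \<in> carrier G \<Longrightarrow> \<epsilon> g = lin_comb a (\<delta> g) b (\<delta>' g)"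
  shows "splits_along G R H \<rho> \<epsilon>"
  unfolding splits_along_def
proof (intro allI impI)
  let ?M = "mat2_ring R"
  fix P assume P: "graded G R H \<rho> P"
  have PU: "P \<in> Units ?M" using P unfolding graded_def by blast
  obtain N S where N: "N \<in> carrier ?M"
    and S: "\<And>g. g \<in> carrier G \<Longrightarrow> S g \<in> carrier ?M \<and> homogeneous R (g \<in> H) (S g) \<and>
      N \<otimes>\<^bsub>?M\<^esub> \<rho> g \<oplus>\<^bsub>?M\<^esub> P \<otimes>\<^bsub>?M\<^esub> \<delta> g = conj_by ?M P (\<rho> g) \<otimes>\<^bsub>?M\<^esub> N \<oplus>\<^bsub>?M\<^esub> S g \<otimes>\<^bsub>?M\<^esub> P"
    using s(1) P unfolding splits_along_def by blast
  obtain N' S' where N': "N' \<in> carrier ?M"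
    and S': "\<And>g. g \<in> carrier G \<Longrightarrow> S' g \<in> carrier ?M \<and> homogeneous R (g \<in> H) (S' g) \<and>
      N' \<otimes>\<^bsub>?M\<^esub> \<rho> g \<oplus>\<^bsub>?M\<^esub> P \<otimes>\<^bsub>?M\<^esub> \<delta>' g = conj_by ?M P (\<rho> g) \<otimes>\<^bsub>?M\<^esub> N' \<oplus>\<^bsub>?M\<^esub> S' g \<otimes>\<^bsub>?M\<^esub> P"
    using s(2) P unfolding splits_along_def by blast
  show "\<exists>N S. N \<in> carrier ?M \<and> (\<forall>g\<in>carrier G. S g \<in> carrier ?M \<and> homogeneous R (g \<in> H) (S g) \<and>
      N \<otimes>\<^bsub>?M\<^esub> \<rho> g \<oplus>\<^bsub>?M\<^esub> P \<otimes>\<^bsub>?M\<^esub> \<epsilon> g = conj_by ?M P (\<rho> g) \<otimes>\<^bsub>?M\<^esub> N \<oplus>\<^bsub>?M\<^esub> S g \<otimes>\<^bsub>?M\<^esub> P)"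
  proof (intro exI conjI ballI)
    show "lin_comb a N b N' \<in> carrier ?M" by (rule lin_comb_closed[OF ab N N'])
    fix g assume g: "g \<in> carrier G"
    note Sg = S[OF g] and S'g = S'[OF g]
    have cc: "S g \<in> carrier ?M" "S' g \<in> carrier ?M" "\<rho> g \<in> carrier ?M" "P \<in> carrier ?M"
      "conj_by ?M P (\<rho> g) \<in> carrier ?M"
      using Sg S'g rep_hom(2)[OF \<rho> g] PU by (auto simp: M.Units_closed)
    show "lin_comb a (S g) b (S' g) \<in> carrier ?M" by (rule lin_comb_closed[OF ab cc(1,2)])
    show "homogeneous R (g \<in> H) (lin_comb a (S g) b (S' g))"
      using homogeneous_lin_comb[OF ab] Sg S'g by blast
    have "lin_comb a N b N' \<otimes>\<^bsub>?M\<^esub> \<rho> g \<oplus>\<^bsub>?M\<^esub> P \<otimes>\<^bsub>?M\<^esub> \<epsilon> g =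
      lin_comb a (N \<otimes>\<^bsub>?M\<^esub> \<rho> g \<oplus>\<^bsub>?M\<^esub> P \<otimes>\<^bsub>?M\<^esub> \<delta> g) b (N' \<otimes>\<^bsub>?M\<^esub> \<rho> g \<oplus>\<^bsub>?M\<^esub> P \<otimes>\<^bsub>?M\<^esub> \<delta>' g)"
      unfolding eq[OF g] using ab N N' c[OF g] cc by (simp add: lin_comb_mult lin_comb_add)
    also have "\<dots> = lin_comb a (conj_by ?M P (\<rho> g) \<otimes>\<^bsub>?M\<^esub> N \<oplus>\<^bsub>?M\<^esub> S g \<otimes>\<^bsub>?M\<^esub> P)
         b (conj_by ?M P (\<rho> g) \<otimes>\<^bsub>?M\<^esub> N' \<oplus>\<^bsub>?M\<^esub> S' g \<otimes>\<^bsub>?M\<^esub> P)"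
      using Sg S'g by simp
    also have "\<dots> = conj_by ?M P (\<rho> g) \<otimes>\<^bsub>?M\<^esub> lin_comb a N b N' \<oplus>\<^bsub>?M\<^esub> lin_comb a (S g) b (S' g) \<otimes>\<^bsub>?M\<^esub> P"
      using ab N N' cc by (simp add: lin_comb_mult lin_comb_add)
    finally show "lin_comb a N b N' \<otimes>\<^bsub>?M\<^esub> \<rho> g \<oplus>\<^bsub>?M\<^esub> P \<otimes>\<^bsub>?M\<^esub> \<epsilon> g =
      conj_by ?M P (\<rho> g) \<otimes>\<^bsub>?M\<^esub> lin_comb a N b N' \<oplus>\<^bsub>?M\<^esub> lin_comb a (S g) b (S' g) \<otimes>\<^bsub>?M\<^esub> P" .
  qed
qed

lemma lin_comb_solve:
  assumes "t \<in> carrier R" "B \<in> carrier (mat2_ring R)" "A \<in> carrier (mat2_ring R)"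
  shows "A = lin_comb \<one> (lin_comb \<one> A t B) (\<ominus> t) B"
proof -
  have "y = \<one> \<otimes> (\<one> \<otimes> y \<oplus> t \<otimes> x) \<oplus> (\<ominus> t) \<otimes> x" if xy: "x \<in> carrier R" "y \<in> carrier R" for x y
  proof -
    have "(y \<oplus> t \<otimes> x) \<oplus> (\<ominus> t) \<otimes> x = y" using assms(1) xy by algebra
    thus ?thesis using assms(1) xy by simp
  qed
  thus ?thesis using assms(2,3) by (intro mat2.expand) (simp only: mat2_ring_add map_mat2_entries mat2.sel mat2_ring_entries)
qed

lemma lin_comb_difference:
  assumes "t \<in> carrier R" "t' \<in> carrier R" "c \<in> carrier R" "c \<otimes> (t \<ominus> t') = \<one>"
    "B \<in> carrier (mat2_ring R)" "A \<in> carrier (mat2_ring R)"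
  shows "B = lin_comb c (lin_comb \<one> A t B) (\<ominus> c) (lin_comb \<one> A t' B)"
proof -
  have "x = c \<otimes> (\<one> \<otimes> y \<oplus> t \<otimes> x) \<oplus> (\<ominus> c) \<otimes> (\<one> \<otimes> y \<oplus> t' \<otimes> x)"
    if xy: "x \<in> carrier R" "y \<in> carrier R" for x y
  proof -
    have "c \<otimes> (\<one> \<otimes> y \<oplus> t \<otimes> x) \<oplus> (\<ominus> c) \<otimes> (\<one> \<otimes> y \<oplus> t' \<otimes> x) = c \<otimes> (t \<ominus> t') \<otimes> x"
      using assms(1-3) xy by algebra
    thus ?thesis using assms(4) xy by simp
  qed
  thus ?thesis using assms(5,6) by (intro mat2.expand) (simp only: mat2_ring_add map_mat2_entries mat2.sel mat2_ring_entries)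
qed

text \<open>The vector space \<open>Z\<close> and its subspaces \<open>A i\<close> consist of functions considered on \<open>C\<close> only.\<close>

lemma three_subspaces:
  fixes Z :: "('g \<Rightarrow> 'a mat2) \<Rightarrow> bool" and A :: "nat \<Rightarrow> ('g \<Rightarrow> 'a mat2) \<Rightarrow> bool"
  assumes two: "\<one> \<noteq> \<ominus> \<one>"
    and c: "\<And>u g. Z u \<Longrightarrow> g \<in> C \<Longrightarrow> u g \<in> carrier (mat2_ring R)"
    and Z: "\<And>u v a b. Z u \<Longrightarrow> Z v \<Longrightarrow> a \<in> carrier R \<Longrightarrow> b \<in> carrier R \<Longrightarrow> Z (\<lambda>g. lin_comb a (u g) b (v g))"
    and A: "\<And>i u v w a b. Z u \<Longrightarrow> Z v \<Longrightarrow> Z w \<Longrightarrow> A i u \<Longrightarrow> A i v \<Longrightarrow> a \<in> carrier R \<Longrightarrow> b \<in> carrier R \<Longrightarrow>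
       (\<And>g. g \<in> C \<Longrightarrow> w g = lin_comb a (u g) b (v g)) \<Longrightarrow> A i w"
    and cover: "\<And>u. Z u \<Longrightarrow> A 0 u \<or> A 1 u \<or> A 2 u"
  shows "\<exists>i. \<forall>u. Z u \<longrightarrow> A i u"
proof (rule ccontr)
  assume "\<not> ?thesis"
  then obtain f where f: "\<And>i. Z (f i) \<and> \<not> A i (f i)" by metis
  have solve: "A i y" if "Z x" "Z y" "A i x" "t \<in> carrier R" "A i (\<lambda>g. lin_comb \<one> (y g) t (x g))" for i x y t
    by (rule A[of "\<lambda>g. lin_comb \<one> (y g) t (x g)" x y i \<one> "\<ominus> t"])
       (use that Z c lin_comb_solve in auto)
  \<comment> \<open>Two proper subspaces never cover: if \<open>f 0\<close> lay in
    \<open>A 1\<close> and \<open>f 1\<close> in \<open>A 0\<close>, their sum would lie in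
    neither.\<close>
  have "\<exists>x. Z x \<and> \<not> A 0 x \<and> \<not> A 1 x"
  proof (rule ccontr)
    assume *: "\<not> ?thesis"
    have 01: "A 1 (f 0)" "A 0 (f 1)" using * f by metis+
    let ?s = "\<lambda>g. lin_comb \<one> (f 0 g) \<one> (f 1 g)"
    have Zs: "Z ?s" "Z (f 0)" "Z (f 1)" using f by (auto intro!: Z)
    have n0: "\<not> A 0 ?s" using solve[OF Zs(3,2) 01(2) one_closed] f by blast
    have "\<not> A 1 ?s"
    proof
      assume s: "A 1 ?s"
      \<comment> \<open>The summands are exchanged to fit \<open>solve\<close>. Functions are
        compared on \<open>C\<close> only, so the exchanged sum is obtained as 1 times
        \<open>?s\<close> plus 0 times \<open>?s\<close>.\<close>
      have Zw: "Z (\<lambda>g. lin_comb \<one> (f 1 g) \<one> (f 0 g))" using Z[OF Zs(3,2)] by simp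
      have "A 1 (\<lambda>g. lin_comb \<one> (f 1 g) \<one> (f 0 g))"
        by (rule A[OF Zs(1) Zs(1) Zw s s one_closed zero_closed])
           (use c[OF Zs(2)] c[OF Zs(3)] in \<open>simp add: mat2_ring_add a_comm\<close>)
      from solve[OF Zs(2,3) 01(1) one_closed this] show False using f by blast
    qed
    thus False using * n0 Zs(1) by blast
  qed
  then obtain x where x: "Z x" "\<not> A 0 x" "\<not> A 1 x" by blast
  hence x2: "A 2 x" using cover by blast
  define y where "y = f 2"
  have y: "Z y" "\<not> A 2 y" unfolding y_def using f by blast+
  \<comment> \<open>Points of the line through \<open>y\<close> in direction \<open>x\<close>. None
    of them lies in \<open>A 2\<close>, which contains \<open>x\<close> but not \<open>y\<close>,
    and each of \<open>A 0\<close> and \<open>A 1\<close> contains at most one, since neither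
    contains \<open>x\<close>. The three parameters 0, 1 and -1 are distinct, which is a
    contradiction.\<close>
  define v where "v t = (\<lambda>g. lin_comb \<one> (y g) t (x g))" for t
  have Zv: "Z (v t)" if "t \<in> carrier R" for t unfolding v_def using Z[OF y(1) x(1)] that by simp
  have v01: "A 0 (v t) \<or> A 1 (v t)" if t: "t \<in> carrier R" for t
    using cover[OF Zv[OF t]] solve[OF x(1) y(1) x2 t] y(2) unfolding v_def by blast
  have diff: "t = t'" if "t \<in> carrier R" "t' \<in> carrier R" "A i (v t)" "A i (v t')" "\<not> A i x" for t t' i
  proof (rule ccontr)
    assume ne: "t \<noteq> t'"
    have "t \<ominus> t' \<in> Units R" using ne that field_Units by auto
    then obtain d where d: "d \<in> carrier R" "d \<otimes> (t \<ominus> t') = \<one>"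
      using Units_l_inv Units_inv_closed by metis
    have "A i x"
      by (rule A[OF Zv[OF that(1)] Zv[OF that(2)] x(1) that(3,4) d(1) a_inv_closed[OF d(1)]])
         (use lin_comb_difference[OF that(1,2) d] c x y in \<open>simp add: v_def\<close>)
    thus False using that(5) by blast
  qed
  have n1: "\<zero> \<noteq> \<ominus> \<one>"
  proof
    assume "\<zero> = \<ominus> \<one>"
    hence "\<ominus> (\<ominus> \<one>) = \<zero>" by (metis minus_zero)
    thus False using one_not_zero by simp
  qed
  have cc: "\<zero> \<in> carrier R" "\<one> \<in> carrier R" "\<ominus> \<one> \<in> carrier R" by auto
  show False
    using v01[OF cc(1)] v01[OF cc(2)] v01[OF cc(3)] diff[OF cc(1,2)] diff[OF cc(1,3)] diff[OF cc(2,3)]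
      x(2,3) two n1 one_not_zero by metis
qed

lemma common_splitting_subgroup:
  assumes G: "group G" and \<rho>: "\<rho> \<in> hom G (GL2 R)"
    and K: "\<And>H'. H' \<in> K \<Longrightarrow> index_two G H' \<and> (\<exists>P. graded G R H' \<rho> P)"
    and H: "H \<in> K" and P: "graded G R H \<rho> P"
    and d: "\<exists>h\<in>H. e11 (conj_by (mat2_ring R) P (\<rho> h)) \<noteq> e22 (conj_by (mat2_ring R) P (\<rho> h))"
    and split: "\<And>\<delta>. derivation G T R \<rho> \<delta> \<Longrightarrow> \<exists>H'\<in>K. splits_along G R H' \<rho> \<delta>"
  shows "\<exists>H'\<in>K. \<forall>\<delta>. derivation G T R \<rho> \<delta> \<longrightarrow> splits_along G R H' \<rho> \<delta>"
proof (cases "K = {H}")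
  case True
  thus ?thesis using split by blast
next
  case False
  then obtain H1 where H1: "H1 \<in> K" "H \<noteq> H1" using H by blast
  obtain P1 where P1: "graded G R H1 \<rho> P1" using K[OF H1(1)] by blast
  note indH = conjunct1[OF K[OF H]]
  \<comment> \<open>A second inducing subgroup excludes characteristic 2.\<close>
  have two: "\<one> \<noteq> \<ominus> \<one>"
    by (rule graded_overlap_iff(1)[OF indH conjunct1[OF K[OF H1(1)]] H1(2) \<rho> P P1 d])
  obtain \<sigma> where \<sigma>: "\<sigma> \<in> carrier G" "\<sigma> \<notin> H" using index_two.obtain_outside[OF indH] by blast
  \<comment> \<open>Numbers the candidates: \<open>H\<close> itself, one other that contains
    \<sigma>, one other that does not. By \<open>graded_subgroup_eq\<close> each number belongs to
    at most one subgroup in \<open>K\<close>, so \<open>A i\<close> below is closed under linear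
    combinations.\<close>
  define cl where "cl H' = (if H' = H then 0 else if \<sigma> \<in> H' then 1 else (2::nat))" for H'
  have uniq: "H' = H''" if k: "H' \<in> K" "H'' \<in> K" "cl H' = cl H''" for H' H''
  proof (cases "H' = H \<or> H'' = H")
    case True
    thus ?thesis using k(3) by (auto simp: cl_def split: if_splits)
  next
    case ne: False
    obtain P' P'' where "graded G R H' \<rho> P'" "graded G R H'' \<rho> P''"
      using K[OF k(1)] K[OF k(2)] by blast
    moreover have "\<sigma> \<in> H' \<longleftrightarrow> \<sigma> \<in> H''" using k(3) ne by (auto simp: cl_def split: if_splits)
    ultimately show ?thesis
      using graded_subgroup_eq[OF indH _ _ _ _ \<rho> P _ _ d \<sigma>] K k ne by blast
  qed
  define A where "A i \<delta> \<longleftrightarrow> (\<exists>H'\<in>K. cl H' = i \<and> splits_along G R H' \<rho> \<delta>)" for i \<delta>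
  have dc: "\<delta> g \<in> carrier (mat2_ring R)" if "derivation G T R \<rho> \<delta>" "g \<in> carrier G" for \<delta> g
    using that unfolding derivation_def by blast
  have "\<exists>i. \<forall>\<delta>. derivation G T R \<rho> \<delta> \<longrightarrow> A i \<delta>"
  proof (rule three_subspaces[where C = "carrier G"])
    show "\<one> \<noteq> \<ominus> \<one>" by (rule two)
    show "derivation G T R \<rho> (\<lambda>g. lin_comb a (u g) b (v g))"
      if "derivation G T R \<rho> u" "derivation G T R \<rho> v" "a \<in> carrier R" "b \<in> carrier R" for u v a b
      by (rule derivation_lin_comb[OF \<rho> that(3,4,1,2) G])
    show "A i w" if k: "derivation G T R \<rho> u" "derivation G T R \<rho> v" "A i u" "A i v"
       "a \<in> carrier R" "b \<in> carrier R" "\<And>g. g \<in> carrier G \<Longrightarrow> w g = lin_comb a (u g) b (v g)" for i u v w a b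
    proof -
      obtain H' where H': "H' \<in> K" "cl H' = i" "splits_along G R H' \<rho> u" using k(3) unfolding A_def by blast
      obtain H'' where H'': "H'' \<in> K" "cl H'' = i" "splits_along G R H'' \<rho> v" using k(4) unfolding A_def by blast
      have "H'' = H'" using uniq H' H'' by blast
      hence "splits_along G R H' \<rho> w"
        using splits_along_lin_comb[OF \<rho> k(5,6) dc[OF k(1)] dc[OF k(2)] H'(3) _ k(7)] H''(3) by blast
      thus ?thesis unfolding A_def using H' by blast
    qed
    show "A 0 u \<or> A 1 u \<or> A 2 u" if "derivation G T R \<rho> u" for u
      using split[OF that] unfolding A_def cl_def by (metis (full_types))
  qed (rule dc)
  then obtain i where i: "\<And>\<delta>. derivation G T R \<rho> \<delta> \<Longrightarrow> A i \<delta>" by blast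
  show ?thesis
  proof (cases "\<exists>\<delta>. derivation G T R \<rho> \<delta>")
    case True
    then obtain H' where H': "H' \<in> K" "cl H' = i" using i unfolding A_def by blast
    have "splits_along G R H' \<rho> \<delta>" if "derivation G T R \<rho> \<delta>" for \<delta>
      using i[OF that] uniq H' unfolding A_def by metis
    thus ?thesis using H' by blast
  qed (use H in blast)
qed

end

section \<open>Dual numbers\<close>

text \<open>A coefficient ring that comes from a quotient repeats its operations in a different
  record, so the axioms have to be carried over.\<close>

lemma cring_transfer:
  assumes "cring R" "carrier S = carrier R" "mult S = mult R" "one S = one R"
    "zero S = zero R" "add S = add R"
  shows "cring S"
proof -
  interpret cring R by fact
  show ?thesis
    by (intro cringI abelian_groupI comm_monoidI)
       (auto simp: assms(2-6) a_assoc m_assoc l_distr intro: a_comm m_comm l_neg a_inv_closed)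
qed

lemma ring_hom_transfer:
  assumes "carrier S = carrier R" "mult S = mult R" "one S = one R" "add S = add R"
  shows "ring_hom S Q = ring_hom R Q" "ring_hom Q S = ring_hom Q R"
  unfolding ring_hom_def by (simp_all add: assms)

text \<open>A Cauchy sequence is constant from index \<open>k\<close> on, and its term
  \<open>x k\<close> is the limit.\<close>

lemma adic_complete_nilpotent:
  assumes loc: "local_ring R" and nil: "max_ideal_pow R k = {\<zero>\<^bsub>R\<^esub>}"
  shows "adic_complete R"
proof -
  interpret cring R using loc unfolding local_ring_def by blast
  let ?m = "max_ideal_pow R"
  have z: "\<zero>\<^bsub>R\<^esub> \<in> ?m n" for n
    using additive_subgroup.zero_closed[OF ideal.axioms(1)[OF max_ideal_pow_is_ideal[OF loc]]] .
  have "(\<Inter>n. ?m n) = {\<zero>\<^bsub>R\<^esub>}" using nil z by blast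
  moreover have "\<exists>y\<in>carrier R. \<forall>n. y \<ominus>\<^bsub>R\<^esub> x n \<in> ?m n"
    if x: "\<forall>n. x n \<in> carrier R \<and> x (Suc n) \<ominus>\<^bsub>R\<^esub> x n \<in> ?m n" for x
  proof -
    have tel: "x (n + j) \<ominus>\<^bsub>R\<^esub> x n \<in> ?m n" for n j
    proof (induct j)
      case 0
      show ?case using x z by (simp add: r_neg minus_eq)
    next
      case (Suc j)
      have "x (Suc (n + j)) \<ominus>\<^bsub>R\<^esub> x (n + j) \<in> ?m n"
        using x max_ideal_pow_antimono[OF loc, of n "n + j"] by auto
      thus ?case
        using minus_in_ideal_trans[OF loc max_ideal_pow_is_ideal[OF loc] _ _ _ _ Suc, of "x (Suc (n + j))"] x by simp
    qed
    have "x k \<ominus>\<^bsub>R\<^esub> x n \<in> ?m n" for n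
    proof (cases "n \<le> k")
      case True
      thus ?thesis using tel[of n "k - n"] by simp
    next
      case False
      hence "x n \<ominus>\<^bsub>R\<^esub> x k \<in> {\<zero>\<^bsub>R\<^esub>}" using tel[of k "n - k"] nil by simp
      hence "x n = x k" using x by simp
      thus ?thesis using x z by (simp add: r_neg minus_eq)
    qed
    thus ?thesis using x by blast
  qed
  ultimately show ?thesis unfolding adic_complete_def by blast
qed

lemma (in ring) finite_noetherian:
  assumes "finite (carrier R)"
  shows "noetherian_ring R"
proof (rule noetherian_ringI)
  fix I assume I: "ideal I R"
  have sub: "I \<subseteq> carrier R" using ideal.Icarr[OF I] by blast
  have "Idl I = I" using genideal_minimal[OF I] genideal_self[OF sub] by blast
  thus "\<exists>A\<subseteq>carrier R. finite A \<and> I = Idl A" using sub finite_subset[OF sub assms] by blast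
qed

section \<open>Witt vectors in degree zero\<close>

lemma witt_law_0: "witt_law f p 0 = f (witt_var (Inl 0)) (witt_var (Inr 0))"
proof -
  have "Poly_Mapping.map (\<lambda>c. c) P = P" for P :: witt_mpoly
    by (rule poly_mapping_eqI) (simp add: Poly_Mapping.map.rep_eq when_def)
  thus ?thesis by (subst witt_law.simps) (simp add: ghost_def)
qed

lemma (in cring) witt_eval_vars:
  assumes "a u \<in> carrier R" "a v \<in> carrier R" "u \<noteq> v"
  shows "witt_eval R a (witt_var u * witt_var v) = a u \<otimes> a v"
    and "witt_eval R a (witt_var u + witt_var v) = a u \<oplus> a v"
proof -
  have one: "add_pow R (1::int) \<one> = \<one>" by (simp add: add_pow_def int_pow_def2)
  let ?s = "\<lambda>v. Poly_Mapping.single v (1::nat)"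
  let ?m = "?s u + ?s v"
  have k: "Poly_Mapping.keys ?m = {u, v}"
    using assms(3) by (auto simp: in_keys_iff lookup_add lookup_single when_def split: if_splits)
  have pr: "(\<Otimes>w\<in>Poly_Mapping.keys ?m. a w [^] Poly_Mapping.lookup ?m w) = a u \<otimes> a v"
    unfolding k using assms by (simp add: lookup_add lookup_single)
  have "witt_var u * witt_var v = Poly_Mapping.single ?m 1"
    by (simp add: witt_var_def mult_single)
  moreover have "witt_eval R a (Poly_Mapping.single ?m 1) = (\<Oplus>n\<in>{?m}. a u \<otimes> a v)"
    unfolding witt_eval_def using assms pr
    by (intro add.finprod_cong') (auto simp: one lookup_single)
  ultimately show "witt_eval R a (witt_var u * witt_var v) = a u \<otimes> a v" using assms by simp
  have ne: "?s u \<noteq> ?s v" using assms(3) by (metis keys_single singleton_insert_inj_eq zero_neq_one)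
  have ks: "Poly_Mapping.keys (witt_var u + witt_var v) = {?s u, ?s v}"
    using ne by (auto simp: witt_var_def in_keys_iff lookup_add lookup_single when_def split: if_splits)
  have "witt_eval R a (witt_var u + witt_var v) = (\<Oplus>n\<in>{?s u, ?s v}. if n = ?s u then a u else a v)"
    unfolding witt_eval_def ks using assms ne
    by (intro add.finprod_cong') (auto simp: one lookup_single lookup_add witt_var_def)
  also have "\<dots> = a u \<oplus> a v" using assms ne by simp
  finally show "witt_eval R a (witt_var u + witt_var v) = a u \<oplus> a v" .
qed

text \<open>The laws in degree 0 are the sum and the product of the zeroth components. Followed by
  the inclusion of constants, this map is the structure map of the dual numbers.\<close>

lemma witt_vectors_proj:
  assumes "cring F"
  shows "(\<lambda>w. w 0) \<in> ring_hom (witt_vectors p F) F"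
proof -
  interpret cring F by fact
  show ?thesis
  proof (rule ring_hom_memI)
    fix x y assume "x \<in> carrier (witt_vectors p F)" "y \<in> carrier (witt_vectors p F)"
    hence c: "x 0 \<in> carrier F" "y 0 \<in> carrier F" by (simp_all add: witt_vectors_def)
    show "(x \<otimes>\<^bsub>witt_vectors p F\<^esub> y) 0 = x 0 \<otimes>\<^bsub>F\<^esub> y 0"
      using witt_eval_vars(1)[of "case_sum x y" "Inl 0" "Inr 0"] c by (simp add: witt_vectors_def witt_law_0)
    show "(x \<oplus>\<^bsub>witt_vectors p F\<^esub> y) 0 = x 0 \<oplus>\<^bsub>F\<^esub> y 0"
      using witt_eval_vars(2)[of "case_sum x y" "Inl 0" "Inr 0"] c by (simp add: witt_vectors_def witt_law_0)
  qed (auto simp: witt_vectors_def)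
qed

section \<open>The ring structure of the dual numbers\<close>

context
  fixes F :: "'f ring"
  assumes F: "field F"
begin

interpretation F: field F by (rule F)

interpretation P: domain "univ_poly F (carrier F)"
  by (rule F.univ_poly_is_domain[OF F.carrier_is_subring])

private abbreviation "P \<equiv> univ_poly F (carrier F)"
private abbreviation "X2 \<equiv> X\<^bsub>F\<^esub> [^]\<^bsub>P\<^esub> (2::nat)"
private abbreviation "\<kappa> \<equiv> \<lambda>q. PIdl\<^bsub>P\<^esub> X2 +>\<^bsub>P\<^esub> q"

definition dual_eps :: "'f list set" where "dual_eps = \<kappa> X\<^bsub>F\<^esub>"

definition dual_const :: "'f \<Rightarrow> 'f list set" where "dual_const a = \<kappa> (F.poly_of_const a)"

lemma X_closed: "X\<^bsub>F\<^esub> \<in> carrier P" by (rule F.var_closed(1)[OF F.carrier_is_subring])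

lemma X2_closed: "X2 \<in> carrier P" using X_closed by simp

lemma X2_eq: "X2 = X\<^bsub>F\<^esub> \<otimes>\<^bsub>P\<^esub> X\<^bsub>F\<^esub>"
  using X_closed by (simp add: numeral_2_eq_2)

lemma dual_numbers_simps:
  "carrier (dual_numbers F) = carrier (Rupt\<^bsub>F\<^esub> (carrier F) X2)"
  "mult (dual_numbers F) = mult (Rupt\<^bsub>F\<^esub> (carrier F) X2)"
  "one (dual_numbers F) = one (Rupt\<^bsub>F\<^esub> (carrier F) X2)"
  "zero (dual_numbers F) = zero (Rupt\<^bsub>F\<^esub> (carrier F) X2)"
  "add (dual_numbers F) = add (Rupt\<^bsub>F\<^esub> (carrier F) X2)"
  "struct_map (dual_numbers F) = (\<lambda>w. dual_const (w 0))"
  "residue (dual_numbers F) = (\<lambda>C. the_elem (F.const_term ` C))"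
  unfolding dual_numbers_def Let_def dual_const_def by simp_all

lemma ideal_X2: "ideal (PIdl\<^bsub>P\<^esub> X2) P" by (rule P.cgenideal_ideal[OF X2_closed])

lemma dual_numbers_cring: "cring (dual_numbers F)"
proof -
  interpret I: ideal "PIdl\<^bsub>P\<^esub> X2" P by (rule ideal_X2)
  show ?thesis
    using cring_transfer[OF I.quotient_is_cring[OF P.cring_axioms]] dual_numbers_simps
    unfolding rupture_def by blast
qed

interpretation D: cring "dual_numbers F" by (rule dual_numbers_cring)

lemma kappa_hom: "\<kappa> \<in> ring_hom P (dual_numbers F)"
  using F.rupture_surj_hom(1)[OF F.carrier_is_subring X2_closed]
    ring_hom_transfer(2)[of "dual_numbers F" "Rupt\<^bsub>F\<^esub> (carrier F) X2" P] dual_numbers_simps by simp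

lemma kappa_surj: "x \<in> carrier (dual_numbers F) \<Longrightarrow> \<exists>q\<in>carrier P. x = \<kappa> q"
  unfolding dual_numbers_simps rupture_def FactRing_def A_RCOSETS_def' by auto

lemma kappa_eq_0_iff: "q \<in> carrier P \<Longrightarrow> \<kappa> q = \<zero>\<^bsub>dual_numbers F\<^esub> \<longleftrightarrow> (\<exists>r\<in>carrier P. q = r \<otimes>\<^bsub>P\<^esub> X2)"
proof -
  assume q: "q \<in> carrier P"
  have "\<kappa> q = \<zero>\<^bsub>dual_numbers F\<^esub> \<longleftrightarrow> q \<in> PIdl\<^bsub>P\<^esub> X2"
    unfolding dual_numbers_simps rupture_def FactRing_def
    using P.a_rcos_zero[OF ideal_X2] ideal.rcos_const_imp_mem[OF ideal_X2 q] by auto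
  thus ?thesis unfolding cgenideal_def by blast
qed

lemma poly_of_const_hom: "F.poly_of_const \<in> ring_hom F P"
  using F.canonical_embedding_is_hom[OF F.carrier_is_subring] by simp

lemma const_term_hom: "F.const_term \<in> ring_hom P F"
  using F.eval_is_hom[OF F.carrier_is_subring F.zero_closed] unfolding F.const_term_def[abs_def] .

lemma const_term_const: "a \<in> carrier F \<Longrightarrow> F.const_term (F.poly_of_const a) = a"
  by (simp add: F.poly_of_const_def F.const_term_def)

lemma const_term_X: "F.const_term X\<^bsub>F\<^esub> = \<zero>\<^bsub>F\<^esub>"
  by (simp add: F.const_term_def F.eval_var)

text \<open>After subtraction of the constant term the last coefficient is zero, and dropping it
  divides by X. Two applications give the normal form a + b \<epsilon> modulo X^2.\<close>

lemma poly_div_X: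
  assumes q: "q \<in> carrier P"
  shows "\<exists>c\<in>carrier F. \<exists>r\<in>carrier P. q = F.poly_of_const c \<oplus>\<^bsub>P\<^esub> r \<otimes>\<^bsub>P\<^esub> X\<^bsub>F\<^esub>"
proof -
  interpret ct: ring_hom_cring P F F.const_term
    by unfold_locales (rule const_term_hom)
  interpret pc: ring_hom_cring F P F.poly_of_const
    by unfold_locales (rule poly_of_const_hom)
  let ?c = "F.const_term q"
  let ?q = "q \<ominus>\<^bsub>P\<^esub> F.poly_of_const ?c"
  have c: "?c \<in> carrier F" using q by simp
  have qc: "?q \<in> carrier P" using q c by simp
  have "F.const_term ?q = \<zero>\<^bsub>F\<^esub>"
    using q c const_term_const[OF c] by (simp add: P.minus_eq F.r_neg)
  have "\<exists>r\<in>carrier P. ?q = r \<otimes>\<^bsub>P\<^esub> X\<^bsub>F\<^esub>"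
  proof (cases "?q = []")
    case True
    thus ?thesis using P.l_null[OF X_closed] univ_poly_zero[of F "carrier F"] P.zero_closed by metis
  next
    case False
    have "polynomial\<^bsub>F\<^esub> (carrier F) ?q" using qc unfolding univ_poly_carrier .
    from F.const_term_zero[OF F.carrier_is_subring this False \<open>F.const_term ?q = \<zero>\<^bsub>F\<^esub>\<close>]
    obtain r where r: "polynomial\<^bsub>F\<^esub> (carrier F) r" "r \<noteq> []" "?q = r @ [\<zero>\<^bsub>F\<^esub>]" by blast
    have rc: "r \<in> carrier P" using r(1) unfolding univ_poly_carrier .
    show ?thesis using F.poly_mult_var[OF F.carrier_is_subring rc] r rc by (intro bexI[of _ r]) auto
  qed
  then obtain r where r: "r \<in> carrier P" "?q = r \<otimes>\<^bsub>P\<^esub> X\<^bsub>F\<^esub>" by blast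
  have "q = F.poly_of_const ?c \<oplus>\<^bsub>P\<^esub> ?q" using q pc.hom_closed[OF c] by algebra
  thus ?thesis using r c by metis
qed

lemma dual_const_hom: "dual_const \<in> ring_hom F (dual_numbers F)"
  using ring_hom_trans[OF poly_of_const_hom kappa_hom] unfolding dual_const_def[abs_def] comp_def .

lemma dual_eps_closed: "dual_eps \<in> carrier (dual_numbers F)"
  unfolding dual_eps_def using ring_hom_closed[OF kappa_hom X_closed] .

lemma dual_eps_sq: "dual_eps \<otimes>\<^bsub>dual_numbers F\<^esub> dual_eps = \<zero>\<^bsub>dual_numbers F\<^esub>"
proof -
  have "dual_eps \<otimes>\<^bsub>dual_numbers F\<^esub> dual_eps = \<kappa> X2"
    unfolding dual_eps_def using ring_hom_mult[OF kappa_hom X_closed X_closed] X2_eq by simp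
  thus ?thesis using kappa_eq_0_iff[OF X2_closed] X2_closed P.l_one[OF X2_closed] P.one_closed by metis
qed

abbreviation dual :: "'f \<Rightarrow> 'f \<Rightarrow> 'f list set" where
  "dual a b \<equiv> dual_const a \<oplus>\<^bsub>dual_numbers F\<^esub> dual_const b \<otimes>\<^bsub>dual_numbers F\<^esub> dual_eps"

interpretation dc: ring_hom_cring F "dual_numbers F" dual_const
  by unfold_locales (rule dual_const_hom)

interpretation \<kappa>: ring_hom_cring P "dual_numbers F" \<kappa>
  by unfold_locales (rule kappa_hom)

interpretation ct: ring_hom_cring P F F.const_term
  by unfold_locales (rule const_term_hom)

interpretation pc: ring_hom_cring F P F.poly_of_const
  by unfold_locales (rule poly_of_const_hom)

lemma dual_closed: "a \<in> carrier F \<Longrightarrow> b \<in> carrier F \<Longrightarrow> dual a b \<in> carrier (dual_numbers F)"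
  using dual_eps_closed by simp

lemma dual_surj:
  assumes "x \<in> carrier (dual_numbers F)"
  shows "\<exists>a\<in>carrier F. \<exists>b\<in>carrier F. x = dual a b"
proof -
  obtain q where q: "q \<in> carrier P" "x = \<kappa> q" using kappa_surj[OF assms] by blast
  obtain a r where a: "a \<in> carrier F" "r \<in> carrier P" "q = F.poly_of_const a \<oplus>\<^bsub>P\<^esub> r \<otimes>\<^bsub>P\<^esub> X\<^bsub>F\<^esub>"
    using poly_div_X[OF q(1)] by blast
  obtain b s where b: "b \<in> carrier F" "s \<in> carrier P" "r = F.poly_of_const b \<oplus>\<^bsub>P\<^esub> s \<otimes>\<^bsub>P\<^esub> X\<^bsub>F\<^esub>"
    using poly_div_X[OF a(2)] by blast
  have ka: "\<kappa> (F.poly_of_const c) = dual_const c" for c unfolding dual_const_def ..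
  have sc: "\<kappa> s \<in> carrier (dual_numbers F)" using b(2) by (rule \<kappa>.hom_closed)
  have "\<kappa> r = dual_const b \<oplus>\<^bsub>dual_numbers F\<^esub> \<kappa> s \<otimes>\<^bsub>dual_numbers F\<^esub> dual_eps"
    unfolding b(3) dual_eps_def dual_const_def using b(1,2) X_closed
    by (simp add: \<kappa>.hom_add \<kappa>.hom_mult)
  hence "\<kappa> r \<otimes>\<^bsub>dual_numbers F\<^esub> dual_eps = dual_const b \<otimes>\<^bsub>dual_numbers F\<^esub> dual_eps"
    using sc b(1) dual_eps_closed dual_eps_sq by (simp add: D.l_distr D.m_assoc)
  moreover have "\<kappa> q = dual_const a \<oplus>\<^bsub>dual_numbers F\<^esub> \<kappa> r \<otimes>\<^bsub>dual_numbers F\<^esub> dual_eps"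
    unfolding a(3) dual_eps_def dual_const_def using a(1,2) X_closed
    by (simp add: \<kappa>.hom_add \<kappa>.hom_mult)
  ultimately show ?thesis using a(1) b(1) q(2) by metis
qed

text \<open>Representatives of a class differ by multiples of X^2, whose constant term is zero, so
  \<open>the_elem\<close> in the residue map is applied to a singleton.\<close>

lemma residue_kappa: "q \<in> carrier P \<Longrightarrow> residue (dual_numbers F) (\<kappa> q) = F.const_term q"
proof -
  assume q: "q \<in> carrier P"
  have eq: "F.const_term r = F.const_term q" if "r \<in> \<kappa> q" for r
  proof -
    obtain s where s: "s \<in> carrier P" "r = s \<otimes>\<^bsub>P\<^esub> X2 \<oplus>\<^bsub>P\<^esub> q"
      using \<open>r \<in> \<kappa> q\<close> unfolding a_r_coset_def' cgenideal_def by auto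
    have "F.const_term X2 = \<zero>\<^bsub>F\<^esub>" unfolding X2_eq using X_closed by (simp add: const_term_X)
    thus ?thesis unfolding s(2) using s(1) q X2_closed by simp
  qed
  have mem: "q \<in> \<kappa> q" 
    unfolding a_r_coset_def' using q additive_subgroup.zero_closed[OF ideal.axioms(1)[OF ideal_X2]]
    by (auto intro!: bexI[of _ "\<zero>\<^bsub>P\<^esub>"])
  have "F.const_term ` \<kappa> q = {F.const_term q}"
  proof (rule equalityI)
    show "F.const_term ` \<kappa> q \<subseteq> {F.const_term q}" 
    proof (rule image_subsetI)
      fix r assume "r \<in> \<kappa> q"
      from eq[OF this] show "F.const_term r \<in> {F.const_term q}" by (rule ssubst) (rule singletonI)
    qed
    show "{F.const_term q} \<subseteq> F.const_term ` \<kappa> q" 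
      unfolding insert_subset using imageI[OF mem] by (intro conjI empty_subsetI)
  qed
  thus ?thesis by (simp only: dual_numbers_simps the_elem_eq)
qed

lemma residue_dual_hom: "residue (dual_numbers F) \<in> ring_hom (dual_numbers F) F"
proof (rule ring_hom_memI)
  fix x y assume x: "x \<in> carrier (dual_numbers F)" and y: "y \<in> carrier (dual_numbers F)"
  obtain q r where q: "q \<in> carrier P" "x = \<kappa> q" and r: "r \<in> carrier P" "y = \<kappa> r"
    using kappa_surj[OF x] kappa_surj[OF y] by blast
  show "residue (dual_numbers F) x \<in> carrier F" using residue_kappa[OF q(1)] q by simp
  show "residue (dual_numbers F) (x \<otimes>\<^bsub>dual_numbers F\<^esub> y) =
    residue (dual_numbers F) x \<otimes>\<^bsub>F\<^esub> residue (dual_numbers F) y"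
    using residue_kappa q r by (simp add: \<kappa>.hom_mult[symmetric] del: \<kappa>.hom_mult)
  show "residue (dual_numbers F) (x \<oplus>\<^bsub>dual_numbers F\<^esub> y) =
    residue (dual_numbers F) x \<oplus>\<^bsub>F\<^esub> residue (dual_numbers F) y"
    using residue_kappa q r by (simp add: \<kappa>.hom_add[symmetric] del: \<kappa>.hom_add)
next
  show "residue (dual_numbers F) \<one>\<^bsub>dual_numbers F\<^esub> = \<one>\<^bsub>F\<^esub>"
    using residue_kappa[OF P.one_closed] \<kappa>.hom_one ct.hom_one by simp
qed

interpretation res: ring_hom_cring "dual_numbers F" F "residue (dual_numbers F)"
  by unfold_locales (rule residue_dual_hom)

lemma residue_dual: "a \<in> carrier F \<Longrightarrow> b \<in> carrier F \<Longrightarrow> residue (dual_numbers F) (dual a b) = a"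
proof -
  have 1: "residue (dual_numbers F) (dual_const c) = c" if "c \<in> carrier F" for c
    using residue_kappa[OF pc.hom_closed[OF that]] const_term_const[OF that] unfolding dual_const_def by metis
  have 2: "residue (dual_numbers F) dual_eps = \<zero>\<^bsub>F\<^esub>"
    using residue_kappa[OF X_closed] const_term_X unfolding dual_eps_def by metis
  show "a \<in> carrier F \<Longrightarrow> b \<in> carrier F \<Longrightarrow> ?thesis"
    using 1 2 dual_eps_closed by simp
qed

text \<open>The residue map shows a = 0. If then b X = r X^2, cancelling X in the domain F[X] gives
  b = r X, and comparing constant terms gives b = 0.\<close>

lemma dual_inj:
  assumes "a \<in> carrier F" "b \<in> carrier F" "dual a b = \<zero>\<^bsub>dual_numbers F\<^esub>"
  shows "a = \<zero>\<^bsub>F\<^esub>" "b = \<zero>\<^bsub>F\<^esub>"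
proof -
  show a: "a = \<zero>\<^bsub>F\<^esub>" using residue_dual[OF assms(1,2)] assms(3) by simp
  have "\<kappa> (F.poly_of_const b \<otimes>\<^bsub>P\<^esub> X\<^bsub>F\<^esub>) = \<zero>\<^bsub>dual_numbers F\<^esub>"
    using assms(2,3) a X_closed dual_eps_closed \<kappa>.hom_mult[OF pc.hom_closed[OF assms(2)] X_closed]
    unfolding dual_const_def[symmetric] dual_eps_def[symmetric] by simp
  then obtain r where r: "r \<in> carrier P" "F.poly_of_const b \<otimes>\<^bsub>P\<^esub> X\<^bsub>F\<^esub> = r \<otimes>\<^bsub>P\<^esub> X2"
    using kappa_eq_0_iff[of "F.poly_of_const b \<otimes>\<^bsub>P\<^esub> X\<^bsub>F\<^esub>"] assms(2) X_closed by auto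
  have "X\<^bsub>F\<^esub> \<noteq> \<zero>\<^bsub>P\<^esub>" by (simp add: univ_poly_zero var_def)
  moreover have "F.poly_of_const b \<otimes>\<^bsub>P\<^esub> X\<^bsub>F\<^esub> = (r \<otimes>\<^bsub>P\<^esub> X\<^bsub>F\<^esub>) \<otimes>\<^bsub>P\<^esub> X\<^bsub>F\<^esub>"
    using r X_closed unfolding X2_eq by (simp add: P.m_assoc)
  ultimately have "F.poly_of_const b = r \<otimes>\<^bsub>P\<^esub> X\<^bsub>F\<^esub>"
    using P.m_rcancel[of "X\<^bsub>F\<^esub>" "F.poly_of_const b" "r \<otimes>\<^bsub>P\<^esub> X\<^bsub>F\<^esub>"] assms(2) r(1) X_closed by auto
  hence "F.const_term (F.poly_of_const b) = \<zero>\<^bsub>F\<^esub>" using r(1) X_closed by (simp add: const_term_X)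
  thus "b = \<zero>\<^bsub>F\<^esub>" using const_term_const[OF assms(2)] by simp
qed

end

section \<open>Matrices A + \<epsilon> B over the dual numbers\<close>

definition dual_mat :: "'f ring \<Rightarrow> 'f mat2 \<Rightarrow> 'f mat2 \<Rightarrow> 'f list set mat2" where
  "dual_mat F A B = Mat2 (dual F (e11 A) (e11 B)) (dual F (e12 A) (e12 B))
     (dual F (e21 A) (e21 B)) (dual F (e22 A) (e22 B))"

context
  fixes F :: "'f ring"
  assumes F: "field F"
begin

interpretation F: field F by (rule F)
interpretation D: cring "dual_numbers F" by (rule dual_numbers_cring[OF F])
interpretation dc: ring_hom_cring F "dual_numbers F" "dual_const F"
  by unfold_locales (rule dual_const_hom[OF F])
interpretation res: ring_hom_cring "dual_numbers F" F "residue (dual_numbers F)"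
  by unfold_locales (rule residue_dual_hom[OF F])

lemma dual_add:
  assumes "a \<in> carrier F" "b \<in> carrier F" "c \<in> carrier F" "d \<in> carrier F"
  shows "dual F a b \<oplus>\<^bsub>dual_numbers F\<^esub> dual F c d = dual F (a \<oplus>\<^bsub>F\<^esub> c) (b \<oplus>\<^bsub>F\<^esub> d)"
  using assms dual_eps_closed[OF F] by (simp add: D.l_distr D.a_ac)

lemma dual_mult:
  assumes "a \<in> carrier F" "b \<in> carrier F" "c \<in> carrier F" "d \<in> carrier F"
  shows "dual F a b \<otimes>\<^bsub>dual_numbers F\<^esub> dual F c d =
    dual F (a \<otimes>\<^bsub>F\<^esub> c) (a \<otimes>\<^bsub>F\<^esub> d \<oplus>\<^bsub>F\<^esub> b \<otimes>\<^bsub>F\<^esub> c)"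
proof -
  let ?D = "dual_numbers F"
  have "\<And>x y z w e. x \<in> carrier ?D \<Longrightarrow> y \<in> carrier ?D \<Longrightarrow> z \<in> carrier ?D \<Longrightarrow> w \<in> carrier ?D \<Longrightarrow> e \<in> carrier ?D \<Longrightarrow>
    (x \<oplus>\<^bsub>?D\<^esub> y \<otimes>\<^bsub>?D\<^esub> e) \<otimes>\<^bsub>?D\<^esub> (z \<oplus>\<^bsub>?D\<^esub> w \<otimes>\<^bsub>?D\<^esub> e) =
    (x \<otimes>\<^bsub>?D\<^esub> z \<oplus>\<^bsub>?D\<^esub> (x \<otimes>\<^bsub>?D\<^esub> w \<oplus>\<^bsub>?D\<^esub> y \<otimes>\<^bsub>?D\<^esub> z) \<otimes>\<^bsub>?D\<^esub> e) \<oplus>\<^bsub>?D\<^esub> (y \<otimes>\<^bsub>?D\<^esub> w) \<otimes>\<^bsub>?D\<^esub> (e \<otimes>\<^bsub>?D\<^esub> e)"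
    by algebra
  from this[of "dual_const F a" "dual_const F b" "dual_const F c" "dual_const F d" "dual_eps F"]
  show ?thesis using assms dual_eps_closed[OF F] dual_eps_sq[OF F] by simp
qed

lemma dual_eq_iff:
  assumes "a \<in> carrier F" "b \<in> carrier F" "c \<in> carrier F" "d \<in> carrier F"
  shows "dual F a b = dual F c d \<longleftrightarrow> a = c \<and> b = d"
proof
  assume eq: "dual F a b = dual F c d"
  have ac: "a = c" using residue_dual[OF F] assms eq by metis
  have "dual_const F b \<otimes>\<^bsub>dual_numbers F\<^esub> dual_eps F = dual_const F d \<otimes>\<^bsub>dual_numbers F\<^esub> dual_eps F"
    using eq assms dual_eps_closed[OF F] unfolding ac by simp
  hence "dual F \<zero>\<^bsub>F\<^esub> (b \<ominus>\<^bsub>F\<^esub> d) = \<zero>\<^bsub>dual_numbers F\<^esub>"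
    using assms dual_eps_closed[OF F] by (simp add: F.minus_eq D.l_distr D.l_minus D.r_neg)
  hence "b \<ominus>\<^bsub>F\<^esub> d = \<zero>\<^bsub>F\<^esub>" using dual_inj(2)[OF F, of "\<zero>\<^bsub>F\<^esub>" "b \<ominus>\<^bsub>F\<^esub> d"] assms by simp
  thus "a = c \<and> b = d" using ac assms by simp
qed auto

lemma dual_one: "\<one>\<^bsub>dual_numbers F\<^esub> = dual F \<one>\<^bsub>F\<^esub> \<zero>\<^bsub>F\<^esub>"
  using dual_eps_closed[OF F] by simp

lemma dual_numbers_local:
  "local_ring (dual_numbers F)" (is ?l)
  "max_ideal (dual_numbers F) = a_kernel (dual_numbers F) F (residue (dual_numbers F))" (is ?m)
proof -
  let ?D = "dual_numbers F"
  let ?M = "a_kernel ?D F (residue ?D)"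
  have I: "ideal ?M ?D" 
    by (rule ring_hom_ring.kernel_is_ideal[OF ring_hom_ringI2[OF D.ring_axioms F.ring_axioms residue_dual_hom[OF F]]])
  have 1: "\<one>\<^bsub>?D\<^esub> \<notin> ?M" unfolding a_kernel_def' by simp
  have U: "x \<in> Units ?D" if x: "x \<in> carrier ?D" "x \<notin> ?M" for x
  proof -
    obtain a b where ab: "a \<in> carrier F" "b \<in> carrier F" "x = dual F a b" using dual_surj[OF F x(1)] by blast
    have "a \<noteq> \<zero>\<^bsub>F\<^esub>" using x residue_dual[OF F ab(1,2)] ab(3) unfolding a_kernel_def' by auto
    hence a: "a \<in> Units F" using ab F.field_Units by auto
    \<comment> \<open>The inverse of a + b \<epsilon> is a^-1 - a^-1 b a^-1 \<epsilon>.\<close>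
    let ?c = "inv\<^bsub>F\<^esub> a" and ?d = "\<ominus>\<^bsub>F\<^esub> (inv\<^bsub>F\<^esub> a \<otimes>\<^bsub>F\<^esub> b \<otimes>\<^bsub>F\<^esub> inv\<^bsub>F\<^esub> a)"
    have c: "?c \<in> carrier F" "?d \<in> carrier F" using a ab by auto
    have "a \<otimes>\<^bsub>F\<^esub> ?d = \<ominus>\<^bsub>F\<^esub> (b \<otimes>\<^bsub>F\<^esub> ?c)"
      using a ab c(1) by (simp add: F.r_minus F.m_assoc[symmetric])
    hence "x \<otimes>\<^bsub>?D\<^esub> dual F ?c ?d = \<one>\<^bsub>?D\<^esub>"
      unfolding ab(3) dual_one using dual_mult[OF ab(1,2) c] a ab c by (simp add: F.l_neg)
    thus ?thesis
      using x(1) dual_closed[OF F c] D.unit_factor[of x "dual F ?c ?d"] by simp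
  qed
  show ?l ?m using local_ring_by_units[OF D.cring_axioms I 1 U] by auto
qed

lemma max_ideal_dual_eq: "max_ideal (dual_numbers F) = dual F \<zero>\<^bsub>F\<^esub> ` carrier F"
proof -
  have "x \<in> carrier (dual_numbers F) \<and> residue (dual_numbers F) x = \<zero>\<^bsub>F\<^esub> \<longleftrightarrow> x \<in> dual F \<zero>\<^bsub>F\<^esub> ` carrier F" for x
  proof
    assume x: "x \<in> carrier (dual_numbers F) \<and> residue (dual_numbers F) x = \<zero>\<^bsub>F\<^esub>"
    then obtain a b where ab: "a \<in> carrier F" "b \<in> carrier F" "x = dual F a b" using dual_surj[OF F] by blast
    hence "a = \<zero>\<^bsub>F\<^esub>" using x residue_dual[OF F ab(1,2)] by metis
    thus "x \<in> dual F \<zero>\<^bsub>F\<^esub> ` carrier F" using ab(2,3) by blast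
  next
    assume "x \<in> dual F \<zero>\<^bsub>F\<^esub> ` carrier F"
    then obtain b where b: "b \<in> carrier F" "x = dual F \<zero>\<^bsub>F\<^esub> b" by blast
    show "x \<in> carrier (dual_numbers F) \<and> residue (dual_numbers F) x = \<zero>\<^bsub>F\<^esub>"
      unfolding b(2) using dual_closed[OF F F.zero_closed b(1)] residue_dual[OF F F.zero_closed b(1)] by blast
  qed
  thus ?thesis unfolding dual_numbers_local(2) a_kernel_def' by blast
qed

lemma max_ideal_pow_dual: "max_ideal_pow (dual_numbers F) 2 = {\<zero>\<^bsub>dual_numbers F\<^esub>}"
proof -
  let ?D = "dual_numbers F"
  note loc = dual_numbers_local(1)
  have "max_ideal_pow ?D 2 = max_ideal_pow ?D 1 \<cdot>\<^bsub>?D\<^esub> max_ideal ?D"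
    using max_ideal_pow_Suc[OF loc, of 1] by (simp only: numeral_2_eq_2 One_nat_def)
  also have "\<dots> = max_ideal ?D \<cdot>\<^bsub>?D\<^esub> max_ideal ?D" unfolding max_ideal_pow_1[OF loc] ..
  also have "\<dots> \<subseteq> {\<zero>\<^bsub>?D\<^esub>}"
  proof
    fix x assume "x \<in> max_ideal ?D \<cdot>\<^bsub>?D\<^esub> max_ideal ?D"
    thus "x \<in> {\<zero>\<^bsub>?D\<^esub>}"
    proof (induct rule: ideal_prod.induct)
      case (prod i j)
      then obtain b d where "b \<in> carrier F" "i = dual F \<zero>\<^bsub>F\<^esub> b" "d \<in> carrier F" "j = dual F \<zero>\<^bsub>F\<^esub> d"
        unfolding max_ideal_dual_eq by blast
      thus ?case using dual_mult[of "\<zero>\<^bsub>F\<^esub>" b "\<zero>\<^bsub>F\<^esub>" d] dual_eps_closed[OF F] by simp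
    qed simp
  qed
  finally show ?thesis
    using additive_subgroup.zero_closed[OF ideal.axioms(1)[OF max_ideal_pow_is_ideal[OF loc]], of 2] by blast
qed

lemma dual_numbers_object:
  assumes "finite (carrier F)"
  shows "coeff_object p F (dual_numbers F)"
proof -
  let ?D = "dual_numbers F"
  have sub: "carrier ?D \<subseteq> (\<lambda>(a, b). dual F a b) ` (carrier F \<times> carrier F)"
    using dual_surj[OF F] by fastforce
  have "finite (carrier ?D)" using finite_subset[OF sub] assms by simp
  hence "noetherian_ring ?D" by (rule D.finite_noetherian)
  moreover have "struct_map ?D \<in> ring_hom (witt_vectors p F) ?D"
    using ring_hom_trans[OF witt_vectors_proj[OF F.cring_axioms] dual_const_hom[OF F], of p]
    unfolding dual_numbers_simps[OF F] comp_def .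
  moreover have rd: "residue ?D (dual_const F a) = a" if "a \<in> carrier F" for a
    using residue_dual[OF F that F.zero_closed] dual_eps_closed[OF F] that by simp
  moreover have "residue ?D ` carrier ?D = carrier F"

  proof (rule equalityI)
    show "residue ?D ` carrier ?D \<subseteq> carrier F" by (rule image_subsetI) (rule res.hom_closed)
    show "carrier F \<subseteq> residue ?D ` carrier ?D" using rd dc.hom_closed by (metis image_eqI subsetI)
  qed
  moreover have "residue ?D (struct_map ?D w) = w 0" if "w \<in> carrier (witt_vectors p F)" for w
    using rd[of "w 0"] that unfolding dual_numbers_simps(6)[OF F] by (simp add: witt_vectors_def)
  ultimately show ?thesis
    unfolding coeff_object_def
    using dual_numbers_local adic_complete_nilpotent[OF dual_numbers_local(1) max_ideal_pow_dual]
      residue_dual_hom[OF F] by blast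
qed

lemma dual_numbers_infinitesimal:
  assumes "[p] \<cdot>\<^bsub>F\<^esub> \<one>\<^bsub>F\<^esub> = \<zero>\<^bsub>F\<^esub>"
  shows "infinitesimal p (dual_numbers F)"
proof -
  let ?D = "dual_numbers F"
  have "dual_const F (add_pow F n \<one>\<^bsub>F\<^esub>) = add_pow ?D n \<one>\<^bsub>?D\<^esub>" for n :: nat
  proof (induct n)
    case (Suc n)
    thus ?case using F.add.nat_pow_closed[OF F.one_closed, of n] by (simp add: add_pow_def)
  qed (simp add: add_pow_def)
  hence p1: "add_pow ?D p \<one>\<^bsub>?D\<^esub> = \<zero>\<^bsub>?D\<^esub>" using assms by (metis dc.hom_zero)
  have "add_pow ?D p x = \<zero>\<^bsub>?D\<^esub>" if "x \<in> carrier ?D" for x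
    using D.add_pow_ldistr[OF D.one_closed that, of p] that p1 by simp
  thus ?thesis unfolding infinitesimal_def using max_ideal_pow_dual by blast
qed

lemma dual_mat_closed:
  "A \<in> carrier (mat2_ring F) \<Longrightarrow> B \<in> carrier (mat2_ring F) \<Longrightarrow> dual_mat F A B \<in> carrier (mat2_ring (dual_numbers F))"
  unfolding dual_mat_def using dual_closed[OF F] by simp

lemma dual_mat_mult:
  assumes "A \<in> carrier (mat2_ring F)" "B \<in> carrier (mat2_ring F)" "C \<in> carrier (mat2_ring F)" "E \<in> carrier (mat2_ring F)"
  shows "dual_mat F A B \<otimes>\<^bsub>mat2_ring (dual_numbers F)\<^esub> dual_mat F C E =
    dual_mat F (A \<otimes>\<^bsub>mat2_ring F\<^esub> C) (A \<otimes>\<^bsub>mat2_ring F\<^esub> E \<oplus>\<^bsub>mat2_ring F\<^esub> B \<otimes>\<^bsub>mat2_ring F\<^esub> C)"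
proof -
  have *: "dual F a b \<otimes>\<^bsub>dual_numbers F\<^esub> dual F c d \<oplus>\<^bsub>dual_numbers F\<^esub> dual F a' b' \<otimes>\<^bsub>dual_numbers F\<^esub> dual F c' d' =
     dual F (a \<otimes>\<^bsub>F\<^esub> c \<oplus>\<^bsub>F\<^esub> a' \<otimes>\<^bsub>F\<^esub> c')
       ((a \<otimes>\<^bsub>F\<^esub> d \<oplus>\<^bsub>F\<^esub> a' \<otimes>\<^bsub>F\<^esub> d') \<oplus>\<^bsub>F\<^esub> (b \<otimes>\<^bsub>F\<^esub> c \<oplus>\<^bsub>F\<^esub> b' \<otimes>\<^bsub>F\<^esub> c'))"
    if "a \<in> carrier F" "b \<in> carrier F" "c \<in> carrier F" "d \<in> carrier F"
       "a' \<in> carrier F" "b' \<in> carrier F" "c' \<in> carrier F" "d' \<in> carrier F" for a b c d a' b' c' d'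
    unfolding dual_mult[OF that(1-4)] dual_mult[OF that(5-8)] using that
    by (subst dual_add) (simp_all add: F.a_ac)
  show ?thesis
    unfolding dual_mat_def mat2_ring_mult mat2_ring_add mat2.sel
    using assms by (simp only: * mat2_ring_entries)
qed

lemma dual_mat_eq_iff:
  assumes "A \<in> carrier (mat2_ring F)" "B \<in> carrier (mat2_ring F)" "C \<in> carrier (mat2_ring F)" "E \<in> carrier (mat2_ring F)"
  shows "dual_mat F A B = dual_mat F C E \<longleftrightarrow> A = C \<and> B = E"
  unfolding dual_mat_def mat2.inject
  using assms by (simp only: dual_eq_iff mat2_ring_entries) (cases A; cases B; cases C; cases E; auto)

lemma dual_mat_surj:
  assumes "Z \<in> carrier (mat2_ring (dual_numbers F))"
  shows "\<exists>A\<in>carrier (mat2_ring F). \<exists>B\<in>carrier (mat2_ring F). Z = dual_mat F A B"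
proof -
  obtain a a' where a: "a \<in> carrier F" "a' \<in> carrier F" "e11 Z = dual F a a'"
    using dual_surj[OF F mat2_ring_entries(1)[OF assms]] by blast
  obtain b b' where b: "b \<in> carrier F" "b' \<in> carrier F" "e12 Z = dual F b b'"
    using dual_surj[OF F mat2_ring_entries(2)[OF assms]] by blast
  obtain c c' where c: "c \<in> carrier F" "c' \<in> carrier F" "e21 Z = dual F c c'"
    using dual_surj[OF F mat2_ring_entries(3)[OF assms]] by blast
  obtain d d' where d: "d \<in> carrier F" "d' \<in> carrier F" "e22 Z = dual F d d'"
    using dual_surj[OF F mat2_ring_entries(4)[OF assms]] by blast
  have "Z = dual_mat F (Mat2 a b c d) (Mat2 a' b' c' d')"
    unfolding dual_mat_def using a(3) b(3) c(3) d(3) by (cases Z) simp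
  thus ?thesis using a b c d by (intro bexI[of _ "Mat2 a b c d"] bexI[of _ "Mat2 a' b' c' d'"]) simp_all
qed

lemma residue_dual_mat:
  assumes "A \<in> carrier (mat2_ring F)" "B \<in> carrier (mat2_ring F)"
  shows "map_mat2 (residue (dual_numbers F)) (dual_mat F A B) = A"
  unfolding dual_mat_def mat2.map
  using assms by (simp only: residue_dual[OF F] mat2_ring_entries mat2.collapse)

lemma homogeneous_dual_mat:
  assumes "A \<in> carrier (mat2_ring F)" "B \<in> carrier (mat2_ring F)"
    "homogeneous (dual_numbers F) s (dual_mat F A B)"
  shows "homogeneous F s B"
proof -
  have *: "b = \<zero>\<^bsub>F\<^esub>" if "a \<in> carrier F" "b \<in> carrier F" "dual F a b = \<zero>\<^bsub>dual_numbers F\<^esub>" for a b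
    using dual_inj(2)[OF F that] .
  show ?thesis
    using assms(3) *[OF mat2_ring_entries(1)[OF assms(1)] mat2_ring_entries(1)[OF assms(2)]]
      *[OF mat2_ring_entries(2)[OF assms(1)] mat2_ring_entries(2)[OF assms(2)]]
      *[OF mat2_ring_entries(3)[OF assms(1)] mat2_ring_entries(3)[OF assms(2)]]
      *[OF mat2_ring_entries(4)[OF assms(1)] mat2_ring_entries(4)[OF assms(2)]]
    unfolding homogeneous_def dual_mat_def mat2.sel by presburger
qed

text \<open>By \<open>dual_mat_mult\<close>, multiplicativity of \<rho>bar + \<epsilon> \<delta> is
  the Leibniz rule for \<delta>.\<close>

lemma dual_mat_lift:
  assumes fin: "finite (carrier F)" and rep: "representation G T F \<rho>bar" and d: "derivation G T F \<rho>bar \<delta>"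
  shows "lift_of G T \<rho>bar (dual_numbers F) (\<lambda>g. dual_mat F (\<rho>bar g) (\<delta> g))"
proof -
  let ?D = "dual_numbers F"
  \<comment> \<open>The statement does not mention \<open>p\<close>, and
    \<open>dual_numbers_object\<close> holds for every value; 0 is an arbitrary choice.\<close>
  interpret C: coefficient_ring 0 F ?D
    by (intro coefficient_ring.intro coefficient_ring_axioms.intro F dual_numbers_object fin)
  have \<rho>: "\<rho>bar \<in> hom G (GL2 F)" and cont: "mat2_continuous T F \<rho>bar"
    using rep unfolding representation_iff by auto
  have dc: "\<delta> g \<in> carrier (mat2_ring F)" if "g \<in> carrier G" for g using d that unfolding derivation_def by blast
  have r: "map_mat2 (residue ?D) (dual_mat F (\<rho>bar g) (\<delta> g)) = \<rho>bar g" if "g \<in> carrier G" for g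
    by (rule residue_dual_mat[OF rep_hom(2)[OF \<rho> that] dc[OF that]])
  have "(\<lambda>g. dual_mat F (\<rho>bar g) (\<delta> g)) \<in> hom G (GL2 ?D)"
    unfolding hom_def GL2_carrier GL2_mult
  proof (intro CollectI conjI ballI funcsetI)
    fix g assume g: "g \<in> carrier G"
    show "dual_mat F (\<rho>bar g) (\<delta> g) \<in> Units (mat2_ring ?D)"
      using C.mat_unit_iff[OF dual_mat_closed[OF rep_hom(2)[OF \<rho> g] dc[OF g]]] r[OF g] rep_hom(1)[OF \<rho> g] by simp
    fix g' assume g': "g' \<in> carrier G"
    have "\<delta> (g \<otimes>\<^bsub>G\<^esub> g') = \<rho>bar g \<otimes>\<^bsub>mat2_ring F\<^esub> \<delta> g' \<oplus>\<^bsub>mat2_ring F\<^esub> \<delta> g \<otimes>\<^bsub>mat2_ring F\<^esub> \<rho>bar g'"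
      using d g g' unfolding derivation_def by blast
    thus "dual_mat F (\<rho>bar (g \<otimes>\<^bsub>G\<^esub> g')) (\<delta> (g \<otimes>\<^bsub>G\<^esub> g')) =
      dual_mat F (\<rho>bar g) (\<delta> g) \<otimes>\<^bsub>mat2_ring ?D\<^esub> dual_mat F (\<rho>bar g') (\<delta> g')"
      using dual_mat_mult[OF rep_hom(2)[OF \<rho> g] dc[OF g] rep_hom(2)[OF \<rho> g'] dc[OF g']] rep_hom(3)[OF \<rho> g g'] by simp
  qed
  moreover have "mat2_continuous T ?D (\<lambda>g. dual_mat F (\<rho>bar g) (\<delta> g))"
  proof -
    have z: "dual_const F ` max_ideal F \<subseteq> max_ideal ?D"
      using field_local(2)[OF F] additive_subgroup.zero_closed[OF ideal.axioms(1)[OF C.max_ideal_ideal]] by simp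
    have *: "continuous_map T (adic_topology ?D) (\<lambda>g. dual F (f g) (f' g))"
      if "continuous_map T (adic_topology F) f" "continuous_map T (adic_topology F) f'" for f f'
      using that dual_eps_closed[OF F]
      by (intro continuous_map_adic_add[OF C.local_ring] continuous_map_adic_mult[OF C.local_ring]
          continuous_map_adic_const[OF C.local_ring]
          continuous_map_adic_hom[OF field_local(1)[OF F] C.local_ring dual_const_hom[OF F] z]) auto
    show ?thesis
      using cont d unfolding derivation_def mat2_continuous_def dual_mat_def mat2.sel by (intro conjI *) auto
  qed
  ultimately show ?thesis unfolding lift_of_def representation_iff using r by blast
qed

text \<open>By \<open>graded_lift_residue\<close> the grading basis may be taken as P0 + \<epsilon>
  N. The \<epsilon>-part of its intertwining relation is then the splitting. The assumption
  \<open>ne\<close> supplies the element with distinct eigenvalues that makes this choice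
  possible.\<close>

lemma dual_mat_graded_splits:
  assumes fin: "finite (carrier F)" and rep: "representation G T F \<rho>bar" and d: "derivation G T F \<rho>bar \<delta>"
    and gr: "graded G (dual_numbers F) H (\<lambda>g. dual_mat F (\<rho>bar g) (\<delta> g)) P"
    and ne: "\<And>P0. graded G F H \<rho>bar P0 \<Longrightarrow>
      \<exists>h\<in>H. e11 (conj_by (mat2_ring F) P0 (\<rho>bar h)) \<noteq> e22 (conj_by (mat2_ring F) P0 (\<rho>bar h))"
    and HG: "H \<subseteq> carrier G"
  shows "splits_along G F H \<rho>bar \<delta>"
  unfolding splits_along_def
proof (intro allI impI)
  let ?D = "dual_numbers F" and ?M = "mat2_ring F" and ?N = "mat2_ring (dual_numbers F)"
  interpret C: coefficient_ring 0 F ?D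
    by (intro coefficient_ring.intro coefficient_ring_axioms.intro F dual_numbers_object fin)
  fix P0 assume P0: "graded G F H \<rho>bar P0"
  have \<rho>: "\<rho>bar \<in> hom G (GL2 F)" using rep unfolding representation_iff by auto
  have dc: "\<delta> g \<in> carrier ?M" if "g \<in> carrier G" for g using d that unfolding derivation_def by blast
  note bc = rep_hom(2)[OF \<rho>]
  have L: "lift_of G T \<rho>bar ?D (\<lambda>g. dual_mat F (\<rho>bar g) (\<delta> g))" by (rule dual_mat_lift[OF fin rep d])
  hence \<rho>D: "(\<lambda>g. dual_mat F (\<rho>bar g) (\<delta> g)) \<in> hom G (GL2 ?D)"
    and r: "\<And>g. g \<in> carrier G \<Longrightarrow> map_mat2 (residue ?D) (dual_mat F (\<rho>bar g) (\<delta> g)) = \<rho>bar g"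
    unfolding lift_of_def representation_iff by auto
  obtain h where h: "h \<in> H" "e11 (conj_by ?M P0 (\<rho>bar h)) \<noteq> e22 (conj_by ?M P0 (\<rho>bar h))"
    using ne[OF P0] by blast
  obtain P' where P': "graded G ?D H (\<lambda>g. dual_mat F (\<rho>bar g) (\<delta> g)) P'" "map_mat2 (residue ?D) P' = P0"
    by (rule C.graded_lift_residue[OF \<rho>D \<rho> r gr P0 h(1) subsetD[OF HG h(1)] h(2)])
  have P'U: "P' \<in> Units ?N" using P'(1) unfolding graded_def by blast
  obtain A N where AN: "A \<in> carrier ?M" "N \<in> carrier ?M" "P' = dual_mat F A N"
    using dual_mat_surj[OF C.M.Units_closed[OF P'U]] by blast
  have A: "A = P0" using residue_dual_mat[OF AN(1,2)] AN(3) P'(2) by simp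
  have P0U: "P0 \<in> Units ?M" using P0 unfolding graded_def by blast
  let ?B = "\<lambda>g. conj_by ?M P0 (\<rho>bar g)"
  have Bc: "?B g \<in> carrier ?M" if "g \<in> carrier G" for g using P0U bc[OF that] by simp
  have "\<exists>S\<in>carrier ?M. conj_by ?N P' (dual_mat F (\<rho>bar g) (\<delta> g)) = dual_mat F (?B g) S" if g: "g \<in> carrier G" for g
  proof -
    let ?c = "conj_by ?N P' (dual_mat F (\<rho>bar g) (\<delta> g))"
    have mc: "dual_mat F (\<rho>bar g) (\<delta> g) \<in> carrier ?N" by (rule dual_mat_closed[OF bc[OF g] dc[OF g]])
    have "?c \<in> carrier ?N" using P'U mc by simp
    then obtain B S where BS: "B \<in> carrier ?M" "S \<in> carrier ?M" "?c = dual_mat F B S"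
      using dual_mat_surj by blast
    have "B = map_mat2 (residue ?D) ?c" unfolding BS(3) residue_dual_mat[OF BS(1,2)] ..
    also have "\<dots> = ?B g"
      using ring_hom_conj_by[OF C.M.monoid_axioms C.MF.monoid_axioms C.residue_mat_hom P'U mc] P'(2) r[OF g] by simp
    finally show ?thesis using BS by blast
  qed
  then obtain S where S: "\<And>g. g \<in> carrier G \<Longrightarrow> S g \<in> carrier ?M"
    "\<And>g. g \<in> carrier G \<Longrightarrow> conj_by ?N P' (dual_mat F (\<rho>bar g) (\<delta> g)) = dual_mat F (?B g) (S g)"
    by metis
  show "\<exists>N S. N \<in> carrier ?M \<and> (\<forall>g\<in>carrier G. S g \<in> carrier ?M \<and> homogeneous F (g \<in> H) (S g) \<and>
      N \<otimes>\<^bsub>?M\<^esub> \<rho>bar g \<oplus>\<^bsub>?M\<^esub> P0 \<otimes>\<^bsub>?M\<^esub> \<delta> g = ?B g \<otimes>\<^bsub>?M\<^esub> N \<oplus>\<^bsub>?M\<^esub> S g \<otimes>\<^bsub>?M\<^esub> P0)"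
  proof (intro exI conjI ballI)
    show "N \<in> carrier ?M" by (rule AN(2))
    fix g assume g: "g \<in> carrier G"
    show "S g \<in> carrier ?M" by (rule S(1)[OF g])
    show "homogeneous F (g \<in> H) (S g)"
    proof (rule homogeneous_dual_mat[OF Bc[OF g] S(1)[OF g]])
      show "homogeneous ?D (g \<in> H) (dual_mat F (?B g) (S g))"
        unfolding S(2)[OF g, symmetric] using P'(1) g unfolding graded_def by blast
    qed
    have mc: "dual_mat F (\<rho>bar g) (\<delta> g) \<in> carrier ?N" by (rule dual_mat_closed[OF bc[OF g] dc[OF g]])
    have "P' \<otimes>\<^bsub>?N\<^esub> dual_mat F (\<rho>bar g) (\<delta> g) = dual_mat F (?B g) (S g) \<otimes>\<^bsub>?N\<^esub> P'"
      using C.M.conj_by_swap[OF P'U mc] S(2)[OF g] by simp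
    hence eq: "dual_mat F P0 N \<otimes>\<^bsub>?N\<^esub> dual_mat F (\<rho>bar g) (\<delta> g) = dual_mat F (?B g) (S g) \<otimes>\<^bsub>?N\<^esub> dual_mat F P0 N"
      unfolding AN(3) A .
    have P0c: "P0 \<in> carrier ?M" using AN(1) A by simp
    have "P0 \<otimes>\<^bsub>?M\<^esub> \<delta> g \<oplus>\<^bsub>?M\<^esub> N \<otimes>\<^bsub>?M\<^esub> \<rho>bar g = ?B g \<otimes>\<^bsub>?M\<^esub> N \<oplus>\<^bsub>?M\<^esub> S g \<otimes>\<^bsub>?M\<^esub> P0"
      using eq unfolding dual_mat_mult[OF P0c AN(2) bc[OF g] dc[OF g]] dual_mat_mult[OF Bc[OF g] S(1)[OF g] P0c AN(2)]
      by (subst (asm) dual_mat_eq_iff) (use P0c AN(2) bc[OF g] dc[OF g] Bc[OF g] S(1)[OF g] in simp_all)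
    thus "N \<otimes>\<^bsub>?M\<^esub> \<rho>bar g \<oplus>\<^bsub>?M\<^esub> P0 \<otimes>\<^bsub>?M\<^esub> \<delta> g = ?B g \<otimes>\<^bsub>?M\<^esub> N \<oplus>\<^bsub>?M\<^esub> S g \<otimes>\<^bsub>?M\<^esub> P0"
      using P0c AN(2) bc[OF g] dc[OF g] by (simp add: C.MF.a_comm)
  qed
qed

end

section \<open>Transport of coefficient rings\<close>

context coefficient_ring
begin

text \<open>\<open>m^n\<close> is finitely generated and the residue field is finite, so
  \<open>m^n / m^(n+1)\<close> is finite. Sums of representatives lead from one power to the
  next.\<close>

lemma finite_representatives:
  assumes fin: "finite (carrier F)"
  shows "\<exists>T\<subseteq>carrier R. finite T \<and> (\<forall>x\<in>carrier R. \<exists>t\<in>T. x \<ominus>\<^bsub>R\<^esub> t \<in> max_ideal_pow R n)"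
proof (induct n)
  case 0
  show ?case
    unfolding max_ideal_pow_0[OF local_ring] by (rule exI[of _ "{\<zero>\<^bsub>R\<^esub>}"]) auto
next
  case (Suc n)
  then obtain T where T: "T \<subseteq> carrier R" "finite T" "\<forall>x\<in>carrier R. \<exists>t\<in>T. x \<ominus>\<^bsub>R\<^esub> t \<in> max_ideal_pow R n" by blast
  let ?I = "max_ideal_pow R n" and ?J = "max_ideal_pow R (Suc n)"
  interpret I: ideal ?I R by (rule max_ideal_pow_is_ideal[OF local_ring])
  interpret J: ideal ?J R by (rule max_ideal_pow_is_ideal[OF local_ring])
  have "\<forall>a\<in>carrier F. \<exists>x. x \<in> carrier R \<and> residue R x = a" using exists_lift_zero by blast
  from bchoice[OF this] obtain f where f: "\<forall>a\<in>carrier F. f a \<in> carrier R \<and> residue R (f a) = a" ..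
  have S: "\<exists>s\<in>f ` carrier F. s \<in> carrier R \<and> r \<ominus>\<^bsub>R\<^esub> s \<in> max_ideal R" if "r \<in> carrier R" for r
    using bspec[OF f res.hom_closed[OF that]] residue_eq_iff[OF that, of "f (residue R r)"] res.hom_closed[OF that]
    by auto
  \<comment> \<open>Induction over the generators. On adding a generator \<open>a\<close>, its
    coefficient \<open>r\<close> may be replaced by the chosen lift \<open>s\<close> of its residue,
    since (r - s) a lies in \<open>m^(n+1)\<close>. The ideal \<open>K\<close> is left unspecified;
    it only has to contain the generators.\<close>
  have ext: "\<exists>K B. ideal K R \<and> A \<subseteq> K \<and> ?J \<subseteq> K \<and> finite B \<and> B \<subseteq> carrier R \<and> (\<forall>x\<in>K. \<exists>b\<in>B. x \<ominus>\<^bsub>R\<^esub> b \<in> ?J)"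
    if "finite A" "A \<subseteq> ?I" for A
    using that
  proof (induct A rule: finite_induct)
    case empty
    have "x \<ominus>\<^bsub>R\<^esub> \<zero>\<^bsub>R\<^esub> \<in> ?J" if "x \<in> ?J" for x using that J.Icarr[OF that] by (simp only: R.minus_eq R.minus_zero R.r_zero)
    thus ?case using J.ideal_axioms by (intro exI[of _ ?J] exI[of _ "{\<zero>\<^bsub>R\<^esub>}"]) auto
  next
    case (insert a A)
    then obtain K B where K: "ideal K R" "A \<subseteq> K" "?J \<subseteq> K" and B: "finite B" "B \<subseteq> carrier R"
      "\<forall>x\<in>K. \<exists>b\<in>B. x \<ominus>\<^bsub>R\<^esub> b \<in> ?J" by blast
    interpret K: ideal K R by (rule K(1))
    have aI: "a \<in> ?I" using insert by blast
    have ac: "a \<in> carrier R" using I.Icarr[OF aI] .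
    let ?K = "K <+>\<^bsub>R\<^esub> PIdl\<^bsub>R\<^esub> a"
    let ?B = "(\<lambda>(b, s). b \<oplus>\<^bsub>R\<^esub> s \<otimes>\<^bsub>R\<^esub> a) ` (B \<times> (f ` carrier F))"
    have el: "k \<in> ?K \<longleftrightarrow> (\<exists>q\<in>K. \<exists>r\<in>carrier R. k = q \<oplus>\<^bsub>R\<^esub> r \<otimes>\<^bsub>R\<^esub> a)" for k
      unfolding set_add_def' cgenideal_def by blast
    have KK: "K \<subseteq> ?K"
    proof
      fix q assume q: "q \<in> K"
      have "q = q \<oplus>\<^bsub>R\<^esub> \<zero>\<^bsub>R\<^esub> \<otimes>\<^bsub>R\<^esub> a" using ac K.Icarr[OF q] by simp
      thus "q \<in> ?K" unfolding el using q R.zero_closed by blast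
    qed
    have "a = \<zero>\<^bsub>R\<^esub> \<oplus>\<^bsub>R\<^esub> \<one>\<^bsub>R\<^esub> \<otimes>\<^bsub>R\<^esub> a" using ac by simp
    hence "a \<in> ?K" unfolding el using K.zero_closed R.one_closed by blast
    moreover have "\<exists>b\<in>?B. x \<ominus>\<^bsub>R\<^esub> b \<in> ?J" if x: "x \<in> ?K" for x
    proof -
      obtain q r where qr: "q \<in> K" "r \<in> carrier R" "x = q \<oplus>\<^bsub>R\<^esub> r \<otimes>\<^bsub>R\<^esub> a" using x unfolding el by blast
      obtain b where b: "b \<in> B" "q \<ominus>\<^bsub>R\<^esub> b \<in> ?J" using B(3) qr(1) by blast
      obtain s where s: "s \<in> f ` carrier F" "s \<in> carrier R" "r \<ominus>\<^bsub>R\<^esub> s \<in> max_ideal R" using S[OF qr(2)] by blast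
      have bc: "b \<in> carrier R" using b(1) B(2) by blast
      have "x \<ominus>\<^bsub>R\<^esub> (b \<oplus>\<^bsub>R\<^esub> s \<otimes>\<^bsub>R\<^esub> a) = (q \<ominus>\<^bsub>R\<^esub> b) \<oplus>\<^bsub>R\<^esub> (r \<ominus>\<^bsub>R\<^esub> s) \<otimes>\<^bsub>R\<^esub> a"
        unfolding qr(3) using K.Icarr[OF qr(1)] qr(2) s(2) bc ac by algebra
      moreover have "(r \<ominus>\<^bsub>R\<^esub> s) \<otimes>\<^bsub>R\<^esub> a \<in> max_ideal_pow R (1 + n)"
        by (rule max_ideal_pow_prod[OF local_ring _ aI]) (simp only: max_ideal_pow_1[OF local_ring] s(3))
      ultimately have "x \<ominus>\<^bsub>R\<^esub> (b \<oplus>\<^bsub>R\<^esub> s \<otimes>\<^bsub>R\<^esub> a) \<in> ?J" using J.a_closed[OF b(2)] by simp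
      moreover have "b \<oplus>\<^bsub>R\<^esub> s \<otimes>\<^bsub>R\<^esub> a \<in> ?B" using b(1) s(1) by force
      ultimately show ?thesis by blast
    qed
    moreover have "finite ?B" using B(1) fin by simp
    moreover have "?B \<subseteq> carrier R" using B(2) f ac by auto
    moreover have "ideal ?K R" by (rule R.add_ideals[OF K(1) R.cgenideal_ideal[OF ac]])
    moreover have "insert a A \<subseteq> ?K" using K(2) KK calculation(1) by blast
    moreover have "?J \<subseteq> ?K" using K(3) KK by blast
    ultimately show ?case by meson
  qed
  obtain A where A: "A \<subseteq> carrier R" "finite A" "?I = Idl\<^bsub>R\<^esub> A"
    using R.finetely_gen[OF I.ideal_axioms] by blast
  have "A \<subseteq> ?I" using R.genideal_self[OF A(1)] A(3) by simp
  then obtain K B where K: "ideal K R" "A \<subseteq> K" and B: "finite B" "B \<subseteq> carrier R"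
    "\<forall>x\<in>K. \<exists>b\<in>B. x \<ominus>\<^bsub>R\<^esub> b \<in> ?J" using ext[OF A(2)] by meson
  have IK: "?I \<subseteq> K" using R.genideal_minimal[OF K] A(3) by simp
  let ?T = "(\<lambda>(t, b). t \<oplus>\<^bsub>R\<^esub> b) ` (T \<times> B)"
  have "\<exists>u\<in>?T. x \<ominus>\<^bsub>R\<^esub> u \<in> ?J" if x: "x \<in> carrier R" for x
  proof -
    obtain t where t: "t \<in> T" "x \<ominus>\<^bsub>R\<^esub> t \<in> ?I" using T(3) x by blast
    obtain b where b: "b \<in> B" "(x \<ominus>\<^bsub>R\<^esub> t) \<ominus>\<^bsub>R\<^esub> b \<in> ?J" using B(3) t(2) IK by blast
    have c: "t \<in> carrier R" "b \<in> carrier R" using t(1) b(1) T(1) B(2) by auto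
    have "x \<ominus>\<^bsub>R\<^esub> (t \<oplus>\<^bsub>R\<^esub> b) = (x \<ominus>\<^bsub>R\<^esub> t) \<ominus>\<^bsub>R\<^esub> b" using x c by algebra
    hence "x \<ominus>\<^bsub>R\<^esub> (t \<oplus>\<^bsub>R\<^esub> b) \<in> ?J" using b(2) by simp
    moreover have "t \<oplus>\<^bsub>R\<^esub> b \<in> ?T" using t(1) b(1) by force
    ultimately show ?thesis by blast
  qed
  moreover have "finite ?T" "?T \<subseteq> carrier R" using T(1,2) B(1,2) by auto
  ultimately show ?case by meson
qed

text \<open>An element is encoded by the graph of the sequence of its chosen representatives modulo
  \<open>m^n\<close>, numbered by naturals. Equal codes mean congruence modulo every power, hence
  equality.\<close>

lemma exists_injection_nat_set:
  assumes fin: "finite (carrier F)"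
  shows "\<exists>j :: 'r \<Rightarrow> nat set. inj_on j (carrier R)"
proof -
  have "\<forall>n. \<exists>T. T \<subseteq> carrier R \<and> finite T \<and> (\<forall>x\<in>carrier R. \<exists>t\<in>T. x \<ominus>\<^bsub>R\<^esub> t \<in> max_ideal_pow R n)"
    using finite_representatives[OF fin] by blast
  then obtain T where T: "\<And>n. T n \<subseteq> carrier R" "\<And>n. finite (T n)"
    "\<And>n x. x \<in> carrier R \<Longrightarrow> \<exists>t\<in>T n. x \<ominus>\<^bsub>R\<^esub> t \<in> max_ideal_pow R n" by metis
  define r where "r n x = (SOME t. t \<in> T n \<and> x \<ominus>\<^bsub>R\<^esub> t \<in> max_ideal_pow R n)" for n x
  have r: "r n x \<in> T n \<and> x \<ominus>\<^bsub>R\<^esub> r n x \<in> max_ideal_pow R n" if "x \<in> carrier R" for n x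
    unfolding r_def by (rule someI_ex) (use T(3)[OF that] in blast)
  have cnt: "countable (\<Union>n. T n)" using T(2) by (simp add: countable_finite)
  define e where "e = to_nat_on (\<Union>n. T n)"
  have e: "inj_on e (\<Union>n. T n)" unfolding e_def using cnt by (rule inj_on_to_nat_on)
  define j where "j x = range (\<lambda>n. prod_encode (n, e (r n x)))" for x
  have "inj_on j (carrier R)"
  proof (rule inj_onI)
    fix x y assume x: "x \<in> carrier R" and y: "y \<in> carrier R" and eq: "j x = j y"
    have "x \<ominus>\<^bsub>R\<^esub> y \<in> max_ideal_pow R n" for n
    proof -
      interpret I: ideal "max_ideal_pow R n" R by (rule max_ideal_pow_is_ideal[OF local_ring])
      have "prod_encode (n, e (r n x)) \<in> j x" unfolding j_def by blast
      hence "prod_encode (n, e (r n x)) \<in> j y" using eq by simp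
      hence "e (r n x) = e (r n y)" unfolding j_def by (auto dest: inj_onD[OF inj_prod_encode])
      hence same: "r n x = r n y" using inj_onD[OF e] r[OF x, of n] r[OF y, of n] by blast
      have c: "r n x \<in> carrier R" using r[OF x, of n] T(1) by blast
      have "x \<ominus>\<^bsub>R\<^esub> y = (x \<ominus>\<^bsub>R\<^esub> r n x) \<oplus>\<^bsub>R\<^esub> \<ominus>\<^bsub>R\<^esub> (y \<ominus>\<^bsub>R\<^esub> r n x)" using x y c by algebra
      thus ?thesis using r[OF x, of n] r[OF y, of n] same I.a_closed I.a_inv_closed by simp
    qed
    hence "x \<ominus>\<^bsub>R\<^esub> y = \<zero>\<^bsub>R\<^esub>" by (rule max_ideal_pow_inter_zero)
    thus "x = y" using x y by simp
  qed
  thus ?thesis by blast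
qed

end

definition copy_coeff_ring :: "('r \<Rightarrow> 's) \<Rightarrow> ('f, 'r) coeff_ring \<Rightarrow> ('f, 's) coeff_ring" where
  "copy_coeff_ring j R =
     (let k = inv_into (carrier R) j in
     \<lparr> carrier = j ` carrier R, mult = (\<lambda>x y. j (k x \<otimes>\<^bsub>R\<^esub> k y)), one = j \<one>\<^bsub>R\<^esub>,
       zero = j \<zero>\<^bsub>R\<^esub>, add = (\<lambda>x y. j (k x \<oplus>\<^bsub>R\<^esub> k y)),
       struct_map = (\<lambda>w. j (struct_map R w)), residue = (\<lambda>x. residue R (k x)) \<rparr>)"

section \<open>Transport of structure along an injection\<close>

context coefficient_ring
begin

context
  fixes j :: "'r \<Rightarrow> 's"
  assumes inj: "inj_on j (carrier R)"
begin

private abbreviation "C \<equiv> copy_coeff_ring j R"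
private abbreviation "k \<equiv> inv_into (carrier R) j"

lemma copy_simps:
  "carrier C = j ` carrier R" "one C = j \<one>\<^bsub>R\<^esub>" "zero C = j \<zero>\<^bsub>R\<^esub>"
  "x \<in> carrier R \<Longrightarrow> y \<in> carrier R \<Longrightarrow> j x \<otimes>\<^bsub>C\<^esub> j y = j (x \<otimes>\<^bsub>R\<^esub> y)"
  "x \<in> carrier R \<Longrightarrow> y \<in> carrier R \<Longrightarrow> j x \<oplus>\<^bsub>C\<^esub> j y = j (x \<oplus>\<^bsub>R\<^esub> y)"
  "struct_map C w = j (struct_map R w)" "x \<in> carrier R \<Longrightarrow> residue C (j x) = residue R x"
  unfolding copy_coeff_ring_def Let_def using inj by simp_all

lemma copy_cring: "cring C"
proof (intro cringI abelian_groupI comm_monoidI)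
  fix x y z assume "x \<in> carrier C" "y \<in> carrier C" "z \<in> carrier C"
  then obtain a b c where "a \<in> carrier R" "b \<in> carrier R" "c \<in> carrier R" "x = j a" "y = j b" "z = j c"
    unfolding copy_simps by blast
  thus "x \<oplus>\<^bsub>C\<^esub> y \<oplus>\<^bsub>C\<^esub> z = x \<oplus>\<^bsub>C\<^esub> (y \<oplus>\<^bsub>C\<^esub> z)" "x \<otimes>\<^bsub>C\<^esub> y \<otimes>\<^bsub>C\<^esub> z = x \<otimes>\<^bsub>C\<^esub> (y \<otimes>\<^bsub>C\<^esub> z)"
    "(x \<oplus>\<^bsub>C\<^esub> y) \<otimes>\<^bsub>C\<^esub> z = x \<otimes>\<^bsub>C\<^esub> z \<oplus>\<^bsub>C\<^esub> y \<otimes>\<^bsub>C\<^esub> z"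
    by (simp_all add: copy_simps R.a_assoc R.m_assoc R.l_distr)
next
  fix x y assume "x \<in> carrier C" "y \<in> carrier C"
  then obtain a b where ab: "a \<in> carrier R" "b \<in> carrier R" "x = j a" "y = j b"
    unfolding copy_simps by blast
  thus "x \<oplus>\<^bsub>C\<^esub> y \<in> carrier C" "x \<otimes>\<^bsub>C\<^esub> y \<in> carrier C" "x \<oplus>\<^bsub>C\<^esub> y = y \<oplus>\<^bsub>C\<^esub> x" "x \<otimes>\<^bsub>C\<^esub> y = y \<otimes>\<^bsub>C\<^esub> x"
    by (simp_all add: copy_simps R.a_comm R.m_comm)
next
  fix x assume "x \<in> carrier C"
  then obtain a where a: "a \<in> carrier R" "x = j a" unfolding copy_simps by blast
  thus "\<zero>\<^bsub>C\<^esub> \<oplus>\<^bsub>C\<^esub> x = x" "\<one>\<^bsub>C\<^esub> \<otimes>\<^bsub>C\<^esub> x = x" by (simp_all add: copy_simps)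
  show "\<exists>y\<in>carrier C. y \<oplus>\<^bsub>C\<^esub> x = \<zero>\<^bsub>C\<^esub>"
    using a by (intro bexI[of _ "j (\<ominus>\<^bsub>R\<^esub> a)"]) (simp_all add: copy_simps R.l_neg)
qed (simp_all add: copy_simps)

interpretation C: cring C by (rule copy_cring)

lemma copy_hom: "j \<in> ring_hom R C"
  by (rule ring_hom_memI) (simp_all add: copy_simps)

lemma copy_inv_hom: "k \<in> ring_hom C R"
proof (rule ring_hom_memI)
  fix x y assume "x \<in> carrier C" "y \<in> carrier C"
  then obtain a b where ab: "a \<in> carrier R" "b \<in> carrier R" "x = j a" "y = j b"
    unfolding copy_simps by blast
  thus "k x \<in> carrier R" "k (x \<otimes>\<^bsub>C\<^esub> y) = k x \<otimes>\<^bsub>R\<^esub> k y" "k (x \<oplus>\<^bsub>C\<^esub> y) = k x \<oplus>\<^bsub>R\<^esub> k y"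
    using inj by (simp_all add: copy_simps)
qed (use inj in \<open>simp add: copy_simps\<close>)

lemma copy_inv [simp]: "x \<in> carrier R \<Longrightarrow> k (j x) = x" "y \<in> carrier C \<Longrightarrow> j (k y) = y"
  using inj by (simp_all add: copy_simps f_inv_into_f)

lemma copy_residue_hom: "residue C \<in> ring_hom C F"
proof -
  have "residue C = residue R \<circ> k" unfolding copy_coeff_ring_def Let_def by auto
  thus ?thesis using ring_hom_trans[OF copy_inv_hom residue_hom] by simp
qed

lemma copy_local:
  "local_ring C" "max_ideal C = a_kernel C F (residue C)"
proof -
  have "ideal (a_kernel C F (residue C)) C"
    by (rule ring_hom_ring.kernel_is_ideal[OF ring_hom_ringI2[OF C.ring_axioms F.ring_axioms copy_residue_hom]])
  moreover have "\<one>\<^bsub>C\<^esub> \<notin> a_kernel C F (residue C)"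
    using ring_hom_one[OF copy_residue_hom] unfolding a_kernel_def' by auto
  moreover have "x \<in> Units C" if x: "x \<in> carrier C" "x \<notin> a_kernel C F (residue C)" for x
  proof -
    obtain a where a: "a \<in> carrier R" "x = j a" using x(1) unfolding copy_simps by blast
    have "residue R a \<noteq> \<zero>\<^bsub>F\<^esub>" using x a copy_simps(7)[OF a(1)] unfolding a_kernel_def' by auto
    hence "a \<in> Units R" using unit_iff[OF a(1)] by simp
    thus ?thesis unfolding a(2) by (rule ring_hom_inv(1)[OF R.monoid_axioms C.monoid_axioms copy_hom])
  qed
  ultimately show "local_ring C" "max_ideal C = a_kernel C F (residue C)"
    using local_ring_by_units[OF copy_cring] by blast+
qed

lemma copy_max_ideal: "j ` max_ideal R \<subseteq> max_ideal C" "k ` max_ideal C \<subseteq> max_ideal R"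
proof -
  show "j ` max_ideal R \<subseteq> max_ideal C"
    unfolding copy_local(2) a_kernel_def' using ideal.Icarr[OF max_ideal_ideal]
    by (auto simp: copy_simps)
  show "k ` max_ideal C \<subseteq> max_ideal R"
  proof
    fix z assume "z \<in> k ` max_ideal C"
    then obtain y where y: "y \<in> carrier C" "residue C y = \<zero>\<^bsub>F\<^esub>" "z = k y"
      unfolding copy_local(2) a_kernel_def' by blast
    obtain a where a: "a \<in> carrier R" "y = j a" using y(1) unfolding copy_simps by blast
    show "z \<in> max_ideal R" using y a residue_eq_0_iff[OF a(1)] by (simp add: copy_simps)
  qed
qed

lemma copy_noetherian: "noetherian_ring C"
proof (rule C.noetherian_ringI)
  fix I assume I: "ideal I C"
  interpret jh: ring_hom_ring R C j by (rule ring_hom_ringI2[OF R.ring_axioms C.ring_axioms copy_hom])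
  have vi: "ideal {r \<in> carrier R. j r \<in> K} R" if "ideal K C" for K by (rule jh.ideal_vimage[OF that])
  obtain A where A: "A \<subseteq> carrier R" "finite A" "{r \<in> carrier R. j r \<in> I} = Idl\<^bsub>R\<^esub> A"
    using R.finetely_gen[OF vi[OF I]] by blast
  have jA: "j ` A \<subseteq> carrier C" using A(1) by (auto simp: copy_simps)
  have "I = Idl\<^bsub>C\<^esub> (j ` A)"
  proof
    have "j ` A \<subseteq> I" using R.genideal_self[OF A(1)] A(3) by blast
    thus "Idl\<^bsub>C\<^esub> (j ` A) \<subseteq> I" by (rule C.genideal_minimal[OF I])
    have "A \<subseteq> {r \<in> carrier R. j r \<in> Idl\<^bsub>C\<^esub> (j ` A)}" using A(1) C.genideal_self[OF jA] by blast
    hence sub: "Idl\<^bsub>R\<^esub> A \<subseteq> {r \<in> carrier R. j r \<in> Idl\<^bsub>C\<^esub> (j ` A)}"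
      by (rule R.genideal_minimal[OF vi[OF C.genideal_ideal[OF jA]]])
    show "I \<subseteq> Idl\<^bsub>C\<^esub> (j ` A)"
    proof
      fix x assume x: "x \<in> I"
      then obtain a where a: "a \<in> carrier R" "x = j a" using ideal.Icarr[OF I x] unfolding copy_simps by blast
      thus "x \<in> Idl\<^bsub>C\<^esub> (j ` A)" using x A(3) sub by blast
    qed
  qed
  thus "\<exists>A\<subseteq>carrier C. finite A \<and> I = Idl\<^bsub>C\<^esub> A" using jA A(2) by blast
qed

lemma copy_adic_complete: "adic_complete C"
proof -
  note jm = hom_max_ideal_pow[OF local_ring copy_local(1) copy_hom copy_max_ideal(1)]
  note km = hom_max_ideal_pow[OF copy_local(1) local_ring copy_inv_hom copy_max_ideal(2)]
  interpret kh: ring_hom_cring C R k by unfold_locales (rule copy_inv_hom)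
  interpret jh: ring_hom_cring R C j by unfold_locales (rule copy_hom)
  have mc: "x \<in> carrier C" if "x \<in> max_ideal_pow C n" for x n
    using ideal.Icarr[OF max_ideal_pow_is_ideal[OF copy_local(1)] that] .
  have "(\<Inter>n. max_ideal_pow C n) = {\<zero>\<^bsub>C\<^esub>}"
  proof
    show "(\<Inter>n. max_ideal_pow C n) \<subseteq> {\<zero>\<^bsub>C\<^esub>}"
    proof
      fix x assume x: "x \<in> (\<Inter>n. max_ideal_pow C n)"
      have "k x \<in> max_ideal_pow R n" for n using x km by blast
      hence "k x = \<zero>\<^bsub>R\<^esub>" by (rule max_ideal_pow_inter_zero)
      moreover have "x \<in> max_ideal_pow C 0" using x by blast
      hence "j (k x) = x" by (rule copy_inv(2)[OF mc])
      ultimately show "x \<in> {\<zero>\<^bsub>C\<^esub>}" using copy_simps(3) by (metis singletonI)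
    qed
    show "{\<zero>\<^bsub>C\<^esub>} \<subseteq> (\<Inter>n. max_ideal_pow C n)"
      using additive_subgroup.zero_closed[OF ideal.axioms(1)[OF max_ideal_pow_is_ideal[OF copy_local(1)]]] by blast
  qed
  moreover have "\<exists>y\<in>carrier C. \<forall>n. y \<ominus>\<^bsub>C\<^esub> x n \<in> max_ideal_pow C n"
    if x: "\<forall>n. x n \<in> carrier C \<and> x (Suc n) \<ominus>\<^bsub>C\<^esub> x n \<in> max_ideal_pow C n" for x
  proof -
    have c: "x n \<in> carrier C" for n using x by blast
    have "k (x (Suc n)) \<ominus>\<^bsub>R\<^esub> k (x n) \<in> max_ideal_pow R n" for n
    proof -
      have "k (x (Suc n) \<ominus>\<^bsub>C\<^esub> x n) \<in> max_ideal_pow R n" using x km by blast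
      thus ?thesis using kh.hom_sub[OF c c] by simp
    qed
    then obtain y where y: "y \<in> carrier R" "\<And>n. y \<ominus>\<^bsub>R\<^esub> k (x n) \<in> max_ideal_pow R n"
      using obtain_limit[of "\<lambda>n. k (x n)"] kh.hom_closed[OF c] by blast
    have "j y \<ominus>\<^bsub>C\<^esub> x n \<in> max_ideal_pow C n" for n
    proof -
      have "j (y \<ominus>\<^bsub>R\<^esub> k (x n)) \<in> max_ideal_pow C n" using jm[OF y(2)] .
      thus ?thesis using jh.hom_sub[OF y(1) kh.hom_closed[OF c]] copy_inv(2)[OF c] by simp
    qed
    thus ?thesis using y(1) jh.hom_closed by blast
  qed
  ultimately show ?thesis unfolding adic_complete_def by blast
qed

lemma copy_object: "coeff_object p F C"
proof -
  have o: "struct_map R \<in> ring_hom (witt_vectors p F) R" "residue R ` carrier R = carrier F"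
    "\<And>w. w \<in> carrier (witt_vectors p F) \<Longrightarrow> residue R (struct_map R w) = w 0"
    using object unfolding coeff_object_def by blast+
  have "struct_map C = j \<circ> struct_map R" by (auto simp: copy_simps)
  hence "struct_map C \<in> ring_hom (witt_vectors p F) C" using ring_hom_trans[OF o(1) copy_hom] by simp
  moreover have "residue C ` carrier C = carrier F"
    unfolding copy_simps(1) image_image using o(2) by (simp add: copy_simps cong: image_cong_simp)
  moreover have "residue C (struct_map C w) = w 0" if w: "w \<in> carrier (witt_vectors p F)" for w
    using o(3)[OF w] ring_hom_closed[OF o(1) w] by (simp add: copy_simps)
  ultimately show ?thesis
    unfolding coeff_object_def
    using copy_local copy_noetherian copy_adic_complete copy_residue_hom by blast
qed

lemma copy_coeff_hom:
  "restrict j (carrier R) \<in> coeff_hom p F R C" "restrict k (carrier C) \<in> coeff_hom p F C R"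
proof -
  have o: "struct_map R \<in> ring_hom (witt_vectors p F) R"
    using object unfolding coeff_object_def by blast+
  have sc: "struct_map R w \<in> carrier R" if "w \<in> carrier (witt_vectors p F)" for w
    using ring_hom_closed[OF o that] .
  have r: "restrict f (carrier A) \<in> ring_hom A B" if "f \<in> ring_hom A B" "cring A"
    for f :: "'x \<Rightarrow> 'y" and A :: "('x, 'z) ring_scheme" and B :: "('y, 'w) ring_scheme"
  proof -
    interpret A: cring A by (rule that(2))
    show ?thesis using that(1) by (auto simp: ring_hom_def)
  qed
  have m: "\<And>x. x \<in> max_ideal R \<Longrightarrow> x \<in> carrier R" "\<And>x. x \<in> max_ideal C \<Longrightarrow> x \<in> carrier C"
    using ideal.Icarr[OF max_ideal_ideal] ideal.Icarr[OF local_ring_max_ideal_is_ideal[OF copy_local(1)]] by blast+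
  show "restrict j (carrier R) \<in> coeff_hom p F R C"
    unfolding coeff_hom_def using r[OF copy_hom R.cring_axioms] copy_max_ideal(1) m sc
    by (auto simp: copy_simps)
  show "restrict k (carrier C) \<in> coeff_hom p F C R"
    unfolding coeff_hom_def using r[OF copy_inv_hom copy_cring] copy_max_ideal(2) m sc
    by (auto simp: copy_simps inv_into_f_f[OF inj])
qed

end

text \<open>The universal properties range over carriers of type \<open>nat set\<close>. Such copies
  make them available for the dual numbers and for the universal rings themselves, whose carriers
  have other types.\<close>

lemma obtain_nat_set_copy:
  assumes "finite (carrier F)"
  obtains C :: "('f, nat set) coeff_ring" and j k
  where "coeff_object p F C" "j \<in> coeff_hom p F R C" "k \<in> coeff_hom p F C R"
    "\<forall>x\<in>carrier R. k (j x) = x" "\<forall>y\<in>carrier C. j (k y) = y"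
proof -
  obtain j :: "'r \<Rightarrow> nat set" where j: "inj_on j (carrier R)"
    using exists_injection_nat_set[OF assms] by blast
  let ?C = "copy_coeff_ring j R" and ?k = "inv_into (carrier R) j"
  note h = copy_hom[OF j] copy_inv_hom[OF j] copy_inv[OF j] copy_object[OF j] copy_coeff_hom[OF j]
  show ?thesis
    by (rule that[OF h(5-7)]) (use h(3,4) ring_hom_closed[OF h(1)] ring_hom_closed[OF h(2)] in auto)
qed

end

section \<open>Homomorphisms of coefficient rings and deformations\<close>

lemma coeff_homD:
  assumes "\<phi> \<in> coeff_hom p F R S"
  shows "\<phi> \<in> ring_hom R S" "\<phi> ` max_ideal R \<subseteq> max_ideal S" "\<phi> \<in> extensional (carrier R)"
    "\<And>w. w \<in> carrier (witt_vectors p F) \<Longrightarrow> \<phi> (struct_map R w) = struct_map S w"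
  using assms unfolding coeff_hom_def by auto

lemma coeff_hom_ext:
  assumes "\<phi> \<in> coeff_hom p F R S" "\<psi> \<in> coeff_hom p F R S" "\<And>x. x \<in> carrier R \<Longrightarrow> \<phi> x = \<psi> x"
  shows "\<phi> = \<psi>"
  using coeff_homD(3)[OF assms(1)] coeff_homD(3)[OF assms(2)] assms(3) by (rule extensionalityI)

text \<open>Every residue class contains the image of a Witt vector, and homomorphisms of algebras
  respect these images.\<close>

lemma coeff_hom_residue:
  assumes "coefficient_ring p F R" "coefficient_ring p F S" "\<phi> \<in> coeff_hom p F R S" "x \<in> carrier R"
  shows "residue S (\<phi> x) = residue R x"
proof -
  interpret R: coefficient_ring p F R by fact
  interpret S: coefficient_ring p F S by fact
  \<comment> \<open>The Teichmueller representative of the residue of \<open>x\<close>.\<close>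
  let ?w = "\<lambda>n::nat. if n = 0 then residue R x else \<zero>\<^bsub>F\<^esub>"
  have w: "?w \<in> carrier (witt_vectors p F)" using assms(4) by (simp add: witt_vectors_def)
  have sR: "struct_map R \<in> ring_hom (witt_vectors p F) R" "residue R (struct_map R ?w) = residue R x"
    using R.object w unfolding coeff_object_def by auto
  have sS: "struct_map S \<in> ring_hom (witt_vectors p F) S" "residue S (struct_map S ?w) = residue R x"
    using S.object w unfolding coeff_object_def by auto
  have c: "struct_map R ?w \<in> carrier R" "struct_map S ?w \<in> carrier S"
    using ring_hom_closed[OF sR(1) w] ring_hom_closed[OF sS(1) w] by auto
  interpret h: ring_hom_cring R S \<phi> by unfold_locales (rule coeff_homD(1)[OF assms(3)])
  have "x \<ominus>\<^bsub>R\<^esub> struct_map R ?w \<in> max_ideal R" using R.residue_eq_iff[OF assms(4) c(1)] sR(2) by simp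
  hence "\<phi> (x \<ominus>\<^bsub>R\<^esub> struct_map R ?w) \<in> max_ideal S" using coeff_homD(2)[OF assms(3)] by blast
  hence "\<phi> x \<ominus>\<^bsub>S\<^esub> struct_map S ?w \<in> max_ideal S"
    using h.hom_sub[OF assms(4) c(1)] coeff_homD(4)[OF assms(3) w] by simp
  thus ?thesis using S.residue_eq_iff[OF h.hom_closed[OF assms(4)] c(2)] sS(2) by simp
qed

lemma coeff_hom_comp:
  assumes "coefficient_ring p F R" "\<phi> \<in> coeff_hom p F R S" "\<psi> \<in> coeff_hom p F S Q"
  shows "compose (carrier R) \<psi> \<phi> \<in> coeff_hom p F R Q"
proof -
  interpret R: coefficient_ring p F R by fact
  have sR: "struct_map R \<in> ring_hom (witt_vectors p F) R"
    using R.object unfolding coeff_object_def by auto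
  note D = coeff_homD[OF assms(2)] and E = coeff_homD[OF assms(3)]
  have m: "x \<in> carrier R" if "x \<in> max_ideal R" for x using ideal.Icarr[OF R.max_ideal_ideal that] .
  have "compose (carrier R) \<psi> \<phi> \<in> ring_hom R Q"
    using D(1) E(1) by (auto simp: ring_hom_def compose_def Pi_iff)
  moreover have "compose (carrier R) \<psi> \<phi> ` max_ideal R \<subseteq> max_ideal Q"
    using D(2) E(2) m by (auto simp: compose_def)
  ultimately show ?thesis
    unfolding coeff_hom_def using ring_hom_closed[OF sR] D(4) E(4) by (auto simp: compose_def)
qed

lemma coeff_hom_id:
  assumes "coefficient_ring p F R"
  shows "restrict (\<lambda>x. x) (carrier R) \<in> coeff_hom p F R R"
proof -
  interpret R: coefficient_ring p F R by fact
  have sR: "struct_map R \<in> ring_hom (witt_vectors p F) R"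
    using R.object unfolding coeff_object_def by auto
  have m: "x \<in> carrier R" if "x \<in> max_ideal R" for x using ideal.Icarr[OF R.max_ideal_ideal that] .
  show ?thesis
    unfolding coeff_hom_def using ring_hom_closed[OF sR] m by (auto simp: ring_hom_def)
qed

lemma map_mat2_compose:
  "A \<in> carrier (mat2_ring R) \<Longrightarrow> map_mat2 (compose (carrier R) \<psi> \<phi>) A = map_mat2 \<psi> (map_mat2 \<phi> A)"
  by (intro mat2.expand) (simp add: compose_def)

lemma lift_of_hom:
  assumes "coefficient_ring p F R" "coefficient_ring p F S" "\<phi> \<in> coeff_hom p F R S" "lift_of G T \<rho>bar R \<rho>"
  shows "lift_of G T \<rho>bar S (\<lambda>g. map_mat2 \<phi> (\<rho> g))"
proof -
  interpret R: coefficient_ring p F R by fact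
  interpret S: coefficient_ring p F S by fact
  have \<rho>: "\<rho> \<in> hom G (GL2 R)" "mat2_continuous T R \<rho>"
    and l: "\<And>g. g \<in> carrier G \<Longrightarrow> map_mat2 (residue R) (\<rho> g) = \<rho>bar g"
    using assms(4) unfolding lift_of_def representation_iff by auto
  have "map_mat2 (residue S) (map_mat2 \<phi> (\<rho> g)) = \<rho>bar g" if g: "g \<in> carrier G" for g
  proof -
    have "map_mat2 (residue S) (map_mat2 \<phi> (\<rho> g)) = map_mat2 (residue R) (\<rho> g)"
      using coeff_hom_residue[OF assms(1-3)] rep_hom(2)[OF \<rho>(1) g] by (intro mat2.expand) simp
    thus ?thesis using l[OF g] by simp
  qed
  thus ?thesis
    unfolding lift_of_def representation_iff
    using rep_hom_map[OF R.R.cring_axioms S.R.cring_axioms coeff_homD(1)[OF assms(3)] \<rho>(1)]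
      mat2_continuous_hom[OF R.local_ring S.local_ring coeff_homD(1,2)[OF assms(3)] \<rho>(2)] by blast
qed

lemma (in coefficient_ring) strictly_equivalent_iff:
  "strictly_equivalent G F R \<rho> \<rho>' \<longleftrightarrow>
     (\<exists>A\<in>Units (mat2_ring R). map_mat2 (residue R) A = \<one>\<^bsub>mat2_ring F\<^esub> \<and>
        (\<forall>g\<in>carrier G. \<rho>' g = conj_by (mat2_ring R) A (\<rho> g)))"
  unfolding strictly_equivalent_def GL2_carrier GL2_one conj_by_def
  by (auto simp: GL2_mult R.GL2_inv)

lemma (in coefficient_ring) strictly_equivalent_trans:
  assumes "\<And>g. g \<in> carrier G \<Longrightarrow> \<rho> g \<in> carrier (mat2_ring R)"
    "strictly_equivalent G F R \<rho> \<rho>'" "strictly_equivalent G F R \<rho>' \<rho>''"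
  shows "strictly_equivalent G F R \<rho> \<rho>''"
proof -
  obtain A where A: "A \<in> Units (mat2_ring R)" "map_mat2 (residue R) A = \<one>\<^bsub>mat2_ring F\<^esub>"
    "\<forall>g\<in>carrier G. \<rho>' g = conj_by (mat2_ring R) A (\<rho> g)" using assms(2) unfolding strictly_equivalent_iff by blast
  obtain B where B: "B \<in> Units (mat2_ring R)" "map_mat2 (residue R) B = \<one>\<^bsub>mat2_ring F\<^esub>"
    "\<forall>g\<in>carrier G. \<rho>'' g = conj_by (mat2_ring R) B (\<rho>' g)" using assms(3) unfolding strictly_equivalent_iff by blast
  show ?thesis
    unfolding strictly_equivalent_iff
    using A B assms(1) M.Units_closed[OF A(1)] M.Units_closed[OF B(1)]
    by (intro bexI[of _ "B \<otimes>\<^bsub>mat2_ring R\<^esub> A"]) (auto simp: M.conj_by_conj_by)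
qed

lemma (in coefficient_ring) strictly_equivalent_refl:
  assumes "\<And>g. g \<in> carrier G \<Longrightarrow> \<rho> g \<in> carrier (mat2_ring R)" "\<And>g. g \<in> carrier G \<Longrightarrow> \<rho>' g = \<rho> g"
  shows "strictly_equivalent G F R \<rho> \<rho>'"
  unfolding strictly_equivalent_iff
  using assms by (intro bexI[of _ "\<one>\<^bsub>mat2_ring R\<^esub>"]) (auto simp: resM.hom_one)

lemma strictly_equivalent_hom:
  assumes "coefficient_ring p F R" "coefficient_ring p F S" "\<phi> \<in> coeff_hom p F R S"
    "\<And>g. g \<in> carrier G \<Longrightarrow> \<rho> g \<in> carrier (mat2_ring R)" "strictly_equivalent G F R \<rho> \<rho>'"
  shows "strictly_equivalent G F S (\<lambda>g. map_mat2 \<phi> (\<rho> g)) (\<lambda>g. map_mat2 \<phi> (\<rho>' g))"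
proof -
  interpret R: coefficient_ring p F R by fact
  interpret S: coefficient_ring p F S by fact
  obtain A where A: "A \<in> Units (mat2_ring R)" "map_mat2 (residue R) A = \<one>\<^bsub>mat2_ring F\<^esub>"
    "\<forall>g\<in>carrier G. \<rho>' g = conj_by (mat2_ring R) A (\<rho> g)" using assms(5) unfolding R.strictly_equivalent_iff by blast
  note h = map_mat2_ring_hom[OF coeff_homD(1)[OF assms(3)] R.R.ring_axioms S.R.ring_axioms]
  have "map_mat2 \<phi> A \<in> Units (mat2_ring S)"
    by (rule ring_hom_inv(1)[OF R.M.monoid_axioms S.M.monoid_axioms h A(1)])
  moreover have "map_mat2 (residue S) (map_mat2 \<phi> A) = \<one>\<^bsub>mat2_ring F\<^esub>"
    unfolding A(2)[symmetric] using coeff_hom_residue[OF assms(1-3)] R.M.Units_closed[OF A(1)]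
    by (intro mat2.expand) simp
  ultimately show ?thesis
    unfolding S.strictly_equivalent_iff
    using A(3) ring_hom_conj_by[OF R.M.monoid_axioms S.M.monoid_axioms h A(1)] assms(4)
    by (intro bexI[of _ "map_mat2 \<phi> A"]) simp_all
qed

lemma lift_of_carrier:
  assumes "lift_of G T \<rho>bar R \<rho>" "g \<in> carrier G"
  shows "\<rho> g \<in> carrier (mat2_ring R)"
  using assms(1) rep_hom(2)[OF _ assms(2), of \<rho> R] unfolding lift_of_def representation_iff by blast

text \<open>The lift is moved to a copy of \<open>R\<close>, classified there, and the classifying
  map is moved back; uniqueness travels in the opposite direction.\<close>

lemma universal_deformation_property:
  assumes F: "field F" and fin: "finite (carrier F)"
    and U: "universal_deformation p F G T \<rho>bar U \<rho>univ"
    and R: "coeff_object p F R" "lift_of G T \<rho>bar R \<rho>"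
  shows "\<exists>!\<phi>. \<phi> \<in> coeff_hom p F U R \<and> strictly_equivalent G F R (\<lambda>g. map_mat2 \<phi> (\<rho>univ g)) \<rho>"
proof -
  interpret F: field F by fact
  have ci: "coefficient_ring p F S" if "coeff_object p F S" for S :: "('a, 's) coeff_ring"
    using that F by (simp add: coefficient_ring_def coefficient_ring_axioms_def)
  note cR = ci[OF R(1)]
  interpret R: coefficient_ring p F R by (rule cR)
  have Uo: "coeff_object p F U" and Ul: "lift_of G T \<rho>bar U \<rho>univ" using U unfolding universal_deformation_def by auto
  note cU = ci[OF Uo]
  obtain C :: "('a, nat set) coeff_ring" and j k
    where C: "coeff_object p F C" "j \<in> coeff_hom p F R C" "k \<in> coeff_hom p F C R"
    "\<forall>x\<in>carrier R. k (j x) = x" "\<forall>y\<in>carrier C. j (k y) = y"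
    by (rule R.obtain_nat_set_copy[OF fin])
  note cC = ci[OF C(1)]
  interpret C: coefficient_ring p F C by (rule cC)
  note \<rho>c = lift_of_carrier[OF R(2)] and uc = lift_of_carrier[OF Ul]
  have lC: "lift_of G T \<rho>bar C (\<lambda>g. map_mat2 j (\<rho> g))" by (rule lift_of_hom[OF cR cC C(2) R(2)])
  have ex: "\<exists>!\<phi>. \<phi> \<in> coeff_hom p F U C \<and>
      strictly_equivalent G F C (\<lambda>g. map_mat2 \<phi> (\<rho>univ g)) (\<lambda>g. map_mat2 j (\<rho> g))"
    using U C(1) lC unfolding universal_deformation_def by simp
  then obtain \<phi> where \<phi>: "\<phi> \<in> coeff_hom p F U C"
      "strictly_equivalent G F C (\<lambda>g. map_mat2 \<phi> (\<rho>univ g)) (\<lambda>g. map_mat2 j (\<rho> g))"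
    by blast
  have uniq: "\<psi> = \<phi>" if "\<psi> \<in> coeff_hom p F U C"
      "strictly_equivalent G F C (\<lambda>g. map_mat2 \<psi> (\<rho>univ g)) (\<lambda>g. map_mat2 j (\<rho> g))" for \<psi>
    using ex \<phi> that by blast
  have kj: "map_mat2 k (map_mat2 j A) = A" if "A \<in> carrier (mat2_ring R)" for A
    using that C(4) by (intro mat2.expand) simp
  let ?f = "compose (carrier U) k \<phi>"
  have f: "?f \<in> coeff_hom p F U R" by (rule coeff_hom_comp[OF cU \<phi>(1) C(3)])
  have mc: "map_mat2 \<psi> (\<rho>univ g) \<in> carrier (mat2_ring S)"
    if "\<psi> \<in> coeff_hom p F U S" "g \<in> carrier G" for \<psi> g and S :: "('a, 's) coeff_ring"
    using ring_hom_closed[OF coeff_homD(1)[OF that(1)]] uc[OF that(2)] by (simp add: map_mat2_conv)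
  have sf: "strictly_equivalent G F R (\<lambda>g. map_mat2 ?f (\<rho>univ g)) \<rho>"
  proof -
    have "strictly_equivalent G F R (\<lambda>g. map_mat2 k (map_mat2 \<phi> (\<rho>univ g))) (\<lambda>g. map_mat2 k (map_mat2 j (\<rho> g)))"
      by (rule strictly_equivalent_hom[OF cC cR C(3) _ \<phi>(2)]) (rule mc[OF \<phi>(1)])
    thus ?thesis unfolding strictly_equivalent_def by (simp add: map_mat2_compose[OF uc] kj[OF \<rho>c])
  qed
  have "\<psi> = ?f" if \<psi>: "\<psi> \<in> coeff_hom p F U R" "strictly_equivalent G F R (\<lambda>g. map_mat2 \<psi> (\<rho>univ g)) \<rho>" for \<psi>
  proof -
    let ?h = "compose (carrier U) j \<psi>"
    have h: "?h \<in> coeff_hom p F U C" by (rule coeff_hom_comp[OF cU \<psi>(1) C(2)])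
    have "strictly_equivalent G F C (\<lambda>g. map_mat2 ?h (\<rho>univ g)) (\<lambda>g. map_mat2 j (\<rho> g))"
    proof -
      have "strictly_equivalent G F C (\<lambda>g. map_mat2 j (map_mat2 \<psi> (\<rho>univ g))) (\<lambda>g. map_mat2 j (\<rho> g))"
        by (rule strictly_equivalent_hom[OF cR cC C(2) _ \<psi>(2)]) (rule mc[OF \<psi>(1)])
      thus ?thesis unfolding strictly_equivalent_def by (simp add: map_mat2_compose[OF uc])
    qed
    hence eq: "?h = \<phi>" by (rule uniq[OF h])
    show ?thesis
    proof (rule coeff_hom_ext[OF \<psi>(1) f])
      fix x assume x: "x \<in> carrier U"
      have "\<psi> x \<in> carrier R" using ring_hom_closed[OF coeff_homD(1)[OF \<psi>(1)] x] .
      hence "\<psi> x = k (j (\<psi> x))" using C(4) by simp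
      also have "j (\<psi> x) = \<phi> x" unfolding eq[symmetric] using x by (simp add: compose_def)
      finally show "\<psi> x = ?f x" using x by (simp add: compose_def)
    qed
  qed
  thus ?thesis using f sf by blast
qed

lemma character_lift_hom:
  assumes "coefficient_ring p F R" "coefficient_ring p F S" "\<phi> \<in> coeff_hom p F R S"
    "character_lift G T H chibar R chi"
  shows "character_lift G T H chibar S (\<lambda>h. \<phi> (chi h))"
proof -
  interpret R: coefficient_ring p F R by fact
  interpret S: coefficient_ring p F S by fact
  note D = coeff_homD[OF assms(3)]
  have c: "chi \<in> hom (G\<lparr>carrier := H\<rparr>) (units_of R)" "continuous_map (subtopology T H) (adic_topology R) chi"
    "\<And>h. h \<in> H \<Longrightarrow> residue R (chi h) = chibar h"
    using assms(4) unfolding character_lift_def character_on_def by auto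
  have u: "chi h \<in> Units R" if "h \<in> H" for h using c(1) that unfolding hom_def units_of_def by auto
  have "(\<lambda>h. \<phi> (chi h)) \<in> hom (G\<lparr>carrier := H\<rparr>) (units_of S)"
    using c(1) u ring_hom_inv(1)[OF R.R.monoid_axioms S.R.monoid_axioms D(1)] ring_hom_mult[OF D(1)]
    by (auto simp: hom_def units_of_def R.R.Units_closed)
  moreover have "continuous_map (subtopology T H) (adic_topology S) (\<lambda>h. \<phi> (chi h))"
    by (rule continuous_map_adic_hom[OF R.local_ring S.local_ring D(1,2) c(2)])
  ultimately show ?thesis
    unfolding character_lift_def character_on_def
    using coeff_hom_residue[OF assms(1-3)] u R.R.Units_closed c(3) by simp
qed

text \<open>Transferred along a copy, as in \<open>universal_deformation_property\<close>.\<close>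

lemma universal_character_deformation_property:
  assumes F: "field F" and fin: "finite (carrier F)"
    and V: "universal_character_deformation p F G T H chibar V chiuniv"
    and R: "coeff_object p F R" "character_lift G T H chibar R chi"
  shows "\<exists>!\<phi>. \<phi> \<in> coeff_hom p F V R \<and> (\<forall>h\<in>H. \<phi> (chiuniv h) = chi h)"
proof -
  interpret F: field F by fact
  have ci: "coefficient_ring p F S" if "coeff_object p F S" for S :: "('a, 's) coeff_ring"
    using that F by (simp add: coefficient_ring_def coefficient_ring_axioms_def)
  note cR = ci[OF R(1)]
  interpret R: coefficient_ring p F R by (rule cR)
  have Vo: "coeff_object p F V" and Vl: "character_lift G T H chibar V chiuniv"
    using V unfolding universal_character_deformation_def by auto
  note cV = ci[OF Vo]
  interpret V: coefficient_ring p F V by (rule cV)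
  obtain C :: "('a, nat set) coeff_ring" and j k
    where C: "coeff_object p F C" "j \<in> coeff_hom p F R C" "k \<in> coeff_hom p F C R"
    "\<forall>x\<in>carrier R. k (j x) = x" "\<forall>y\<in>carrier C. j (k y) = y"
    by (rule R.obtain_nat_set_copy[OF fin])
  note cC = ci[OF C(1)]
  have cc: "chi h \<in> carrier R" if "h \<in> H" for h
    using R(2) that R.R.Units_closed unfolding character_lift_def character_on_def hom_def units_of_def by auto
  have uc: "chiuniv h \<in> carrier V" if "h \<in> H" for h
    using Vl that V.R.Units_closed unfolding character_lift_def character_on_def hom_def units_of_def by auto
  have lC: "character_lift G T H chibar C (\<lambda>h. j (chi h))" by (rule character_lift_hom[OF cR cC C(2) R(2)])
  have ex: "\<exists>!\<phi>. \<phi> \<in> coeff_hom p F V C \<and> (\<forall>h\<in>H. \<phi> (chiuniv h) = j (chi h))"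
    using V C(1) lC unfolding universal_character_deformation_def by simp
  then obtain \<phi> where \<phi>: "\<phi> \<in> coeff_hom p F V C" "\<forall>h\<in>H. \<phi> (chiuniv h) = j (chi h)"
    by blast
  have uniq: "\<psi> = \<phi>" if "\<psi> \<in> coeff_hom p F V C" "\<forall>h\<in>H. \<psi> (chiuniv h) = j (chi h)" for \<psi>
    using ex \<phi> that by blast
  let ?f = "compose (carrier V) k \<phi>"
  have f: "?f \<in> coeff_hom p F V R" by (rule coeff_hom_comp[OF cV \<phi>(1) C(3)])
  have sf: "\<forall>h\<in>H. ?f (chiuniv h) = chi h" using \<phi>(2) C(4) cc uc by (simp add: compose_def)
  have "\<psi> = ?f" if \<psi>: "\<psi> \<in> coeff_hom p F V R" "\<forall>h\<in>H. \<psi> (chiuniv h) = chi h" for \<psi>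
  proof -
    let ?h = "compose (carrier V) j \<psi>"
    have h: "?h \<in> coeff_hom p F V C" by (rule coeff_hom_comp[OF cV \<psi>(1) C(2)])
    have "\<forall>h\<in>H. ?h (chiuniv h) = j (chi h)" using \<psi>(2) uc by (simp add: compose_def)
    hence eq: "?h = \<phi>" by (rule uniq[OF h])
    show ?thesis
    proof (rule coeff_hom_ext[OF \<psi>(1) f])
      fix x assume x: "x \<in> carrier V"
      have "\<psi> x \<in> carrier R" using ring_hom_closed[OF coeff_homD(1)[OF \<psi>(1)] x] .
      hence "\<psi> x = k (j (\<psi> x))" using C(4) by simp
      also have "j (\<psi> x) = \<phi> x" unfolding eq[symmetric] using x by (simp add: compose_def)
      finally show "\<psi> x = ?f x" using x by (simp add: compose_def)
    qed
  qed
  thus ?thesis using f sf by blast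
qed

section \<open>Dihedral representations as graded representations\<close>

lemma induced_imp_graded:
  assumes "index_two G H" "cring R" "chi \<in> hom (G\<lparr>carrier := H\<rparr>) (units_of R)"
    "\<rho> \<in> hom G (GL2 R)" "equiv_to_ind G R \<rho> H chi"
  shows "\<exists>P. graded G R H \<rho> P"
proof -
  interpret index_two G H by fact
  obtain \<sigma> where \<sigma>: "\<sigma> \<in> carrier G" "\<sigma> \<notin> H" using obtain_outside by blast
  interpret induction_datum G H R \<sigma>
    by (intro induction_datum.intro induction_datum_axioms.intro assms(1,2) \<sigma>)
  obtain P where P: "P \<in> Units (mat2_ring R)"
    "\<And>g. g \<in> carrier G \<Longrightarrow> conj_by (mat2_ring R) P (\<rho> g) = induced_mat G R H \<sigma> chi g"
    by (rule equiv_to_ind_imp_conj[OF assms(3-5)]) blast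
  thus ?thesis unfolding graded_def using induced_mat_homogeneous[OF assms(3)] by auto
qed

lemma graded_imp_induced:
  assumes ind: "index_two G H" and loc: "local_ring R" and rep: "representation G T R \<rho>"
    and gr: "graded G R H \<rho> P"
  shows "\<exists>chi. character_on G T R H chi \<and> equiv_to_ind G R \<rho> H chi"
proof -
  interpret index_two G H by fact
  have cr: "cring R" using loc unfolding local_ring_def by blast
  obtain \<sigma> where \<sigma>: "\<sigma> \<in> carrier G" "\<sigma> \<notin> H" using obtain_outside by blast
  interpret induction_datum G H R \<sigma>
    by (intro induction_datum.intro induction_datum_axioms.intro ind cr \<sigma>)
  have \<rho>: "\<rho> \<in> hom G (GL2 R)" "mat2_continuous T R \<rho>" using rep unfolding representation_iff by auto
  note N = graded_normalize[OF \<rho>(1) gr]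
  have PU: "P \<in> Units (mat2_ring R)" using gr unfolding graded_def by blast
  have "equiv_to_ind G R \<rho> H (\<lambda>h. e11 (conj_by (mat2_ring R) P (\<rho> h)))"
    by (rule conj_imp_equiv_to_ind[OF N(3) \<rho>(1) N(2,4)])
  moreover have "continuous_map T (adic_topology R) (\<lambda>h. e11 (conj_by (mat2_ring R) P (\<rho> h)))"
    using mat2_continuous_conj_by[OF loc PU \<rho>(2)] unfolding mat2_continuous_def by blast
  ultimately show ?thesis
    unfolding character_on_def using N(3) continuous_map_from_subtopology by blast
qed

lemma dihedral_iff_graded:
  assumes "group G" "local_ring R" "representation G T R \<rho>"
  shows "dihedral G T R \<rho> \<longleftrightarrow> (\<exists>H P. open_index2 G T H \<and> graded G R H \<rho> P)"
proof
  assume "dihedral G T R \<rho>"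
  then obtain H chi where H: "open_index2 G T H" "character_on G T R H chi" "equiv_to_ind G R \<rho> H chi"
    unfolding dihedral_def by blast
  have "cring R" using assms(2) unfolding local_ring_def by blast
  thus "\<exists>H P. open_index2 G T H \<and> graded G R H \<rho> P"
    using induced_imp_graded[OF open_index2_index_two[OF assms(1) H(1)]] H assms(3)
    unfolding character_on_def representation_iff by blast
next
  assume "\<exists>H P. open_index2 G T H \<and> graded G R H \<rho> P"
  thus "dihedral G T R \<rho>"
    unfolding dihedral_def
    using graded_imp_induced[OF open_index2_index_two[OF assms(1)] assms(2,3)] by blast
qed

text \<open>The complement is the preimage of \<open>H\<close> under translation by an element
  outside \<open>H\<close>. That \<open>H\<close> is also closed makes the degree locally
  constant.\<close>

lemma open_index2_complement:
  assumes "profinite_group G T" "open_index2 G T H"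
  shows "openin T (carrier G - H)"
proof -
  have G: "group G" and top: "topspace T = carrier G"
    and cont: "continuous_map (prod_topology T T) T (\<lambda>(x, y). x \<otimes>\<^bsub>G\<^esub> y)"
    using assms(1) unfolding profinite_group_def by auto
  interpret index_two G H by (rule open_index2_index_two[OF G assms(2)])
  obtain \<sigma> where \<sigma>: "\<sigma> \<in> carrier G" "\<sigma> \<notin> H" using obtain_outside by blast
  have "continuous_map T (prod_topology T T) (\<lambda>x. (\<sigma>, x))"
    using \<sigma> top by (intro continuous_map_pairedI) auto
  from continuous_map_compose[OF this cont]
  have "continuous_map T T (\<lambda>x. \<sigma> \<otimes>\<^bsub>G\<^esub> x)" by (simp add: comp_def)
  hence "openin T {x \<in> topspace T. \<sigma> \<otimes>\<^bsub>G\<^esub> x \<in> H}"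
    using assms(2) unfolding open_index2_def continuous_map_def by blast
  moreover have "{x \<in> topspace T. \<sigma> \<otimes>\<^bsub>G\<^esub> x \<in> H} = carrier G - H"
    unfolding top using \<sigma> by (auto simp: mult_mem_iff)
  ultimately show ?thesis by simp
qed

text \<open>\<open>\<phi>\<close> is constant on the classes of \<open>I\<close>. The factor map is
  written with \<open>the_elem\<close> so that it agrees with the residue map stored in
  \<open>quot_coeff_ring\<close>.\<close>

lemma quotient_factor_hom:
  assumes R: "cring R" and S: "cring S" and \<phi>: "\<phi> \<in> ring_hom R S" and I: "ideal I R"
    and ker: "\<And>x. x \<in> I \<Longrightarrow> \<phi> x = \<zero>\<^bsub>S\<^esub>"
  defines "\<psi> \<equiv> \<lambda>C. the_elem (\<phi> ` C)"
  shows "\<psi> \<in> ring_hom (R Quot I) S" and "\<And>x. x \<in> carrier R \<Longrightarrow> \<psi> (I +>\<^bsub>R\<^esub> x) = \<phi> x"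
proof -
  interpret R: cring R by fact
  interpret S: cring S by fact
  interpret I: ideal I R by fact
  interpret h: ring_hom_cring R S \<phi> by unfold_locales (rule \<phi>)
  show v: "\<psi> (I +>\<^bsub>R\<^esub> x) = \<phi> x" if x: "x \<in> carrier R" for x
  proof -
    have eq: "\<phi> y = \<phi> x" if "y \<in> I +>\<^bsub>R\<^esub> x" for y
    proof -
      obtain i where i: "i \<in> I" "y = i \<oplus>\<^bsub>R\<^esub> x" using \<open>y \<in> I +>\<^bsub>R\<^esub> x\<close> unfolding a_r_coset_def' by blast
      thus ?thesis using ker[OF i(1)] I.Icarr[OF i(1)] x by simp
    qed
    have "x \<in> I +>\<^bsub>R\<^esub> x" by (rule I.a_rcos_self[OF x])
    hence "\<phi> x \<in> \<phi> ` (I +>\<^bsub>R\<^esub> x)" by (rule imageI)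
    moreover have "\<phi> ` (I +>\<^bsub>R\<^esub> x) \<subseteq> {\<phi> x}" by (rule image_subsetI) (simp only: eq singletonI)
    ultimately have "\<phi> ` (I +>\<^bsub>R\<^esub> x) = {\<phi> x}" by blast
    thus ?thesis unfolding \<psi>_def by simp
  qed
  note q = I.rcos_ring_hom
  show "\<psi> \<in> ring_hom (R Quot I) S"
  proof (rule ring_hom_memI)
    fix C D assume C: "C \<in> carrier (R Quot I)" and D: "D \<in> carrier (R Quot I)"
    obtain x y where xy: "x \<in> carrier R" "C = I +>\<^bsub>R\<^esub> x" "y \<in> carrier R" "D = I +>\<^bsub>R\<^esub> y"
      using C D unfolding FactRing_def A_RCOSETS_def' by auto
    show "\<psi> C \<in> carrier S" using v xy by simp
    have "\<psi> (I +>\<^bsub>R\<^esub> x \<otimes>\<^bsub>R\<^esub> y) = \<psi> (I +>\<^bsub>R\<^esub> x) \<otimes>\<^bsub>S\<^esub> \<psi> (I +>\<^bsub>R\<^esub> y)"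
      "\<psi> (I +>\<^bsub>R\<^esub> x \<oplus>\<^bsub>R\<^esub> y) = \<psi> (I +>\<^bsub>R\<^esub> x) \<oplus>\<^bsub>S\<^esub> \<psi> (I +>\<^bsub>R\<^esub> y)"
      using v xy by simp_all
    thus "\<psi> (C \<otimes>\<^bsub>R Quot I\<^esub> D) = \<psi> C \<otimes>\<^bsub>S\<^esub> \<psi> D" "\<psi> (C \<oplus>\<^bsub>R Quot I\<^esub> D) = \<psi> C \<oplus>\<^bsub>S\<^esub> \<psi> D"
      unfolding xy(2,4) ring_hom_mult[OF q xy(1,3), symmetric] ring_hom_add[OF q xy(1,3), symmetric] by blast+
  next
    show "\<psi> \<one>\<^bsub>R Quot I\<^esub> = \<one>\<^bsub>S\<^esub>" using v[OF R.one_closed] ring_hom_one[OF q] by simp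
  qed
qed

section \<open>Dihedral deformations\<close>

lemma hom_add_pow:
  assumes "cring R" "cring S" "\<phi> \<in> ring_hom R S" "x \<in> carrier R"
  shows "\<phi> (add_pow R (n::nat) x) = add_pow S n (\<phi> x)"
proof -
  interpret R: cring R by fact
  interpret S: cring S by fact
  interpret h: ring_hom_cring R S \<phi> by unfold_locales (rule assms(3))
  show ?thesis
  proof (induct n)
    case (Suc n)
    thus ?case using R.add.nat_pow_closed[OF assms(4), of n] assms(4) by (simp add: add_pow_def)
  qed (simp add: add_pow_def)
qed

text \<open>\<open>k\<close> is an injective local homomorphism, so the vanishing of m^2 and of p
  can be checked after applying it.\<close>

lemma infinitesimal_iso:
  assumes "coefficient_ring p F R" "coefficient_ring p F S" "infinitesimal p R"
    "j \<in> coeff_hom p F R S" "k \<in> coeff_hom p F S R" "\<forall>y\<in>carrier S. j (k y) = y"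
  shows "infinitesimal p S"
proof -
  interpret R: coefficient_ring p F R by fact
  interpret S: coefficient_ring p F S by fact
  interpret jh: ring_hom_cring R S j by unfold_locales (rule coeff_homD(1)[OF assms(4)])
  interpret kh: ring_hom_cring S R k by unfold_locales (rule coeff_homD(1)[OF assms(5)])
  have z: "y = \<zero>\<^bsub>S\<^esub>" if "y \<in> carrier S" "k y = \<zero>\<^bsub>R\<^esub>" for y
    using assms(6) that jh.hom_zero by metis
  have "max_ideal_pow S 2 \<subseteq> {\<zero>\<^bsub>S\<^esub>}"
  proof
    fix y assume y: "y \<in> max_ideal_pow S 2"
    have "k y \<in> max_ideal_pow R 2"
      by (rule hom_max_ideal_pow[OF S.local_ring R.local_ring coeff_homD(1,2)[OF assms(5)] y])
    hence "k y = \<zero>\<^bsub>R\<^esub>" using assms(3) unfolding infinitesimal_def by blast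
    thus "y \<in> {\<zero>\<^bsub>S\<^esub>}" using z ideal.Icarr[OF max_ideal_pow_is_ideal[OF S.local_ring] y] by blast
  qed
  moreover have "\<zero>\<^bsub>S\<^esub> \<in> max_ideal_pow S 2"
    using additive_subgroup.zero_closed[OF ideal.axioms(1)[OF max_ideal_pow_is_ideal[OF S.local_ring]]] .
  moreover have "add_pow S p y = \<zero>\<^bsub>S\<^esub>" if y: "y \<in> carrier S" for y
  proof (rule z)
    show "add_pow S p y \<in> carrier S" using S.R.add.nat_pow_closed[OF y] by (simp add: add_pow_def)
    show "k (add_pow S p y) = \<zero>\<^bsub>R\<^esub>"
      unfolding hom_add_pow[OF S.R.cring_axioms R.R.cring_axioms coeff_homD(1)[OF assms(5)] y]
      using assms(3) kh.hom_closed[OF y] unfolding infinitesimal_def by blast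
  qed
  ultimately show ?thesis unfolding infinitesimal_def by blast
qed

section \<open>Reduction modulo (m^2, p)\<close>

context coefficient_ring
begin

lemma inf_ideal_is_ideal: "ideal (inf_ideal p R) R"
  and inf_ideal_minimal: "ideal K R \<Longrightarrow> max_ideal_pow R 2 \<subseteq> K \<Longrightarrow> [p] \<cdot>\<^bsub>R\<^esub> \<one>\<^bsub>R\<^esub> \<in> K \<Longrightarrow> inf_ideal p R \<subseteq> K"
proof -
  have "max_ideal_pow R 2 \<union> {[p] \<cdot>\<^bsub>R\<^esub> \<one>\<^bsub>R\<^esub>} \<subseteq> carrier R"
    using ideal.Icarr[OF max_ideal_pow_is_ideal[OF local_ring]] R.add.nat_pow_closed[OF R.one_closed, of p]
    by (auto simp: add_pow_def)
  thus "ideal (inf_ideal p R) R" unfolding inf_ideal_def by (rule R.genideal_ideal)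
  show "inf_ideal p R \<subseteq> K" if "ideal K R" "max_ideal_pow R 2 \<subseteq> K" "[p] \<cdot>\<^bsub>R\<^esub> \<one>\<^bsub>R\<^esub> \<in> K"
    unfolding inf_ideal_def using that by (intro R.genideal_minimal) auto
qed

text \<open>A local homomorphism to an infinitesimal ring kills m^2 and p, so its kernel contains
  the ideal they generate. This is how the reduced universal deformation reaches the dual
  numbers.\<close>

lemma inf_ideal_in_kernel:
  assumes S: "local_ring S" "infinitesimal p S" and \<phi>: "\<phi> \<in> ring_hom R S" "\<phi> ` max_ideal R \<subseteq> max_ideal S"
    and x: "x \<in> inf_ideal p R"
  shows "\<phi> x = \<zero>\<^bsub>S\<^esub>"
proof -
  interpret S: cring S using S(1) unfolding local_ring_def by blast
  have "inf_ideal p R \<subseteq> a_kernel R S \<phi>"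
  proof (rule inf_ideal_minimal)
    show "ideal (a_kernel R S \<phi>) R"
      by (rule ring_hom_ring.kernel_is_ideal[OF ring_hom_ringI2[OF R.ring_axioms S.ring_axioms \<phi>(1)]])
    show "max_ideal_pow R 2 \<subseteq> a_kernel R S \<phi>"
    proof
      fix y assume y: "y \<in> max_ideal_pow R 2"
      have "\<phi> y \<in> max_ideal_pow S 2" by (rule hom_max_ideal_pow[OF local_ring S(1) \<phi> y])
      thus "y \<in> a_kernel R S \<phi>"
        using S(2) ideal.Icarr[OF max_ideal_pow_is_ideal[OF local_ring] y] unfolding infinitesimal_def a_kernel_def' by blast
    qed
    have "\<phi> ([p] \<cdot>\<^bsub>R\<^esub> \<one>\<^bsub>R\<^esub>) = [p] \<cdot>\<^bsub>S\<^esub> \<phi> \<one>\<^bsub>R\<^esub>"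
      by (rule hom_add_pow[OF R.cring_axioms S.cring_axioms \<phi>(1) R.one_closed])
    also have "\<dots> = \<zero>\<^bsub>S\<^esub>"
      using S(2) ring_hom_closed[OF \<phi>(1) R.one_closed] unfolding infinitesimal_def by blast
    finally show "[p] \<cdot>\<^bsub>R\<^esub> \<one>\<^bsub>R\<^esub> \<in> a_kernel R S \<phi>"
      using R.add.nat_pow_closed[OF R.one_closed, of p] unfolding a_kernel_def' by (simp add: add_pow_def)
  qed
  thus ?thesis using x unfolding a_kernel_def' by blast
qed

text \<open>The residue field is itself infinitesimal, since p = 0 in \<open>F\<close>. So the
  residue map factors through the quotient, and an element outside the kernel of the factor map is
  the class of a unit.\<close>

lemma quot_coeff_ring_facts:
  assumes char: "[p] \<cdot>\<^bsub>F\<^esub> \<one>\<^bsub>F\<^esub> = \<zero>\<^bsub>F\<^esub>"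
  defines "Q \<equiv> quot_coeff_ring R (inf_ideal p R)" and "q \<equiv> \<lambda>x. inf_ideal p R +>\<^bsub>R\<^esub> x"
  shows "q \<in> ring_hom R Q" "local_ring Q" "q ` max_ideal R \<subseteq> max_ideal Q"
proof -
  let ?I = "inf_ideal p R"
  interpret I: ideal ?I R by (rule inf_ideal_is_ideal)
  have eqs: "carrier Q = carrier (R Quot ?I)" "mult Q = mult (R Quot ?I)" "one Q = one (R Quot ?I)"
    "zero Q = zero (R Quot ?I)" "add Q = add (R Quot ?I)"
    unfolding Q_def quot_coeff_ring_def by simp_all
  have crQ: "cring Q" by (rule cring_transfer[OF I.quotient_is_cring[OF R.cring_axioms] eqs])
  interpret Q: cring Q by (rule crQ)
  show q: "q \<in> ring_hom R Q"
    using I.rcos_ring_hom ring_hom_transfer(2)[OF eqs(1-3,5), of R] unfolding q_def by simp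
  have F0: "infinitesimal p F"
  proof -
    have "max_ideal_pow F 2 \<subseteq> max_ideal F"
      using max_ideal_pow_antimono[OF field_local(1)[OF F.field_axioms], of 1 2] max_ideal_pow_1[OF field_local(1)[OF F.field_axioms]]
      by simp
    moreover have "\<zero>\<^bsub>F\<^esub> \<in> max_ideal_pow F 2"
      using additive_subgroup.zero_closed[OF ideal.axioms(1)[OF max_ideal_pow_is_ideal[OF field_local(1)[OF F.field_axioms]]]] .
    moreover have "add_pow F p x = \<zero>\<^bsub>F\<^esub>" if "x \<in> carrier F" for x
      using F.add_pow_ldistr[OF F.one_closed that, of p] that char by simp
    ultimately show ?thesis unfolding infinitesimal_def using field_local(2)[OF F.field_axioms] by blast
  qed
  have resm: "residue R ` max_ideal R \<subseteq> max_ideal F"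
    using field_local(2)[OF F.field_axioms] by auto
  have ker: "residue R x = \<zero>\<^bsub>F\<^esub>" if "x \<in> ?I" for x
    by (rule inf_ideal_in_kernel[OF field_local(1)[OF F.field_axioms] F0 residue_hom resm that])
  have fh: "(\<lambda>C. the_elem (residue R ` C)) \<in> ring_hom (R Quot ?I) F"
    "the_elem (residue R ` (?I +>\<^bsub>R\<^esub> x)) = residue R x" if "x \<in> carrier R" for x
    using quotient_factor_hom[OF R.cring_axioms F.cring_axioms residue_hom I.ideal_axioms] ker that by blast+
  let ?r = "\<lambda>C. the_elem (residue R ` C)"
  have r: "?r \<in> ring_hom Q F" using fh(1)[OF R.zero_closed] ring_hom_transfer(1)[OF eqs(1-3,5), of F] by simp
  have rq: "?r (q x) = residue R x" if "x \<in> carrier R" for x unfolding q_def by (rule fh(2)[OF that])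
  let ?M = "a_kernel Q F ?r"
  have 1: "ideal ?M Q"
    by (rule ring_hom_ring.kernel_is_ideal[OF ring_hom_ringI2[OF Q.ring_axioms F.ring_axioms r]])
  have 2: "\<one>\<^bsub>Q\<^esub> \<notin> ?M" using ring_hom_one[OF r] unfolding a_kernel_def' by auto
  have 3: "C \<in> Units Q" if C: "C \<in> carrier Q" "C \<notin> ?M" for C
  proof -
    obtain x where x: "x \<in> carrier R" "C = q x"
      using C(1) unfolding eqs(1) FactRing_def A_RCOSETS_def' q_def by auto
    have "residue R x \<noteq> \<zero>\<^bsub>F\<^esub>" using C x(2) rq[OF x(1)] unfolding a_kernel_def' by auto
    hence "x \<in> Units R" using unit_iff[OF x(1)] by simp
    thus ?thesis unfolding x(2) by (rule ring_hom_inv(1)[OF R.monoid_axioms Q.monoid_axioms q])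
  qed
  show "local_ring Q" by (rule local_ring_by_units(1)[OF crQ 1 2 3])
  have m: "max_ideal Q = ?M" by (rule local_ring_by_units(2)[OF crQ 1 2 3])
  show "q ` max_ideal R \<subseteq> max_ideal Q"
  proof (rule image_subsetI)
    fix x assume x: "x \<in> max_ideal R"
    have xc: "x \<in> carrier R" by (rule ideal.Icarr[OF max_ideal_ideal x])
    show "q x \<in> max_ideal Q"
      unfolding m a_kernel_def' using rq[OF xc] x ring_hom_closed[OF q xc] by simp
  qed
qed

end

lemma induced_mat_cong:
  "(\<And>h. h \<in> H \<Longrightarrow> chi h = chi' h) \<Longrightarrow> induced_mat G R H \<sigma> chi g = induced_mat G R H \<sigma> chi' g"
  unfolding induced_mat_def extend0_def by auto

lemma map_induced_mat:
  assumes "\<phi> \<in> ring_hom R S" "ring R" "ring S"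
  shows "map_mat2 \<phi> (induced_mat G R H \<sigma> chi g) = induced_mat G S H \<sigma> (\<lambda>h. \<phi> (chi h)) g"
  using ring_hom_zero[OF assms] unfolding induced_mat_def extend0_def by auto

section \<open>The residual representation and the equivalence of the four conditions\<close>

locale residual_dihedral = F: field F
  for p :: nat and F :: "'f ring" and G :: "'g monoid" and T :: "'g topology"
    and H :: "'g set" and \<sigma> :: 'g and chibar :: "'g \<Rightarrow> 'f" and \<rho>bar :: "'g \<Rightarrow> 'f mat2" +
  assumes fin: "finite (carrier F)" and char: "[p] \<cdot>\<^bsub>F\<^esub> \<one>\<^bsub>F\<^esub> = \<zero>\<^bsub>F\<^esub>"
    and prof: "profinite_group G T"
    and openH: "open_index2 G T H" and \<sigma>: "\<sigma> \<in> carrier G - H"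
    and chibar: "character_on G T F H chibar"
    and ne: "\<exists>h\<in>H. chibar h \<noteq> chibar (\<sigma> \<otimes>\<^bsub>G\<^esub> h \<otimes>\<^bsub>G\<^esub> inv\<^bsub>G\<^esub> \<sigma>)"
    and rep: "representation G T F \<rho>bar" and ind: "equiv_to_ind G F \<rho>bar H chibar"
begin

lemma G: "group G" and top: "topspace T = carrier G"
  using prof unfolding profinite_group_def by auto

sublocale index_two G H by (rule open_index2_index_two[OF G openH])

lemma datum: "cring R \<Longrightarrow> induction_datum G H R \<sigma>"
  using \<sigma> by (intro induction_datum.intro induction_datum_axioms.intro index_two_axioms) auto

sublocale FM: induction_datum G H F \<sigma> by (rule datum[OF F.cring_axioms])

lemma \<rho>bar: "\<rho>bar \<in> hom G (GL2 F)" using rep unfolding representation_iff by blast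

lemma chibar_hom: "chibar \<in> hom (G\<lparr>carrier := H\<rparr>) (units_of F)"
  using chibar unfolding character_on_def by blast

lemma exists_P0: "\<exists>P. P \<in> Units (mat2_ring F) \<and>
    (\<forall>g\<in>carrier G. conj_by (mat2_ring F) P (\<rho>bar g) = induced_mat G F H \<sigma> chibar g)"
  by (rule FM.equiv_to_ind_imp_conj[OF chibar_hom \<rho>bar ind]) blast

text \<open>Chosen once and used for all lifts: two bases with this reduction differ by a matrix
  congruent to 1.\<close>

definition P0 :: "'f mat2" where
  "P0 = (SOME P. P \<in> Units (mat2_ring F) \<and>
    (\<forall>g\<in>carrier G. conj_by (mat2_ring F) P (\<rho>bar g) = induced_mat G F H \<sigma> chibar g))"

lemma P0: "P0 \<in> Units (mat2_ring F)"
  "\<And>g. g \<in> carrier G \<Longrightarrow> conj_by (mat2_ring F) P0 (\<rho>bar g) = induced_mat G F H \<sigma> chibar g"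
  using someI_ex[OF exists_P0] unfolding P0_def by blast+

lemma graded_P0: "graded G F H \<rho>bar P0"
  unfolding graded_def using P0 FM.induced_mat_homogeneous[OF chibar_hom] by simp

lemma induced_entries:
  "h \<in> H \<Longrightarrow> e11 (induced_mat G R H \<sigma> chi h) = chi h"
  "h \<in> H \<Longrightarrow> e22 (induced_mat G R H \<sigma> chi h) = chi (\<sigma> \<otimes>\<^bsub>G\<^esub> h \<otimes>\<^bsub>G\<^esub> inv\<^bsub>G\<^esub> \<sigma>)"
  "h \<in> H \<Longrightarrow> e12 (induced_mat G R H \<sigma> chi h) = \<zero>\<^bsub>R\<^esub>"
  "h \<in> H \<Longrightarrow> e21 (induced_mat G R H \<sigma> chi h) = \<zero>\<^bsub>R\<^esub>"
  using \<sigma> by (auto simp: induced_mat_def extend0_def mult_mem_iff inv_mem_iff)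

lemma induced_\<sigma>_12: "e12 (induced_mat G R H \<sigma> chi \<sigma>) = chi \<one>\<^bsub>G\<^esub>"
  using \<sigma> by (simp add: induced_mat_def extend0_def)

lemma distinct_P0:
  "\<exists>h\<in>H. e11 (conj_by (mat2_ring F) P0 (\<rho>bar h)) \<noteq> e22 (conj_by (mat2_ring F) P0 (\<rho>bar h))"
  using ne P0(2) induced_entries(1,2)[of _ F chibar] by (metis mem_carrier)

text \<open>The matrices of \<sigma> and of an \<open>h\<close> at which the two characters differ
  do not commute. The hypothesis on the characters concerns \<open>H\<close> only; noncommutativity
  does not refer to a subgroup and so provides distinct eigenvalues for every inducing subgroup, in
  \<open>distinct\<close>.\<close>

lemma noncommuting:
  "\<exists>g1\<in>carrier G. \<exists>g2\<in>carrier G. \<rho>bar g1 \<otimes>\<^bsub>mat2_ring F\<^esub> \<rho>bar g2 \<noteq> \<rho>bar g2 \<otimes>\<^bsub>mat2_ring F\<^esub> \<rho>bar g1"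
proof -
  let ?S = "induced_mat G F H \<sigma> chibar"
  obtain h where h: "h \<in> H" "chibar h \<noteq> chibar (\<sigma> \<otimes>\<^bsub>G\<^esub> h \<otimes>\<^bsub>G\<^esub> inv\<^bsub>G\<^esub> \<sigma>)" using ne by blast
  have hc: "h \<in> carrier G" and sc: "\<sigma> \<in> carrier G" using h \<sigma> by auto
  have 1: "e12 (?S \<sigma>) = \<one>\<^bsub>F\<^esub>" unfolding induced_\<sigma>_12 by (rule FM.chi_one[OF chibar_hom])
  have 0: "e11 (?S \<sigma>) = \<zero>\<^bsub>F\<^esub>" using \<sigma> by (simp add: induced_mat_def extend0_def)
  have cl: "?S g \<in> carrier (mat2_ring F)" for g by (rule FM.induced_mat_closed[OF chibar_hom])
  have "e12 (?S h \<otimes>\<^bsub>mat2_ring F\<^esub> ?S \<sigma>) = chibar h"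
    "e12 (?S \<sigma> \<otimes>\<^bsub>mat2_ring F\<^esub> ?S h) = chibar (\<sigma> \<otimes>\<^bsub>G\<^esub> h \<otimes>\<^bsub>G\<^esub> inv\<^bsub>G\<^esub> \<sigma>)"
    using 0 1 induced_entries[OF h(1), of F chibar] mat2_ring_entries[OF cl[of h]] mat2_ring_entries[OF cl[of \<sigma>]]
    by (simp_all add: mat2_ring_mult)
  hence "?S h \<otimes>\<^bsub>mat2_ring F\<^esub> ?S \<sigma> \<noteq> ?S \<sigma> \<otimes>\<^bsub>mat2_ring F\<^esub> ?S h" using h(2) by metis
  moreover have "conj_by (mat2_ring F) P0 (\<rho>bar a \<otimes>\<^bsub>mat2_ring F\<^esub> \<rho>bar b) = ?S a \<otimes>\<^bsub>mat2_ring F\<^esub> ?S b"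
    if "a \<in> carrier G" "b \<in> carrier G" for a b
    using P0 that rep_hom(2)[OF \<rho>bar] by (simp add: FM.M.conj_by_mult)
  ultimately show ?thesis using hc sc by metis
qed

lemma distinct:
  assumes "index_two G H'" "graded G F H' \<rho>bar P"
  shows "\<exists>h\<in>H'. e11 (conj_by (mat2_ring F) P (\<rho>bar h)) \<noteq> e22 (conj_by (mat2_ring F) P (\<rho>bar h))"
  using F.graded_noncommuting_distinct[OF assms(1) \<rho>bar assms(2)] noncommuting by blast

lemma coefficient: "coeff_object p F R \<Longrightarrow> coefficient_ring p F R"
  using F.field_axioms by (simp add: coefficient_ring_def coefficient_ring_axioms_def)

lemma lift_dihedral_iff:
  assumes "coeff_object p F R" "lift_of G T \<rho>bar R \<rho>"
  shows "dihedral G T R \<rho> \<longleftrightarrow> (\<exists>H P. open_index2 G T H \<and> graded G R H \<rho> P)"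
proof -
  interpret coefficient_ring p F R by (rule coefficient[OF assms(1)])
  show ?thesis using dihedral_iff_graded[OF G local_ring] assms(2) unfolding lift_of_def by blast
qed

lemma lift_hom: "lift_of G T \<rho>bar R \<rho> \<Longrightarrow> \<rho> \<in> hom G (GL2 R)"
  unfolding lift_of_def representation_iff by blast

lemma graded_residue:
  assumes "coeff_object p F R" "lift_of G T \<rho>bar R \<rho>" "graded G R H' \<rho> P"
  shows "graded G F H' \<rho>bar (map_mat2 (residue R) P)"
proof -
  interpret coefficient_ring p F R by (rule coefficient[OF assms(1)])
  have "graded G F H' (\<lambda>g. map_mat2 (residue R) (\<rho> g)) (map_mat2 (residue R) P)"
    by (rule graded_hom[OF R.cring_axioms F.cring_axioms residue_hom lift_hom[OF assms(2)] assms(3)])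
  thus ?thesis using assms(2) unfolding lift_of_def graded_def by simp
qed

text \<open>With the universal ring in place of \<open>R\<close> this gives (ii) implies (i). The
  candidates \<open>?K\<close> are the open subgroups of index two that grade
  \<open>\<rho>bar\<close>; by \<open>graded_residue\<close> every subgroup that grades a lift is
  among them.\<close>

lemma dual_numbers_imp_all:
  assumes dual: "\<forall>\<rho>. lift_of G T \<rho>bar (dual_numbers F) \<rho> \<longrightarrow> dihedral G T (dual_numbers F) \<rho>"
    and R: "coeff_object p F R" "lift_of G T \<rho>bar R \<rho>"
  shows "dihedral G T R \<rho>"
proof -
  interpret coefficient_ring p F R by (rule coefficient[OF R(1)])
  note Do = dual_numbers_object[OF F.field_axioms fin, of p]
  let ?K = "{H'. open_index2 G T H' \<and> (\<exists>P. graded G F H' \<rho>bar P)}"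
  have "\<exists>H'\<in>?K. splits_along G F H' \<rho>bar \<delta>" if d: "derivation G T F \<rho>bar \<delta>" for \<delta>
  proof -
    have l: "lift_of G T \<rho>bar (dual_numbers F) (\<lambda>g. dual_mat F (\<rho>bar g) (\<delta> g))"
      by (rule dual_mat_lift[OF F.field_axioms fin rep d])
    then obtain H' P where H': "open_index2 G T H'" "graded G (dual_numbers F) H' (\<lambda>g. dual_mat F (\<rho>bar g) (\<delta> g)) P"
      using dual lift_dihedral_iff[OF Do l] by blast
    note i2 = open_index2_index_two[OF G H'(1)]
    have "splits_along G F H' \<rho>bar \<delta>"
      by (rule dual_mat_graded_splits[OF F.field_axioms fin rep d H'(2) distinct[OF i2]])
         (use subgroup.subset[OF index_two.subgroup[OF i2]] in auto)
    thus ?thesis using H'(1) graded_residue[OF Do l H'(2)] by blast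
  qed
  hence "\<exists>H'\<in>?K. \<forall>\<delta>. derivation G T F \<rho>bar \<delta> \<longrightarrow> splits_along G F H' \<rho>bar \<delta>"
    using openH graded_P0 open_index2_index_two[OF G]
    by (intro F.common_splitting_subgroup[OF G \<rho>bar _ _ graded_P0 distinct_P0]) auto
  then obtain H' P where H': "open_index2 G T H'" "graded G F H' \<rho>bar P"
    "\<And>\<delta>. derivation G T F \<rho>bar \<delta> \<Longrightarrow> splits_along G F H' \<rho>bar \<delta>" by blast
  note i2 = open_index2_index_two[OF G H'(1)]
  obtain h where h: "h \<in> H'" "e11 (conj_by (mat2_ring F) P (\<rho>bar h)) \<noteq> e22 (conj_by (mat2_ring F) P (\<rho>bar h))"
    using distinct[OF i2 H'(2)] by blast
  have op: "openin T H'" using H'(1) unfolding open_index2_def by blast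
  have "\<exists>P. graded G R H' \<rho> P"
  proof (rule graded_of_splits[OF i2 top op open_index2_complement[OF prof H'(1)] _ \<rho>bar _ H'(2) h H'(3)])
    show "representation G T R \<rho>" using R(2) unfolding lift_of_def by blast
    show "map_mat2 (residue R) (\<rho> g) = \<rho>bar g" if "g \<in> carrier G" for g
      using R(2) that unfolding lift_of_def by blast
  qed
  thus ?thesis using lift_dihedral_iff[OF R] H'(1) by blast
qed

lemma strictly_equivalent_graded:
  assumes "coeff_object p F R" "\<rho> \<in> hom G (GL2 R)" "graded G R H' \<rho> P" "strictly_equivalent G F R \<rho> \<rho>'"
  shows "\<exists>P. graded G R H' \<rho>' P"
proof -
  interpret coefficient_ring p F R by (rule coefficient[OF assms(1)])
  obtain A where A: "A \<in> Units (mat2_ring R)" "\<forall>g\<in>carrier G. \<rho>' g = conj_by (mat2_ring R) A (\<rho> g)"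
    using assms(4) unfolding strictly_equivalent_iff by blast
  thus ?thesis using graded_conj_by[OF R.cring_axioms A(1) assms(2,3)] unfolding graded_def by auto
qed

lemma universal_imp_all:
  assumes U: "universal_deformation p F G T \<rho>bar U \<rho>univ" and d: "dihedral G T U \<rho>univ"
    and R: "coeff_object p F R" "lift_of G T \<rho>bar R \<rho>"
  shows "dihedral G T R \<rho>"
proof -
  have Uo: "coeff_object p F U" "lift_of G T \<rho>bar U \<rho>univ" using U unfolding universal_deformation_def by auto
  interpret R: coefficient_ring p F R by (rule coefficient[OF R(1)])
  interpret U: coefficient_ring p F U by (rule coefficient[OF Uo(1)])
  obtain \<phi> where \<phi>: "\<phi> \<in> coeff_hom p F U R" "strictly_equivalent G F R (\<lambda>g. map_mat2 \<phi> (\<rho>univ g)) \<rho>"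
    using universal_deformation_property[OF F.field_axioms fin U R] by blast
  obtain H' P where H': "open_index2 G T H'" "graded G U H' \<rho>univ P"
    using d lift_dihedral_iff[OF Uo] by blast
  note h = coeff_homD(1)[OF \<phi>(1)]
  have "graded G R H' (\<lambda>g. map_mat2 \<phi> (\<rho>univ g)) (map_mat2 \<phi> P)"
    by (rule graded_hom[OF U.R.cring_axioms R.R.cring_axioms h lift_hom[OF Uo(2)] H'(2)])
  from strictly_equivalent_graded[OF R(1) rep_hom_map[OF U.R.cring_axioms R.R.cring_axioms h lift_hom[OF Uo(2)]] this \<phi>(2)]
  show ?thesis using lift_dihedral_iff[OF R] H'(1) by blast
qed

text \<open>Condition (iii) ranges over carriers of type \<open>nat set\<close>, so it is applied to
  a copy of the dual numbers and the grading is moved back.\<close>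

lemma infinitesimal_imp_dual:
  assumes inf: "\<forall>(R :: ('f, nat set) coeff_ring) \<rho>.
           coeff_object p F R \<and> infinitesimal p R \<and> lift_of G T \<rho>bar R \<rho> \<longrightarrow> dihedral G T R \<rho>"
    and l: "lift_of G T \<rho>bar (dual_numbers F) \<rho>"
  shows "dihedral G T (dual_numbers F) \<rho>"
proof -
  note Do = dual_numbers_object[OF F.field_axioms fin, of p]
  interpret D: coefficient_ring p F "dual_numbers F" by (rule coefficient[OF Do])
  obtain C :: "('f, nat set) coeff_ring" and j k
    where C: "coeff_object p F C" "j \<in> coeff_hom p F (dual_numbers F) C" "k \<in> coeff_hom p F C (dual_numbers F)"
    "\<forall>x\<in>carrier (dual_numbers F). k (j x) = x" "\<forall>y\<in>carrier C. j (k y) = y"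
    by (rule D.obtain_nat_set_copy[OF fin])
  note cD = coefficient[OF Do] and cC = coefficient[OF C(1)]
  interpret C: coefficient_ring p F C by (rule cC)
  have "infinitesimal p C"
    by (rule infinitesimal_iso[OF cD cC dual_numbers_infinitesimal[OF F.field_axioms char] C(2,3,5)])
  moreover have lC: "lift_of G T \<rho>bar C (\<lambda>g. map_mat2 j (\<rho> g))" by (rule lift_of_hom[OF cD cC C(2) l])
  ultimately have "dihedral G T C (\<lambda>g. map_mat2 j (\<rho> g))" using inf C(1) by blast
  then obtain H' P where H': "open_index2 G T H'" "graded G C H' (\<lambda>g. map_mat2 j (\<rho> g)) P"
    using lift_dihedral_iff[OF C(1) lC] by blast
  have "graded G (dual_numbers F) H' (\<lambda>g. map_mat2 k (map_mat2 j (\<rho> g))) (map_mat2 k P)"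
    by (rule graded_hom[OF C.R.cring_axioms D.R.cring_axioms coeff_homD(1)[OF C(3)] lift_hom[OF lC] H'(2)])
  moreover have "map_mat2 k (map_mat2 j (\<rho> g)) = \<rho> g" if "g \<in> carrier G" for g
    using lift_of_carrier[OF l that] C(4) by (intro mat2.expand) simp
  ultimately have "graded G (dual_numbers F) H' \<rho> (map_mat2 k P)" unfolding graded_def by simp
  thus ?thesis using lift_dihedral_iff[OF Do l] H'(1) by blast
qed

lemma dihedral_imp_reduction:
  assumes U: "coeff_object p F U" "lift_of G T \<rho>bar U \<rho>" and d: "dihedral G T U \<rho>"
  shows "dihedral G T (quot_coeff_ring U (inf_ideal p U)) (reduce_inf p U \<rho>)"
proof -
  interpret U: coefficient_ring p F U by (rule coefficient[OF U(1)])
  let ?Q = "quot_coeff_ring U (inf_ideal p U)" and ?q = "\<lambda>x. inf_ideal p U +>\<^bsub>U\<^esub> x"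
  note q = U.quot_coeff_ring_facts[OF char]
  have crQ: "cring ?Q" using q(2) unfolding local_ring_def by blast
  obtain H' P where H': "open_index2 G T H'" "graded G U H' \<rho> P" using d lift_dihedral_iff[OF U] by blast
  have red: "reduce_inf p U \<rho> = (\<lambda>g. map_mat2 ?q (\<rho> g))" unfolding reduce_inf_def ..
  have "graded G ?Q H' (reduce_inf p U \<rho>) (map_mat2 ?q P)"
    unfolding red by (rule graded_hom[OF U.R.cring_axioms crQ q(1) lift_hom[OF U(2)] H'(2)])
  moreover have "representation G T ?Q (reduce_inf p U \<rho>)"
    using U(2) rep_hom_map[OF U.R.cring_axioms crQ q(1)] mat2_continuous_hom[OF U.local_ring q(2,1,3)]
    unfolding red lift_of_def representation_iff by blast
  ultimately show ?thesis using dihedral_iff_graded[OF G q(2)] H'(1) by blast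
qed

text \<open>The classifying map of a lift to the dual numbers kills (m^2, p), hence factors through
  the quotient, and the grading of the reduced universal deformation is pushed forward along the
  factor map.\<close>

lemma reduction_imp_dual:
  assumes U: "universal_deformation p F G T \<rho>bar U \<rho>univ"
    and d: "dihedral G T (quot_coeff_ring U (inf_ideal p U)) (reduce_inf p U \<rho>univ)"
    and l: "lift_of G T \<rho>bar (dual_numbers F) \<rho>"
  shows "dihedral G T (dual_numbers F) \<rho>"
proof -
  have Uo: "coeff_object p F U" "lift_of G T \<rho>bar U \<rho>univ" using U unfolding universal_deformation_def by auto
  note Do = dual_numbers_object[OF F.field_axioms fin, of p]
  interpret D: coefficient_ring p F "dual_numbers F" by (rule coefficient[OF Do])
  interpret U: coefficient_ring p F U by (rule coefficient[OF Uo(1)])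
  let ?I = "inf_ideal p U"
  let ?Q = "quot_coeff_ring U ?I" and ?q = "\<lambda>x. ?I +>\<^bsub>U\<^esub> x"
  note q = U.quot_coeff_ring_facts[OF char]
  have crQ: "cring ?Q" using q(2) unfolding local_ring_def by blast
  obtain \<phi> where \<phi>: "\<phi> \<in> coeff_hom p F U (dual_numbers F)"
    "strictly_equivalent G F (dual_numbers F) (\<lambda>g. map_mat2 \<phi> (\<rho>univ g)) \<rho>"
    using universal_deformation_property[OF F.field_axioms fin U Do l] by blast
  note h = coeff_homD(1,2)[OF \<phi>(1)]
  have ker: "\<phi> x = \<zero>\<^bsub>dual_numbers F\<^esub>" if "x \<in> ?I" for x
    by (rule U.inf_ideal_in_kernel[OF D.local_ring dual_numbers_infinitesimal[OF F.field_axioms char] h that])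
  let ?f = "\<lambda>C. the_elem (\<phi> ` C)"
  have fh: "?f \<in> ring_hom (U Quot ?I) (dual_numbers F)" "?f (?I +>\<^bsub>U\<^esub> x) = \<phi> x" if "x \<in> carrier U" for x
    using quotient_factor_hom[OF U.R.cring_axioms D.R.cring_axioms h(1) U.inf_ideal_is_ideal] ker that by blast+
  have f: "?f \<in> ring_hom ?Q (dual_numbers F)"
    using fh(1)[OF U.R.zero_closed] ring_hom_transfer(1)[of ?Q "U Quot ?I" "dual_numbers F"] by (simp add: quot_coeff_ring_def)
  have red: "reduce_inf p U \<rho>univ = (\<lambda>g. map_mat2 ?q (\<rho>univ g))" unfolding reduce_inf_def ..
  have rh: "reduce_inf p U \<rho>univ \<in> hom G (GL2 ?Q)"
    unfolding red by (rule rep_hom_map[OF U.R.cring_axioms crQ q(1) lift_hom[OF Uo(2)]])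
  obtain H' chi where H': "open_index2 G T H'" "character_on G T ?Q H' chi" "equiv_to_ind G ?Q (reduce_inf p U \<rho>univ) H' chi"
    using d unfolding dihedral_def by blast
  have "chi \<in> hom (G\<lparr>carrier := H'\<rparr>) (units_of ?Q)" using H'(2) unfolding character_on_def by blast
  then obtain P where P: "graded G ?Q H' (reduce_inf p U \<rho>univ) P"
    using induced_imp_graded[OF open_index2_index_two[OF G H'(1)] crQ _ rh H'(3)] by blast
  have "graded G (dual_numbers F) H' (\<lambda>g. map_mat2 ?f (reduce_inf p U \<rho>univ g)) (map_mat2 ?f P)"
    by (rule graded_hom[OF crQ D.R.cring_axioms f rh P])
  moreover have "map_mat2 ?f (reduce_inf p U \<rho>univ g) = map_mat2 \<phi> (\<rho>univ g)" if "g \<in> carrier G" for g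
    unfolding red using lift_of_carrier[OF Uo(2) that] fh(2) by (intro mat2.expand) simp
  ultimately have "graded G (dual_numbers F) H' (\<lambda>g. map_mat2 \<phi> (\<rho>univ g)) (map_mat2 ?f P)"
    unfolding graded_def by simp
  from strictly_equivalent_graded[OF Do rep_hom_map[OF U.R.cring_axioms D.R.cring_axioms h(1) lift_hom[OF Uo(2)]] this \<phi>(2)]
  show ?thesis using lift_dihedral_iff[OF Do l] H'(1) by blast
qed

end

section \<open>Comparison of lifts and characters\<close>

context residual_dihedral
begin

text \<open>The basis change is normalised modulo the maximal ideal so that it can be compared
  across lifts by strict equivalences.\<close>

definition induced_via ::
    "('f, 'r) coeff_ring \<Rightarrow> ('g \<Rightarrow> 'r mat2) \<Rightarrow> ('g \<Rightarrow> 'r) \<Rightarrow> 'r mat2 \<Rightarrow> bool" where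
  "induced_via R \<rho> chi P \<longleftrightarrow> P \<in> Units (mat2_ring R) \<and> map_mat2 (residue R) P = P0 \<and>
     (\<forall>g\<in>carrier G. conj_by (mat2_ring R) P (\<rho> g) = induced_mat G R H \<sigma> chi g)"

lemma \<sigma>_carrier: "\<sigma> \<in> carrier G" using \<sigma> by blast

lemma character_lift_character:
  assumes "character_lift G T H chibar R chi"
  shows "chi \<in> hom (G\<lparr>carrier := H\<rparr>) (units_of R)"
    "continuous_map (subtopology T H) (adic_topology R) chi" "\<And>h. h \<in> H \<Longrightarrow> residue R (chi h) = chibar h"
  using assms unfolding character_lift_def character_on_def by auto

lemma graded_imp_induced_via:
  assumes R: "coeff_object p F R" "lift_of G T \<rho>bar R \<rho>" and gr: "graded G R H \<rho> P"
  shows "\<exists>chi P'. character_lift G T H chibar R chi \<and> induced_via R \<rho> chi P'"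
proof -
  interpret coefficient_ring p F R by (rule coefficient[OF R(1)])
  interpret I: induction_datum G H R \<sigma> by (rule datum[OF R.cring_axioms])
  have lift: "map_mat2 (residue R) (\<rho> g) = \<rho>bar g" if "g \<in> carrier G" for g
    using R(2) that unfolding lift_of_def by blast
  note \<rho> = lift_hom[OF R(2)]
  obtain h where h: "h \<in> H" "e11 (conj_by (mat2_ring F) P0 (\<rho>bar h)) \<noteq> e22 (conj_by (mat2_ring F) P0 (\<rho>bar h))"
    using distinct_P0 by blast
  obtain Q where Q: "graded G R H \<rho> Q" "map_mat2 (residue R) Q = P0"
    by (rule graded_lift_residue[OF \<rho> \<rho>bar lift gr graded_P0 h(1) mem_carrier[OF h(1)] h(2)])
  have QU: "Q \<in> Units (mat2_ring R)" using Q(1) unfolding graded_def by blast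
  let ?D = "\<lambda>g. conj_by (mat2_ring R) Q (\<rho> g)"
  define y where "y = e12 (?D \<sigma>)"
  define chi where "chi = (\<lambda>h. e11 (?D h))"
  define P' where "P' = Mat2 \<one>\<^bsub>R\<^esub> \<zero>\<^bsub>R\<^esub> \<zero>\<^bsub>R\<^esub> y \<otimes>\<^bsub>mat2_ring R\<^esub> Q"
  note N = I.graded_normalize[OF \<rho> Q(1), folded y_def chi_def, folded P'_def]
  have res: "map_mat2 (residue R) (?D g) = induced_mat G F H \<sigma> chibar g" if g: "g \<in> carrier G" for g
    unfolding ring_hom_conj_by[OF M.monoid_axioms FM.M.monoid_axioms residue_mat_hom QU rep_hom(2)[OF \<rho> g]]
    using Q(2) lift[OF g] P0(2)[OF g] by simp
  \<comment> \<open>Normalising must not change the reduction of the basis. The scaling factor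
    reduces to 1 because the upper right entry of the residual matrix at \<sigma> is the value of
    \<open>chibar\<close> at 1.\<close>
  have "residue R y = e12 (map_mat2 (residue R) (?D \<sigma>))" unfolding y_def by (simp add: map_mat2_entries)
  also have "\<dots> = \<one>\<^bsub>F\<^esub>"
    unfolding res[OF \<sigma>_carrier] induced_\<sigma>_12 by (rule FM.chi_one[OF chibar_hom])
  finally have ry: "residue R y = \<one>\<^bsub>F\<^esub>" .
  have yc: "y \<in> carrier R" using N(1) by (rule R.Units_closed)
  have "map_mat2 (residue R) P' = map_mat2 (residue R) (Mat2 \<one>\<^bsub>R\<^esub> \<zero>\<^bsub>R\<^esub> \<zero>\<^bsub>R\<^esub> y) \<otimes>\<^bsub>mat2_ring F\<^esub> map_mat2 (residue R) Q"
    unfolding P'_def by (rule resM.hom_mult) (use yc M.Units_closed[OF QU] in simp_all)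
  also have "\<dots> = \<one>\<^bsub>mat2_ring F\<^esub> \<otimes>\<^bsub>mat2_ring F\<^esub> P0"
    by (simp add: Q(2) ry mat2_ring_one)
  also have "\<dots> = P0" using FM.M.Units_closed[OF P0(1)] by simp
  finally have "induced_via R \<rho> chi P'" unfolding induced_via_def using N(2,4) by blast
  moreover have "character_lift G T H chibar R chi"
  proof -
    have "mat2_continuous T R ?D"
      using R(2) mat2_continuous_conj_by[OF local_ring QU] unfolding lift_of_def representation_iff by blast
    hence "continuous_map T (adic_topology R) chi" unfolding mat2_continuous_def chi_def by blast
    moreover have "residue R (chi h) = chibar h" if k: "h \<in> H" for h
    proof -
      have "residue R (chi h) = e11 (map_mat2 (residue R) (?D h))" unfolding chi_def by (simp add: map_mat2_entries)
      thus ?thesis unfolding res[OF mem_carrier[OF k]] induced_entries(1)[OF k] .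
    qed
    ultimately show ?thesis
      unfolding character_lift_def character_on_def using N(3) continuous_map_from_subtopology by blast
  qed
  ultimately show ?thesis by blast
qed

lemma continuous_translation:
  assumes "a \<in> carrier G"
  shows "continuous_map T T (\<lambda>x. a \<otimes>\<^bsub>G\<^esub> x)" "continuous_map T T (\<lambda>x. x \<otimes>\<^bsub>G\<^esub> a)"
proof -
  have cont: "continuous_map (prod_topology T T) T (\<lambda>(x, y). x \<otimes>\<^bsub>G\<^esub> y)"
    using prof unfolding profinite_group_def by blast
  have l: "continuous_map T (prod_topology T T) (\<lambda>x. (a, x))" and r: "continuous_map T (prod_topology T T) (\<lambda>x. (x, a))"
    using assms top by (auto intro!: continuous_map_pairedI)
  show "continuous_map T T (\<lambda>x. a \<otimes>\<^bsub>G\<^esub> x)" "continuous_map T T (\<lambda>x. x \<otimes>\<^bsub>G\<^esub> a)"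
    using continuous_map_compose[OF l cont] continuous_map_compose[OF r cont] by (simp_all add: comp_def)
qed

text \<open>Extension by zero is continuous because \<open>H\<close> and its complement are both
  open, and the entries are its composites with translations.\<close>

lemma continuous_induced_mat:
  assumes loc: "local_ring R" and chi: "character_on G T R H chi"
  shows "mat2_continuous T R (induced_mat G R H \<sigma> chi)"
proof -
  interpret R: cring R using loc unfolding local_ring_def by blast
  interpret I: induction_datum G H R \<sigma> by (rule datum[OF R.cring_axioms])
  have hom: "chi \<in> hom (G\<lparr>carrier := H\<rparr>) (units_of R)"
    and c: "continuous_map (subtopology T H) (adic_topology R) chi" using chi unfolding character_on_def by auto
  have oH: "openin T H" using openH unfolding open_index2_def by blast
  have tsH: "topspace (subtopology T H) = H" using openin_subset[OF oH] by (simp add: topspace_subtopology Int_absorb1)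
  have e: "continuous_map T (adic_topology R) (extend0 R H chi)"
    unfolding continuous_map_adic_topology[OF loc]
  proof (intro conjI ballI allI)
    fix x assume x: "x \<in> topspace T"
    show "extend0 R H chi x \<in> carrier R" by (rule I.extend0_closed[OF hom])
    fix n
    show "\<exists>W. openin T W \<and> x \<in> W \<and> (\<forall>y\<in>W. extend0 R H chi y \<ominus>\<^bsub>R\<^esub> extend0 R H chi x \<in> max_ideal_pow R n)"
    proof (cases "x \<in> H")
      case True
      then obtain W where W: "openin (subtopology T H) W" "x \<in> W" "\<forall>y\<in>W. chi y \<ominus>\<^bsub>R\<^esub> chi x \<in> max_ideal_pow R n"
        using c unfolding continuous_map_adic_topology[OF loc] tsH by blast
      have "openin T W" "W \<subseteq> H" using W(1) openin_open_subtopology[OF oH] by auto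
      thus ?thesis using W(2,3) True by (intro exI[of _ W]) (auto simp: extend0_def)
    next
      case False
      have "\<zero>\<^bsub>R\<^esub> \<in> max_ideal_pow R n"
        using additive_subgroup.zero_closed[OF ideal.axioms(1)[OF max_ideal_pow_is_ideal[OF loc]]] .
      hence "\<zero>\<^bsub>R\<^esub> \<ominus>\<^bsub>R\<^esub> \<zero>\<^bsub>R\<^esub> \<in> max_ideal_pow R n" by (simp add: R.minus_eq)
      thus ?thesis
        using False x open_index2_complement[OF prof openH] unfolding top
        by (intro exI[of _ "carrier G - H"]) (simp add: extend0_def)
    qed
  qed
  have ec: "continuous_map T (adic_topology R) (\<lambda>x. extend0 R H chi (f x))" if "continuous_map T T f" for f
    using continuous_map_compose[OF that e] by (simp add: comp_def)
  have i: "inv\<^bsub>G\<^esub> \<sigma> \<in> carrier G" using \<sigma>_carrier by simp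
  have "continuous_map T T (\<lambda>x. \<sigma> \<otimes>\<^bsub>G\<^esub> x \<otimes>\<^bsub>G\<^esub> inv\<^bsub>G\<^esub> \<sigma>)"
    using continuous_map_compose[OF continuous_translation(1)[OF \<sigma>_carrier] continuous_translation(2)[OF i]]
    by (simp add: comp_def)
  thus ?thesis
    unfolding mat2_continuous_def induced_mat_def mat2.sel
    by (intro conjI e ec continuous_translation \<sigma>_carrier i)
qed

text \<open>The induced matrices reduce to \<open>\<rho>bar\<close> written in the basis
  \<open>P0\<close>. Conjugating back by a lift of \<open>P0\<close> gives a lift of
  \<open>\<rho>bar\<close> itself and not just of an equivalent representation.\<close>

lemma character_lift_imp_induced_via:
  assumes R: "coeff_object p F R" and chi: "character_lift G T H chibar R chi"
  shows "\<exists>\<rho> P. lift_of G T \<rho>bar R \<rho> \<and> induced_via R \<rho> chi P"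
proof -
  interpret coefficient_ring p F R by (rule coefficient[OF R])
  interpret I: induction_datum G H R \<sigma> by (rule datum[OF R.cring_axioms])
  note c = character_lift_character[OF chi]
  let ?S = "induced_mat G R H \<sigma> chi"
  obtain P where P: "P \<in> carrier (mat2_ring R)" "map_mat2 (residue R) P = P0"
    using obtain_mat_lift[OF FM.M.Units_closed[OF P0(1)]] by blast
  have PU: "P \<in> Units (mat2_ring R)" using mat_unit_iff[OF P(1)] P(2) P0(1) by simp
  have iU: "inv\<^bsub>mat2_ring R\<^esub> P \<in> Units (mat2_ring R)" using PU by simp
  let ?\<rho> = "\<lambda>g. conj_by (mat2_ring R) (inv\<^bsub>mat2_ring R\<^esub> P) (?S g)"
  have Sc: "?S g \<in> carrier (mat2_ring R)" for g by (rule I.induced_mat_closed[OF c(1)])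
  have "map_mat2 (residue R) (?\<rho> g) = \<rho>bar g" if g: "g \<in> carrier G" for g
  proof -
    have "map_mat2 (residue R) (?S g) = induced_mat G F H \<sigma> chibar g"
      unfolding map_induced_mat[OF residue_hom R.ring_axioms F.ring_axioms] by (rule induced_mat_cong) (rule c(3))
    hence "map_mat2 (residue R) (?\<rho> g) = conj_by (mat2_ring F) (inv\<^bsub>mat2_ring F\<^esub> P0) (conj_by (mat2_ring F) P0 (\<rho>bar g))"
      unfolding ring_hom_conj_by[OF M.monoid_axioms FM.M.monoid_axioms residue_mat_hom iU Sc]
      using ring_hom_inv(2)[OF M.monoid_axioms FM.M.monoid_axioms residue_mat_hom PU] P(2) P0(2)[OF g] by simp
    thus ?thesis using FM.M.conj_by_inv(1)[OF P0(1) rep_hom(2)[OF \<rho>bar g]] by simp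
  qed
  moreover have "representation G T R ?\<rho>"
    unfolding representation_iff
    using rep_hom_conj_by[OF R.cring_axioms iU I.induced_mat_hom[OF c(1)]]
      mat2_continuous_conj_by[OF local_ring iU continuous_induced_mat[OF local_ring]] chi
    unfolding character_lift_def by blast
  moreover have "induced_via R ?\<rho> chi P"
    unfolding induced_via_def using PU P(2) Sc by simp
  ultimately show ?thesis unfolding lift_of_def by blast
qed

lemma induced_via_hom:
  assumes "coeff_object p F R" "coeff_object p F S" "\<phi> \<in> coeff_hom p F R S"
    "lift_of G T \<rho>bar R \<rho>" "induced_via R \<rho> chi P"
  shows "induced_via S (\<lambda>g. map_mat2 \<phi> (\<rho> g)) (\<lambda>h. \<phi> (chi h)) (map_mat2 \<phi> P)"
proof -
  note cR = coefficient[OF assms(1)] and cS = coefficient[OF assms(2)]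
  interpret R: coefficient_ring p F R by (rule cR)
  interpret S: coefficient_ring p F S by (rule cS)
  note h = coeff_homD(1)[OF assms(3)]
  note hM = map_mat2_ring_hom[OF h R.R.ring_axioms S.R.ring_axioms]
  have P: "P \<in> Units (mat2_ring R)" "map_mat2 (residue R) P = P0"
    "\<And>g. g \<in> carrier G \<Longrightarrow> conj_by (mat2_ring R) P (\<rho> g) = induced_mat G R H \<sigma> chi g"
    using assms(5) unfolding induced_via_def by auto
  have "map_mat2 (residue S) (map_mat2 \<phi> P) = P0"
    unfolding P(2)[symmetric] using coeff_hom_residue[OF cR cS assms(3)] R.M.Units_closed[OF P(1)]
    by (intro mat2.expand) simp
  moreover have "conj_by (mat2_ring S) (map_mat2 \<phi> P) (map_mat2 \<phi> (\<rho> g)) = induced_mat G S H \<sigma> (\<lambda>h. \<phi> (chi h)) g"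
    if g: "g \<in> carrier G" for g
    unfolding ring_hom_conj_by[OF R.M.monoid_axioms S.M.monoid_axioms hM P(1) lift_of_carrier[OF assms(4) g], symmetric]
      P(3)[OF g] by (rule map_induced_mat[OF h R.R.ring_axioms S.R.ring_axioms])
  ultimately show ?thesis
    unfolding induced_via_def using ring_hom_inv(1)[OF R.M.monoid_axioms S.M.monoid_axioms hM P(1)] by blast
qed

lemma induced_via_strictly_equivalent:
  assumes "coeff_object p F R" "\<And>g. g \<in> carrier G \<Longrightarrow> \<rho> g \<in> carrier (mat2_ring R)"
    "induced_via R \<rho> chi P" "strictly_equivalent G F R \<rho> \<rho>'"
  shows "\<exists>P'. induced_via R \<rho>' chi P'"
proof -
  interpret coefficient_ring p F R by (rule coefficient[OF assms(1)])
  obtain A where A: "A \<in> Units (mat2_ring R)" "map_mat2 (residue R) A = \<one>\<^bsub>mat2_ring F\<^esub>"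
    "\<forall>g\<in>carrier G. \<rho>' g = conj_by (mat2_ring R) A (\<rho> g)" using assms(4) unfolding strictly_equivalent_iff by blast
  have P: "P \<in> Units (mat2_ring R)" "map_mat2 (residue R) P = P0"
    "\<And>g. g \<in> carrier G \<Longrightarrow> conj_by (mat2_ring R) P (\<rho> g) = induced_mat G R H \<sigma> chi g"
    using assms(3) unfolding induced_via_def by auto
  have "map_mat2 (residue R) (P \<otimes>\<^bsub>mat2_ring R\<^esub> inv\<^bsub>mat2_ring R\<^esub> A) = P0"
    using A(1,2) P(1,2) ring_hom_inv(2)[OF M.monoid_axioms FM.M.monoid_axioms residue_mat_hom A(1)]
      FM.M.Units_closed[OF P0(1)] by (simp add: M.Units_closed)
  hence "induced_via R \<rho>' chi (P \<otimes>\<^bsub>mat2_ring R\<^esub> inv\<^bsub>mat2_ring R\<^esub> A)"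
    unfolding induced_via_def using A(1,3) P(1,3) assms(2) by (auto simp: M.conj_by_conj_by)
  thus ?thesis by blast
qed

text \<open>The transition matrix reduces to 1, so its upper left entry is a unit. The upper left
  entries of the relation between the two diagonal matrices at \<open>h\<close> can then be
  compared.\<close>

lemma induced_via_character_unique:
  assumes R: "coeff_object p F R" and \<rho>: "\<And>g. g \<in> carrier G \<Longrightarrow> \<rho> g \<in> carrier (mat2_ring R)"
    and P: "induced_via R \<rho> chi P" "induced_via R \<rho> chi' P'"
    and chi: "character_lift G T H chibar R chi" "character_lift G T H chibar R chi'" and h: "h \<in> H"
  shows "chi h = chi' h"
proof -
  interpret coefficient_ring p F R by (rule coefficient[OF R])
  interpret I: induction_datum G H R \<sigma> by (rule datum[OF R.cring_axioms])
  note c = character_lift_character(1)[OF chi(1)] and c' = character_lift_character(1)[OF chi(2)]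
  let ?S = "induced_mat G R H \<sigma>"
  have PU: "P \<in> Units (mat2_ring R)" "P' \<in> Units (mat2_ring R)"
    and res: "map_mat2 (residue R) P = P0" "map_mat2 (residue R) P' = P0"
    and eq: "conj_by (mat2_ring R) P (\<rho> h) = ?S chi h" "conj_by (mat2_ring R) P' (\<rho> h) = ?S chi' h"
    using P h unfolding induced_via_def by auto
  have hc: "h \<in> carrier G" using h by simp
  define Q where "Q = P' \<otimes>\<^bsub>mat2_ring R\<^esub> inv\<^bsub>mat2_ring R\<^esub> P"
  have QU: "Q \<in> Units (mat2_ring R)" unfolding Q_def using PU by simp
  note Qc = M.Units_closed[OF QU]
  have "map_mat2 (residue R) Q = \<one>\<^bsub>mat2_ring F\<^esub>"
    unfolding Q_def using PU res P0(1) ring_hom_inv(2)[OF M.monoid_axioms FM.M.monoid_axioms residue_mat_hom PU(1)]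
    by (simp add: M.Units_closed)
  from arg_cong[OF this, of e11] have "residue R (e11 Q) = \<one>\<^bsub>F\<^esub>"
    by (simp add: map_mat2_entries mat2_ring_one)
  hence qU: "e11 Q \<in> Units R" using unit_iff[of "e11 Q"] Qc by simp
  have Sc: "?S chi h \<in> carrier (mat2_ring R)" "?S chi' h \<in> carrier (mat2_ring R)"
    using I.induced_mat_closed[OF c] I.induced_mat_closed[OF c'] by auto
  have "conj_by (mat2_ring R) Q (?S chi h) = ?S chi' h"
    unfolding Q_def eq[symmetric] using PU \<rho>[OF hc] by (simp add: M.conj_by_conj_by)
  hence qs: "Q \<otimes>\<^bsub>mat2_ring R\<^esub> ?S chi h = ?S chi' h \<otimes>\<^bsub>mat2_ring R\<^esub> Q"
    using M.conj_by_eq_iff[OF QU Sc] by simp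
  have "e11 Q \<otimes>\<^bsub>R\<^esub> chi h = chi' h \<otimes>\<^bsub>R\<^esub> e11 Q"
    using arg_cong[OF qs, of e11] Qc I.chi_closed[OF c h] I.chi_closed[OF c' h] induced_entries[OF h, of R chi]
      induced_entries[OF h, of R chi'] by (simp add: mat2_ring_mult)
  hence "e11 Q \<otimes>\<^bsub>R\<^esub> chi h = e11 Q \<otimes>\<^bsub>R\<^esub> chi' h"
    using R.m_comm Qc I.chi_closed[OF c' h] by simp
  thus ?thesis using R.Units_l_cancel[OF qU I.chi_closed[OF c h] I.chi_closed[OF c' h]] by simp
qed

text \<open>Both bases reduce to \<open>P0\<close>, so the matrix carrying one representation to the
  other reduces to 1.\<close>

lemma induced_via_same_character:
  assumes R: "coeff_object p F R"
    and \<rho>: "\<And>g. g \<in> carrier G \<Longrightarrow> \<rho> g \<in> carrier (mat2_ring R)" "\<And>g. g \<in> carrier G \<Longrightarrow> \<rho>' g \<in> carrier (mat2_ring R)"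
    and P: "induced_via R \<rho> chi P" "induced_via R \<rho>' chi' P'" and eq: "\<And>h. h \<in> H \<Longrightarrow> chi h = chi' h"
  shows "strictly_equivalent G F R \<rho> \<rho>'"
proof -
  interpret coefficient_ring p F R by (rule coefficient[OF R])
  have PU: "P \<in> Units (mat2_ring R)" "P' \<in> Units (mat2_ring R)"
    and res: "map_mat2 (residue R) P = P0" "map_mat2 (residue R) P' = P0"
    using P unfolding induced_via_def by auto
  have c: "conj_by (mat2_ring R) P (\<rho> g) = conj_by (mat2_ring R) P' (\<rho>' g)" if "g \<in> carrier G" for g
    using P that induced_mat_cong[OF eq] unfolding induced_via_def by simp
  let ?A = "inv\<^bsub>mat2_ring R\<^esub> P' \<otimes>\<^bsub>mat2_ring R\<^esub> P"
  have "map_mat2 (residue R) ?A = \<one>\<^bsub>mat2_ring F\<^esub>"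
    using PU res P0(1) ring_hom_inv(2)[OF M.monoid_axioms FM.M.monoid_axioms residue_mat_hom PU(2)]
    by (simp add: M.Units_closed)
  moreover have "\<rho>' g = conj_by (mat2_ring R) ?A (\<rho> g)" if g: "g \<in> carrier G" for g
    using c[OF g] PU \<rho>(1)[OF g] \<rho>(2)[OF g] by (simp add: M.conj_by_conj_by)
  moreover have "?A \<in> Units (mat2_ring R)" using PU by simp
  ultimately show ?thesis unfolding strictly_equivalent_iff by blast
qed

text \<open>If \<open>\<chi>\<^sup>2 \<noteq> (\<chi>\<^sup>\<sigma>)\<^sup>2\<close>, the projective image of the residual representation is not the Klein
  four-group, and then \<open>H\<close> is the only subgroup from which it can be induced.\<close>

lemma inducing_subgroup_unique:
  assumes sq: "\<exists>h\<in>H. chibar h [^]\<^bsub>F\<^esub> (2::nat) \<noteq> chibar (\<sigma> \<otimes>\<^bsub>G\<^esub> h \<otimes>\<^bsub>G\<^esub> inv\<^bsub>G\<^esub> \<sigma>) [^]\<^bsub>F\<^esub> (2::nat)"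
    and H': "index_two G H'" "graded G F H' \<rho>bar P"
  shows "H' = H"
proof (rule ccontr)
  assume "H' \<noteq> H"
  hence ne: "H \<noteq> H'" by blast
  obtain h where h: "h \<in> H" "chibar h [^]\<^bsub>F\<^esub> (2::nat) \<noteq> chibar (\<sigma> \<otimes>\<^bsub>G\<^esub> h \<otimes>\<^bsub>G\<^esub> inv\<^bsub>G\<^esub> \<sigma>) [^]\<^bsub>F\<^esub> (2::nat)"
    using sq by blast
  let ?x = "chibar h" and ?y = "chibar (\<sigma> \<otimes>\<^bsub>G\<^esub> h \<otimes>\<^bsub>G\<^esub> inv\<^bsub>G\<^esub> \<sigma>)"
  have hc: "h \<in> carrier G" using h by simp
  have kH: "\<sigma> \<otimes>\<^bsub>G\<^esub> h \<otimes>\<^bsub>G\<^esub> inv\<^bsub>G\<^esub> \<sigma> \<in> H" using \<sigma> h(1) by (auto simp: mult_mem_iff inv_mem_iff)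
  have y: "?y \<in> carrier F" using FM.chi_closed[OF chibar_hom kH] .
  note ov = F.graded_overlap[OF index_two_axioms H'(1) ne \<rho>bar graded_P0 H'(2) h(1),
      unfolded P0(2)[OF hc] induced_entries(1,2)[OF h(1)]]
  \<comment> \<open>Both cases of the overlap give equal squares.\<close>
  have "?x = ?y \<or> ?x = \<ominus>\<^bsub>F\<^esub> ?y" using ov(1,2) by blast
  hence "?x \<otimes>\<^bsub>F\<^esub> ?x = ?y \<otimes>\<^bsub>F\<^esub> ?y" using y by (auto simp: F.l_minus F.r_minus)
  moreover have "?x \<in> carrier F" using FM.chi_closed[OF chibar_hom h(1)] .
  ultimately show False using h(2) y by (simp add: numeral_2_eq_2)
qed

text \<open>Yoneda: \<alpha> classifies the character from which \<open>\<rho>univ\<close> is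
  induced, \<beta> a lift induced from \<open>chiuniv\<close>. Each composite fixes a universal
  object, in the case of \<open>\<rho>univ\<close> up to strict equivalence, and is therefore the
  identity.\<close>

lemma universal_rings_iso:
  assumes U: "universal_deformation p F G T \<rho>bar U \<rho>univ" and gr: "graded G U H \<rho>univ P"
    and V: "universal_character_deformation p F G T H chibar V chiuniv"
  shows "coeff_iso p F U V"
proof -
  have Uo: "coeff_object p F U" "lift_of G T \<rho>bar U \<rho>univ" using U unfolding universal_deformation_def by auto
  have Vo: "coeff_object p F V" "character_lift G T H chibar V chiuniv"
    using V unfolding universal_character_deformation_def by auto
  note cU = coefficient[OF Uo(1)] and cV = coefficient[OF Vo(1)]
  interpret U: coefficient_ring p F U by (rule cU)
  interpret V: coefficient_ring p F V by (rule cV)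
  obtain chi PU where chi: "character_lift G T H chibar U chi" "induced_via U \<rho>univ chi PU"
    using graded_imp_induced_via[OF Uo gr] by blast
  obtain \<rho> PV where \<rho>: "lift_of G T \<rho>bar V \<rho>" "induced_via V \<rho> chiuniv PV"
    using character_lift_imp_induced_via[OF Vo] by blast
  obtain \<alpha> where \<alpha>: "\<alpha> \<in> coeff_hom p F V U" "\<forall>h\<in>H. \<alpha> (chiuniv h) = chi h"
    using universal_character_deformation_property[OF F.field_axioms fin V Uo(1) chi(1)] by blast
  obtain \<beta> where \<beta>: "\<beta> \<in> coeff_hom p F U V" "strictly_equivalent G F V (\<lambda>g. map_mat2 \<beta> (\<rho>univ g)) \<rho>"
    using universal_deformation_property[OF F.field_axioms fin U Vo(1) \<rho>(1)] by blast
  note l\<beta> = lift_of_hom[OF cU cV \<beta>(1) Uo(2)] and l\<alpha> = lift_of_hom[OF cV cU \<alpha>(1) \<rho>(1)]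
  \<comment> \<open>The image of \<open>\<rho>univ\<close> under \<beta> is strictly equivalent to
    \<rho>, so \<rho> is induced from the image of \<open>chi\<close> as well as from
    \<open>chiuniv\<close>, and the character of a lift is unique.\<close>
  have \<beta>chi: "\<beta> (chi h) = chiuniv h" if h: "h \<in> H" for h
  proof -
    obtain Q where Q: "induced_via V \<rho> (\<lambda>h. \<beta> (chi h)) Q"
      using induced_via_strictly_equivalent[OF Vo(1) lift_of_carrier[OF l\<beta>] induced_via_hom[OF Uo(1) Vo(1) \<beta>(1) Uo(2) chi(2)] \<beta>(2)]
      by blast
    show ?thesis
      by (rule induced_via_character_unique[OF Vo(1) lift_of_carrier[OF \<rho>(1)] Q \<rho>(2) character_lift_hom[OF cU cV \<beta>(1) chi(1)] Vo(2) h])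
  qed
  have chiV: "chiuniv h \<in> carrier V" if "h \<in> H" for h
    using that character_lift_character(1)[OF Vo(2)] V.R.Units_closed unfolding hom_def units_of_def by auto
  let ?\<beta>\<alpha> = "compose (carrier V) \<beta> \<alpha>" and ?\<alpha>\<beta> = "compose (carrier U) \<alpha> \<beta>"
  let ?iV = "restrict (\<lambda>x. x) (carrier V)" and ?iU = "restrict (\<lambda>x. x) (carrier U)"
  have ba: "?\<beta>\<alpha> = ?iV"
  proof (rule ex1E[OF universal_character_deformation_property[OF F.field_axioms fin V Vo]])
    fix \<phi> assume uniq: "\<forall>y. y \<in> coeff_hom p F V V \<and> (\<forall>h\<in>H. y (chiuniv h) = chiuniv h) \<longrightarrow> y = \<phi>"
    have "?\<beta>\<alpha> = \<phi>"
      by (rule uniq[rule_format])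
        (use coeff_hom_comp[OF cV \<alpha>(1) \<beta>(1)] \<alpha>(2) \<beta>chi chiV in \<open>simp add: compose_def\<close>)
    moreover have "?iV = \<phi>" by (rule uniq[rule_format]) (use coeff_hom_id[OF cV] chiV in simp)
    ultimately show ?thesis by simp
  qed
  have ab: "?\<alpha>\<beta> = ?iU"
  proof (rule ex1E[OF universal_deformation_property[OF F.field_axioms fin U Uo]])
    fix \<phi> assume uniq: "\<forall>y. y \<in> coeff_hom p F U U \<and> strictly_equivalent G F U (\<lambda>g. map_mat2 y (\<rho>univ g)) \<rho>univ \<longrightarrow> y = \<phi>"
    note uc = lift_of_carrier[OF Uo(2)]
    have 1: "strictly_equivalent G F U (\<lambda>g. map_mat2 \<alpha> (map_mat2 \<beta> (\<rho>univ g))) (\<lambda>g. map_mat2 \<alpha> (\<rho> g))"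
      by (rule strictly_equivalent_hom[OF cV cU \<alpha>(1) lift_of_carrier[OF l\<beta>] \<beta>(2)])
    have 2: "strictly_equivalent G F U (\<lambda>g. map_mat2 \<alpha> (\<rho> g)) \<rho>univ"
      using \<alpha>(2)
      by (intro induced_via_same_character[OF Uo(1) lift_of_carrier[OF l\<alpha>] uc induced_via_hom[OF Vo(1) Uo(1) \<alpha>(1) \<rho>] chi(2)]) auto
    have "strictly_equivalent G F U (\<lambda>g. map_mat2 \<alpha> (map_mat2 \<beta> (\<rho>univ g))) \<rho>univ"
      by (rule U.strictly_equivalent_trans[OF lift_of_carrier[OF lift_of_hom[OF cV cU \<alpha>(1) l\<beta>]] 1 2])
    hence "strictly_equivalent G F U (\<lambda>g. map_mat2 ?\<alpha>\<beta> (\<rho>univ g)) \<rho>univ"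
      unfolding strictly_equivalent_def by (simp add: map_mat2_compose[OF uc])
    hence "?\<alpha>\<beta> = \<phi>" by (intro uniq[rule_format]) (use coeff_hom_comp[OF cU \<beta>(1) \<alpha>(1)] in simp)
    moreover have "map_mat2 ?iU (\<rho>univ g) = \<rho>univ g" if "g \<in> carrier G" for g
      using uc[OF that] by (intro mat2.expand) simp
    hence "strictly_equivalent G F U (\<lambda>g. map_mat2 ?iU (\<rho>univ g)) \<rho>univ"
      using uc by (intro U.strictly_equivalent_refl) simp_all
    hence "?iU = \<phi>" by (intro uniq[rule_format]) (use coeff_hom_id[OF cU] in simp)
    ultimately show ?thesis by simp
  qed
  have "\<beta> (\<alpha> y) = y" if "y \<in> carrier V" for y
    using that fun_cong[OF ba, of y] by (simp add: compose_def)
  moreover have "\<alpha> (\<beta> x) = x" if "x \<in> carrier U" for x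
    using that fun_cong[OF ab, of x] by (simp add: compose_def)
  ultimately show ?thesis unfolding coeff_iso_def using \<alpha>(1) \<beta>(1) by blast
qed

end

text \<open>The last conjunct asks for a condition that makes \<open>H\<close> itself an inducing
  subgroup of the universal deformation; the example given with the definition of
  \<open>dihedral\<close> shows why. The first alternative states it, and in the second one
  \<open>inducing_subgroup_unique\<close> yields it.\<close>

theorem theorem1p4:
  fixes p :: nat
    and F :: "'f ring"
    and G :: "'g monoid" and T :: "'g topology"
    and H :: "'g set" and \<sigma> :: 'g
    and chibar :: "'g \<Rightarrow> 'f" and \<rho>bar :: "'g \<Rightarrow> 'f mat2"
    and U :: "('f, 'u) coeff_ring" and \<rho>univ :: "'g \<Rightarrow> 'u mat2"
    and V :: "('f, 'v) coeff_ring" and chiuniv :: "'g \<Rightarrow> 'v"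
  assumes "prime p"
    and "field F" and "finite (carrier F)" and "[p] \<cdot>\<^bsub>F\<^esub> \<one>\<^bsub>F\<^esub> = \<zero>\<^bsub>F\<^esub>"
    and "profinite_group G T"
    and "open_index2 G T H" and "\<sigma> \<in> carrier G - H"
    and "character_on G T F H chibar"
    and "\<exists>h\<in>H. chibar h \<noteq> chibar (\<sigma> \<otimes>\<^bsub>G\<^esub> h \<otimes>\<^bsub>G\<^esub> inv\<^bsub>G\<^esub> \<sigma>)"
    and "representation G T F \<rho>bar" and "equiv_to_ind G F \<rho>bar H chibar"
    and "mazur_finiteness p G T"
    and "universal_deformation p F G T \<rho>bar U \<rho>univ"
  shows
    "(dihedral G T U \<rho>univ \<longleftrightarrow>
        (\<forall>\<rho>. lift_of G T \<rho>bar (dual_numbers F) \<rho> \<longrightarrow> dihedral G T (dual_numbers F) \<rho>)) \<and>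
     (dihedral G T U \<rho>univ \<longleftrightarrow>
        (\<forall>(R :: ('f, nat set) coeff_ring) \<rho>.
           coeff_object p F R \<and> infinitesimal p R \<and> lift_of G T \<rho>bar R \<rho> \<longrightarrow> dihedral G T R \<rho>)) \<and>
     (dihedral G T U \<rho>univ \<longleftrightarrow>
        dihedral G T (quot_coeff_ring U (inf_ideal p U)) (reduce_inf p U \<rho>univ)) \<and>
     (dihedral G T U \<rho>univ \<and>
        ((\<exists>chi. character_on G T U H chi \<and> equiv_to_ind G U \<rho>univ H chi) \<or>
         (\<exists>h\<in>H. chibar h [^]\<^bsub>F\<^esub> (2::nat) \<noteq> chibar (\<sigma> \<otimes>\<^bsub>G\<^esub> h \<otimes>\<^bsub>G\<^esub> inv\<^bsub>G\<^esub> \<sigma>) [^]\<^bsub>F\<^esub> (2::nat))) \<and>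
        universal_character_deformation p F G T H chibar V chiuniv
        \<longrightarrow> coeff_iso p F U V)"
proof -
  interpret residual_dihedral p F G T H \<sigma> chibar \<rho>bar
    using assms by (intro residual_dihedral.intro residual_dihedral_axioms.intro)
  note U = assms(13)
  have Uo: "coeff_object p F U" "lift_of G T \<rho>bar U \<rho>univ" using U unfolding universal_deformation_def by auto
  note Do = dual_numbers_object[OF F.field_axioms fin, of p]
  let ?i = "dihedral G T U \<rho>univ"
  let ?ii = "\<forall>\<rho>. lift_of G T \<rho>bar (dual_numbers F) \<rho> \<longrightarrow> dihedral G T (dual_numbers F) \<rho>"
  let ?iii = "\<forall>(R :: ('f, nat set) coeff_ring) \<rho>.
     coeff_object p F R \<and> infinitesimal p R \<and> lift_of G T \<rho>bar R \<rho> \<longrightarrow> dihedral G T R \<rho>"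
  let ?iv = "dihedral G T (quot_coeff_ring U (inf_ideal p U)) (reduce_inf p U \<rho>univ)"
  \<comment> \<open>All implications towards (i) pass through (ii), which follows from (iii) and
    from (iv) because the dual numbers are infinitesimal.\<close>
  have a: "?ii \<Longrightarrow> ?i" by (rule dual_numbers_imp_all[OF _ Uo])
  have "?i \<Longrightarrow> ?ii" using universal_imp_all[OF U _ Do] by blast
  moreover have "?i \<Longrightarrow> ?iii" using universal_imp_all[OF U] by blast
  moreover have "?iii \<Longrightarrow> ?i" by (intro a allI impI) (rule infinitesimal_imp_dual)
  moreover have "?i \<Longrightarrow> ?iv" by (rule dihedral_imp_reduction[OF Uo])
  moreover have "?iv \<Longrightarrow> ?i" by (intro a allI impI) (rule reduction_imp_dual[OF U])
  moreover have "coeff_iso p F U V"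
    if i: ?i and alt: "(\<exists>chi. character_on G T U H chi \<and> equiv_to_ind G U \<rho>univ H chi) \<or>
         (\<exists>h\<in>H. chibar h [^]\<^bsub>F\<^esub> (2::nat) \<noteq> chibar (\<sigma> \<otimes>\<^bsub>G\<^esub> h \<otimes>\<^bsub>G\<^esub> inv\<^bsub>G\<^esub> \<sigma>) [^]\<^bsub>F\<^esub> (2::nat))"
      and V: "universal_character_deformation p F G T H chibar V chiuniv"
  proof -
    interpret U: coefficient_ring p F U by (rule coefficient[OF Uo(1)])
    from alt have "\<exists>P. graded G U H \<rho>univ P"
    proof
      assume "\<exists>chi. character_on G T U H chi \<and> equiv_to_ind G U \<rho>univ H chi"
      thus ?thesis
        using induced_imp_graded[OF index_two_axioms U.R.cring_axioms _ lift_hom[OF Uo(2)]]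
        unfolding character_on_def by blast
    next
      assume sq: "\<exists>h\<in>H. chibar h [^]\<^bsub>F\<^esub> (2::nat) \<noteq> chibar (\<sigma> \<otimes>\<^bsub>G\<^esub> h \<otimes>\<^bsub>G\<^esub> inv\<^bsub>G\<^esub> \<sigma>) [^]\<^bsub>F\<^esub> (2::nat)"
      obtain H' P where H': "open_index2 G T H'" "graded G U H' \<rho>univ P"
        using i lift_dihedral_iff[OF Uo] by blast
      have "H' = H"
        by (rule inducing_subgroup_unique[OF sq open_index2_index_two[OF G H'(1)] graded_residue[OF Uo H'(2)]])
      thus ?thesis using H'(2) by blast
    qed
    thus ?thesis using universal_rings_iso[OF U _ V] by blast
  qed
  ultimately show ?thesis using a by blast
qed

end
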